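(* Let $(\mathfrak A,\alpha,\omega)$ be a $C^*$-dynamical system such that the support $s(\omega)$ of $\omega$ in the bidual $\mathfrak A^{**}$ is central, i.e. $s(\omega)\in Z(\mathfrak A^{**})$. Fix integers $k_1,k_2$ with $k_1\neq 0$, $k_2\neq 0$, $k_1\neq k_2$, and suppose that $\omega$ is ergodic with respect to the action $\{\alpha^{n(k_2-k_1)}\mid n\in\mathbb Z\}$. Let $M=\pi_\omega(\mathfrak A)''$, $M'=\pi_\omega(\mathfrak A)'$, and let $\mathfrak X$ be the norm closure of $M+M'$ in $\mathcal B(\mathcal H_\omega)$. Then for each $X\in\mathfrak X$, $$\mathop{\rm s\text{-}lim}_{N\to+\infty}\frac1N\sum_{n=0}^{N-1}U_\omega^{nk_1}XU_\omega^{n(k_2-k_1)}=V(X\Omega\otimes\,\cdot\,),$$ where the limit is in the strong operator topology, $V:\mathcal H_\omega\otimes\mathcal H_\omega\to\mathcal H_\omega$ is the partial isometry associated to $(k_1,k_2)$ defined in the context, and $V(X\Omega\otimes\,\cdot\,)$ denotes the operator $\xi\mapsto V(X\Omega\otimes\xi)$.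
   Context: A (discrete) $C^*$-dynamical system $(\mathfrak A,\alpha,\omega)$ consists of a unital $C^*$-algebra $\mathfrak A$, a $*$-automorphism $\alpha$ of $\mathfrak A$, and a state $\omega$ with $\omega\circ\alpha=\omega$. Inner products are linear in the first variable. $(\mathcal H_\omega,\pi_\omega,U_\omega,\Omega)$ is the covariant GNS representation: $\omega(A)=\langle\pi_\omega(A)\Omega,\Omega\rangle$, $U_\omega$ unitary, $U_\omega\Omega=\Omega$, $U_\omega\pi_\omega(A)U_\omega^*=\pi_\omega(\alpha(A))$. $Z(\cdot)$ denotes the centre. The condition $s(\omega)\in Z(\mathfrak A^{**})$ is equivalent to $\Omega$ being separating for $\pi_\omega(\mathfrak A)''$. $\omega$ is ergodic for an automorphism $\beta$ leaving it invariant if it is an extreme point of the convex set of $\beta$-invariant states; when $s(\omega)$ is central this is equivalent to the implementing unitary having one-dimensional space of fixed vectors (here: the fixed vectors of $U_\omega^{k_2-k_1}$ are $\mathbb C\Omega$; in particular those of $U_\omega$ are $\mathbb C\Omega$). $\sigma_{\rm pp}(U)$ denotes the set of eigenvalues of a unitary $U$. If $s(\omega)\in Z(\mathfrak A^{**})$, $k_1,k_2$ are integers with $k_1\neq 0$, $k_2\neq 0$, $k_1\neq k_2$, and $\omega$ is ergodic with respect to the action $\{\alpha^{n(k_2-k_1)}\mid n\in\mathbb Z\}$, it is known that for each $v\in\sigma_{\rm pp}(U_\omega)$ the eigenspace of $U_\omega$ for $v$ is one-dimensional, equal to $\mathbb C V_v\Omega=\mathbb C W_v\Omega$ for unitaries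 $V_v\in M$, $W_v\in M'$, each unique up to a phase, with $U_\omega V_vU_\omega^*=vV_v$, $U_\omega W_vU_\omega^*=vW_v$. Set $$\Sigma(k_1,k_2)=\{(v,w)\in\sigma_{\rm pp}(U_\omega)\times\sigma_{\rm pp}(U_\omega): v^{k_1}w^{k_2}=1\}.$$ The partial isometry $V$ is given by the strongly convergent sum $$V=\sum_{(v,w)\in\Sigma(k_1,k_2)}\langle\,\cdot\,,V_v\Omega\otimes W_w\Omega\rangle\,V_vW_w\Omega .$$ *)

theory Defs
  imports "HOL-Analysis.Analysis"
begin

section \<open>Complex normed spaces, Hilbert spaces and unital C*-algebras\<close>

class complex_normed = real_normed_vector +
  fixes scaleC :: "complex \<Rightarrow> 'a \<Rightarrow> 'a"  (infixr "*\<^sub>C" 75)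
  assumes scaleC_add_right: "c *\<^sub>C (x + y) = c *\<^sub>C x + c *\<^sub>C y"
    and scaleC_add_left: "(c + d) *\<^sub>C x = c *\<^sub>C x + d *\<^sub>C x"
    and scaleC_scaleC: "c *\<^sub>C d *\<^sub>C x = (c * d) *\<^sub>C x"
    and scaleC_of_real: "complex_of_real r *\<^sub>C x = r *\<^sub>R x"
    and norm_scaleC: "norm (c *\<^sub>C x) = cmod c * norm x"

text \<open>The inner product is linear in the first variable. Positive definiteness is
  contained in the last axiom.\<close>

class complex_hilbert = complex_normed + complete_space +
  fixes cinner :: "'a \<Rightarrow> 'a \<Rightarrow> complex"
  assumes cinner_add_left: "cinner (x + y) z = cinner x z + cinner y z"
    and cinner_scaleC_left: "cinner (c *\<^sub>C x) y = c * cinner x y"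
    and cinner_commute: "cinner x y = cnj (cinner y x)"
    and cinner_self: "cinner x x = complex_of_real ((norm x)\<^sup>2)"

text \<open>The axiom \<open>norm 1 = 1\<close> of \<open>real_normed_algebra_1\<close> only excludes the zero algebra,
  which has no states.\<close>

class cstar_algebra = complex_normed + real_normed_algebra_1 + complete_space +
  fixes star :: "'a \<Rightarrow> 'a"
  assumes scaleC_mult_left: "(c *\<^sub>C x) * y = c *\<^sub>C (x * y)"
    and scaleC_mult_right: "x * (c *\<^sub>C y) = c *\<^sub>C (x * y)"
    and star_add: "star (x + y) = star x + star y"
    and star_scaleC: "star (c *\<^sub>C x) = cnj c *\<^sub>C star x"
    and star_mult: "star (x * y) = star y * star x"
    and star_star: "star (star x) = x"
    and cstar_identity: "norm (star x * x) = (norm x)\<^sup>2"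

instantiation complex :: complex_normed
begin

definition scaleC_complex :: "complex \<Rightarrow> complex \<Rightarrow> complex"
  where "scaleC_complex c x = c * x"

instance
  by standard (auto simp: scaleC_complex_def algebra_simps scaleR_conv_of_real norm_mult)

end

section \<open>Bounded complex-linear maps\<close>

definition bounded_clinear :: "('a::complex_normed \<Rightarrow> 'b::complex_normed) \<Rightarrow> bool"
  where "bounded_clinear f \<longleftrightarrow> bounded_linear f \<and> (\<forall>c x. f (c *\<^sub>C x) = c *\<^sub>C f x)"

lemma scaleC_zero_right [simp]: "c *\<^sub>C (0::'a::complex_normed) = 0"
  using scaleC_add_right[of c "0::'a" 0] by simp

lemma scaleC_minus_right: "c *\<^sub>C (- x) = - (c *\<^sub>C (x::'a::complex_normed))"
  using scaleC_add_right[of c x "- x"] by (simp add: eq_neg_iff_add_eq_0 add.commute)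

lemma scaleC_scaleR_commute: "c *\<^sub>C r *\<^sub>R (x::'a::complex_normed) = r *\<^sub>R c *\<^sub>C x"
  by (simp add: scaleC_scaleC mult.commute flip: scaleC_of_real)

lemma bounded_linear_scaleC_right: "bounded_linear (\<lambda>x::'a::complex_normed. c *\<^sub>C x)"
  by (rule bounded_linear_intro[where K = "cmod c"])
    (auto simp: scaleC_add_right scaleC_scaleR_commute norm_scaleC mult.commute)

lemma bounded_clinearI:
  assumes "\<And>x y. f (x + y) = f x + f y" "\<And>c x. f (c *\<^sub>C x) = c *\<^sub>C f x"
    and "\<And>x. norm (f x) \<le> norm x * K"
  shows "bounded_clinear f"
proof -
  have "f (r *\<^sub>R x) = r *\<^sub>R f x" for r x
    using assms(2)[of "complex_of_real r" x] by (simp add: scaleC_of_real)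
  then show ?thesis
    unfolding bounded_clinear_def using assms by (auto intro!: bounded_linear_intro[where K = K])
qed

lemma onorm_scaleC:
  assumes "bounded_linear f"
  shows "onorm (\<lambda>x. c *\<^sub>C f x) = cmod c * onorm (f :: _ \<Rightarrow> 'b::complex_normed)"
proof -
  have "norm (c *\<^sub>C f x) = norm (cmod c *\<^sub>R f x)" for x
    by (simp add: norm_scaleC)
  then have "onorm (\<lambda>x. c *\<^sub>C f x) = onorm (\<lambda>x. cmod c *\<^sub>R f x)"
    by (simp add: onorm_def)
  then show ?thesis
    using onorm_scaleR[OF assms, of "cmod c"] by simp
qed

typedef (overloaded) ('a, 'b) cblinfun = "{f :: 'a::complex_normed \<Rightarrow> 'b::complex_normed. bounded_clinear f}"
  morphisms capply CBlinfun
  by (rule exI[of _ "\<lambda>x. 0"]) (auto simp: bounded_clinear_def)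

setup_lifting type_definition_cblinfun

instantiation cblinfun :: (complex_normed, complex_normed) complex_normed
begin

lift_definition norm_cblinfun :: "('a, 'b) cblinfun \<Rightarrow> real" is onorm .

lift_definition zero_cblinfun :: "('a, 'b) cblinfun" is "\<lambda>x. 0"
  by (auto simp: bounded_clinear_def)

lift_definition plus_cblinfun :: "('a, 'b) cblinfun \<Rightarrow> ('a, 'b) cblinfun \<Rightarrow> ('a, 'b) cblinfun"
  is "\<lambda>f g x. f x + g x"
  by (auto simp: bounded_clinear_def scaleC_add_right intro: bounded_linear_add)

lift_definition uminus_cblinfun :: "('a, 'b) cblinfun \<Rightarrow> ('a, 'b) cblinfun" is "\<lambda>f x. - f x"
  by (auto simp: bounded_clinear_def scaleC_minus_right intro: bounded_linear_minus)

lift_definition minus_cblinfun :: "('a, 'b) cblinfun \<Rightarrow> ('a, 'b) cblinfun \<Rightarrow> ('a, 'b) cblinfun"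
  is "\<lambda>f g x. f x - g x"
  by (auto simp: bounded_clinear_def scaleC_add_right scaleC_minus_right diff_conv_add_uminus
      simp del: add_uminus_conv_diff intro!: bounded_linear_add bounded_linear_minus)

lift_definition scaleC_cblinfun :: "complex \<Rightarrow> ('a, 'b) cblinfun \<Rightarrow> ('a, 'b) cblinfun"
  is "\<lambda>c f x. c *\<^sub>C f x"
  by (auto simp: bounded_clinear_def scaleC_scaleC mult.commute
      intro: bounded_linear_compose[OF bounded_linear_scaleC_right])

lift_definition scaleR_cblinfun :: "real \<Rightarrow> ('a, 'b) cblinfun \<Rightarrow> ('a, 'b) cblinfun"
  is "\<lambda>r f x. r *\<^sub>R f x"
  by (auto simp: bounded_clinear_def scaleC_scaleR_commute
      intro: bounded_linear_compose[OF bounded_linear_scaleR_right])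

definition dist_cblinfun :: "('a, 'b) cblinfun \<Rightarrow> ('a, 'b) cblinfun \<Rightarrow> real"
  where "dist_cblinfun a b = norm (a - b)"

definition uniformity_cblinfun :: "(('a, 'b) cblinfun \<times> ('a, 'b) cblinfun) filter"
  where "uniformity_cblinfun = (INF e\<in>{0 <..}. principal {(x, y). dist x y < e})"

definition open_cblinfun :: "('a, 'b) cblinfun set \<Rightarrow> bool"
  where "open_cblinfun S = (\<forall>x\<in>S. \<forall>\<^sub>F (x', y) in uniformity. x' = x \<longrightarrow> y \<in> S)"

definition sgn_cblinfun :: "('a, 'b) cblinfun \<Rightarrow> ('a, 'b) cblinfun"
  where "sgn_cblinfun x = inverse (norm x) *\<^sub>R x"

instance
  apply standard
  unfolding dist_cblinfun_def open_cblinfun_def sgn_cblinfun_def uniformity_cblinfun_def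
  apply (rule refl | (transfer, force simp: bounded_clinear_def onorm_triangle onorm_scaleR
        onorm_scaleC onorm_eq_0 algebra_simps scaleC_add_right scaleC_add_left scaleC_scaleC
        scaleC_of_real))+
  done

end

lemma bounded_clinear_capply: "bounded_clinear (capply T)"
  using capply by auto

lemma capply_add: "capply T (x + y) = capply T x + capply T y"
  and capply_scaleC: "capply T (c *\<^sub>C x) = c *\<^sub>C capply T x"
  using bounded_clinear_capply[of T]
  by (auto simp: bounded_clinear_def linear_add bounded_linear.linear)

lemma norm_capply: "norm (capply T x) \<le> norm T * norm x"
  by transfer (auto simp: bounded_clinear_def intro: onorm)

lemma capply_plus: "capply (S + T) x = capply S x + capply T x"
  and capply_scaleC_left: "capply (c *\<^sub>C T) x = c *\<^sub>C capply T x"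
  by (transfer, simp)+

type_synonym 'a cdual = "('a, complex) cblinfun"
type_synonym 'h operator = "('h, 'h) cblinfun"

lift_definition cid :: "'h::complex_normed operator" is "\<lambda>x. x"
  by (auto simp: bounded_clinear_def)

lift_definition ccompose :: "('b::complex_normed, 'c::complex_normed) cblinfun \<Rightarrow>
    ('a::complex_normed, 'b) cblinfun \<Rightarrow> ('a, 'c) cblinfun"  (infixl "o\<^sub>C" 67) is "\<lambda>f g x. f (g x)"
  by (auto simp: bounded_clinear_def intro: bounded_linear_compose)

definition cadj :: "'h::complex_hilbert operator \<Rightarrow> 'h operator"
  where "cadj T = (THE S. \<forall>x y. cinner (capply T x) y = cinner x (capply S y))"

definition unitary_op :: "'h::complex_hilbert operator \<Rightarrow> bool"
  where "unitary_op T \<longleftrightarrow> cadj T o\<^sub>C T = cid \<and> T o\<^sub>C cadj T = cid"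

text \<open>The commutant \<open>S'\<close> in \<open>B(H)\<close>.\<close>

definition commutant :: "'h::complex_hilbert operator set \<Rightarrow> 'h operator set"
  where "commutant S = {T. \<forall>R\<in>S. T o\<^sub>C R = R o\<^sub>C T}"

text \<open>Integer powers of a bijection.\<close>

definition zpow :: "('a \<Rightarrow> 'a) \<Rightarrow> int \<Rightarrow> 'a \<Rightarrow> 'a"
  where "zpow f k = (if 0 \<le> k then f ^^ nat k else inv f ^^ nat (- k))"

section \<open>The bidual of a C*-algebra\<close>

lemma norm_star: "norm (star (x::'a::cstar_algebra)) = norm x"
proof -
  have le: "norm y \<le> norm (star y)" for y :: 'a
  proof (cases "y = 0")
    case False
    have "norm y * norm y \<le> norm (star y) * norm y"
      using norm_mult_ineq[of "star y" y] cstar_identity[of y] by (simp add: power2_eq_square)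
    then show ?thesis
      using False by simp
  qed simp
  show ?thesis
    using le[of x] le[of "star x"] by (simp add: star_star)
qed

text \<open>\<open>A**\<close> is the type \<open>'a cdual cdual\<close>, made into an algebra by the Arens product
  \<open>(F G)(f) = F (a \<mapsto> G (b \<mapsto> f (a b)))\<close>, the separately weak*-continuous extension of the
  product of \<open>A\<close> (both Arens products agree since C*-algebras are Arens regular).
  The involution is \<open>F* (f) = cnj (F (f*))\<close> where \<open>f* (a) = cnj (f (a*))\<close>.\<close>

lift_definition dual_shift :: "'a::cstar_algebra cdual \<Rightarrow> 'a \<Rightarrow> 'a cdual"
  is "\<lambda>f a b. f (a * b)"
  by (auto simp: bounded_clinear_def scaleC_mult_right
      intro: bounded_linear_compose[OF _ bounded_linear_mult_right])

lemma dual_shift_apply: "capply (dual_shift f a) b = capply f (a * b)"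
  by transfer simp

lemma norm_dual_shift: "norm (dual_shift f a) \<le> norm f * norm a"
proof -
  have "norm (capply (dual_shift f a) b) \<le> (norm f * norm a) * norm b" for b
  proof -
    have "norm (capply f (a * b)) \<le> norm f * norm (a * b)"
      by (rule norm_capply)
    also have "\<dots> \<le> norm f * (norm a * norm b)"
      by (intro mult_left_mono norm_mult_ineq) simp
    finally show ?thesis
      by (simp add: dual_shift_apply mult.assoc)
  qed
  then show ?thesis
    unfolding norm_cblinfun.rep_eq[of "dual_shift f a"] by (intro onorm_bound) simp_all
qed

lift_definition bidual_act :: "'a::cstar_algebra cdual cdual \<Rightarrow> 'a cdual \<Rightarrow> 'a cdual"
  is "\<lambda>G f a. capply G (dual_shift f a)"
proof (rule bounded_clinearI)
  fix G :: "'a cdual cdual" and f :: "'a cdual" and a b :: 'a and c :: complex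
  have "dual_shift f (a + b) = dual_shift f a + dual_shift f b"
    by (intro capply_inject[THEN iffD1] ext)
      (simp add: dual_shift_apply capply_plus capply_add distrib_right)
  then show "capply G (dual_shift f (a + b)) = capply G (dual_shift f a) + capply G (dual_shift f b)"
    by (simp add: capply_add)
  have "dual_shift f (c *\<^sub>C a) = c *\<^sub>C dual_shift f a"
    by (intro capply_inject[THEN iffD1] ext)
      (simp add: dual_shift_apply capply_scaleC_left capply_scaleC scaleC_mult_left)
  then show "capply G (dual_shift f (c *\<^sub>C a)) = c *\<^sub>C capply G (dual_shift f a)"
    by (simp add: capply_scaleC)
  have "norm (capply G (dual_shift f a)) \<le> norm G * norm (dual_shift f a)"
    by (rule norm_capply)
  also have "\<dots> \<le> norm G * (norm f * norm a)"
    by (intro mult_left_mono norm_dual_shift) simp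
  finally show "norm (capply G (dual_shift f a)) \<le> norm a * (norm G * norm f)"
    by (simp add: mult_ac)
qed

lemma bidual_act_apply: "capply (bidual_act G f) a = capply G (dual_shift f a)"
  by transfer simp

lemma norm_bidual_act: "norm (bidual_act G f) \<le> norm G * norm f"
proof -
  have "norm (capply (bidual_act G f) a) \<le> (norm G * norm f) * norm a" for a
  proof -
    have "norm (capply G (dual_shift f a)) \<le> norm G * norm (dual_shift f a)"
      by (rule norm_capply)
    also have "\<dots> \<le> norm G * (norm f * norm a)"
      by (intro mult_left_mono norm_dual_shift) simp
    finally show ?thesis
      by (simp add: bidual_act_apply mult.assoc)
  qed
  then show ?thesis
    unfolding norm_cblinfun.rep_eq[of "bidual_act G f"] by (intro onorm_bound) simp_all
qed

lift_definition arens :: "'a::cstar_algebra cdual cdual \<Rightarrow> 'a cdual cdual \<Rightarrow> 'a cdual cdual"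
  is "\<lambda>F G f. capply F (bidual_act G f)"
proof (rule bounded_clinearI)
  fix F G :: "'a cdual cdual" and f g :: "'a cdual" and c :: complex
  have "dual_shift (f + g) a = dual_shift f a + dual_shift g a" for a
    by (intro capply_inject[THEN iffD1] ext) (simp add: dual_shift_apply capply_plus)
  then have "bidual_act G (f + g) = bidual_act G f + bidual_act G g"
    by (intro capply_inject[THEN iffD1] ext) (simp add: bidual_act_apply capply_plus capply_add)
  then show "capply F (bidual_act G (f + g)) = capply F (bidual_act G f) + capply F (bidual_act G g)"
    by (simp add: capply_add)
  have "dual_shift (c *\<^sub>C f) a = c *\<^sub>C dual_shift f a" for a
    by (intro capply_inject[THEN iffD1] ext) (simp add: dual_shift_apply capply_scaleC_left)
  then have "bidual_act G (c *\<^sub>C f) = c *\<^sub>C bidual_act G f"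
    by (intro capply_inject[THEN iffD1] ext) (simp add: bidual_act_apply capply_scaleC_left capply_scaleC)
  then show "capply F (bidual_act G (c *\<^sub>C f)) = c *\<^sub>C capply F (bidual_act G f)"
    by (simp add: capply_scaleC)
  have "norm (capply F (bidual_act G f)) \<le> norm F * norm (bidual_act G f)"
    by (rule norm_capply)
  also have "\<dots> \<le> norm F * (norm G * norm f)"
    by (intro mult_left_mono norm_bidual_act) simp
  finally show "norm (capply F (bidual_act G f)) \<le> norm f * (norm F * norm G)"
    by (simp add: mult_ac)
qed

lift_definition dual_star :: "'a::cstar_algebra cdual \<Rightarrow> 'a cdual"
  is "\<lambda>f a. cnj (capply f (star a))"
proof (rule bounded_clinearI)
  fix f :: "'a cdual" and a b :: 'a and c :: complex
  show "cnj (capply f (star (a + b))) = cnj (capply f (star a)) + cnj (capply f (star b))"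
    by (simp add: star_add capply_add)
  show "cnj (capply f (star (c *\<^sub>C a))) = c *\<^sub>C cnj (capply f (star a))"
    by (simp add: star_scaleC capply_scaleC scaleC_complex_def)
  show "norm (cnj (capply f (star a))) \<le> norm a * norm f"
    using norm_capply[of f "star a"] by (simp add: norm_star mult.commute)
qed

lemma dual_star_apply: "capply (dual_star f) a = cnj (capply f (star a))"
  by transfer simp

lemma norm_dual_star: "norm (dual_star f) \<le> norm f"
proof -
  have "norm (capply (dual_star f) a) \<le> norm f * norm a" for a
    using norm_capply[of f "star a"] by (simp add: dual_star_apply norm_star)
  then show ?thesis
    unfolding norm_cblinfun.rep_eq[of "dual_star f"] by (intro onorm_bound) simp_all
qed

lift_definition bidual_star :: "'a::cstar_algebra cdual cdual \<Rightarrow> 'a cdual cdual"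
  is "\<lambda>F f. cnj (capply F (dual_star f))"
proof (rule bounded_clinearI)
  fix F :: "'a cdual cdual" and f g :: "'a cdual" and c :: complex
  have "dual_star (f + g) = dual_star f + dual_star g"
    by (intro capply_inject[THEN iffD1] ext) (simp add: dual_star_apply capply_plus)
  then show "cnj (capply F (dual_star (f + g))) = cnj (capply F (dual_star f)) + cnj (capply F (dual_star g))"
    by (simp add: capply_add)
  have "dual_star (c *\<^sub>C f) = cnj c *\<^sub>C dual_star f"
    by (intro capply_inject[THEN iffD1] ext)
      (simp add: dual_star_apply capply_scaleC_left scaleC_complex_def)
  then show "cnj (capply F (dual_star (c *\<^sub>C f))) = c *\<^sub>C cnj (capply F (dual_star f))"
    by (simp add: capply_scaleC scaleC_complex_def)
  have "norm (capply F (dual_star f)) \<le> norm F * norm (dual_star f)"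
    by (rule norm_capply)
  also have "\<dots> \<le> norm F * norm f"
    by (intro mult_left_mono norm_dual_star) simp
  finally show "norm (cnj (capply F (dual_star f))) \<le> norm f * norm F"
    by (simp add: mult.commute)
qed

definition bidual_centre :: "'a::cstar_algebra cdual cdual set"
  where "bidual_centre = {z. \<forall>F. arens z F = arens F z}"

definition bidual_projection :: "'a::cstar_algebra cdual cdual \<Rightarrow> bool"
  where "bidual_projection p \<longleftrightarrow> arens p p = p \<and> bidual_star p = p"

text \<open>The support of a state \<open>\<phi>\<close>: the smallest projection of \<open>A**\<close> on which the normal
  extension \<open>F \<mapsto> F \<phi>\<close> of \<open>\<phi>\<close> takes the value 1. The order is \<open>p \<le> q \<longleftrightarrow> p = p q = q p\<close>.\<close>

definition is_support :: "'a::cstar_algebra cdual \<Rightarrow> 'a cdual cdual \<Rightarrow> bool"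
  where "is_support \<phi> p \<longleftrightarrow> bidual_projection p \<and> capply p \<phi> = 1 \<and>
    (\<forall>q. bidual_projection q \<and> capply q \<phi> = 1 \<longrightarrow> arens p q = p \<and> arens q p = p)"

section \<open>C*-dynamical systems, ergodicity and the covariant GNS representation\<close>

definition is_state :: "'a::cstar_algebra cdual \<Rightarrow> bool"
  where "is_state \<phi> \<longleftrightarrow> (\<forall>a. capply \<phi> (star a * a) \<in> \<real>\<^sub>\<ge>\<^sub>0) \<and> capply \<phi> 1 = 1"

definition star_automorphism :: "('a::cstar_algebra \<Rightarrow> 'a) \<Rightarrow> bool"
  where "star_automorphism \<alpha> \<longleftrightarrow> bij \<alpha> \<and> (\<forall>a b. \<alpha> (a + b) = \<alpha> a + \<alpha> b) \<and>
    (\<forall>c a. \<alpha> (c *\<^sub>C a) = c *\<^sub>C \<alpha> a) \<and> (\<forall>a b. \<alpha> (a * b) = \<alpha> a * \<alpha> b) \<and>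
    (\<forall>a. \<alpha> (star a) = star (\<alpha> a))"

definition cstar_dynamical_system :: "('a::cstar_algebra \<Rightarrow> 'a) \<Rightarrow> 'a cdual \<Rightarrow> bool"
  where "cstar_dynamical_system \<alpha> \<omega> \<longleftrightarrow>
    star_automorphism \<alpha> \<and> is_state \<omega> \<and> (\<forall>a. capply \<omega> (\<alpha> a) = capply \<omega> a)"

definition invariant_states :: "('a::cstar_algebra \<Rightarrow> 'a) set \<Rightarrow> 'a cdual set"
  where "invariant_states G = {\<phi>. is_state \<phi> \<and> (\<forall>\<beta>\<in>G. \<forall>a. capply \<phi> (\<beta> a) = capply \<phi> a)}"

definition ergodic_state :: "('a::cstar_algebra \<Rightarrow> 'a) set \<Rightarrow> 'a cdual \<Rightarrow> bool"
  where "ergodic_state G \<omega> \<longleftrightarrow> \<omega> extreme_point_of invariant_states G"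

definition star_representation :: "('a::cstar_algebra \<Rightarrow> 'h::complex_hilbert operator) \<Rightarrow> bool"
  where "star_representation \<pi> \<longleftrightarrow> (\<forall>a b. \<pi> (a + b) = \<pi> a + \<pi> b) \<and>
    (\<forall>c a. \<pi> (c *\<^sub>C a) = c *\<^sub>C \<pi> a) \<and> (\<forall>a b. \<pi> (a * b) = \<pi> a o\<^sub>C \<pi> b) \<and> \<pi> 1 = cid \<and>
    (\<forall>a. \<pi> (star a) = cadj (\<pi> a))"

text \<open>The covariant GNS representation is determined by these properties up to unitary
  equivalence.\<close>

definition covariant_GNS :: "('a::cstar_algebra \<Rightarrow> 'a) \<Rightarrow> 'a cdual \<Rightarrow>
    ('a \<Rightarrow> 'h::complex_hilbert operator) \<Rightarrow> 'h operator \<Rightarrow> 'h \<Rightarrow> bool"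
  where "covariant_GNS \<alpha> \<omega> \<pi> U \<Omega> \<longleftrightarrow> star_representation \<pi> \<and>
    closure (range (\<lambda>a. capply (\<pi> a) \<Omega>)) = UNIV \<and>
    (\<forall>a. capply \<omega> a = cinner (capply (\<pi> a) \<Omega>) \<Omega>) \<and>
    unitary_op U \<and> capply U \<Omega> = \<Omega> \<and> (\<forall>a. U o\<^sub>C \<pi> a o\<^sub>C cadj U = \<pi> (\<alpha> a))"

section \<open>The partial isometry V\<close>

text \<open>\<open>t\<close> exhibits the space \<open>'k\<close> as the Hilbert space tensor product of \<open>'g\<close> and \<open>'h\<close>, i.e.
  as a completion of the algebraic tensor product: finite sums of simple tensors are dense.\<close>

definition hilbert_tensor ::
    "('g::complex_hilbert \<Rightarrow> 'h::complex_hilbert \<Rightarrow> 'k::complex_hilbert) \<Rightarrow> bool"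
  where "hilbert_tensor t \<longleftrightarrow>
    (\<forall>x x' y. t (x + x') y = t x y + t x' y) \<and> (\<forall>x y y'. t x (y + y') = t x y + t x y') \<and>
    (\<forall>c x y. t (c *\<^sub>C x) y = c *\<^sub>C t x y) \<and> (\<forall>c x y. t x (c *\<^sub>C y) = c *\<^sub>C t x y) \<and>
    (\<forall>x y x' y'. cinner (t x y) (t x' y') = cinner x x' * cinner y y') \<and>
    closure {(\<Sum>i<n. t (x i) (y i)) | (n::nat) x y. True} = UNIV"

definition eigenspace :: "'h::complex_hilbert operator \<Rightarrow> complex \<Rightarrow> 'h set"
  where "eigenspace U v = {\<xi>. capply U \<xi> = v *\<^sub>C \<xi>}"

definition point_spectrum :: "'h::complex_hilbert operator \<Rightarrow> complex set"
  where "point_spectrum U = {v. \<exists>\<xi>. \<xi> \<noteq> 0 \<and> \<xi> \<in> eigenspace U v}"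

text \<open>A unitary of \<open>M\<close> with \<open>U T U* = v T\<close> for which \<open>T \<Omega>\<close> spans the eigenspace of \<open>v\<close>.
  It is unique up to a phase in the situation of interest, where \<open>\<Omega>\<close> is separating for \<open>M\<close>;
  \<open>ergodic_V\<close> below does not depend on the phases.\<close>

definition eigen_unitary :: "'h::complex_hilbert operator set \<Rightarrow> 'h operator \<Rightarrow> 'h \<Rightarrow> complex \<Rightarrow> 'h operator"
  where "eigen_unitary M U \<Omega> v = (SOME T. T \<in> M \<and> unitary_op T \<and>
    U o\<^sub>C T o\<^sub>C cadj U = v *\<^sub>C T \<and> eigenspace U v = range (\<lambda>c. c *\<^sub>C capply T \<Omega>))"

definition Sigma_set :: "'h::complex_hilbert operator \<Rightarrow> int \<Rightarrow> int \<Rightarrow> (complex \<times> complex) set"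
  where "Sigma_set U k1 k2 = {(v, w). v \<in> point_spectrum U \<and> w \<in> point_spectrum U \<and>
    v powi k1 * w powi k2 = 1}"

text \<open>Here \<open>M'\<close> is passed to \<open>eigen_unitary\<close> to obtain the \<open>W\<^sub>w\<close>; \<open>infsum\<close> is the unordered
  norm-convergent sum of vectors, so that the operator sum is the strong one.\<close>

definition ergodic_V :: "'h::complex_hilbert operator set \<Rightarrow> 'h operator \<Rightarrow> 'h \<Rightarrow>
    ('h \<Rightarrow> 'h \<Rightarrow> 'k::complex_hilbert) \<Rightarrow> int \<Rightarrow> int \<Rightarrow> 'k \<Rightarrow> 'h"
  where "ergodic_V M U \<Omega> t k1 k2 \<zeta> =
    (\<Sum>\<^sub>\<infinity>(v, w)\<in>Sigma_set U k1 k2.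
      (let V\<^sub>v = eigen_unitary M U \<Omega> v; W\<^sub>w = eigen_unitary (commutant M) U \<Omega> w
       in cinner \<zeta> (t (capply V\<^sub>v \<Omega>) (capply W\<^sub>w \<Omega>)) *\<^sub>C capply V\<^sub>v (capply W\<^sub>w \<Omega>)))"

end

theory Submission
  imports Defs
begin

text \<open>
  For \<open>X \<in> M\<close> and \<open>B \<in> M'\<close> the average applied to \<open>B \<Omega>\<close> becomes the average of
  \<open>U\<^bsup>n k2\<^esup> B U\<^bsup>- n (k2 - k1)\<^esup> x\<close> at \<open>x = X \<Omega>\<close>, which is continuous in \<open>x\<close>. For an eigenvector \<open>x\<close>
  the mean ergodic theorem gives the limit. For \<open>x\<close> orthogonal to all eigenvectors the limit is \<open>0\<close>:
  the van der Corput inequality bounds it by the norm of the mean of \<open>U\<^bsup>n k1\<^esup> x \<otimes> U\<^bsup>n k2\<^esup> B \<Omega>\<close>, and a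
  nonzero mean would be a compact conjugate-linear operator intertwining the powers of \<open>U\<close>, hence
  would produce an eigenvector. The case \<open>X \<in> M'\<close> is symmetric, once one knows that \<open>V\<^sub>v\<close> and \<open>V\<^sub>w\<close>
  commute when \<open>v\<^bsup>k1\<^esup> w\<^bsup>k2\<^esup> = 1\<close>.

  All this needs \<open>M' \<Omega>\<close> to be dense. If \<open>\<xi> \<noteq> 0\<close> were orthogonal to it, a Kaplansky type argument
  yields positive contractions \<open>a\<^sub>k\<close> with \<open>\<omega>(a\<^sub>k) \<le> 4\<^bsup>-k\<^esup>\<close> and \<open>a\<^sub>k \<xi> \<approx> \<xi> / 2\<close>. The projection in \<open>A**\<close>
  onto the domain of the quadratic form \<open>\<Sum>2\<^sup>k a\<^sub>k\<close> has \<open>\<omega>\<close>-value \<open>1\<close> and annihilates \<open>\<xi>\<close>, whereas the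
  support, being central, acts as the identity.
\<close>

section \<open>Hilbert space preliminaries\<close>

text \<open>The tensor product enters through correlations. In the inner product of A B \<Omega>
  with A1 B1 \<Omega>, where A, A1 lie in \<open>M\<close> and B, B1 in \<open>M'\<close>,
  everything from \<open>M\<close> can be moved to one side and everything from \<open>M'\<close> to
  the other. Powers of \<open>U\<close> then survive only as a relative power with exponent n (k2 -
  k1), so ergodicity replaces the mean over n by a product of two inner products, that is, by an
  inner product of simple tensors. The obstacle behind the density of M' \<Omega> is that centrality
  of the support speaks about the Arens algebra, so the competing projection has to be constructed
  there. It is a double limit of resolvents, while the Arens product is itself an iterated limit in
  a fixed order. The limits can be combined because bounded monotone sequences, acting on a
  functional, converge in the norm of the dual. The order theory this requires is derived from the
  norm alone: a positive element is the square of a selfadjoint one, and roots come from an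
  iteration.\<close>

instance complex_hilbert \<subseteq> banach ..
instance cstar_algebra \<subseteq> banach ..

lemma scaleC_one [simp]: "1 *\<^sub>C (x::'a::complex_normed) = x"
  using scaleC_of_real[of 1 x] by simp

lemma scaleC_zero_left [simp]: "0 *\<^sub>C (x::'a::complex_normed) = 0"
  using scaleC_of_real[of 0 x] by simp

lemma scaleC_minus_left: "(- c) *\<^sub>C (x::'a::complex_normed) = - (c *\<^sub>C x)"
  using scaleC_add_left[of c "- c" x] by (simp add: eq_neg_iff_add_eq_0 add.commute)

lemma scaleC_diff_right: "c *\<^sub>C (x - y) = c *\<^sub>C x - c *\<^sub>C (y::'a::complex_normed)"
  using scaleC_add_right[of c x "- y"] by (simp add: scaleC_minus_right)

lemma scaleC_diff_left: "(c - d) *\<^sub>C (x::'a::complex_normed) = c *\<^sub>C x - d *\<^sub>C x"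
  using scaleC_add_left[of c "- d" x] by (simp add: scaleC_minus_left)

lemma scaleC_sum_right: "c *\<^sub>C (\<Sum>i\<in>I. f i) = (\<Sum>i\<in>I. c *\<^sub>C (f i::'a::complex_normed))"
  by (induction I rule: infinite_finite_induct) (auto simp: scaleC_add_right)

lemma scaleC_eq_0_iff [simp]: "c *\<^sub>C (x::'a::complex_normed) = 0 \<longleftrightarrow> c = 0 \<or> x = 0"
  using norm_scaleC[of c x] by (metis mult_eq_0_iff norm_eq_zero)

lemma bounded_linear_scaleC_left: "bounded_linear (\<lambda>c. c *\<^sub>C (x::'a::complex_normed))"
  by (rule bounded_linear_intro[where K = "norm x"])
    (auto simp: scaleC_add_left norm_scaleC scaleR_conv_of_real
      scaleC_scaleC[symmetric] scaleC_of_real)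

lemma tendsto_scaleC_right [tendsto_intros]:
  "(f \<longlongrightarrow> l) F \<Longrightarrow> ((\<lambda>n. c *\<^sub>C (f n::'a::complex_normed)) \<longlongrightarrow> c *\<^sub>C l) F"
  by (rule bounded_linear.tendsto[OF bounded_linear_scaleC_right])

lemma cinner_add_right: "cinner x (y + z) = cinner x y + cinner x (z::'h::complex_hilbert)"
  by (metis cinner_add_left cinner_commute complex_cnj_add)

lemma cinner_scaleC_right: "cinner x (c *\<^sub>C y) = cnj c * cinner x (y::'h::complex_hilbert)"
  by (metis cinner_scaleC_left cinner_commute complex_cnj_mult)

lemma cinner_zero_left [simp]: "cinner 0 (y::'h::complex_hilbert) = 0"
  using cinner_scaleC_left[of 0 y y] by simp

lemma cinner_zero_right [simp]: "cinner y (0::'h::complex_hilbert) = 0"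
  using cinner_scaleC_right[of y 0 y] by simp

lemma cinner_minus_left: "cinner (- x) (y::'h::complex_hilbert) = - cinner x y"
  using cinner_add_left[of x "- x" y] by (simp add: eq_neg_iff_add_eq_0 add.commute)

lemma cinner_minus_right: "cinner x (- y::'h::complex_hilbert) = - cinner x y"
  using cinner_add_right[of x y "- y"] by (simp add: eq_neg_iff_add_eq_0 add.commute)

lemma cinner_diff_left: "cinner (x - y) (z::'h::complex_hilbert) = cinner x z - cinner y z"
  using cinner_add_left[of x "- y" z] by (simp add: cinner_minus_left)

lemma cinner_diff_right: "cinner x (y - z::'h::complex_hilbert) = cinner x y - cinner x z"
  using cinner_add_right[of x y "- z"] by (simp add: cinner_minus_right)

lemma cinner_scaleR_left: "cinner (r *\<^sub>R x) (y::'h::complex_hilbert) = of_real r * cinner x y"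
  by (metis cinner_scaleC_left scaleC_of_real)

lemma cinner_scaleR_right: "cinner x (r *\<^sub>R y::'h::complex_hilbert) = of_real r * cinner x y"
  by (metis cinner_scaleC_right scaleC_of_real complex_cnj_complex_of_real)

lemma cinner_sum_left: "cinner (\<Sum>i\<in>I. f i) (y::'h::complex_hilbert) = (\<Sum>i\<in>I. cinner (f i) y)"
  by (induction I rule: infinite_finite_induct) (auto simp: cinner_add_left)

lemma cinner_sum_right: "cinner y (\<Sum>i\<in>I. f i::'h::complex_hilbert) = (\<Sum>i\<in>I. cinner y (f i))"
  by (induction I rule: infinite_finite_induct) (auto simp: cinner_add_right)

lemmas cinner_simps = cinner_add_left cinner_add_right cinner_diff_left cinner_diff_right
  cinner_minus_left cinner_minus_right cinner_scaleC_left cinner_scaleC_right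
  cinner_scaleR_left cinner_scaleR_right

lemma Re_cinner_commute: "Re (cinner x y) = Re (cinner y (x::'h::complex_hilbert))"
  by (subst cinner_commute) simp

lemma norm_add_sq:
  "(norm (x + y))\<^sup>2 = (norm x)\<^sup>2 + (norm y)\<^sup>2 + 2 * Re (cinner x (y::'h::complex_hilbert))"
proof -
  have "complex_of_real ((norm (x + y))\<^sup>2) = cinner (x + y) (x + y)"
    by (simp add: cinner_self)
  also have "\<dots> = cinner x x + cinner y y + cinner x y + cinner y x"
    by (simp add: cinner_simps)
  finally have "Re (complex_of_real ((norm (x + y))\<^sup>2)) = Re (cinner x x + cinner y y + cinner x y + cinner y x)"
    by simp
  then show ?thesis
    by (simp add: cinner_self Re_cinner_commute[of y x])
qed

lemma norm_diff_sq:
  "(norm (x - y))\<^sup>2 = (norm x)\<^sup>2 + (norm y)\<^sup>2 - 2 * Re (cinner x (y::'h::complex_hilbert))"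
  using norm_add_sq[of x "- y"] by (simp add: cinner_minus_right)

lemma parallelogram:
  "(norm (x + y))\<^sup>2 + (norm (x - y))\<^sup>2 = 2 * (norm x)\<^sup>2 + 2 * (norm (y::'h::complex_hilbert))\<^sup>2"
  by (simp add: norm_add_sq norm_diff_sq)

lemma cinner_self_eq_0 [simp]: "cinner x x = 0 \<longleftrightarrow> x = (0::'h::complex_hilbert)"
  by (simp add: cinner_self)

lemma cinner_norm_le: "cmod (cinner x y) \<le> norm x * norm (y::'h::complex_hilbert)"
proof (cases "y = 0")
  case False
  define c where "c = cinner x y / of_real ((norm y)\<^sup>2)"
  have ny: "norm y > 0" using False by simp
  have "(norm (x - c *\<^sub>C y))\<^sup>2 = (norm x)\<^sup>2 + (cmod c * norm y)\<^sup>2 - 2 * Re (cnj c * cinner x y)"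
    by (simp add: norm_diff_sq norm_scaleC cinner_scaleC_right)
  also have "cnj c * cinner x y = of_real ((cmod (cinner x y))\<^sup>2 / (norm y)\<^sup>2)"
    by (simp add: c_def complex_norm_square mult.commute flip: of_real_power)
  also have "(cmod c * norm y)\<^sup>2 = (cmod (cinner x y))\<^sup>2 / (norm y)\<^sup>2"
    using ny by (simp add: c_def norm_divide norm_mult power2_eq_square field_simps)
  finally have "(cmod (cinner x y))\<^sup>2 / (norm y)\<^sup>2 \<le> (norm x)\<^sup>2"
    using zero_le_power2[of "norm (x - c *\<^sub>C y)"] by simp
  then have "(cmod (cinner x y))\<^sup>2 \<le> (norm x * norm y)\<^sup>2"
    using ny by (simp add: field_simps power_mult_distrib)
  then show ?thesis
    by (rule power2_le_imp_le) simp
qed simp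

lemma bounded_bilinear_cinner: "bounded_bilinear (cinner :: 'h::complex_hilbert \<Rightarrow> _)"
  by (rule bounded_bilinear.intro)
    (auto simp: cinner_simps scaleR_conv_of_real intro!: exI[of _ 1] cinner_norm_le)

lemmas tendsto_cinner [tendsto_intros] = bounded_bilinear.tendsto[OF bounded_bilinear_cinner]

lemma cinner_ext: "(\<And>z. cinner z x = cinner z y) \<Longrightarrow> x = (y::'h::complex_hilbert)"
  by (metis cinner_diff_right cinner_self_eq_0 right_minus_eq)

lemma closure_UNIV_approx:
  fixes S :: "'a::real_normed_vector set"
  assumes "closure S = UNIV" "e > 0"
  obtains y where "y \<in> S" "norm (x - y) < e"
  using assms closure_approachable[of x S] by (auto simp: dist_norm norm_minus_commute)

lemma cinner_ext_dense:
  fixes x y :: "'h::complex_hilbert"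
  assumes "closure S = UNIV" "\<And>z. z \<in> S \<Longrightarrow> cinner z x = cinner z y"
  shows "x = y"
proof -
  have "UNIV \<subseteq> {z. cinner z x = cinner z y}"
    unfolding assms(1)[symmetric]
    by (intro closure_minimal closed_Collect_eq continuous_intros
        linear_continuous_on bounded_bilinear.bounded_linear_left[OF bounded_bilinear_cinner])
      (use assms(2) in auto)
  then show ?thesis by (intro cinner_ext) auto
qed

section \<open>Nearest points and orthogonal projections\<close>

lemma nearest_point:
  fixes S :: "'h::complex_hilbert set"
  assumes S: "closed S" "convex S" "S \<noteq> {}"
  shows "\<exists>x\<in>S. \<forall>y\<in>S. norm (p - x) \<le> norm (p - y)"
proof -
  define d where "d = (INF y\<in>S. norm (p - y))"
  have bdd: "bdd_below ((\<lambda>y. norm (p - y)) ` S)"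
    by (rule bdd_belowI[of _ 0]) auto
  have dle: "d \<le> norm (p - y)" if "y \<in> S" for y
    unfolding d_def using that bdd by (intro cINF_lower)
  have d0: "d \<ge> 0"
    unfolding d_def using S(3) by (intro cINF_greatest) auto
  have "\<exists>y\<in>S. norm (p - y) < d + 1 / real (Suc n)" for n
    using cINF_less_iff[OF S(3) bdd, of "d + 1 / real (Suc n)"] unfolding d_def by auto
  then obtain x where x: "\<And>n. x n \<in> S" "\<And>n. norm (p - x n) < d + 1 / real (Suc n)"
    by metis
  \<comment> \<open>The midpoint of \<open>x n\<close> and \<open>x m\<close> lies in
    \<open>S\<close>, so the parallelogram law turns closeness of both distances to \<open>d\<close>
    into closeness of the two points.\<close>
  have est: "(norm (x n - x m))\<^sup>2 \<le> 4 * ((d + 1 / real (Suc k))\<^sup>2 - d\<^sup>2)"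
    if "k \<le> n" "k \<le> m" for n m k
  proof -
    let ?e = "1 / real (Suc k)"
    have n: "norm (p - x n) \<le> d + ?e" if "k \<le> n" for n
    proof -
      have "1 / real (Suc n) \<le> ?e" using that by (simp add: frac_le)
      then show ?thesis using x(2)[of n] by linarith
    qed
    have mid: "(1/2) *\<^sub>R x n + (1/2) *\<^sub>R x m \<in> S"
      using S(2) x(1) by (auto simp: convex_def)
    have eq: "(p - x n) + (p - x m) = 2 *\<^sub>R (p - ((1/2) *\<^sub>R x n + (1/2) *\<^sub>R x m))"
      by (simp add: algebra_simps scaleR_2)
    have "norm ((p - x n) + (p - x m)) \<ge> 2 * d"
      unfolding eq using dle[OF mid] by simp
    then have "(norm ((p - x n) + (p - x m)))\<^sup>2 \<ge> (2 * d)\<^sup>2"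
      using d0 by (intro power_mono) auto
    moreover have "(norm (p - x n))\<^sup>2 \<le> (d + ?e)\<^sup>2" "(norm (p - x m))\<^sup>2 \<le> (d + ?e)\<^sup>2"
      using n that by (auto intro!: power_mono)
    moreover have "(p - x n) - (p - x m) = x m - x n" by simp
    ultimately show ?thesis
      using parallelogram[of "p - x n" "p - x m"]
      by (simp add: norm_minus_commute power_mult_distrib)
  qed
  have lim0: "(\<lambda>k. 4 * ((d + 1 / real (Suc k))\<^sup>2 - d\<^sup>2)) \<longlonglongrightarrow> 4 * ((d + 0)\<^sup>2 - d\<^sup>2)"
    by (intro tendsto_intros LIMSEQ_Suc lim_1_over_n)
  have "Cauchy x"
  proof (rule metric_CauchyI)
    fix e :: real assume "e > 0"
    then have "\<forall>\<^sub>F k in sequentially. 4 * ((d + 1 / real (Suc k))\<^sup>2 - d\<^sup>2) < e\<^sup>2"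
      using order_tendstoD(2)[OF lim0, of "e\<^sup>2"] by simp
    then obtain k where k: "4 * ((d + 1 / real (Suc k))\<^sup>2 - d\<^sup>2) < e\<^sup>2"
      by (auto simp: eventually_sequentially)
    show "\<exists>M. \<forall>m\<ge>M. \<forall>n\<ge>M. dist (x m) (x n) < e"
    proof (intro exI[of _ k] allI impI)
      fix m n assume "k \<le> m" "k \<le> n"
      then have "(norm (x m - x n))\<^sup>2 < e\<^sup>2" using est[of k m n] k by simp
      then show "dist (x m) (x n) < e"
        using \<open>e > 0\<close> by (simp add: dist_norm power_less_imp_less_base)
    qed
  qed
  then obtain l where l: "x \<longlonglongrightarrow> l"
    using Cauchy_convergent convergent_def by blast
  have lS: "l \<in> S" using S(1) x(1) l closed_sequentially by blast
  have "(\<lambda>n. norm (p - x n)) \<longlonglongrightarrow> norm (p - l)"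
    by (intro tendsto_intros l)
  moreover have "(\<lambda>n. d + 1 / real (Suc n)) \<longlonglongrightarrow> d + 0"
    by (intro tendsto_intros LIMSEQ_Suc lim_1_over_n)
  ultimately have "norm (p - l) \<le> d + 0"
    by (rule LIMSEQ_le) (use x(2) less_imp_le in blast)
  then show ?thesis using lS dle by force
qed

text \<open>The real-linear version comes first because \<open>selfadjoint_density\<close> projects
  onto a space that is only a real subspace. Orthogonality is the vanishing of the first variation
  of the distance.\<close>

lemma real_subspace_projection:
  fixes S :: "'h::complex_hilbert set"
  assumes S: "closed S" "subspace S"
  shows "\<exists>x\<in>S. \<forall>y\<in>S. Re (cinner y (p - x)) = 0"
proof -
  obtain x where x: "x \<in> S" "\<And>y. y \<in> S \<Longrightarrow> norm (p - x) \<le> norm (p - y)"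
    using nearest_point[OF S(1) subspace_imp_convex[OF S(2)], of p] subspace_0[OF S(2)] by blast
  have "Re (cinner y (p - x)) = 0" if y: "y \<in> S" for y
  proof (cases "y = 0")
    case False
    \<comment> \<open>The real multiple of \<open>y\<close> closest to \<open>p - x\<close>;
      minimality of \<open>x\<close> forces it to be \<open>0\<close>.\<close>
    define t where "t = Re (cinner (p - x) y) / (norm y)\<^sup>2"
    have "x + t *\<^sub>R y \<in> S" using S(2) x(1) y by (simp add: subspace_add subspace_scale)
    then have "(norm (p - x))\<^sup>2 \<le> (norm (p - (x + t *\<^sub>R y)))\<^sup>2"
      using x(2) by (intro power_mono) auto
    also have "p - (x + t *\<^sub>R y) = (p - x) - t *\<^sub>R y" by simp
    also have "(norm \<dots>)\<^sup>2 = (norm (p - x))\<^sup>2 + t\<^sup>2 * (norm y)\<^sup>2 - 2 * (t * Re (cinner (p - x) y))"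
      by (subst norm_diff_sq) (simp add: cinner_scaleR_right power_mult_distrib)
    finally have "2 * (t * Re (cinner (p - x) y)) \<le> t\<^sup>2 * (norm y)\<^sup>2"
      by simp
    moreover have "Re (cinner (p - x) y) = t * (norm y)\<^sup>2"
      using False by (simp add: t_def)
    ultimately have "t\<^sup>2 * (norm y)\<^sup>2 \<le> 0"
      by (simp add: power2_eq_square mult.assoc)
    then have "t = 0" using False by (simp add: mult_le_0_iff)
    then show ?thesis
      using False by (simp add: t_def Re_cinner_commute[of y])
  qed simp
  then show ?thesis using x(1) by blast
qed

definition csubspace :: "'a::complex_normed set \<Rightarrow> bool"
  where "csubspace S \<longleftrightarrow> 0 \<in> S \<and> (\<forall>x\<in>S. \<forall>y\<in>S. x + y \<in> S) \<and> (\<forall>c. \<forall>x\<in>S. c *\<^sub>C x \<in> S)"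

lemma csubspace_imp_subspace: "csubspace S \<Longrightarrow> subspace S"
  unfolding csubspace_def subspace_def by (metis scaleC_of_real)

lemma csubspace_closure:
  fixes S :: "'a::complex_normed set"
  assumes "csubspace S" shows "csubspace (closure S)"
proof -
  have "c *\<^sub>C x \<in> closure S" if "x \<in> closure S" for c x
  proof -
    obtain f where f: "\<And>n. f n \<in> S" "f \<longlonglongrightarrow> x" using \<open>x \<in> closure S\<close> closure_sequential by blast
    then have "(\<lambda>n. c *\<^sub>C f n) \<longlonglongrightarrow> c *\<^sub>C x" by (intro tendsto_intros)
    moreover have "c *\<^sub>C f n \<in> S" for n using f(1) assms unfolding csubspace_def by blast
    ultimately show ?thesis unfolding closure_sequential by (intro exI[of _ "\<lambda>n. c *\<^sub>C f n"]) auto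
  qed
  moreover have "x + y \<in> closure S" if "x \<in> closure S" "y \<in> closure S" for x y
  proof -
    obtain f where f: "\<And>n. f n \<in> S" "f \<longlonglongrightarrow> x" using \<open>x \<in> closure S\<close> closure_sequential by blast
    obtain g where g: "\<And>n. g n \<in> S" "g \<longlonglongrightarrow> y" using \<open>y \<in> closure S\<close> closure_sequential by blast
    have "(\<lambda>n. f n + g n) \<longlonglongrightarrow> x + y" by (intro tendsto_intros f g)
    moreover have "f n + g n \<in> S" for n using f(1) g(1) assms unfolding csubspace_def by blast
    ultimately show ?thesis unfolding closure_sequential by (intro exI[of _ "\<lambda>n. f n + g n"]) auto
  qed
  moreover have "0 \<in> closure S"
    using assms closure_subset unfolding csubspace_def by blast
  ultimately show ?thesis unfolding csubspace_def by blast
qed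

lemma csubspace_projection:
  fixes S :: "'h::complex_hilbert set"
  assumes S: "closed S" "csubspace S"
  shows "\<exists>x\<in>S. \<forall>y\<in>S. cinner y (p - x) = 0"
proof -
  obtain x where x: "x \<in> S" "\<And>y. y \<in> S \<Longrightarrow> Re (cinner y (p - x)) = 0"
    using real_subspace_projection[OF S(1) csubspace_imp_subspace[OF S(2)], of p] by blast
  have "cinner y (p - x) = 0" if "y \<in> S" for y
  proof -
    \<comment> \<open>Testing with this multiple of \<open>y\<close> turns the imaginary part of the
      inner product into a real part.\<close>
    have "(- \<i>) *\<^sub>C y \<in> S" using S(2) that unfolding csubspace_def by blast
    from x(2)[OF this] x(2)[OF that] show ?thesis
      by (simp add: cinner_scaleC_left complex_eq_iff)
  qed
  then show ?thesis using x(1) by blast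
qed

lemma dense_if_orthogonal_trivial:
  fixes S :: "'h::complex_hilbert set"
  assumes "csubspace S" "\<And>x. (\<And>y. y \<in> S \<Longrightarrow> cinner y x = 0) \<Longrightarrow> x = 0"
  shows "closure S = UNIV"
proof -
  have "p \<in> closure S" for p
  proof -
    obtain x where x: "x \<in> closure S" "\<And>y. y \<in> closure S \<Longrightarrow> cinner y (p - x) = 0"
      using csubspace_projection[OF closed_closure csubspace_closure[OF assms(1)], of p] by blast
    then have "p - x = 0" using assms(2) closure_subset by blast
    then show ?thesis using x(1) by simp
  qed
  then show ?thesis by blast
qed

section \<open>Bounded operators\<close>

lemma capply_zero [simp]: "capply T 0 = 0"
  and capply_minus: "capply T (- x) = - capply T x"
  and capply_diff: "capply T (x - y) = capply T x - capply T y"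
  and capply_scaleR: "capply T (r *\<^sub>R x) = r *\<^sub>R capply T x"
  and capply_sum: "capply T (\<Sum>i\<in>I. f i) = (\<Sum>i\<in>I. capply T (f i))"
  and bounded_linear_capply: "bounded_linear (capply T)"
  using bounded_clinear_capply[of T] unfolding bounded_clinear_def
  by (auto simp: linear_0 linear_diff linear_neg linear_scale linear_sum bounded_linear.linear)

lemma tendsto_capply [tendsto_intros]:
  "(f \<longlongrightarrow> l) F \<Longrightarrow> ((\<lambda>n. capply T (f n)) \<longlongrightarrow> capply T l) F"
  by (rule bounded_linear.tendsto[OF bounded_linear_capply])

lemma capply_minus_left: "capply (S - T) x = capply S x - capply T x"
  by transfer simp

lemma capply_zero_left [simp]: "capply 0 x = 0"
  by transfer simp

lemma capply_scaleR_left: "capply (r *\<^sub>R T) x = r *\<^sub>R capply T x"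
  by transfer simp

lemma capply_cid [simp]: "capply cid x = x"
  by transfer simp

lemma capply_compose [simp]: "capply (S o\<^sub>C T) x = capply S (capply T x)"
  by transfer simp

lemma cblinfun_ext: "(\<And>x. capply S x = capply T x) \<Longrightarrow> S = T"
  by (metis capply_inject ext)

lemma ccompose_assoc: "(R o\<^sub>C S) o\<^sub>C T = R o\<^sub>C (S o\<^sub>C T)"
  by (rule cblinfun_ext) simp

lemma cid_compose [simp]: "cid o\<^sub>C T = T" "T o\<^sub>C cid = T"
  by (rule cblinfun_ext, simp)+

lemma norm_cblinfun_bound: "0 \<le> b \<Longrightarrow> (\<And>x. norm (capply T x) \<le> b * norm x) \<Longrightarrow> norm T \<le> b"
  unfolding norm_cblinfun.rep_eq by (rule onorm_bound)

lemma cblinfun_exists: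
  assumes "\<And>x y. f (x + y) = f x + f y" "\<And>c x. f (c *\<^sub>C x) = c *\<^sub>C f x"
    and "\<And>x. norm (f x) \<le> K * norm x"
  shows "\<exists>T. capply T = f"
  using CBlinfun_inverse[of f] bounded_clinearI[OF assms(1,2), of K] assms(3)
  by (auto simp: mult.commute)

lemma cblinfun_ext_dense:
  assumes "closure S = UNIV" "\<And>x. x \<in> S \<Longrightarrow> capply A x = capply B x"
  shows "A = B"
proof -
  have "UNIV \<subseteq> {x. capply A x = capply B x}"
    unfolding assms(1)[symmetric]
    by (intro closure_minimal closed_Collect_eq linear_continuous_on bounded_linear_capply)
      (use assms(2) in auto)
  then show ?thesis by (intro cblinfun_ext) auto
qed

section \<open>Riesz representation and adjoints\<close>

lemma riesz:
  fixes f :: "'h::complex_hilbert cdual"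
  shows "\<exists>z. \<forall>x. capply f x = cinner x z"
proof (cases "\<exists>p. capply f p \<noteq> 0")
  case True
  then obtain p where p: "capply f p \<noteq> 0" by blast
  let ?S = "{x. capply f x = 0}"
  have "closed ?S"
    by (intro closed_Collect_eq linear_continuous_on bounded_linear_capply continuous_on_const)
  moreover have "csubspace ?S"
    by (auto simp: csubspace_def capply_add capply_scaleC)
  ultimately obtain x where x: "capply f x = 0" "\<And>y. capply f y = 0 \<Longrightarrow> cinner y (p - x) = 0"
    using csubspace_projection[of ?S p] by blast
  \<comment> \<open>\<open>u\<close> is orthogonal to the kernel, and subtracting the right multiple
    of \<open>u\<close> moves any \<open>y\<close> into the kernel.\<close>
  define u where "u = p - x"
  have fu: "capply f u \<noteq> 0" using p x(1) by (simp add: u_def capply_diff)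
  then have uu: "cinner u u \<noteq> 0" by auto
  have "capply f y = cinner y (cnj (capply f u / cinner u u) *\<^sub>C u)" for y
  proof -
    have "capply f (y - (capply f y / capply f u) *\<^sub>C u) = 0"
      using fu by (simp add: capply_diff capply_scaleC scaleC_complex_def)
    from x(2)[OF this] have "cinner y u = (capply f y / capply f u) * cinner u u"
      by (simp add: u_def[symmetric] cinner_simps)
    then show ?thesis using fu uu by (simp add: cinner_simps)
  qed
  then show ?thesis by blast
next
  case False
  then show ?thesis by (auto intro!: exI[of _ 0])
qed

lemma cadj_exists:
  fixes T :: "'h::complex_hilbert operator"
  shows "\<exists>S. \<forall>x y. cinner (capply T x) y = cinner x (capply S y)"
proof -
  have "\<exists>z. \<forall>x. cinner (capply T x) y = cinner x z" for y
  proof -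
    have "\<exists>f::'h cdual. capply f = (\<lambda>x. cinner (capply T x) y)"
    proof (rule cblinfun_exists)
      fix x
      have "cmod (cinner (capply T x) y) \<le> norm (capply T x) * norm y" by (rule cinner_norm_le)
      also have "\<dots> \<le> norm T * norm x * norm y" by (intro mult_right_mono norm_capply) simp
      finally show "cmod (cinner (capply T x) y) \<le> (norm T * norm y) * norm x" by (simp add: mult_ac)
    qed (auto simp: capply_add capply_scaleC cinner_simps scaleC_complex_def)
    then show ?thesis using riesz by metis
  qed
  then obtain g where g: "\<And>x y. cinner (capply T x) y = cinner x (g y)" by metis
  have "\<exists>S. capply S = g"
  proof (rule cblinfun_exists)
    fix x
    have "(norm (g x))\<^sup>2 = Re (cinner (capply T (g x)) x)" by (simp add: g cinner_self)
    also have "\<dots> \<le> norm (capply T (g x)) * norm x"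
      using cinner_norm_le complex_Re_le_cmod order_trans by blast
    also have "\<dots> \<le> norm T * norm (g x) * norm x" by (intro mult_right_mono norm_capply) simp
    finally have "norm (g x) * norm (g x) \<le> norm (g x) * (norm T * norm x)"
      by (simp add: power2_eq_square mult_ac)
    then show "norm (g x) \<le> norm T * norm x"
      by (cases "g x = 0") auto
  qed (rule cinner_ext, simp add: g[symmetric] cinner_simps)+
  then show ?thesis using g by metis
qed

text \<open>\<open>cadj\<close> is a definite description, so its characteristic identity needs
  uniqueness in addition to \<open>cadj_exists\<close>.\<close>

lemma cinner_cadj: "cinner (capply T x) y = cinner x (capply (cadj T) (y::'h::complex_hilbert))"
proof -
  have "\<exists>!S. \<forall>x y. cinner (capply T x) y = cinner x (capply S y)"
  proof (rule ex_ex1I)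
    show "\<exists>S. \<forall>x y. cinner (capply T x) y = cinner x (capply S y)" by (rule cadj_exists)
  next
    fix S S' assume "\<forall>x y. cinner (capply T x) y = cinner x (capply S y)"
      "\<forall>x y. cinner (capply T x) y = cinner x (capply S' y)"
    then show "S = S'" by (intro cblinfun_ext cinner_ext) metis
  qed
  from theI'[OF this] show ?thesis unfolding cadj_def by blast
qed

lemma cinner_cadj': "cinner (capply (cadj T) x) y = cinner x (capply T (y::'h::complex_hilbert))"
  by (metis cinner_cadj cinner_commute)

lemma cadj_eqI: "(\<And>x y. cinner (capply T x) y = cinner x (capply S y)) \<Longrightarrow> cadj T = S"
  by (intro cblinfun_ext cinner_ext) (metis cinner_cadj)

lemma cadj_cadj [simp]: "cadj (cadj T) = T"
  by (rule cadj_eqI) (rule cinner_cadj')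

lemma cadj_compose: "cadj (S o\<^sub>C T) = cadj T o\<^sub>C cadj S"
  by (rule cadj_eqI) (simp add: cinner_cadj)

lemma cadj_add: "cadj (S + T) = cadj S + cadj T"
  by (rule cadj_eqI) (simp add: cinner_cadj cinner_simps capply_plus)

lemma cadj_scaleC: "cadj (c *\<^sub>C T) = cnj c *\<^sub>C cadj T"
  by (rule cadj_eqI) (simp add: cinner_cadj cinner_simps capply_scaleC_left)

lemma cadj_cid [simp]: "cadj cid = cid"
  by (rule cadj_eqI) simp

lemma unitary_op_apply:
  assumes "unitary_op U"
  shows "capply (cadj U) (capply U x) = x" "capply U (capply (cadj U) x) = x"
  using assms unfolding unitary_op_def by (metis capply_compose capply_cid)+

lemma unitary_opI:
  "(\<And>x. capply (cadj U) (capply U x) = x) \<Longrightarrow> (\<And>x. capply U (capply (cadj U) x) = x) \<Longrightarrow> unitary_op U"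
  unfolding unitary_op_def by (auto intro!: cblinfun_ext)

lemma unitary_op_cadj: "unitary_op U \<Longrightarrow> unitary_op (cadj U)"
  unfolding unitary_op_def by simp

lemma unitary_op_cid: "unitary_op cid"
  unfolding unitary_op_def by simp

lemma unitary_op_compose: "unitary_op U \<Longrightarrow> unitary_op W \<Longrightarrow> unitary_op (U o\<^sub>C W)"
  by (rule unitary_opI) (simp_all add: cadj_compose unitary_op_apply)

lemma unitary_op_scaleC: "unitary_op U \<Longrightarrow> cmod c = 1 \<Longrightarrow> unitary_op (c *\<^sub>C U)"
  by (rule unitary_opI)
    (simp_all add: cadj_scaleC capply_scaleC_left capply_scaleC scaleC_scaleC unitary_op_apply
      complex_norm_square[symmetric] mult.commute[of "cnj c"])

lemma unitary_cinner: "unitary_op U \<Longrightarrow> cinner (capply U x) (capply U y) = cinner x y"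
  by (simp add: cinner_cadj unitary_op_apply)

lemma unitary_norm: "unitary_op U \<Longrightarrow> norm (capply U x) = norm x"
proof -
  assume "unitary_op U"
  then have "complex_of_real ((norm (capply U x))\<^sup>2) = of_real ((norm x)\<^sup>2)"
    unfolding cinner_self[symmetric] by (rule unitary_cinner)
  then show ?thesis
    using of_real_eq_iff[of "(norm (capply U x))\<^sup>2" "(norm x)\<^sup>2", where 'a = complex]
    by simp
qed

text \<open>Linearity comes from uniqueness of the orthogonal decomposition, the norm bound from
  Pythagoras.\<close>

lemma projection_operator:
  fixes S :: "'h::complex_hilbert set"
  assumes S: "closed S" "csubspace S"
  obtains E where "\<And>x. capply E x \<in> S" "\<And>x y. y \<in> S \<Longrightarrow> cinner y (x - capply E x) = 0"
    "\<And>x. x \<in> S \<Longrightarrow> capply E x = x"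
proof -
  obtain f where f: "\<And>p. f p \<in> S" "\<And>p y. y \<in> S \<Longrightarrow> cinner y (p - f p) = 0"
    using csubspace_projection[OF S] by metis
  have uniq: "x = f p" if "x \<in> S" "\<And>y. y \<in> S \<Longrightarrow> cinner y (p - x) = 0" for x p
  proof -
    have "x + (- 1) *\<^sub>C f p \<in> S" using S(2) f(1) that(1) unfolding csubspace_def by blast
    then have mem: "x - f p \<in> S" by (simp add: scaleC_minus_left)
    have "cinner (x - f p) (x - f p) = cinner (x - f p) (p - f p) - cinner (x - f p) (p - x)"
      by (simp add: cinner_simps)
    then show ?thesis using that(2)[OF mem] f(2)[OF mem] by simp
  qed
  have "\<exists>E. capply E = f"
  proof (rule cblinfun_exists)
    fix x y
    have "f x + f y \<in> S" using S(2) f(1) unfolding csubspace_def by blast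
    moreover have "cinner z (x + y - (f x + f y)) = 0" if "z \<in> S" for z
      using f(2)[OF that, of x] f(2)[OF that, of y] by (simp add: cinner_simps)
    ultimately show "f (x + y) = f x + f y" using uniq by metis
  next
    fix c x
    have "c *\<^sub>C f x \<in> S" using S(2) f(1) unfolding csubspace_def by blast
    moreover have "cinner z (c *\<^sub>C x - c *\<^sub>C f x) = 0" if "z \<in> S" for z
      using f(2)[OF that, of x] by (simp add: cinner_simps)
    ultimately show "f (c *\<^sub>C x) = c *\<^sub>C f x" using uniq by metis
  next
    fix x
    have "(norm x)\<^sup>2 = (norm (f x))\<^sup>2 + (norm (x - f x))\<^sup>2"
      using norm_add_sq[of "f x" "x - f x"] f(2)[OF f(1), of x x] by simp
    then have "(norm (f x))\<^sup>2 \<le> (norm x)\<^sup>2" by simp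
    then show "norm (f x) \<le> 1 * norm x" by (simp add: power2_le_iff_abs_le)
  qed
  then obtain E where E: "capply E = f" by blast
  show thesis
  proof (rule that[of E])
    fix x assume "x \<in> S"
    then show "capply E x = x" unfolding E by (intro uniq[symmetric]) auto
  qed (auto simp: E f)
qed

text \<open>The principle by which limits known on a dense set pass to all vectors; the
  approximation has to be uniform in \<open>n\<close>.\<close>

lemma limit_from_approx:
  fixes G :: "nat \<Rightarrow> 'a::real_normed_vector" and l :: 'a
  assumes "\<And>e. e > 0 \<Longrightarrow> \<exists>H m. H \<longlonglongrightarrow> m \<and> (\<forall>n. norm (G n - H n) \<le> e) \<and> norm (l - m) \<le> e"
  shows "G \<longlonglongrightarrow> l"
proof (rule metric_LIMSEQ_I)
  fix e :: real assume e: "e > 0"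
  obtain H m where H: "H \<longlonglongrightarrow> m" "\<And>n. norm (G n - H n) \<le> e/4" "norm (l - m) \<le> e/4"
    using assms[of "e/4"] e by auto
  obtain N where N: "\<And>n. n \<ge> N \<Longrightarrow> dist (H n) m < e/4"
    using metric_LIMSEQ_D[OF H(1), of "e/4"] e by auto
  have "dist (G n) l < e" if "n \<ge> N" for n
  proof -
    have eq: "G n - l = (G n - H n) + (H n - m) - (l - m)" by simp
    have "norm (G n - l) \<le> norm (G n - H n) + norm (H n - m) + norm (l - m)"
      unfolding eq using norm_triangle_ineq[of "G n - H n" "H n - m"]
        norm_triangle_ineq4[of "(G n - H n) + (H n - m)" "l - m"] by linarith
    then show ?thesis using H(2)[of n] H(3) N[OF that] e by (simp add: dist_norm)
  qed
  then show "\<exists>no. \<forall>n\<ge>no. dist (G n) l < e" by blast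
qed

lemma Cauchy_from_approx:
  fixes G :: "nat \<Rightarrow> 'a::real_normed_vector"
  assumes "\<And>e. e > 0 \<Longrightarrow> \<exists>H. Cauchy H \<and> (\<forall>n. norm (G n - H n) \<le> e)"
  shows "Cauchy G"
proof (rule metric_CauchyI)
  fix e :: real assume e: "e > 0"
  obtain H where H: "Cauchy H" "\<And>n. norm (G n - H n) \<le> e/4"
    using assms[of "e/4"] e by auto
  obtain N where N: "\<And>m n. m \<ge> N \<Longrightarrow> n \<ge> N \<Longrightarrow> dist (H m) (H n) < e/4"
    using metric_CauchyD[OF H(1), of "e/4"] e by auto
  have "dist (G m) (G n) < e" if "m \<ge> N" "n \<ge> N" for m n
  proof -
    have eq: "G m - G n = (G m - H m) + (H m - H n) - (G n - H n)" by simp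
    have "norm (G m - G n) \<le> norm (G m - H m) + norm (H m - H n) + norm (G n - H n)"
      unfolding eq using norm_triangle_ineq[of "G m - H m" "H m - H n"]
        norm_triangle_ineq4[of "(G m - H m) + (H m - H n)" "G n - H n"] by linarith
    then show ?thesis using H(2)[of n] H(2)[of m] N[OF that] e by (simp add: dist_norm)
  qed
  then show "\<exists>N. \<forall>m\<ge>N. \<forall>n\<ge>N. dist (G m) (G n) < e" by blast
qed

text \<open>For uniformly bounded operators convergence on a dense set is enough. With
  \<open>UNIV\<close> as dense set this also produces limit functionals on the algebra and on its
  dual.\<close>

lemma strong_limit_exists:
  fixes S :: "nat \<Rightarrow> ('a::complex_normed, 'b::{complex_normed,banach}) cblinfun"
  assumes bnd: "\<And>n x. norm (capply (S n) x) \<le> C * norm x"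
    and D: "closure D = UNIV" and conv: "\<And>x. x \<in> D \<Longrightarrow> convergent (\<lambda>n. capply (S n) x)"
  shows "\<exists>T. \<forall>x. (\<lambda>n. capply (S n) x) \<longlonglongrightarrow> capply T x"
proof -
  have "Cauchy (\<lambda>n. capply (S n) x)" for x
  proof (rule Cauchy_from_approx)
    fix e :: real assume e: "e > 0"
    have C: "\<bar>C\<bar> + 1 > 0" by simp
    obtain y where y: "y \<in> D" "norm (x - y) < e / (\<bar>C\<bar> + 1)"
      using closure_UNIV_approx[OF D, of "e / (\<bar>C\<bar> + 1)" x] e by auto
    have "norm (capply (S n) x - capply (S n) y) \<le> e" for n
    proof -
      have "norm (capply (S n) x - capply (S n) y) \<le> C * norm (x - y)"
        using bnd[of n "x - y"] by (simp add: capply_diff)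
      also have "\<dots> \<le> (\<bar>C\<bar> + 1) * norm (x - y)" by (intro mult_right_mono) auto
      also have "\<dots> \<le> e" using y(2) C by (simp add: field_simps)
      finally show ?thesis .
    qed
    then show "\<exists>H. Cauchy H \<and> (\<forall>n. norm (capply (S n) x - H n) \<le> e)"
      using conv[OF y(1)] convergent_Cauchy by blast
  qed
  then have "\<exists>l. (\<lambda>n. capply (S n) x) \<longlonglongrightarrow> l" for x
    using Cauchy_convergent convergent_def by blast
  then obtain f where f: "\<And>x. (\<lambda>n. capply (S n) x) \<longlonglongrightarrow> f x" by metis
  have "\<exists>T. capply T = f"
  proof (rule cblinfun_exists)
    fix x y
    have "(\<lambda>n. capply (S n) (x + y)) \<longlonglongrightarrow> f x + f y"
      unfolding capply_add by (intro tendsto_intros f)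
    then show "f (x + y) = f x + f y" using f LIMSEQ_unique by blast
  next
    fix c x
    have "(\<lambda>n. capply (S n) (c *\<^sub>C x)) \<longlonglongrightarrow> c *\<^sub>C f x"
      unfolding capply_scaleC by (intro tendsto_intros f)
    then show "f (c *\<^sub>C x) = c *\<^sub>C f x" using f LIMSEQ_unique by blast
  next
    fix x
    show "norm (f x) \<le> C * norm x"
      by (rule LIMSEQ_le_const2[OF tendsto_norm[OF f]]) (use bnd in auto)
  qed
  then show ?thesis using f by auto
qed

lemma commutant_iff: "T \<in> commutant S \<longleftrightarrow> (\<forall>R\<in>S. \<forall>x. capply T (capply R x) = capply R (capply T x))"
  unfolding commutant_def by (auto intro!: cblinfun_ext) (metis capply_compose)

lemma commutantD: "T \<in> commutant S \<Longrightarrow> R \<in> S \<Longrightarrow> capply T (capply R x) = capply R (capply T x)"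
  by (simp add: commutant_iff)

lemma commutant_triple: "commutant (commutant (commutant S)) = commutant S"
  by (auto simp: commutant_def)

lemma commutant_compose: "A \<in> commutant S \<Longrightarrow> B \<in> commutant S \<Longrightarrow> A o\<^sub>C B \<in> commutant S"
  and commutant_add: "A \<in> commutant S \<Longrightarrow> B \<in> commutant S \<Longrightarrow> A + B \<in> commutant S"
  and commutant_scaleC: "A \<in> commutant S \<Longrightarrow> c *\<^sub>C A \<in> commutant S"
  and commutant_cid: "cid \<in> commutant S"
  by (auto simp: commutant_iff capply_plus capply_add capply_scaleC_left capply_scaleC)

lemma commutant_cadj:
  assumes "\<And>R. R \<in> S \<Longrightarrow> cadj R \<in> S" "A \<in> commutant S"
  shows "cadj A \<in> commutant S"
  unfolding commutant_iff
proof (intro ballI allI cinner_ext)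
  fix R x z assume "R \<in> S"
  then show "cinner z (capply (cadj A) (capply R x)) = cinner z (capply R (capply (cadj A) x))"
    using commutantD[OF assms(2) assms(1)] by (metis cinner_cadj cinner_cadj')
qed

section \<open>Positive elements of a C*-algebra\<close>

lemma star_one [simp]: "star (1::'a::cstar_algebra) = 1"
  by (metis mult.left_neutral mult.right_neutral star_mult star_star)

lemma star_scaleR: "star (r *\<^sub>R x) = r *\<^sub>R star (x::'a::cstar_algebra)"
  by (metis star_scaleC scaleC_of_real complex_cnj_complex_of_real)

lemma star_zero [simp]: "star (0::'a::cstar_algebra) = 0"
  using star_scaleR[of 0 "0::'a"] by simp

lemma star_minus: "star (- x) = - star (x::'a::cstar_algebra)"
  using star_scaleR[of "-1" x] by simp

lemma star_diff: "star (x - y) = star x - star (y::'a::cstar_algebra)"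
  using star_add[of x "- y"] by (simp add: star_minus)

lemma star_sum: "star (\<Sum>i\<in>I. f i) = (\<Sum>i\<in>I. star (f i::'a::cstar_algebra))"
  by (induction I rule: infinite_finite_induct) (auto simp: star_add)

lemma bounded_linear_star: "bounded_linear (star :: 'a::cstar_algebra \<Rightarrow> 'a)"
  by (rule bounded_linear_intro[where K = 1]) (auto simp: star_add star_scaleR norm_star)

lemmas star_simps = star_add star_diff star_minus star_scaleR star_scaleC star_mult star_star

lemma norm_selfadjoint_sq: "star h = h \<Longrightarrow> norm (h * h) = (norm (h::'a::cstar_algebra))\<^sup>2"
  using cstar_identity[of h] by simp

section \<open>Square roots by iteration\<close>

fun root_iter :: "'a::cstar_algebra \<Rightarrow> nat \<Rightarrow> 'a" where
  "root_iter x 0 = 0"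
| "root_iter x (Suc n) = (1/2) *\<^sub>R (x + root_iter x n * root_iter x n)"

fun root_iter_real :: "nat \<Rightarrow> real" where
  "root_iter_real 0 = 0"
| "root_iter_real (Suc n) = (1/2) * (1 + root_iter_real n * root_iter_real n)"

lemma root_iter_commute: "x * y = y * x \<Longrightarrow> root_iter x n * y = y * root_iter x n"
proof (induction n)
  case (Suc n)
  have "root_iter x n * root_iter x n * y = y * (root_iter x n * root_iter x n)"
    using Suc by (metis mult.assoc)
  then show ?case using Suc.prems by (simp add: distrib_left distrib_right)
qed simp

lemma root_iter_real_bounds: "0 \<le> root_iter_real n \<and> root_iter_real n \<le> 1"
proof (induction n)
  case (Suc n)
  then have "root_iter_real n * root_iter_real n \<le> 1 * 1" by (intro mult_mono) auto
  then show ?case using Suc by simp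
qed simp

text \<open>The iteration \<open>s \<mapsto> (x + s\<^sup>2) / 2\<close> converges to \<open>1 - \<surd>(1 - x)\<close>; its increments are
  dominated by those of the scalar iteration for \<open>x = 1\<close>, which increases to at most \<open>1\<close>.\<close>

lemma root_iter_bounds:
  assumes "norm x \<le> 1"
  shows "norm (root_iter x n) \<le> root_iter_real n \<and>
    norm (root_iter x (Suc n) - root_iter x n) \<le> root_iter_real (Suc n) - root_iter_real n"
proof (induction n)
  case 0
  then show ?case using assms by simp
next
  case (Suc n)
  let ?s = "root_iter x" and ?t = "root_iter_real"
  have 1: "norm (?s (Suc n)) \<le> ?t (Suc n)"
  proof -
    have "norm (?s (Suc n)) \<le> norm (?s (Suc n) - ?s n) + norm (?s n)"
      using norm_triangle_ineq[of "?s (Suc n) - ?s n" "?s n"] by (simp del: root_iter.simps)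
    then show ?thesis using Suc by linarith
  qed
  have comm: "?s n * ?s (Suc n) = ?s (Suc n) * ?s n"
    by (rule root_iter_commute) (metis root_iter_commute)
  have "?s (Suc (Suc n)) - ?s (Suc n) = (1/2) *\<^sub>R ((?s (Suc n) - ?s n) * (?s (Suc n) + ?s n))"
  proof -
    have "(1/2) *\<^sub>R (x + p * p) - (1/2) *\<^sub>R (x + q * q) = (1/2) *\<^sub>R ((p - q) * (p + q))"
      if "q * p = p * q" for p q
      using that by (simp add: algebra_simps)
    from this[OF comm] show ?thesis by (simp only: root_iter.simps(2)[symmetric])
  qed
  also have "norm \<dots> \<le> (1/2) * (norm (?s (Suc n) - ?s n) * norm (?s (Suc n) + ?s n))"
    by (simp add: norm_mult_ineq del: root_iter.simps)
  also have "\<dots> \<le> (1/2) * ((?t (Suc n) - ?t n) * (?t (Suc n) + ?t n))"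
  proof (intro mult_left_mono mult_mono)
    show "norm (?s (Suc n) + ?s n) \<le> ?t (Suc n) + ?t n"
      using 1 Suc norm_triangle_ineq[of "?s (Suc n)" "?s n"] by linarith
    show "0 \<le> ?t (Suc n) - ?t n" using Suc norm_ge_zero order_trans by blast
  qed (use Suc in auto)
  also have "\<dots> = ?t (Suc (Suc n)) - ?t (Suc n)"
  proof -
    have "(1/2) * ((p - q) * (p + q)) = (1/2) * (1 + p * p) - (1/2) * (1 + q * q)" for p q :: real
      by (simp add: algebra_simps)
    from this[of "?t (Suc n)" "?t n"] show ?thesis by (simp only: root_iter_real.simps(2)[symmetric])
  qed
  finally show ?case using 1 by blast
qed

text \<open>The increments are summable because the bounded monotone majorant converges. Whatever
  commutes with \<open>x\<close> commutes with every iterate, hence with the limit.\<close>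

lemma sqrt_one_minus:
  fixes x :: "'a::cstar_algebra"
  assumes x: "norm x \<le> 1"
  obtains s where "(1 - s) * (1 - s) = 1 - x" "norm s \<le> 1" "star x = x \<Longrightarrow> star s = s"
    "\<And>y. x * y = y * x \<Longrightarrow> s * y = y * s"
proof -
  let ?s = "root_iter x" and ?t = root_iter_real
  have mono: "incseq ?t"
  proof (rule incseq_SucI)
    fix n
    have "0 \<le> ?t (Suc n) - ?t n" using root_iter_bounds[OF x, of n] norm_ge_zero order_trans by blast
    then show "?t n \<le> ?t (Suc n)" by simp
  qed
  have "convergent ?t"
    using incseq_convergent[OF mono, of 1] root_iter_real_bounds by (metis convergentI)
  then have "summable (\<lambda>n. ?t (Suc n) - ?t n)"
    using telescope_summable convergent_LIMSEQ_iff by blast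
  then have "summable (\<lambda>n. ?s (Suc n) - ?s n)"
    by (rule summable_comparison_test') (use root_iter_bounds[OF x] in blast)
  then have "convergent (\<lambda>n. \<Sum>i<n. (?s (Suc i) - ?s i))"
    by (simp add: summable_iff_convergent)
  moreover have "(\<Sum>i<n. (?s (Suc i) - ?s i)) = ?s n" for n
    using sum_lessThan_telescope[of ?s n] by simp
  ultimately obtain s where s: "?s \<longlonglongrightarrow> s" by (auto simp: convergent_def)
  have "(\<lambda>n. ?s (Suc n)) \<longlonglongrightarrow> (1/2) *\<^sub>R (x + s * s)"
    unfolding root_iter.simps by (intro tendsto_intros s)
  then have fix_s: "s = (1/2) *\<^sub>R (x + s * s)"
    using LIMSEQ_Suc[OF s] LIMSEQ_unique by blast
  have "2 *\<^sub>R s = x + s * s" using arg_cong[OF fix_s, of "\<lambda>z. 2 *\<^sub>R z"] by simp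
  then have "(1 - s) * (1 - s) = 1 - x"
    by (simp add: algebra_simps scaleR_2)
  moreover have "norm s \<le> 1"
    by (rule LIMSEQ_le_const2[OF tendsto_norm[OF s]])
      (use root_iter_bounds[OF x] root_iter_real_bounds order_trans in blast)
  moreover have "star s = s" if "star x = x"
  proof -
    have "star (?s n) = ?s n" for n
      by (induction n) (auto simp: star_simps that)
    then show ?thesis
      using bounded_linear.tendsto[OF bounded_linear_star s] s LIMSEQ_unique by auto
  qed
  moreover have "s * y = y * s" if "x * y = y * x" for y
  proof -
    have "(\<lambda>n. ?s n * y) \<longlonglongrightarrow> s * y" "(\<lambda>n. y * ?s n) \<longlonglongrightarrow> y * s"
      by (intro tendsto_intros s)+
    then show ?thesis using root_iter_commute[OF that] LIMSEQ_unique by auto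
  qed
  ultimately show thesis using that by blast
qed

text \<open>Positivity is encoded by a selfadjoint root, so that no spectrum is involved. That these
  elements form a cone rests on the norm criterion given by \<open>cposI_norm\<close> and
  \<open>norm_le_of_cpos\<close>.\<close>

definition cpos :: "'a::cstar_algebra \<Rightarrow> bool"
  where "cpos a \<longleftrightarrow> (\<exists>h. star h = h \<and> a = h * h)"

lemma cpos_star: "cpos a \<Longrightarrow> star a = a"
  by (auto simp: cpos_def star_mult)

lemma cpos_square: "star h = h \<Longrightarrow> cpos (h * h)"
  by (auto simp: cpos_def)

lemma cpos_zero [simp]: "cpos 0" and cpos_one [simp]: "cpos 1"
  using cpos_square[of 0] cpos_square[of 1] by auto

lemma cpos_scaleR:
  assumes "cpos a" "r \<ge> 0" shows "cpos (r *\<^sub>R a)"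
proof -
  obtain h where "star h = h" "a = h * h" using assms(1) by (auto simp: cpos_def)
  then show ?thesis
    using cpos_square[of "sqrt r *\<^sub>R h"] assms(2) by (simp add: star_scaleR flip: power2_eq_square)
qed

lemma cpos_of_norm_one:
  fixes a :: "'a::cstar_algebra"
  assumes "star a = a" "norm (1 - a) \<le> 1"
  obtains h where "star h = h" "h * h = a" "norm (1 - h) \<le> 1" "\<And>y. a * y = y * a \<Longrightarrow> h * y = y * h"
proof -
  obtain s where s: "(1 - s) * (1 - s) = 1 - (1 - a)" "norm s \<le> 1"
    "star (1 - a) = 1 - a \<Longrightarrow> star s = s" "\<And>y. (1 - a) * y = y * (1 - a) \<Longrightarrow> s * y = y * s"
    using sqrt_one_minus[OF assms(2)] by metis
  show thesis
  proof (rule that[of "1 - s"])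
    fix y assume "a * y = y * a"
    then show "(1 - s) * y = y * (1 - s)" using s(4)[of y] by (simp add: algebra_simps)
  qed (use s assms in \<open>auto simp: star_simps\<close>)
qed

lemma cpos_of_norm:
  fixes a :: "'a::cstar_algebra"
  assumes "star a = a" "t > 0" "norm (t *\<^sub>R 1 - a) \<le> t"
  obtains h where "cpos h" "h * h = a" "\<And>y. a * y = y * a \<Longrightarrow> h * y = y * h"
proof -
  let ?b = "(1/t) *\<^sub>R a"
  have "1 - ?b = (1/t) *\<^sub>R (t *\<^sub>R 1 - a)" using assms(2) by (simp add: algebra_simps)
  then have "norm (1 - ?b) = (1/t) * norm (t *\<^sub>R 1 - a)" using assms(2) by simp
  then have "norm (1 - ?b) \<le> 1" using assms(2,3) by simp
  then obtain h where h: "star h = h" "h * h = ?b" "norm (1 - h) \<le> 1" "\<And>y. ?b * y = y * ?b \<Longrightarrow> h * y = y * h"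
    using cpos_of_norm_one[of ?b] assms(1) by (metis star_scaleR)
  show thesis
  proof (rule that[of "sqrt t *\<^sub>R h"])
    \<comment> \<open>The root \<open>h\<close> satisfies \<open>norm (1 - h) \<le> 1\<close> and so
      has a selfadjoint root itself; this makes it positive and not merely selfadjoint.\<close>
    obtain k where "star k = k" "k * k = h" using cpos_of_norm_one[OF h(1,3)] by metis
    then show "cpos (sqrt t *\<^sub>R h)" using assms(2) cpos_square by (auto intro!: cpos_scaleR)
    show "sqrt t *\<^sub>R h * sqrt t *\<^sub>R h = a" using h(2) assms(2) by simp
    show "sqrt t *\<^sub>R h * y = y * sqrt t *\<^sub>R h" if "a * y = y * a" for y using h(4)[of y] that by simp
  qed
qed

text \<open>For commuting selfadjoint \<open>h\<close>, \<open>k\<close> with \<open>h\<^sup>2 + k\<^sup>2 = t\<close>, the element \<open>h + i k\<close> has norm \<open>\<surd>t\<close>.\<close>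

lemma norm_le_of_square_sum:
  fixes h k :: "'a::cstar_algebra"
  assumes "star h = h" "star k = k" "h * k = k * h" "h * h + k * k = t *\<^sub>R 1" "t \<ge> 0"
  shows "norm (h * h) \<le> t"
proof -
  define u where "u = h + \<i> *\<^sub>C k"
  have su: "star u = h - \<i> *\<^sub>C k" by (simp add: u_def star_simps assms scaleC_minus_left)
  have "star u * u = h * h + k * k"
    unfolding su by (simp add: u_def algebra_simps scaleC_mult_left scaleC_mult_right scaleC_scaleC
        assms(3) scaleC_minus_left scaleC_add_right scaleC_diff_right)
  then have "(norm u)\<^sup>2 = t" using cstar_identity[of u] assms(4,5) by simp
  have "2 *\<^sub>R h = u + star u" unfolding su by (simp add: u_def scaleR_2)
  then have "2 * norm h \<le> norm u + norm (star u)" by (metis norm_triangle_ineq norm_scaleR abs_numeral)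
  then have "norm h \<le> norm u" by (simp add: norm_star)
  then have "(norm h)\<^sup>2 \<le> (norm u)\<^sup>2" by (intro power_mono) auto
  then show ?thesis using \<open>(norm u)\<^sup>2 = t\<close> norm_selfadjoint_sq[OF assms(1)] by simp
qed

text \<open>The converse direction of the norm criterion. The element
  \<open>t *\<^sub>R 1 - a\<close> has a root commuting with a root of \<open>a\<close>, and the two
  squares add up to \<open>t\<close>, so \<open>norm_le_of_square_sum\<close> applies.\<close>

lemma norm_le_of_cpos:
  fixes a :: "'a::cstar_algebra"
  assumes "cpos a" "norm a \<le> t"
  shows "norm (t *\<^sub>R 1 - a) \<le> t"
proof (cases "t = 0")
  case False
  then have t: "t > 0" using assms(2) norm_ge_zero[of a] by linarith
  obtain h where h: "star h = h" "a = h * h" using assms(1) by (auto simp: cpos_def)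
  have "norm (t *\<^sub>R 1 - (t *\<^sub>R 1 - a)) \<le> t" using assms(2) by simp
  moreover have "star (t *\<^sub>R 1 - a) = t *\<^sub>R 1 - a" using cpos_star[OF assms(1)] by (simp add: star_simps)
  ultimately obtain k where k: "cpos k" "k * k = t *\<^sub>R 1 - a"
    "\<And>y. (t *\<^sub>R 1 - a) * y = y * (t *\<^sub>R 1 - a) \<Longrightarrow> k * y = y * k"
    using cpos_of_norm[OF _ t, of "t *\<^sub>R 1 - a"] by metis
  have "k * h = h * k" by (rule k(3)) (simp add: h(2) algebra_simps)
  then have "norm (k * k) \<le> t"
    using norm_le_of_square_sum[OF cpos_star[OF k(1)] h(1), of t] t k(2) h(2) by simp
  then show ?thesis by (simp add: k(2))
qed (use assms in simp)

lemma cpos_root: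
  fixes a :: "'a::cstar_algebra"
  assumes "cpos a"
  obtains h where "cpos h" "h * h = a" "\<And>y. a * y = y * a \<Longrightarrow> h * y = y * h"
  using cpos_of_norm[OF cpos_star[OF assms], of "norm a + 1"] norm_le_of_cpos[OF assms, of "norm a + 1"]
    norm_ge_zero[of a] by (smt (verit, best))

lemma cposI_norm: "star a = a \<Longrightarrow> t > 0 \<Longrightarrow> norm (t *\<^sub>R 1 - a) \<le> t \<Longrightarrow> cpos (a::'a::cstar_algebra)"
  by (metis cpos_of_norm cpos_square cpos_star)

text \<open>In terms of the norm criterion, additivity of the cone is the triangle
  inequality.\<close>

lemma cpos_add:
  assumes "cpos a" "cpos b" shows "cpos (a + b :: 'a::cstar_algebra)"
proof (rule cposI_norm)
  let ?s = "norm a + 1" and ?t = "norm b + 1"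
  show "star (a + b) = a + b" using assms by (simp add: star_add cpos_star)
  show "0 < ?s + ?t" by (smt (verit) norm_ge_zero)
  have "(?s + ?t) *\<^sub>R 1 - (a + b) = (?s *\<^sub>R 1 - a) + (?t *\<^sub>R 1 - b)"
    by (simp only: scaleR_add_left[of ?s ?t] add_diff_add)
  also have "norm \<dots> \<le> ?s + ?t"
    using norm_le_of_cpos[OF assms(1), of ?s] norm_le_of_cpos[OF assms(2), of ?t]
    by (intro norm_triangle_mono) auto
  finally show "norm ((?s + ?t) *\<^sub>R 1 - (a + b)) \<le> ?s + ?t" .
qed

lemma cpos_sum: "(\<And>i. i \<in> I \<Longrightarrow> cpos (f i)) \<Longrightarrow> cpos (\<Sum>i\<in>I. f i :: 'a::cstar_algebra)"
  by (induction I rule: infinite_finite_induct) (auto intro: cpos_add)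

lemma cpos_norm_minus: "star a = a \<Longrightarrow> norm a \<le> t \<Longrightarrow> cpos (t *\<^sub>R 1 - a :: 'a::cstar_algebra)"
proof (cases "t = 0")
  case False
  assume a: "star a = a" "norm a \<le> t"
  then have "t > 0" using False norm_ge_zero[of a] by linarith
  then show ?thesis by (intro cposI_norm[of _ t]) (use a in \<open>auto simp: star_simps\<close>)
qed simp

lemma norm_le_scalar:
  fixes d :: "'a::cstar_algebra"
  assumes "cpos d" "cpos (t *\<^sub>R 1 - d)" "t \<ge> 0"
  shows "norm d \<le> t"
proof -
  obtain h where h: "star h = h" "d = h * h" using assms(1) by (auto simp: cpos_def)
  obtain k where k: "cpos k" "k * k = t *\<^sub>R 1 - d"
    "\<And>y. (t *\<^sub>R 1 - d) * y = y * (t *\<^sub>R 1 - d) \<Longrightarrow> k * y = y * k"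
    using cpos_root[OF assms(2)] by metis
  have "k * h = h * k" by (rule k(3)) (simp add: h(2) algebra_simps)
  then show ?thesis
    using norm_le_of_square_sum[OF h(1) cpos_star[OF k(1)], of t] k(2) h(2) assms(3) by simp
qed

lemma cpos_norm_mono:
  fixes d e :: "'a::cstar_algebra"
  assumes "cpos d" "cpos (e - d)"
  shows "norm d \<le> norm e"
proof (rule norm_le_scalar[OF assms(1)])
  have "cpos e" using cpos_add[OF assms] by simp
  then have "cpos (norm e *\<^sub>R 1 - e)" by (intro cpos_norm_minus cpos_star) auto
  from cpos_add[OF this assms(2)] show "cpos (norm e *\<^sub>R 1 - d)" by simp
qed simp

lemma cpos_mult_commute:
  fixes a b :: "'a::cstar_algebra"
  assumes "cpos a" "cpos b" "a * b = b * a" shows "cpos (a * b)"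
proof -
  obtain h where h: "cpos h" "h * h = a" "\<And>y. a * y = y * a \<Longrightarrow> h * y = y * h"
    using cpos_root[OF assms(1)] by metis
  obtain k where k: "cpos k" "k * k = b" "\<And>y. b * y = y * b \<Longrightarrow> k * y = y * k"
    using cpos_root[OF assms(2)] by metis
  have hk: "k * h = h * k" using k(3) h(3) assms(3) by metis
  have "star (h * k) = h * k" using hk h(1) k(1) by (simp add: star_mult cpos_star)
  moreover have "(h * k) * (h * k) = a * b" by (metis hk h(2) k(2) mult.assoc)
  ultimately show ?thesis using cpos_square by metis
qed

text \<open>With \<open>a\<close> for the element in question and \<open>g\<close> for the positive
  root of its square, \<open>e = g - a\<close> is twice the negative part of \<open>a\<close> and
  has to vanish. The usual comparison of the spectra of \<open>star y * y\<close> and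
  \<open>y * star y\<close> is replaced by a norm estimate.\<close>

lemma cpos_star_mult: "cpos (star x * x :: 'a::cstar_algebra)"
proof -
  define a where "a = star x * x"
  have sa: "star a = a" by (simp add: a_def star_mult star_star)
  obtain g where g: "cpos g" "g * g = a * a" "\<And>y. a * a * y = y * (a * a) \<Longrightarrow> g * y = y * g"
    using cpos_root[OF cpos_square[OF sa]] by metis
  have ga: "g * a = a * g" by (rule g(3)) (simp add: mult.assoc)
  obtain k where k: "cpos k" "k * k = g" "\<And>y. g * y = y * g \<Longrightarrow> k * y = y * k"
    using cpos_root[OF g(1)] by metis
  define e where "e = g - a"
  have se: "star e = e" using g(1) sa by (simp add: e_def star_diff cpos_star)
  have ge: "g * e = e * g" using ga by (simp add: e_def algebra_simps)
  have ke: "k * e = e * k" by (rule k(3)[OF ge])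
  \<comment> \<open>On its negative part \<open>a\<close> acts as minus its absolute value, so
    compressing \<open>a\<close> by \<open>e\<close> gives minus a positive element.\<close>
  have ae: "a * e = - (g * e)" by (simp add: e_def right_diff_distrib ga g(2))
  define y where "y = x * e"
  define c where "c = e * g * e"
  have yy: "star y * y = - c"
  proof -
    have "star y * y = e * (a * e)" by (simp add: y_def a_def star_mult se mult.assoc)
    then show ?thesis by (simp add: ae c_def mult.assoc)
  qed
  have c_pos: "cpos c"
  proof -
    have "star (k * e) = k * e" using ke k(1) se by (simp add: star_mult cpos_star)
    moreover have "(k * e) * (k * e) = c" by (metis c_def ke k(2) mult.assoc)
    ultimately show ?thesis using cpos_square by metis
  qed
  \<comment> \<open>Polarization: \<open>star y * y + y * star y\<close> is half the sum of the
    squares of the selfadjoint elements \<open>y + star y\<close> and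
    \<open>\<i> *\<^sub>C (y - star y)\<close>. Adding \<open>c\<close>, which is minus
    \<open>star y * y\<close>, leaves \<open>y * star y\<close>.\<close>
  have d_pos: "cpos (y * star y)"
  proof -
    have 1: "cpos ((y + star y) * (y + star y))" by (rule cpos_square) (simp add: star_simps add.commute)
    have 2: "cpos ((\<i> *\<^sub>C (y - star y)) * (\<i> *\<^sub>C (y - star y)))"
      by (rule cpos_square) (simp add: star_simps scaleC_diff_right scaleC_minus_left)
    have eq: "(\<i> *\<^sub>C (y - star y)) * (\<i> *\<^sub>C (y - star y)) = - ((y - star y) * (y - star y))"
      by (simp add: scaleC_mult_left scaleC_mult_right scaleC_scaleC scaleC_minus_left)
    have "cpos ((1/2) *\<^sub>R ((y + star y) * (y + star y) + - ((y - star y) * (y - star y))))"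
      using cpos_add[OF 1 2] unfolding eq by (intro cpos_scaleR) auto
    also have "(1/2) *\<^sub>R ((y + star y) * (y + star y) + - ((y - star y) * (y - star y)))
        = star y * y + y * star y"
      by (simp add: algebra_simps flip: scaleR_2)
    finally have "cpos (star y * y + y * star y)" .
    from cpos_add[OF this c_pos] show ?thesis by (simp add: yy)
  qed
  \<comment> \<open>Both \<open>c\<close> and \<open>y * star y\<close> have norm \<open>N\<close>.
    As \<open>c \<le> N\<close>, twice the square of \<open>c\<close> is dominated by (N + c) c. The
    latter is minus \<open>star y * ((N *\<^sub>R 1 - y * star y) * y)\<close>, whose norm is at
    most N^2 because \<open>y * star y\<close> is positive. Hence 2 N^2 \<le> N^2.\<close>
  define N where "N = (norm y)\<^sup>2"
  have N0: "N \<ge> 0" by (simp add: N_def)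
  have nc: "norm c = N" using cstar_identity[of y] by (simp add: yy N_def)
  have nd: "norm (y * star y) = N" using cstar_identity[of "star y"] by (simp add: star_star norm_star N_def)
  have "2 * N\<^sup>2 = norm (2 *\<^sub>R (c * c))" using norm_selfadjoint_sq[OF cpos_star[OF c_pos]] by (simp add: nc)
  also have "\<dots> \<le> norm ((N *\<^sub>R 1 + c) * c)"
  proof (rule cpos_norm_mono)
    show "cpos (2 *\<^sub>R (c * c))" by (intro cpos_scaleR cpos_square cpos_star c_pos) simp
    have "cpos ((N *\<^sub>R 1 - c) * c)"
      by (intro cpos_mult_commute cpos_norm_minus cpos_star c_pos) (auto simp: nc algebra_simps)
    then show "cpos ((N *\<^sub>R 1 + c) * c - 2 *\<^sub>R (c * c))" by (simp add: algebra_simps scaleR_2)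
  qed
  also have "(N *\<^sub>R 1 + c) * c = - (star y * ((N *\<^sub>R 1 - y * star y) * y))"
  proof -
    have "star y * ((N *\<^sub>R 1 - y * star y) * y) = N *\<^sub>R (star y * y) - (star y * y) * (star y * y)"
      by (simp add: algebra_simps)
    then show ?thesis unfolding yy by (simp add: algebra_simps)
  qed
  also have "norm \<dots> \<le> norm (star y) * (norm (N *\<^sub>R 1 - y * star y) * norm y)"
    unfolding norm_minus_cancel
    by (rule order_trans[OF norm_mult_ineq] mult_left_mono norm_mult_ineq norm_ge_zero)+
  also have "\<dots> \<le> norm y * (N * norm y)"
    unfolding norm_star using norm_le_of_cpos[OF d_pos, of N] nd
    by (intro mult_left_mono mult_right_mono) auto
  also have "\<dots> = N\<^sup>2" by (simp add: N_def power2_eq_square mult_ac)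
  finally have "N = 0" by simp
  then have y0: "y = 0" and c0: "c = 0" using nc by (auto simp: N_def)
  have "e * (a * e) = 0" using y0 by (simp add: y_def a_def star_mult se mult.assoc flip: mult.assoc[of _ x e])
  moreover have "e * e * e = e * g * e - e * (a * e)"
    by (subst (2) e_def) (simp add: algebra_simps)
  ultimately have "e * e * e = 0" using c0 by (simp add: c_def)
  then have "(e * e) * (e * e) = 0" by (metis mult.assoc mult_zero_left)
  then have "norm e = 0"
    using norm_selfadjoint_sq[OF se] norm_selfadjoint_sq[of "e * e"] by (simp add: star_mult se)
  then show ?thesis using g(1) by (simp add: e_def a_def)
qed

lemma cpos_conj:
  assumes "cpos a" shows "cpos (star y * a * y :: 'a::cstar_algebra)"
proof -
  obtain h where "star h = h" "a = h * h" using assms by (auto simp: cpos_def)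
  then show ?thesis using cpos_star_mult[of "h * y"] by (simp add: star_mult mult.assoc)
qed

lemma cpos_le_one_norm: "cpos a \<Longrightarrow> cpos (1 - a) \<Longrightarrow> norm (a::'a::cstar_algebra) \<le> 1"
  using norm_le_scalar[of a 1] by simp

text \<open>The gain of \<open>\<surd>n\<close> over the trivial bound \<open>n\<close> is what makes bounded monotone sequences
  converge in the norm of the dual.\<close>

lemma norm_sum_positive_decomposition:
  fixes b \<delta> :: "'i \<Rightarrow> 'a::cstar_algebra"
  assumes I: "finite I" and pos: "\<And>i. i \<in> I \<Longrightarrow> cpos (\<delta> i)" and le1: "cpos (1 - (\<Sum>i\<in>I. \<delta> i))"
    and b: "\<And>i. i \<in> I \<Longrightarrow> norm (b i) \<le> 1"
  shows "(norm (\<Sum>i\<in>I. b i * \<delta> i))\<^sup>2 \<le> real (card I)"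
proof (cases "I = {}")
  case False
  define n where "n = real (card I)"
  have n: "n > 0" using False I by (simp add: n_def card_gt_0_iff)
  have "\<exists>d. star d = d \<and> d * d = \<delta> i" if "i \<in> I" for i using pos[OF that] by (auto simp: cpos_def)
  then obtain d where d: "\<And>i. i \<in> I \<Longrightarrow> star (d i) = d i" "\<And>i. i \<in> I \<Longrightarrow> d i * d i = \<delta> i" by metis
  define x where "x i = b i * d i" for i
  define z where "z = (\<Sum>i\<in>I. b i * \<delta> i)"
  have z: "z = (\<Sum>i\<in>I. x i * d i)" unfolding z_def x_def by (intro sum.cong) (auto simp: mult.assoc d)
  have sz: "star z = (\<Sum>i\<in>I. d i * star (x i))"
    unfolding z star_sum by (intro sum.cong) (auto simp: star_mult d)
  define S where "S = (\<Sum>i\<in>I. x i * star (x i))"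
  have "norm (\<delta> i) \<le> 1" if "i \<in> I" for i
  proof (rule cpos_le_one_norm[OF pos[OF that]])
    have "cpos ((1 - (\<Sum>i\<in>I. \<delta> i)) + (\<Sum>j\<in>I - {i}. \<delta> j))" by (intro cpos_add le1 cpos_sum pos) auto
    then show "cpos (1 - \<delta> i)" using I that by (simp add: sum.remove)
  qed
  then have nd: "norm (d i) \<le> 1" if "i \<in> I" for i
    using that norm_selfadjoint_sq[OF d(1)[OF that]] d(2)[OF that]
    by (metis norm_ge_zero power2_le_imp_le zero_le_one power_one)
  have nx: "norm (x i * star (x i)) \<le> 1" if "i \<in> I" for i
  proof -
    have "norm (x i) \<le> norm (b i) * norm (d i)" unfolding x_def by (rule norm_mult_ineq)
    also have "\<dots> \<le> 1 * 1" using nd[OF that] b[OF that] by (intro mult_mono) auto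
    finally have "norm (x i) \<le> 1" by simp
    then have "norm (x i) * norm (star (x i)) \<le> 1 * 1" unfolding norm_star by (intro mult_mono) auto
    then show ?thesis using norm_mult_ineq[of "x i" "star (x i)"] by linarith
  qed
  have "norm S \<le> n"
    unfolding S_def n_def using sum_norm_bound[of I _ 1] nx by fastforce
  moreover have sS: "star S = S" by (simp add: S_def star_sum star_mult star_star)
  ultimately have 1: "cpos (star z * (n *\<^sub>R 1 - S) * z)" by (intro cpos_conj cpos_norm_minus)
  \<comment> \<open>An operator Cauchy-Schwarz inequality by completing squares: adding
    \<open>star z * (n *\<^sub>R 1 - S) * z\<close> to \<open>T\<close> leaves \<open>n\<close>
    times the difference of \<open>n *\<^sub>R (\<Sum>i\<in>I. \<delta> i)\<close> and
    \<open>star z * z\<close>.\<close>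
  define T where "T = (\<Sum>i\<in>I. star (star (x i) * z - n *\<^sub>R d i) * (star (x i) * z - n *\<^sub>R d i))"
  have 2: "cpos T" unfolding T_def by (intro cpos_sum cpos_star_mult)
  have "T
      = (\<Sum>i\<in>I. star z * (x i * star (x i)) * z - n *\<^sub>R (star z * (x i * d i))
          - n *\<^sub>R ((d i * star (x i)) * z) + (n * n) *\<^sub>R \<delta> i)"
    unfolding T_def by (intro sum.cong) (auto simp: star_simps algebra_simps d)
  also have "\<dots> = star z * S * z - n *\<^sub>R (star z * z) - n *\<^sub>R (star z * z) + (n * n) *\<^sub>R (\<Sum>i\<in>I. \<delta> i)"
    unfolding sum.distrib sum_subtractf scaleR_sum_right[symmetric] sum_distrib_left[symmetric]
      sum_distrib_right[symmetric] S_def[symmetric] z[symmetric] sz[symmetric] ..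
  finally have "star z * (n *\<^sub>R 1 - S) * z + T = n *\<^sub>R (n *\<^sub>R (\<Sum>i\<in>I. \<delta> i) - star z * z)"
    by (simp add: algebra_simps)
  then have "cpos (n *\<^sub>R (n *\<^sub>R (\<Sum>i\<in>I. \<delta> i) - star z * z))"
    using cpos_add[OF 1 2] by simp
  from cpos_scaleR[OF this, of "1/n"] have "cpos (n *\<^sub>R (\<Sum>i\<in>I. \<delta> i) - star z * z)"
    using n by simp
  from cpos_norm_mono[OF cpos_star_mult this]
  have "(norm z)\<^sup>2 \<le> norm (n *\<^sub>R (\<Sum>i\<in>I. \<delta> i))" by (simp add: cstar_identity)
  also have "\<dots> \<le> n"
    using n cpos_le_one_norm[OF cpos_sum[OF pos] le1] by simp
  finally show ?thesis by (simp add: z_def n_def)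
qed simp

section \<open>Inverses of \<open>1 + b\<close>\<close>

definition one_plus_inv :: "'a::cstar_algebra \<Rightarrow> 'a"
  where "one_plus_inv b = (SOME r. r * (1 + b) = 1 \<and> (1 + b) * r = 1)"

text \<open>By positivity of \<open>b\<close>, the element 1 + b divided by
  \<open>t = norm b + 1\<close> is at distance less than one from \<open>1\<close>, so a Neumann
  series converges.\<close>

lemma one_plus_inv:
  fixes b :: "'a::cstar_algebra"
  assumes "cpos b"
  shows one_plus_inv_left: "one_plus_inv b * (1 + b) = 1"
    and one_plus_inv_right: "(1 + b) * one_plus_inv b = 1"
proof -
  define t where "t = norm b + 1"
  have t: "t > 0" unfolding t_def by (smt (verit) norm_ge_zero)
  define x where "x = 1 - (1/t) *\<^sub>R (1 + b)"
  have "x = (1/t) *\<^sub>R (norm b *\<^sub>R 1 - b)" using t by (simp add: x_def t_def field_simps scaleR_add_left)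
      (simp add: algebra_simps flip: scaleR_add_left add_divide_distrib)
  then have "norm x \<le> norm b / t"
    using norm_le_of_cpos[OF assms, of "norm b"] t by (simp add: divide_right_mono)
  also have "\<dots> < 1" using t by (simp add: t_def)
  finally have s: "summable (\<lambda>n. x ^ n)" by (rule complete_algebra_summable_geometric)
  define S where "S = (\<Sum>n. x ^ n)"
  have S: "S = 1 + x * S"
    unfolding S_def using suminf_split_head[OF s] suminf_mult[OF s, of x] by simp
  have S': "S = 1 + S * x"
    unfolding S_def using suminf_split_head[OF s] suminf_mult2[OF s, of x] by (simp add: power_commutes)
  have "((1/t) *\<^sub>R S) * (1 + b) = 1 \<and> (1 + b) * ((1/t) *\<^sub>R S) = 1"
  proof -
    have "(1/t) *\<^sub>R (1 + b) = 1 - x" by (simp add: x_def)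
    then have "((1/t) *\<^sub>R S) * (1 + b) = S * (1 - x)" "(1 + b) * ((1/t) *\<^sub>R S) = (1 - x) * S"
      by (metis mult_scaleR_left mult_scaleR_right)+
    moreover have "S * (1 - x) = 1" using S' by (simp add: right_diff_distrib diff_eq_eq)
    moreover have "(1 - x) * S = 1" using S by (simp add: left_diff_distrib diff_eq_eq)
    ultimately show ?thesis by simp
  qed
  from someI[of "\<lambda>r. r * (1 + b) = 1 \<and> (1 + b) * r = 1", OF this]
  show "one_plus_inv b * (1 + b) = 1" "(1 + b) * one_plus_inv b = 1"
    unfolding one_plus_inv_def by auto
qed

lemma one_plus_inv_unique:
  assumes "cpos b" "(1 + b) * s = 1" shows "s = one_plus_inv b"
  by (metis assms mult.assoc mult.left_neutral mult.right_neutral one_plus_inv_left)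

lemma one_plus_inv_commute:
  assumes b: "cpos b" and "b * y = y * b"
  shows "one_plus_inv b * y = y * one_plus_inv b"
proof -
  let ?r = "one_plus_inv b"
  have "?r * y = ?r * (y * (1 + b)) * ?r"
    by (metis mult.assoc mult.right_neutral one_plus_inv_right[OF b])
  also have "y * (1 + b) = (1 + b) * y" using assms(2) by (simp add: algebra_simps)
  also have "?r * ((1 + b) * y) * ?r = y * ?r"
    by (metis mult.assoc mult.left_neutral one_plus_inv_left[OF b])
  finally show ?thesis .
qed

text \<open>The inverse is its own square times \<open>1 + b\<close>, a product of commuting
  positive elements.\<close>

lemma one_plus_inv_cpos:
  assumes b: "cpos b" shows "cpos (one_plus_inv b)"
proof -
  let ?r = "one_plus_inv b"
  have "star (?r * (1 + b)) = 1" by (simp add: one_plus_inv_left[OF b])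
  then have "(1 + b) * star ?r = 1" by (simp add: star_simps cpos_star[OF b])
  then have sr: "star ?r = ?r" by (rule one_plus_inv_unique[OF b])
  have 1: "?r * ?r * (1 + b) = ?r"
    by (metis mult.assoc mult.right_neutral one_plus_inv_left[OF b])
  have "cpos ((?r * ?r) * (1 + b))"
  proof (rule cpos_mult_commute[OF cpos_square[OF sr] cpos_add[OF cpos_one b]])
    show "?r * ?r * (1 + b) = (1 + b) * (?r * ?r)"
      unfolding 1 by (metis mult.assoc mult.left_neutral one_plus_inv_right[OF b])
  qed
  then show ?thesis by (simp add: 1)
qed

lemma one_minus_one_plus_inv:
  assumes b: "cpos b"
  shows "1 - one_plus_inv b = b * one_plus_inv b" "cpos (1 - one_plus_inv b)"
proof -
  show eq: "1 - one_plus_inv b = b * one_plus_inv b"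
    using one_plus_inv_right[OF b] by (simp add: algebra_simps)
  show "cpos (1 - one_plus_inv b)"
    unfolding eq by (intro cpos_mult_commute b one_plus_inv_cpos)
      (rule one_plus_inv_commute[OF b refl, symmetric])
qed

text \<open>By Woodbury's identity.\<close>

lemma one_plus_inv_antimono:
  fixes b c :: "'a::cstar_algebra"
  assumes b: "cpos b" and bc: "cpos (c - b)"
  shows "cpos (one_plus_inv b - one_plus_inv c)"
proof -
  have c: "cpos c" using cpos_add[OF b bc] by simp
  let ?r = "one_plus_inv b"
  obtain h where h: "star h = h" "c - b = h * h" using bc by (auto simp: cpos_def)
  have hrh: "cpos (h * ?r * h)" using cpos_conj[OF one_plus_inv_cpos[OF b], of h] h(1) by simp
  let ?t = "one_plus_inv (h * ?r * h)"
  have sr: "star ?r = ?r" by (intro cpos_star one_plus_inv_cpos b)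
  \<comment> \<open>The difference of the two inverses when \<open>c\<close> is
    \<open>b + h * h\<close>; it has the form \<open>star y * ?t * y\<close> with positive
    \<open>?t\<close>.\<close>
  define W where "W = ?r * h * ?t * h * ?r"
  have "(1 + c) * (?r - W) = 1"
  proof -
    have r1: "(1 + b) * (?r * y) = y" for y by (metis mult.assoc mult.left_neutral one_plus_inv_right[OF b])
    have t1: "?t + h * (?r * (h * ?t)) = 1"
      using one_plus_inv_right[OF hrh] by (simp add: distrib_right mult.assoc)
    have "1 + c = (1 + b) + h * h" using h(2) by (simp add: algebra_simps)
    then have "(1 + c) * (?r - W)
        = (1 + b) * (?r * 1) - (1 + b) * (?r * (h * (?t * (h * ?r)))) + h * (h * ?r - h * (?r * (h * (?t * (h * ?r)))))"
      by (simp add: W_def algebra_simps)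
    also have "\<dots> = 1 + h * ((1 - (?t + h * (?r * (h * ?t)))) * (h * ?r))"
      unfolding r1 by (simp add: algebra_simps)
    finally show ?thesis by (simp add: t1)
  qed
  then have "one_plus_inv b - one_plus_inv c = W"
    using one_plus_inv_unique[OF c] by (metis diff_diff_eq2 add_diff_cancel_left' diff_add_cancel)
  moreover have "W = star (h * ?r) * ?t * (h * ?r)" by (simp add: W_def star_mult h(1) sr mult.assoc)
  ultimately show ?thesis by (metis cpos_conj one_plus_inv_cpos hrh)
qed

section \<open>Projections in the bidual from resolvents\<close>

lift_definition bidual_embed :: "'a::cstar_algebra \<Rightarrow> 'a cdual cdual" is "\<lambda>a f. capply f a"
proof (rule bounded_clinearI)
  fix a :: 'a and f :: "'a cdual"
  show "norm (capply f a) \<le> norm f * norm a" by (rule norm_capply)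
qed (simp_all add: capply_plus capply_scaleC_left)

lemma bidual_embed_apply [simp]: "capply (bidual_embed a) f = capply f a"
  by transfer simp

lemma arens_apply: "capply (arens F G) f = capply F (bidual_act G f)"
  by transfer simp

lemma bidual_star_apply: "capply (bidual_star F) f = cnj (capply F (dual_star f))"
  by transfer simp

text \<open>If all values exceeded \<open>e\<close>, phases could be chosen so that they add up to
  at least \<open>card I\<close> times \<open>e\<close>, whereas the corresponding sum of elements
  has norm at most the square root of \<open>card I\<close>.\<close>

lemma positive_decomposition_small:
  fixes f :: "'a::cstar_algebra cdual"
  assumes I: "finite I" and pos: "\<And>i. i \<in> I \<Longrightarrow> cpos (\<delta> i)" and le1: "cpos (1 - (\<Sum>i\<in>I. \<delta> i))"
    and b: "\<And>i. i \<in> I \<Longrightarrow> norm (b i) \<le> 1" and e: "e > 0" and card: "(norm f)\<^sup>2 < real (card I) * e\<^sup>2"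
  shows "\<exists>i\<in>I. cmod (capply f (b i * \<delta> i)) \<le> e"
proof (rule ccontr)
  assume "\<not> ?thesis"
  then have big: "cmod (capply f (b i * \<delta> i)) > e" if "i \<in> I" for i using that by force
  define w where "w i = capply f (b i * \<delta> i)" for i
  define b' where "b' i = (cnj (w i) / cmod (w i)) *\<^sub>C b i" for i
  have w: "cmod (w i) > e" if "i \<in> I" for i using big[OF that] by (simp add: w_def)
  have "norm (b' i) \<le> 1" if "i \<in> I" for i
    using b[OF that] w[OF that] e by (simp add: b'_def norm_scaleC norm_divide)
  then have z: "(norm (\<Sum>i\<in>I. b' i * \<delta> i))\<^sup>2 \<le> real (card I)"
    by (intro norm_sum_positive_decomposition I pos le1)
  have "capply f (b' i * \<delta> i) = of_real (cmod (w i))" if "i \<in> I" for i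
  proof -
    have "capply f (b' i * \<delta> i) = (w i * cnj (w i)) / of_real (cmod (w i))"
      by (simp add: b'_def scaleC_mult_left capply_scaleC scaleC_complex_def w_def[symmetric] mult.commute)
    also have "\<dots> = of_real (cmod (w i))"
      unfolding complex_norm_square[symmetric] using w[OF that] e by (simp add: power2_eq_square)
    finally show ?thesis .
  qed
  then have "capply f (\<Sum>i\<in>I. b' i * \<delta> i) = of_real (\<Sum>i\<in>I. cmod (w i))"
    by (simp add: capply_sum)
  then have "(\<Sum>i\<in>I. cmod (w i)) \<le> norm f * norm (\<Sum>i\<in>I. b' i * \<delta> i)"
    using norm_capply[of f "\<Sum>i\<in>I. b' i * \<delta> i"] abs_ge_self[of "\<Sum>i\<in>I. cmod (w i)"]
    by (simp only: norm_of_real)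
  moreover have "real (card I) * e \<le> (\<Sum>i\<in>I. cmod (w i))"
    using sum_bounded_below[of I e "\<lambda>i. cmod (w i)"] w by (auto intro: less_imp_le)
  ultimately have "real (card I) * e \<le> norm f * norm (\<Sum>i\<in>I. b' i * \<delta> i)" by linarith
  then have "(real (card I) * e)\<^sup>2 \<le> (norm f * norm (\<Sum>i\<in>I. b' i * \<delta> i))\<^sup>2"
    using e by (intro power_mono) auto
  also have "\<dots> \<le> (norm f)\<^sup>2 * real (card I)"
    unfolding power_mult_distrib by (intro mult_left_mono z) simp
  finally have "real (card I) * (real (card I) * e\<^sup>2) \<le> real (card I) * (norm f)\<^sup>2"
    by (simp add: power2_eq_square mult_ac)
  moreover have "card I > 0" using card by (cases "card I = 0") auto
  ultimately show False using card by simp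
qed

text \<open>A sequence that is not Cauchy in the dual norm admits an infinite chain of indices with
  a witness in the unit ball for each jump; the hypothesis bounds the length of such chains.\<close>

lemma uniform_limit_from_chains:
  fixes h :: "nat \<Rightarrow> 'a::complex_normed cdual"
  assumes chains: "\<And>e. e > 0 \<Longrightarrow> \<exists>k. \<forall>p b. strict_mono p \<longrightarrow> (\<forall>j. norm (b j) \<le> 1) \<longrightarrow>
    (\<exists>j<k. cmod (capply (h (p (Suc j))) (b j) - capply (h (p j)) (b j)) \<le> e)"
  shows "Cauchy h"
proof (rule metric_CauchyI)
  fix e :: real assume e: "e > 0"
  have "\<exists>N. \<forall>n\<ge>N. norm (h n - h N) \<le> e/3"
  proof (rule ccontr)
    assume "\<not> ?thesis"
    then have *: "\<exists>n\<ge>N. norm (h n - h N) > e/3" for N by (meson not_le)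
    have "\<exists>n>N. \<exists>b. norm b \<le> 1 \<and> cmod (capply (h n) b - capply (h N) b) > e/3" for N
    proof -
      obtain n where n: "n \<ge> N" "norm (h n - h N) > e/3" using * by blast
      have "n \<noteq> N" using n(2) e by auto
      have "\<exists>x. cmod (capply (h n - h N) x) > e/3 * norm x"
      proof (rule ccontr)
        assume "\<nexists>x. cmod (capply (h n - h N) x) > e/3 * norm x"
        then have "norm (h n - h N) \<le> e/3"
          using e by (intro norm_cblinfun_bound) (auto simp: not_less)
        then show False using n(2) by simp
      qed
      then obtain x where x: "cmod (capply (h n - h N) x) > e/3 * norm x" by blast
      then have x0: "norm x > 0" by (cases "x = 0") auto
      let ?b = "(1 / norm x) *\<^sub>R x"
      have "cmod (capply (h n - h N) ?b) > e/3"
        using x x0 by (simp add: capply_scaleR field_simps)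
      moreover have "norm ?b \<le> 1" using x0 by simp
      ultimately show ?thesis using n(1) \<open>n \<noteq> N\<close>
        by (intro exI[of _ n] conjI exI[of _ ?b]) (auto simp: capply_minus_left)
    qed
    then obtain s c where s: "\<And>N. s N > N" and c: "\<And>N. norm (c N) \<le> 1"
      "\<And>N. cmod (capply (h (s N)) (c N) - capply (h N) (c N)) > e/3" by metis
    define p where "p j = (s ^^ j) 0" for j
    have pS: "p (Suc j) = s (p j)" for j by (simp add: p_def)
    have "strict_mono p" by (rule strict_monoI_Suc) (simp add: pS s)
    moreover have "norm (c (p j)) \<le> 1" for j by (rule c)
    moreover have "\<not> cmod (capply (h (p (Suc j))) (c (p j)) - capply (h (p j)) (c (p j))) \<le> e/3" for j
      using c(2)[of "p j"] by (simp add: pS)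
    moreover obtain k where k: "\<forall>p b. strict_mono p \<longrightarrow> (\<forall>j. norm (b j) \<le> 1) \<longrightarrow>
      (\<exists>j<k. cmod (capply (h (p (Suc j))) (b j) - capply (h (p j)) (b j)) \<le> e/3)"
      using chains[of "e/3"] e by auto
    ultimately show False using k[rule_format, of p "\<lambda>j. c (p j)"] by blast
  qed
  then obtain N where N: "\<And>n. n \<ge> N \<Longrightarrow> norm (h n - h N) \<le> e/3" by blast
  have "dist (h m) (h n) < e" if "m \<ge> N" "n \<ge> N" for m n
  proof -
    have "dist (h m) (h n) \<le> norm (h m - h N) + norm (h n - h N)"
      by (metis dist_norm dist_triangle2)
    then show ?thesis using N[OF that(1)] N[OF that(2)] e by linarith
  qed
  then show "\<exists>M. \<forall>m\<ge>M. \<forall>n\<ge>M. dist (h m) (h n) < e" by blast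
qed

text \<open>Completeness of the dual: the pointwise limit is bounded, and the Cauchy estimate is
  uniform on the unit ball.\<close>

lemma cdual_limit_exists:
  fixes h :: "nat \<Rightarrow> 'a::complex_normed cdual"
  assumes "Cauchy h"
  obtains H where "h \<longlonglongrightarrow> H"
proof -
  obtain C where C: "\<And>n. norm (h n) \<le> C" using Cauchy_Bseq[OF assms] by (auto simp: Bseq_def)
  have app: "cmod (capply (h n) x) \<le> C * norm x" for n x
    using norm_capply[of "h n" x] mult_right_mono[OF C[of n], of "norm x"] by simp
  have "convergent (\<lambda>n. capply (h n) x)" for x
  proof (rule Cauchy_convergent, rule metric_CauchyI)
    fix e :: real assume e: "e > 0"
    then obtain N where N: "\<And>m n. m \<ge> N \<Longrightarrow> n \<ge> N \<Longrightarrow> dist (h m) (h n) < e / (norm x + 1)"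
      using metric_CauchyD[OF assms, of "e / (norm x + 1)"] by (auto simp: add_nonneg_pos)
    have nx: "norm x + 1 > 0" by (simp add: add_nonneg_pos)
    have "dist (capply (h m) x) (capply (h n) x) < e" if "m \<ge> N" "n \<ge> N" for m n
    proof -
      have "dist (capply (h m) x) (capply (h n) x) \<le> dist (h m) (h n) * norm x"
        using norm_capply[of "h m - h n" x] by (simp add: dist_norm capply_minus_left)
      also have "\<dots> \<le> e / (norm x + 1) * norm x" using N[OF that] by (intro mult_right_mono) auto
      also have "\<dots> < e" using e nx by (simp add: field_simps)
      finally show ?thesis .
    qed
    then show "\<exists>M. \<forall>m\<ge>M. \<forall>n\<ge>M. dist (capply (h m) x) (capply (h n) x) < e" by blast
  qed
  then obtain H where H: "\<And>x. (\<lambda>n. capply (h n) x) \<longlonglongrightarrow> capply H x"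
    using strong_limit_exists[of h C UNIV] app by auto
  have "h \<longlonglongrightarrow> H"
  proof (rule metric_LIMSEQ_I)
    fix e :: real assume e: "e > 0"
    obtain N where N: "\<And>m n. m \<ge> N \<Longrightarrow> n \<ge> N \<Longrightarrow> dist (h m) (h n) < e / 2"
      using metric_CauchyD[OF assms, of "e / 2"] e by auto
    have "dist (h m) H < e" if "m \<ge> N" for m
    proof -
      have "norm (h m - H) \<le> e / 2"
      proof (rule norm_cblinfun_bound)
        fix x
        have "(\<lambda>n. norm (capply (h m) x - capply (h n) x)) \<longlonglongrightarrow> norm (capply (h m) x - capply H x)"
          by (intro tendsto_intros H)
        moreover have "norm (capply (h m) x - capply (h n) x) \<le> e / 2 * norm x" if "n \<ge> N" for n
        proof -
          have "norm (capply (h m) x - capply (h n) x) \<le> dist (h m) (h n) * norm x"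
            using norm_capply[of "h m - h n" x] by (simp add: dist_norm capply_minus_left)
          also have "\<dots> \<le> e / 2 * norm x"
            using N[OF \<open>m \<ge> N\<close> that] by (intro mult_right_mono) auto
          finally show ?thesis .
        qed
        ultimately have "norm (capply (h m) x - capply H x) \<le> e / 2 * norm x"
          by (intro LIMSEQ_le_const2) blast+
        then show "norm (capply (h m - H) x) \<le> e / 2 * norm x" by (simp add: capply_minus_left)
      qed (use e in simp)
      then show ?thesis using e by (simp add: dist_norm)
    qed
    then show "\<exists>no. \<forall>n\<ge>no. dist (h n) H < e" by blast
  qed
  then show thesis by (rule that)
qed

lemma tendsto_capply_left:
  fixes h :: "nat \<Rightarrow> ('a::complex_normed, 'b::complex_normed) cblinfun"
  assumes "h \<longlonglongrightarrow> H" shows "(\<lambda>n. capply (h n) x) \<longlonglongrightarrow> capply H x"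
proof -
  have "norm (capply (h n) x - capply H x) \<le> norm (h n - H) * norm x" for n
    using norm_capply[of "h n - H" x] by (simp add: capply_minus_left)
  then have "\<forall>\<^sub>F n in sequentially. norm (capply (h n) x - capply H x) \<le> norm (h n - H) * norm x"
    by simp
  moreover have "(\<lambda>n. norm (h n - H) * norm x) \<longlonglongrightarrow> 0"
    using tendsto_mult_left_zero[OF tendsto_norm_zero[OF LIM_zero[OF assms]]] .
  ultimately have "(\<lambda>n. capply (h n) x - capply H x) \<longlonglongrightarrow> 0"
    by (rule Lim_null_comparison)
  then show ?thesis by (rule LIM_zero_cancel)
qed

text \<open>The left action of the algebra on its dual. Norm convergence of
  \<open>right_shift f (g n m)\<close> in \<open>n\<close> means that the values of \<open>f\<close>
  at \<open>a * g n m\<close> converge uniformly for \<open>a\<close> in the unit ball.\<close>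

lift_definition right_shift :: "'a::cstar_algebra cdual \<Rightarrow> 'a \<Rightarrow> 'a cdual"
  is "\<lambda>f c a. f (a * c)"
  by (auto simp: bounded_clinear_def scaleC_mult_left
      intro: bounded_linear_compose[OF _ bounded_linear_mult_left])

lemma right_shift_apply: "capply (right_shift f c) a = capply f (a * c)"
  by transfer simp

text \<open>Modelled on \<open>g n m\<close> = (1 + b_n / (m + 1))^-1 for an increasing sequence of
  positive b_n. Letting n grow gives resolvents of the quadratic form that is the supremum of the
  b_n; letting m grow afterwards gives the projection onto the closure of its form domain.\<close>

locale resolvent_family =
  fixes g :: "nat \<Rightarrow> nat \<Rightarrow> 'a::cstar_algebra"
  assumes pos: "cpos (g n m)" and le_one: "cpos (1 - g n m)"
    and dec: "cpos (g n m - g (Suc n) m)" and inc: "cpos (g n (Suc m) - g n m)"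
    and resolvent: "(real k - real m) *\<^sub>R (g n k * g n m) = real (Suc k) *\<^sub>R g n m - real (Suc m) *\<^sub>R g n k"
begin

lemma dec_le: "n \<le> n' \<Longrightarrow> cpos (g n m - g n' m)"
proof (induction n' rule: dec_induct)
  case (step k)
  then show ?case using cpos_add[OF step.IH dec[of k m]] by simp
qed simp

lemma inc_le: "m \<le> m' \<Longrightarrow> cpos (g n m' - g n m)"
proof (induction m' rule: dec_induct)
  case (step k)
  then show ?case using cpos_add[OF step.IH inc[of n k]] by simp
qed simp

lemma norm_le_one: "norm (g n m) \<le> 1"
  by (rule cpos_le_one_norm[OF pos le_one])

text \<open>Along a chain of indices the decrements are positive with sum at most \<open>1\<close>,
  so among sufficiently many of them one is small on \<open>f\<close>.\<close>

lemma Cauchy_inner: "Cauchy (\<lambda>n. right_shift f (g n m))"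
proof (rule uniform_limit_from_chains)
  fix e :: real assume e: "e > 0"
  obtain k :: nat where k: "(norm f)\<^sup>2 / e\<^sup>2 < real k" using reals_Archimedean2 by blast
  then have k: "(norm f)\<^sup>2 < real k * e\<^sup>2" using e by (simp add: field_simps)
  have "\<exists>j<k. cmod (capply (right_shift f (g (p (Suc j)) m)) (b j) - capply (right_shift f (g (p j) m)) (b j)) \<le> e"
    if p: "strict_mono p" and b: "\<And>j. norm (b j) \<le> 1" for p b
  proof -
    have "(\<Sum>j<k. g (p j) m - g (p (Suc j)) m) = g (p 0) m - g (p k) m"
      by (rule sum_lessThan_telescope')
    then have "1 - (\<Sum>j<k. g (p j) m - g (p (Suc j)) m) = (1 - g (p 0) m) + g (p k) m" by simp
    then have "cpos (1 - (\<Sum>j<k. g (p j) m - g (p (Suc j)) m))"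
      by (simp only: cpos_add[OF le_one pos])
    moreover have "cpos (g (p j) m - g (p (Suc j)) m)" for j
      using p by (intro dec_le) (simp add: strict_mono_leD)
    ultimately have "\<exists>j\<in>{..<k}. cmod (capply f (b j * (g (p j) m - g (p (Suc j)) m))) \<le> e"
      using e k b by (intro positive_decomposition_small) auto
    then show ?thesis
      by (auto simp: right_shift_apply right_diff_distrib capply_diff norm_minus_commute)
  qed
  then show "\<exists>k. \<forall>p b. strict_mono p \<longrightarrow> (\<forall>j. norm (b j) \<le> 1) \<longrightarrow>
    (\<exists>j<k. cmod (capply (right_shift f (g (p (Suc j)) m)) (b j) - capply (right_shift f (g (p j) m)) (b j)) \<le> e)"
    by blast
qed

text \<open>With r_m for the limit of \<open>g n m\<close> in the bidual as n grows, this is the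
  action of r_m on \<open>f\<close>.\<close>

definition inner_limit :: "'a cdual \<Rightarrow> nat \<Rightarrow> 'a cdual"
  where "inner_limit f m = lim (\<lambda>n. right_shift f (g n m))"

lemma inner_limit: "(\<lambda>n. right_shift f (g n m)) \<longlonglongrightarrow> inner_limit f m"
  unfolding inner_limit_def by (metis cdual_limit_exists[OF Cauchy_inner] limI)

lemma inner_limit_apply: "(\<lambda>n. capply f (a * g n m)) \<longlonglongrightarrow> capply (inner_limit f m) a"
  using tendsto_capply_left[OF inner_limit, of f m a] by (simp add: right_shift_apply)

lemma Cauchy_outer: "Cauchy (inner_limit f)"
proof (rule uniform_limit_from_chains)
  fix e :: real assume e: "e > 0"
  obtain k :: nat where k: "(norm f)\<^sup>2 / e\<^sup>2 < real k" using reals_Archimedean2 by blast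
  then have k: "(norm f)\<^sup>2 < real k * e\<^sup>2" using e by (simp add: field_simps)
  have "\<exists>j<k. cmod (capply (inner_limit f (p (Suc j))) (b j) - capply (inner_limit f (p j)) (b j)) \<le> e"
    if p: "strict_mono p" and b: "\<And>j. norm (b j) \<le> 1" for p b
  proof (rule ccontr)
    assume "\<not> ?thesis"
    \<comment> \<open>Only finitely many strict inequalities are involved, so all of them persist at
      one large \<open>n\<close>, where the increments in the second index form a positive
      decomposition inside the algebra.\<close>
    then have big: "\<And>j. j < k \<Longrightarrow> cmod (capply (inner_limit f (p (Suc j))) (b j) - capply (inner_limit f (p j)) (b j)) > e"
      by force
    have "\<forall>\<^sub>F n in sequentially. \<forall>j\<in>{..<k}. cmod (capply f (b j * (g n (p (Suc j)) - g n (p j)))) > e"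
    proof (rule eventually_ball_finite; (intro ballI)?)
      fix j assume "j \<in> {..<k}"
      have "(\<lambda>n. cmod (capply f (b j * g n (p (Suc j))) - capply f (b j * g n (p j)))) \<longlonglongrightarrow>
          cmod (capply (inner_limit f (p (Suc j))) (b j) - capply (inner_limit f (p j)) (b j))"
        by (intro tendsto_intros inner_limit_apply)
      from order_tendstoD(1)[OF this big]
      show "\<forall>\<^sub>F n in sequentially. cmod (capply f (b j * (g n (p (Suc j)) - g n (p j)))) > e"
        using \<open>j \<in> {..<k}\<close> by (simp add: right_diff_distrib capply_diff)
    qed simp
    then obtain n where n: "\<And>j. j < k \<Longrightarrow> cmod (capply f (b j * (g n (p (Suc j)) - g n (p j)))) > e"
      by (auto simp: eventually_sequentially)
    have "(\<Sum>j<k. g n (p (Suc j)) - g n (p j)) = g n (p k) - g n (p 0)"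
      by (rule sum_lessThan_telescope)
    then have "1 - (\<Sum>j<k. g n (p (Suc j)) - g n (p j)) = (1 - g n (p k)) + g n (p 0)" by simp
    then have "cpos (1 - (\<Sum>j<k. g n (p (Suc j)) - g n (p j)))"
      by (simp only: cpos_add[OF le_one pos])
    moreover have "cpos (g n (p (Suc j)) - g n (p j))" for j
      using p by (intro inc_le) (simp add: strict_mono_leD)
    ultimately have "\<exists>j\<in>{..<k}. cmod (capply f (b j * (g n (p (Suc j)) - g n (p j)))) \<le> e"
      using e k b by (intro positive_decomposition_small) auto
    then show False using n by force
  qed
  then show "\<exists>k. \<forall>p b. strict_mono p \<longrightarrow> (\<forall>j. norm (b j) \<le> 1) \<longrightarrow>
    (\<exists>j<k. cmod (capply (inner_limit f (p (Suc j))) (b j) - capply (inner_limit f (p j)) (b j)) \<le> e)"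
    by blast
qed

definition outer_limit :: "'a cdual \<Rightarrow> 'a cdual"
  where "outer_limit f = lim (inner_limit f)"

lemma outer_limit: "inner_limit f \<longlonglongrightarrow> outer_limit f"
  unfolding outer_limit_def by (metis cdual_limit_exists[OF Cauchy_outer] limI)

text \<open>Linearity and boundedness in \<open>f\<close> are inherited from the embedded elements
  \<open>g n m\<close> through two successive pointwise limits.\<close>

lemma limit_projection_exists: "\<exists>q. \<forall>f. capply q f = capply (outer_limit f) 1"
proof -
  have 1: "\<exists>r. \<forall>f. capply r f = capply (inner_limit f m) 1 \<and> norm (capply r f) \<le> norm f" for m
  proof -
    have bnd: "norm (capply (bidual_embed (g n m)) f) \<le> 1 * norm f" for n f
      using norm_capply[of f "g n m"] mult_left_mono[OF norm_le_one[of n m], of "norm f"] by simp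
    have lim: "(\<lambda>n. capply (bidual_embed (g n m)) f) \<longlonglongrightarrow> capply (inner_limit f m) 1" for f
      using inner_limit_apply[of f 1 m] by simp
    then obtain r where r: "\<And>f. (\<lambda>n. capply (bidual_embed (g n m)) f) \<longlonglongrightarrow> capply r f"
      using strong_limit_exists[of "\<lambda>n. bidual_embed (g n m)" 1 UNIV] bnd by (auto simp: convergent_def)
    have "norm (capply r f) \<le> norm f" for f
      by (rule LIMSEQ_le_const2[OF tendsto_norm[OF r]]) (use bnd in auto)
    then show ?thesis using LIMSEQ_unique[OF r lim] by metis
  qed
  then obtain r where r: "\<And>m f. capply (r m) f = capply (inner_limit f m) 1"
    "\<And>m f. norm (capply (r m) f) \<le> 1 * norm f" by (metis mult_1)
  have lim: "(\<lambda>m. capply (r m) f) \<longlonglongrightarrow> capply (outer_limit f) 1" for f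
    unfolding r(1) by (rule tendsto_capply_left[OF outer_limit])
  then obtain q where "\<And>f. (\<lambda>m. capply (r m) f) \<longlonglongrightarrow> capply q f"
    using strong_limit_exists[of r 1 UNIV] r(2) by (auto simp: convergent_def)
  then show ?thesis using lim LIMSEQ_unique by metis
qed

definition limit_projection :: "'a cdual cdual"
  where "limit_projection = (SOME q. \<forall>f. capply q f = capply (outer_limit f) 1)"

lemma limit_projection_apply: "capply limit_projection f = capply (outer_limit f) 1"
  using someI_ex[OF limit_projection_exists] unfolding limit_projection_def by blast

lemma limit_projection_tendsto:
  "(\<lambda>m. capply (inner_limit f m) 1) \<longlonglongrightarrow> capply limit_projection f"
  unfolding limit_projection_apply by (rule tendsto_capply_left[OF outer_limit])

lemma inner_limit_dual_shift: "capply (inner_limit (dual_shift f a) m) b = capply (inner_limit f m) (a * b)"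
  using inner_limit_apply[of "dual_shift f a" b m] inner_limit_apply[of f "a * b" m]
  by (auto simp: dual_shift_apply mult.assoc intro: LIMSEQ_unique)

text \<open>Identifies the functional that the second factor of an Arens product hands to the first
  one. Since \<open>inner_limit f\<close> tends to it in norm, the first factor can be applied term
  by term.\<close>

lemma bidual_act_limit_projection: "bidual_act limit_projection f = outer_limit f"
proof (rule cblinfun_ext)
  fix a
  have "(\<lambda>m. capply (inner_limit f m) a) \<longlonglongrightarrow> capply (bidual_act limit_projection f) a"
    using limit_projection_tendsto[of "dual_shift f a"]
    by (simp add: bidual_act_apply inner_limit_dual_shift)
  then show "capply (bidual_act limit_projection f) a = capply (outer_limit f) a"
    using tendsto_capply_left[OF outer_limit, of f a] LIMSEQ_unique by blast
qed

text \<open>The resolvent identity as \<open>n\<close> grows. Both factors of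
  \<open>g n k * g n m\<close> move; norm convergence of \<open>right_shift f (g n m)\<close>
  permits replacing the right one by its limit before the left one.\<close>

lemma inner_limit_inner_limit:
  assumes "m < k"
  shows "(real k - real m) *\<^sub>R capply (inner_limit (inner_limit f m) k) 1
    = real (Suc k) *\<^sub>R capply (inner_limit f m) 1 - real (Suc m) *\<^sub>R capply (inner_limit f k) 1"
proof -
  let ?h = "\<lambda>n. (real k - real m) *\<^sub>R capply (inner_limit f m) (g n k)"
  let ?h' = "\<lambda>n. (real k - real m) *\<^sub>R capply f (g n k * g n m)"
  have "(\<lambda>n. capply (inner_limit f m - right_shift f (g n m)) (g n k)) \<longlonglongrightarrow> 0"
  proof (rule Lim_null_comparison)
    show "\<forall>\<^sub>F n in sequentially. norm (capply (inner_limit f m - right_shift f (g n m)) (g n k))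
      \<le> norm (right_shift f (g n m) - inner_limit f m)"
    proof (intro always_eventually allI)
      fix n
      have "norm (capply (inner_limit f m - right_shift f (g n m)) (g n k))
          \<le> norm (inner_limit f m - right_shift f (g n m)) * norm (g n k)" by (rule norm_capply)
      also have "\<dots> \<le> norm (inner_limit f m - right_shift f (g n m)) * 1"
        by (intro mult_left_mono norm_le_one) simp
      finally show "norm (capply (inner_limit f m - right_shift f (g n m)) (g n k))
          \<le> norm (right_shift f (g n m) - inner_limit f m)" by (simp add: norm_minus_commute)
    qed
    show "(\<lambda>n. norm (right_shift f (g n m) - inner_limit f m)) \<longlonglongrightarrow> 0"
      using tendsto_norm_zero[OF LIM_zero[OF inner_limit]] .
  qed
  then have "(\<lambda>n. (real k - real m) *\<^sub>R capply (inner_limit f m - right_shift f (g n m)) (g n k)) \<longlonglongrightarrow> (real k - real m) *\<^sub>R 0"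
    by (intro tendsto_intros)
  then have d: "(\<lambda>n. ?h n - ?h' n) \<longlonglongrightarrow> 0"
    by (simp add: capply_minus_left right_shift_apply scaleR_diff_right)
  have "?h' n = real (Suc k) *\<^sub>R capply f (1 * g n m) - real (Suc m) *\<^sub>R capply f (1 * g n k)" for n
    using arg_cong[OF resolvent[of k m n], of "capply f"] by (simp only: capply_diff capply_scaleR mult_1)
  then have "?h' \<longlonglongrightarrow> real (Suc k) *\<^sub>R capply (inner_limit f m) 1 - real (Suc m) *\<^sub>R capply (inner_limit f k) 1"
    by (simp only:) (intro tendsto_intros inner_limit_apply)
  from tendsto_add[OF d this]
  have "?h \<longlonglongrightarrow> real (Suc k) *\<^sub>R capply (inner_limit f m) 1 - real (Suc m) *\<^sub>R capply (inner_limit f k) 1"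
    by simp
  moreover have "?h \<longlonglongrightarrow> (real k - real m) *\<^sub>R capply (inner_limit (inner_limit f m) k) 1"
    by (intro tendsto_scaleR tendsto_const inner_limit_apply[of "inner_limit f m" 1 k, unfolded mult_1])
  ultimately show ?thesis by (rule LIMSEQ_unique[rotated])
qed

text \<open>The limit projection absorbs each limit resolvent: divide the identity in
  \<open>inner_limit_inner_limit\<close> by \<open>k - m\<close> and let \<open>k\<close>
  grow.\<close>

lemma limit_projection_inner_limit: "capply limit_projection (inner_limit f m) = capply (inner_limit f m) 1"
proof -
  let ?c = "\<lambda>k. real (Suc k) / (real k - real m)" and ?d = "\<lambda>k. real (Suc m) / (real k - real m)"
  have d: "?d \<longlonglongrightarrow> 0"
  proof (rule LIMSEQ_offset[of _ m])
    show "(\<lambda>k. ?d (k + m)) \<longlonglongrightarrow> 0" using lim_const_over_n[of "real (Suc m)"] by simp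
  qed
  have "(\<lambda>k. 1 + ?d k) \<longlonglongrightarrow> 1 + 0" by (intro tendsto_intros d)
  moreover have "\<forall>\<^sub>F k in sequentially. 1 + ?d k = ?c k"
    using eventually_gt_at_top[of m] by eventually_elim (simp add: field_simps)
  ultimately have c: "?c \<longlonglongrightarrow> 1" by (simp add: tendsto_cong)
  have "(\<lambda>k. ?c k *\<^sub>R capply (inner_limit f m) 1 - ?d k *\<^sub>R capply (inner_limit f k) 1)
      \<longlonglongrightarrow> 1 *\<^sub>R capply (inner_limit f m) 1 - 0 *\<^sub>R capply limit_projection f"
    by (intro tendsto_intros c d limit_projection_tendsto)
  moreover have "\<forall>\<^sub>F k in sequentially. ?c k *\<^sub>R capply (inner_limit f m) 1 - ?d k *\<^sub>R capply (inner_limit f k) 1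
      = capply (inner_limit (inner_limit f m) k) 1"
    using eventually_gt_at_top[of m]
  proof eventually_elim
    case (elim k)
    then have "capply (inner_limit (inner_limit f m) k) 1 = (1 / (real k - real m)) *\<^sub>R
      ((real k - real m) *\<^sub>R capply (inner_limit (inner_limit f m) k) 1)" by simp
    then show ?case unfolding inner_limit_inner_limit[OF elim] by (simp add: scaleR_diff_right)
  qed
  ultimately have "(\<lambda>k. capply (inner_limit (inner_limit f m) k) 1) \<longlonglongrightarrow> capply (inner_limit f m) 1"
    by (simp add: tendsto_cong)
  then show ?thesis using limit_projection_tendsto LIMSEQ_unique by blast
qed

lemma bidual_projection_limit_projection: "bidual_projection limit_projection"
  unfolding bidual_projection_def
proof (intro conjI cblinfun_ext)
  fix f
  have "(\<lambda>m. capply limit_projection (inner_limit f m)) \<longlonglongrightarrow> capply limit_projection (outer_limit f)"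
    by (intro tendsto_capply outer_limit)
  then show "capply (arens limit_projection limit_projection) f = capply limit_projection f"
    unfolding limit_projection_inner_limit arens_apply bidual_act_limit_projection
    using limit_projection_tendsto LIMSEQ_unique by blast
  have "capply (inner_limit (dual_star f) m) 1 = cnj (capply (inner_limit f m) 1)" for m
  proof -
    have "(\<lambda>n. cnj (capply f (1 * g n m))) \<longlonglongrightarrow> cnj (capply (inner_limit f m) 1)"
      by (intro tendsto_cnj inner_limit_apply)
    moreover have "(\<lambda>n. cnj (capply f (1 * g n m))) \<longlonglongrightarrow> capply (inner_limit (dual_star f) m) 1"
      using inner_limit_apply[of "dual_star f" 1 m] by (simp add: dual_star_apply cpos_star[OF pos])
    ultimately show ?thesis using LIMSEQ_unique by blast
  qed
  then have "(\<lambda>m. cnj (capply (inner_limit f m) 1)) \<longlonglongrightarrow> capply limit_projection (dual_star f)"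
    using limit_projection_tendsto[of "dual_star f"] by simp
  moreover have "(\<lambda>m. cnj (capply (inner_limit f m) 1)) \<longlonglongrightarrow> cnj (capply limit_projection f)"
    by (intro tendsto_cnj limit_projection_tendsto)
  ultimately have "capply limit_projection (dual_star f) = cnj (capply limit_projection f)"
    using LIMSEQ_unique by blast
  then show "capply (bidual_star limit_projection) f = capply limit_projection f"
    by (simp add: bidual_star_apply)
qed

end

lemma resolvent_family_of_increasing:
  fixes b :: "nat \<Rightarrow> 'a::cstar_algebra"
  assumes b: "\<And>n. cpos (b n)" "\<And>n. cpos (b (Suc n) - b n)"
  shows "resolvent_family (\<lambda>n m. one_plus_inv ((1 / real (Suc m)) *\<^sub>R b n))"
proof
  fix n m k :: nat
  let ?c = "\<lambda>m. (1 / real (Suc m)) *\<^sub>R b n"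
  have c: "cpos (?c m)" for m by (intro cpos_scaleR b) simp
  show "cpos (one_plus_inv (?c m))" "cpos (1 - one_plus_inv (?c m))"
    by (intro one_plus_inv_cpos one_minus_one_plus_inv c)+
  show "cpos (one_plus_inv (?c m) - one_plus_inv ((1 / real (Suc m)) *\<^sub>R b (Suc n)))"
  proof (rule one_plus_inv_antimono[OF c])
    show "cpos ((1 / real (Suc m)) *\<^sub>R b (Suc n) - ?c m)"
      unfolding scaleR_diff_right[symmetric] by (rule cpos_scaleR[OF b(2)]) simp
  qed
  have "cpos (?c m - ?c (Suc m))"
    unfolding scaleR_diff_left[symmetric] by (rule cpos_scaleR[OF b(1)]) (simp add: frac_le)
  then show "cpos (one_plus_inv (?c (Suc m)) - one_plus_inv (?c m))"
    by (intro one_plus_inv_antimono c)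
  let ?r = "one_plus_inv (?c m)" and ?s = "one_plus_inv (?c k)"
  have "b n * ?r = real (Suc m) *\<^sub>R 1 - real (Suc m) *\<^sub>R ?r"
    using arg_cong[OF one_plus_inv_right[OF c[of m]], of "\<lambda>x. real (Suc m) *\<^sub>R x"]
    by (simp add: distrib_right scaleR_add_right eq_diff_eq add.commute del: of_nat_Suc)
  \<comment> \<open>\<open>?s * (b n * ?r)\<close> is computed twice, eliminating \<open>b n\<close>
    once against \<open>?r\<close> and once against \<open>?s\<close>; comparing the results is the
    resolvent identity.\<close>
  then have 1: "?s * (b n * ?r) = real (Suc m) *\<^sub>R ?s - real (Suc m) *\<^sub>R (?s * ?r)"
    by (simp add: right_diff_distrib del: of_nat_Suc)
  have "?s * b n = real (Suc k) *\<^sub>R 1 - real (Suc k) *\<^sub>R ?s"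
    using arg_cong[OF one_plus_inv_left[OF c[of k]], of "\<lambda>x. real (Suc k) *\<^sub>R x"]
    by (simp add: distrib_left scaleR_add_right eq_diff_eq add.commute del: of_nat_Suc)
  then have 2: "?s * (b n * ?r) = real (Suc k) *\<^sub>R ?r - real (Suc k) *\<^sub>R (?s * ?r)"
    by (simp add: left_diff_distrib mult.assoc[symmetric] del: of_nat_Suc)
  have "real (Suc k) *\<^sub>R (?s * ?r) - real (Suc m) *\<^sub>R (?s * ?r) = real (Suc k) *\<^sub>R ?r - real (Suc m) *\<^sub>R ?s"
    using 1 2 by (simp add: algebra_simps del: of_nat_Suc)
  then show "(real k - real m) *\<^sub>R (?s * ?r) = real (Suc k) *\<^sub>R ?r - real (Suc m) *\<^sub>R ?s"
    by (simp only: scaleR_diff_left[symmetric] of_nat_Suc add_diff_cancel_left)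
qed

lemma subspace_closure:
  fixes S :: "'a::real_normed_vector set"
  assumes S: "subspace S" shows "subspace (closure S)"
  unfolding subspace_def
proof (intro conjI ballI allI)
  show "0 \<in> closure S" using subspace_0[OF S] closure_subset by blast
  fix x y assume "x \<in> closure S" "y \<in> closure S"
  then obtain f g where "\<And>n. f n \<in> S" "f \<longlonglongrightarrow> x" "\<And>n. g n \<in> S" "g \<longlonglongrightarrow> y"
    by (metis closure_sequential)
  then show "x + y \<in> closure S"
    unfolding closure_sequential
    by (intro exI[of _ "\<lambda>n. f n + g n"]) (auto intro: tendsto_add subspace_add[OF S])
next
  fix c x assume "x \<in> closure S"
  then obtain f where "\<And>n. f n \<in> S" "f \<longlonglongrightarrow> x" by (metis closure_sequential)
  then show "c *\<^sub>R x \<in> closure S"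
    unfolding closure_sequential
    by (intro exI[of _ "\<lambda>n. c *\<^sub>R f n"]) (auto intro: tendsto_scaleR subspace_scale[OF S])
qed

section \<open>Amplification and selfadjoint approximation\<close>

instantiation prod :: (complex_normed, complex_normed) complex_normed
begin

definition scaleC_prod :: "complex \<Rightarrow> 'a \<times> 'b \<Rightarrow> 'a \<times> 'b"
  where "scaleC_prod c p = (c *\<^sub>C fst p, c *\<^sub>C snd p)"

instance
proof
  fix c :: complex and x :: "'a \<times> 'b"
  have "norm (c *\<^sub>C x) = sqrt ((cmod c)\<^sup>2 * ((norm (fst x))\<^sup>2 + (norm (snd x))\<^sup>2))"
    by (simp add: norm_prod_def scaleC_prod_def norm_scaleC power_mult_distrib distrib_left)
  also have "\<dots> = cmod c * norm x"
    by (simp add: norm_prod_def real_sqrt_mult)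
  finally show "norm (c *\<^sub>C x) = cmod c * norm x" .
qed (auto simp: scaleC_prod_def scaleC_add_right scaleC_add_left scaleC_scaleC scaleC_of_real prod_eq_iff)

end

instantiation prod :: (complex_hilbert, complex_hilbert) complex_hilbert
begin

definition cinner_prod :: "'a \<times> 'b \<Rightarrow> 'a \<times> 'b \<Rightarrow> complex"
  where "cinner_prod p q = cinner (fst p) (fst q) + cinner (snd p) (snd q)"

instance
proof
  fix x y :: "'a \<times> 'b"
  show "cinner x y = cnj (cinner y x)"
    unfolding cinner_prod_def complex_cnj_add
    by (metis cinner_commute)
  show "cinner x x = complex_of_real ((norm x)\<^sup>2)"
    by (simp add: cinner_prod_def norm_prod_def cinner_self)
qed (auto simp: cinner_prod_def scaleC_prod_def cinner_simps algebra_simps)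

end

lemma scaleC_Pair [simp]: "c *\<^sub>C (x, y) = (c *\<^sub>C x, c *\<^sub>C y)"
  by (simp add: scaleC_prod_def)

lemma cinner_Pair [simp]: "cinner (x, y) (x', y') = cinner x x' + cinner y y'"
  by (simp add: cinner_prod_def)

text \<open>The amplification of an operator to the direct sum of two copies; iterated once more it
  controls four vectors at a time.\<close>

lift_definition diag :: "('a::complex_normed, 'b::complex_normed) cblinfun \<Rightarrow> ('a \<times> 'a, 'b \<times> 'b) cblinfun"
  is "\<lambda>f p. (f (fst p), f (snd p))"
  by (auto simp: bounded_clinear_def scaleC_prod_def
      intro!: bounded_linear_Pair bounded_linear_compose[of _ fst] bounded_linear_compose[of _ snd]
        bounded_linear_fst bounded_linear_snd)

lemma capply_diag: "capply (diag T) p = (capply T (fst p), capply T (snd p))"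
  by transfer simp

definition operator_star_algebra :: "'h::complex_hilbert operator set \<Rightarrow> bool"
  where "operator_star_algebra R \<longleftrightarrow> cid \<in> R \<and> (\<forall>A\<in>R. cadj A \<in> R) \<and>
    (\<forall>A\<in>R. \<forall>B\<in>R. A o\<^sub>C B \<in> R) \<and> (\<forall>A\<in>R. \<forall>B\<in>R. A + B \<in> R) \<and> (\<forall>c. \<forall>A\<in>R. c *\<^sub>C A \<in> R)"

lemma operator_star_algebraD:
  assumes "operator_star_algebra R"
  shows "cid \<in> R" "A \<in> R \<Longrightarrow> cadj A \<in> R" "A \<in> R \<Longrightarrow> B \<in> R \<Longrightarrow> A o\<^sub>C B \<in> R"
    "A \<in> R \<Longrightarrow> B \<in> R \<Longrightarrow> A + B \<in> R" "A \<in> R \<Longrightarrow> c *\<^sub>C A \<in> R"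
  using assms unfolding operator_star_algebra_def by auto

lemma operator_star_algebra_commutant:
  "(\<And>A. A \<in> R \<Longrightarrow> cadj A \<in> R) \<Longrightarrow> operator_star_algebra (commutant R)"
  unfolding operator_star_algebra_def
  by (auto intro: commutant_cid commutant_cadj commutant_compose commutant_add commutant_scaleC)

lemma operator_star_algebra_diag:
  assumes R: "operator_star_algebra R" shows "operator_star_algebra (diag ` R)"
proof -
  have eq: "diag cid = cid" "cadj (diag A) = diag (cadj A)" "diag A o\<^sub>C diag B = diag (A o\<^sub>C B)"
    "diag A + diag B = diag (A + B)" "c *\<^sub>C diag A = diag (c *\<^sub>C A)" for A B :: "'a operator" and c
    by (auto intro!: cblinfun_ext cadj_eqI simp: capply_diag cinner_prod_def cinner_cadj capply_plus
        capply_scaleC_left)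
  have "cid \<in> diag ` R" using operator_star_algebraD(1)[OF R] eq(1) by (metis imageI)
  then show ?thesis
    using operator_star_algebraD(2-)[OF R] unfolding operator_star_algebra_def
    by (auto simp: eq)
qed

text \<open>The closure of R \<xi> is invariant under \<open>R\<close> and, as \<open>R\<close>
  contains adjoints, so is its orthogonal complement; hence the projection commutes with
  \<open>R\<close>.\<close>

lemma cyclic_projection:
  fixes \<xi> :: "'h::complex_hilbert"
  assumes R: "operator_star_algebra R"
  obtains E where "E \<in> commutant R" "cadj E = E" "capply E \<xi> = \<xi>"
    "\<And>x. capply E x \<in> closure ((\<lambda>A. capply A \<xi>) ` R)"
    "\<And>x. (\<And>A. A \<in> R \<Longrightarrow> cinner (capply A \<xi>) x = 0) \<Longrightarrow> capply E x = 0"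
proof -
  let ?S = "(\<lambda>A. capply A \<xi>) ` R"
  note Rs = operator_star_algebraD[OF R]
  have "csubspace ?S"
    unfolding csubspace_def
  proof (intro conjI ballI allI)
    show "0 \<in> ?S" using Rs(5)[OF Rs(1), of 0] by (intro image_eqI[of _ _ "0 *\<^sub>C cid"]) (auto simp: capply_scaleC_left)
    fix x y assume "x \<in> ?S" "y \<in> ?S"
    then show "x + y \<in> ?S" using Rs(4) by (auto simp: capply_plus[symmetric])
  next
    fix c x assume "x \<in> ?S"
    then show "c *\<^sub>C x \<in> ?S" using Rs(5) by (auto simp: capply_scaleC_left[symmetric])
  qed
  then have cs: "csubspace (closure ?S)" by (rule csubspace_closure)
  obtain E where E: "\<And>x. capply E x \<in> closure ?S" "\<And>x y. y \<in> closure ?S \<Longrightarrow> cinner y (x - capply E x) = 0"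
    "\<And>x. x \<in> closure ?S \<Longrightarrow> capply E x = x"
    using projection_operator[OF closed_closure cs] by metis
  have zero: "capply E x = 0" if "\<And>y. y \<in> closure ?S \<Longrightarrow> cinner y x = 0" for x
    using E(2)[OF E(1), of x x] that[OF E(1)] by (simp add: cinner_diff_right)
  have orth: "cinner y x = 0" if "\<And>A. A \<in> R \<Longrightarrow> cinner (capply A \<xi>) x = 0" "y \<in> closure ?S" for x y
  proof -
    obtain f where f: "\<And>n. f n \<in> ?S" "f \<longlonglongrightarrow> y" using \<open>y \<in> closure ?S\<close> closure_sequential by blast
    have "(\<lambda>n. cinner (f n) x) \<longlonglongrightarrow> cinner y x" by (intro tendsto_intros f)
    moreover have "cinner (f n) x = 0" for n using f(1)[of n] that(1) by auto
    ultimately show ?thesis by (simp add: LIMSEQ_const_iff)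
  qed
  have inv: "capply A y \<in> closure ?S" if "A \<in> R" "y \<in> closure ?S" for A y
  proof -
    obtain f where f: "\<And>n. f n \<in> ?S" "f \<longlonglongrightarrow> y" using \<open>y \<in> closure ?S\<close> closure_sequential by blast
    have "(\<lambda>n. capply A (f n)) \<longlonglongrightarrow> capply A y" by (intro tendsto_intros f)
    moreover have "capply A (f n) \<in> ?S" for n
      using f(1)[of n] Rs(3)[OF \<open>A \<in> R\<close>] by (auto simp: capply_compose[symmetric] simp del: capply_compose)
    ultimately show ?thesis unfolding closure_sequential by (intro exI[of _ "\<lambda>n. capply A (f n)"]) auto
  qed
  have "E \<in> commutant R"
    unfolding commutant_iff
  proof (intro ballI allI)
    fix A x assume A: "A \<in> R"
    have "capply E (capply A (x - capply E x)) = 0"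
      by (rule zero) (use inv[OF Rs(2)[OF A]] E(2) in \<open>simp flip: cinner_cadj'\<close>)
    then show "capply E (capply A x) = capply A (capply E x)"
      using E(3)[OF inv[OF A E(1)[of x]]] by (simp add: capply_diff)
  qed
  moreover have "cadj E = E"
  proof (rule cadj_eqI)
    fix x y
    have "cinner (capply E x) y = cinner (capply E x) (capply E y)"
      using E(2)[OF E(1)[of x], of y] by (simp add: cinner_diff_right)
    also have "\<dots> = cinner x (capply E y)"
      using E(2)[OF E(1)[of y], of x] cinner_commute by (metis cinner_diff_right complex_cnj_zero_iff right_minus_eq)
    finally show "cinner (capply E x) y = cinner x (capply E y)" .
  qed
  moreover have "capply E \<xi> = \<xi>"
    by (rule E(3)) (use Rs(1) closure_subset[of ?S] in \<open>force simp: image_iff\<close>)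
  moreover have "capply E x = 0" if "\<And>A. A \<in> R \<Longrightarrow> cinner (capply A \<xi>) x = 0" for x
    by (rule zero) (rule orth[OF that])
  ultimately show thesis using that E(1) by blast
qed

text \<open>Von Neumann's density argument at one vector; several vectors are reached by
  amplification.\<close>

lemma double_commutant_density:
  fixes \<xi> :: "'h::complex_hilbert"
  assumes R: "operator_star_algebra R" and T: "T \<in> commutant (commutant R)" and e: "e > 0"
  obtains A where "A \<in> R" "norm (capply A \<xi> - capply T \<xi>) < e"
proof -
  obtain E where E: "E \<in> commutant R" "capply E \<xi> = \<xi>"
    "\<And>x. capply E x \<in> closure ((\<lambda>A. capply A \<xi>) ` R)"
    using cyclic_projection[OF R, of \<xi>] by metis
  have "capply T \<xi> = capply E (capply T \<xi>)" using commutantD[OF T E(1), of \<xi>] by (simp add: E(2))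
  then have "capply T \<xi> \<in> closure ((\<lambda>A. capply A \<xi>) ` R)" using E(3) by metis
  then show thesis using that e by (auto simp: closure_approachable dist_norm)
qed

text \<open>The four blocks of an operator commuting with all amplified elements of \<open>R\<close>
  lie in the commutant of \<open>R\<close>, so \<open>T\<close> commutes with each block.\<close>

lemma diag_double_commutant:
  fixes T :: "'h::complex_hilbert operator"
  assumes T: "T \<in> commutant (commutant R)"
  shows "diag T \<in> commutant (commutant (diag ` R))"
proof -
  have blk: "capply T (p (capply S (i x))) = p (capply S (i (capply T x)))"
    if S: "S \<in> commutant (diag ` R)" and p: "p = fst \<or> p = snd" and i: "i = (\<lambda>x. (x, 0)) \<or> i = (\<lambda>x. (0, x))"
    for S x and p :: "'h \<times> 'h \<Rightarrow> 'h" and i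
  proof -
    have "\<exists>B. capply B = (\<lambda>x. p (capply S (i x)))"
    proof (rule cblinfun_exists)
      fix x y
      have "i (x + y) = i x + i y" using i by auto
      then show "p (capply S (i (x + y))) = p (capply S (i x)) + p (capply S (i y))"
        using p by (auto simp: capply_add)
    next
      fix c x
      have "i (c *\<^sub>C x) = c *\<^sub>C i x" using i by auto
      then show "p (capply S (i (c *\<^sub>C x))) = c *\<^sub>C p (capply S (i x))"
        using p capply_scaleC[of S c "i x"] by (auto simp: scaleC_prod_def)
    next
      fix x
      have "norm (p (capply S (i x))) \<le> norm (capply S (i x))"
        using p norm_fst_le norm_snd_le by (metis prod.collapse)
      also have "\<dots> \<le> norm S * norm (i x)" by (rule norm_capply)
      also have "norm (i x) = norm x" using i by (auto simp: norm_Pair)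
      finally show "norm (p (capply S (i x))) \<le> norm S * norm x" .
    qed
    then obtain B where B: "\<And>x. capply B x = p (capply S (i x))" by metis
    have "B \<in> commutant R"
      unfolding commutant_iff B
    proof (intro ballI allI)
      fix A x assume "A \<in> R"
      then have "capply S (capply (diag A) (i x)) = capply (diag A) (capply S (i x))"
        using commutantD[OF S] by blast
      moreover have "capply (diag A) (i x) = i (capply A x)" using i by (auto simp: capply_diag)
      ultimately show "p (capply S (i (capply A x))) = capply A (p (capply S (i x)))"
        using p by (auto simp: capply_diag)
    qed
    from commutantD[OF T this, of x] show ?thesis by (simp add: B)
  qed
  show ?thesis
    unfolding commutant_iff
  proof (intro ballI allI)
    fix S and z :: "'h \<times> 'h" assume S: "S \<in> commutant (diag ` R)"
    obtain x y where z: "z = (x, y)" by fastforce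
    have dec: "capply S (u, v) = capply S (u, 0) + capply S (0, v)" for u v
      by (simp flip: capply_add)
    show "capply (diag T) (capply S z) = capply S (capply (diag T) z)"
      using blk[OF S, of fst "\<lambda>x. (x, 0)" x] blk[OF S, of fst "\<lambda>x. (0, x)" y]
        blk[OF S, of snd "\<lambda>x. (x, 0)" x] blk[OF S, of snd "\<lambda>x. (0, x)" y]
      by (simp add: z capply_diag dec[of x y] dec[of "capply T x" "capply T y"] capply_add prod_eq_iff)
  qed
qed

lemma double_commutant_density4:
  fixes w x y z :: "'h::complex_hilbert"
  assumes R: "operator_star_algebra R" and T: "T \<in> commutant (commutant R)" and e: "e > 0"
  obtains A where "A \<in> R" "norm (capply A w - capply T w) < e" "norm (capply A x - capply T x) < e"
    "norm (capply A y - capply T y) < e" "norm (capply A z - capply T z) < e"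
proof -
  obtain A' where A': "A' \<in> diag ` diag ` R"
    "norm (capply A' ((w, x), (y, z)) - capply (diag (diag T)) ((w, x), (y, z))) < e"
    using double_commutant_density[OF operator_star_algebra_diag[OF operator_star_algebra_diag[OF R]]
      diag_double_commutant[OF diag_double_commutant[OF T]] e] by metis
  then obtain A where A: "A \<in> R" "A' = diag (diag A)" by blast
  let ?d = "\<lambda>v. capply A v - capply T v"
  have "norm ((?d w, ?d x), (?d y, ?d z)) < e" using A'(2) by (simp add: A(2) capply_diag)
  moreover have "norm (?d w, ?d x) \<le> norm ((?d w, ?d x), (?d y, ?d z))"
    "norm (?d y, ?d z) \<le> norm ((?d w, ?d x), (?d y, ?d z))" by (rule norm_fst_le norm_snd_le)+
  moreover have "norm (?d w) \<le> norm (?d w, ?d x)" "norm (?d x) \<le> norm (?d w, ?d x)"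
    "norm (?d y) \<le> norm (?d y, ?d z)" "norm (?d z) \<le> norm (?d y, ?d z)"
    by (rule norm_fst_le norm_snd_le)+
  ultimately show thesis by (intro that[OF A(1)]) linarith+
qed

text \<open>Approximation by selfadjoint elements needs the \<open>4\<close>-fold amplification: the adjoint is only
  weakly continuous, and strong approximants are recovered from convexity.\<close>

lemma selfadjoint_density:
  fixes \<eta> \<xi> :: "'h::complex_hilbert"
  assumes R: "operator_star_algebra R" and T: "T \<in> commutant (commutant R)" "cadj T = T" and e: "e > 0"
  obtains A where "A \<in> R" "cadj A = A" "norm (capply A \<eta> - capply T \<eta>) < e" "norm (capply A \<xi> - capply T \<xi>) < e"
proof -
  note Rs = operator_star_algebraD[OF R]
  \<comment> \<open>Only a real subspace, since selfadjointness survives real but not complex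
    multiples.\<close>
  let ?S = "(\<lambda>A. (capply A \<eta>, capply A \<xi>)) ` {A\<in>R. cadj A = A}"
  have scR: "r *\<^sub>R A = complex_of_real r *\<^sub>C A" for r and A :: "'h operator" by (simp add: scaleC_of_real)
  have "subspace ?S"
    unfolding subspace_def
  proof (intro conjI ballI allI)
    have "0 *\<^sub>C cid \<in> R" using Rs(1,5) by blast
    then have z: "0 \<in> R" by simp
    have "cadj 0 = (0 :: 'h operator)" by (rule cadj_eqI) simp
    then show "0 \<in> ?S" using z by (intro image_eqI[of _ _ 0]) (auto simp: zero_prod_def)
  next
    fix p q assume "p \<in> ?S" "q \<in> ?S"
    then obtain A B where "A \<in> R" "cadj A = A" "p = (capply A \<eta>, capply A \<xi>)"
      "B \<in> R" "cadj B = B" "q = (capply B \<eta>, capply B \<xi>)" by blast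
    then show "p + q \<in> ?S" using Rs(4) by (intro image_eqI[of _ _ "A + B"]) (auto simp: capply_plus cadj_add)
  next
    fix r p assume "p \<in> ?S"
    then obtain A where "A \<in> R" "cadj A = A" "p = (capply A \<eta>, capply A \<xi>)" by blast
    moreover have "r *\<^sub>R A \<in> R" unfolding scR using Rs(5) \<open>A \<in> R\<close> .
    moreover have "cadj (r *\<^sub>R A) = r *\<^sub>R A" unfolding scR cadj_scaleC \<open>cadj A = A\<close> by simp
    ultimately show "r *\<^sub>R p \<in> ?S"
      by (intro image_eqI[of _ _ "r *\<^sub>R A"]) (auto simp: capply_scaleR_left)
  qed
  have cl_sub: "subspace (closure ?S)" by (rule subspace_closure[OF \<open>subspace ?S\<close>])
  let ?p = "(capply T \<eta>, capply T \<xi>)"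
  obtain q where q: "q \<in> closure ?S" "\<And>y. y \<in> closure ?S \<Longrightarrow> Re (cinner y (?p - q)) = 0"
    using real_subspace_projection[OF closed_closure cl_sub, of ?p] by blast
  obtain x z where xz: "?p - q = (x, z)" by fastforce
  \<comment> \<open>Orthogonality is tested on \<open>A + cadj A\<close> for arbitrary
    \<open>A\<close> in \<open>R\<close>. After expansion \<open>A\<close> is evaluated at \<eta>,
    \<xi>, \<open>x\<close> and \<open>z\<close>, and \<open>cadj A\<close> nowhere.\<close>
  have id: "Re (cinner (capply A \<eta>) x + cinner \<eta> (capply A x) + cinner (capply A \<xi>) z + cinner \<xi> (capply A z)) = 0"
    if A: "A \<in> R" for A
  proof -
    have "(capply (A + cadj A) \<eta>, capply (A + cadj A) \<xi>) \<in> ?S"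
      using A Rs(2,4) by (intro imageI) (auto simp: cadj_add add.commute)
    from q(2)[OF subsetD[OF closure_subset this], unfolded xz]
    show ?thesis by (simp add: capply_plus cinner_simps cinner_cadj')
  qed
  have "\<exists>A\<in>R. norm (capply A \<eta> - capply T \<eta>) < 1 / real (Suc n) \<and> norm (capply A \<xi> - capply T \<xi>) < 1 / real (Suc n)
      \<and> norm (capply A x - capply T x) < 1 / real (Suc n) \<and> norm (capply A z - capply T z) < 1 / real (Suc n)" for n
    by (rule double_commutant_density4[OF R T(1), of "1 / real (Suc n)" \<eta> \<xi> x z]) auto
  then obtain A where A: "\<And>n. A n \<in> R" "\<And>n. norm (capply (A n) \<eta> - capply T \<eta>) < 1 / real (Suc n)"
    "\<And>n. norm (capply (A n) \<xi> - capply T \<xi>) < 1 / real (Suc n)"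
    "\<And>n. norm (capply (A n) x - capply T x) < 1 / real (Suc n)"
    "\<And>n. norm (capply (A n) z - capply T z) < 1 / real (Suc n)" by metis
  have conv: "(\<lambda>n. capply (A n) v) \<longlonglongrightarrow> capply T v"
    if "\<And>n. norm (capply (A n) v - capply T v) < 1 / real (Suc n)" for v
  proof (rule LIM_zero_cancel, rule Lim_null_comparison)
    show "\<forall>\<^sub>F n in sequentially. norm (capply (A n) v - capply T v) \<le> 1 / real (Suc n)"
      using that by (intro always_eventually) (auto intro: less_imp_le)
    show "(\<lambda>n. 1 / real (Suc n)) \<longlonglongrightarrow> 0" using LIMSEQ_Suc[OF lim_1_over_n] .
  qed
  have "(\<lambda>n. Re (cinner (capply (A n) \<eta>) x + cinner \<eta> (capply (A n) x) + cinner (capply (A n) \<xi>) z + cinner \<xi> (capply (A n) z)))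
      \<longlonglongrightarrow> Re (cinner (capply T \<eta>) x + cinner \<eta> (capply T x) + cinner (capply T \<xi>) z + cinner \<xi> (capply T z))"
    by (intro tendsto_intros conv A)
  then have "Re (cinner (capply T \<eta>) x + cinner \<eta> (capply T x) + cinner (capply T \<xi>) z + cinner \<xi> (capply T z)) = 0"
    unfolding id[OF A(1)] by (simp add: LIMSEQ_const_iff)
  \<comment> \<open>The identity now holds for \<open>T\<close>, whose selfadjointness collapses it
    to twice the real inner product of \<open>?p\<close> with \<open>?p - q\<close>.\<close>
  moreover have "cinner \<eta> (capply T x) = cinner (capply T \<eta>) x" "cinner \<xi> (capply T z) = cinner (capply T \<xi>) z"
    using T(2) by (metis cinner_cadj)+
  ultimately have "Re (cinner ?p (?p - q)) = 0" unfolding xz by simp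
  then have "Re (cinner (?p - q) (?p - q)) = 0"
    using q(2)[OF q(1)] by (simp add: cinner_diff_left del: cinner_Pair diff_Pair)
  then have "?p = q" by (simp only: cinner_self Re_complex_of_real power_eq_0_iff norm_eq_zero right_minus_eq)
  then obtain w where w: "w \<in> ?S" "norm (w - ?p) < e"
    using q(1) e unfolding closure_approachable dist_norm by blast
  then obtain A where A: "A \<in> R" "cadj A = A" "w = (capply A \<eta>, capply A \<xi>)" by blast
  have "norm (capply A \<eta> - capply T \<eta>, capply A \<xi> - capply T \<xi>) < e" using w(2) A(3) by simp
  then show thesis
    using norm_fst_le[of "capply A \<eta> - capply T \<eta>" "capply A \<xi> - capply T \<xi>"]
      norm_snd_le[of "capply A \<xi> - capply T \<xi>" "capply A \<eta> - capply T \<eta>"]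
    by (intro that[OF A(1,2)]) linarith+
qed

section \<open>A central support makes the GNS vector cyclic for the commutant\<close>

locale star_rep =
  fixes \<pi> :: "'a::cstar_algebra \<Rightarrow> 'h::complex_hilbert operator"
  assumes rep: "star_representation \<pi>"
begin

lemma rep_simps:
  shows rep_add: "\<pi> (a + b) = \<pi> a + \<pi> b" and rep_scaleC: "\<pi> (c *\<^sub>C a) = c *\<^sub>C \<pi> a"
    and rep_mult: "\<pi> (a * b) = \<pi> a o\<^sub>C \<pi> b" and rep_one: "\<pi> 1 = cid"
    and rep_star: "\<pi> (star a) = cadj (\<pi> a)"
  using rep unfolding star_representation_def by auto

lemma rep_scaleR: "\<pi> (r *\<^sub>R a) = r *\<^sub>R \<pi> a"
  using rep_scaleC[of "complex_of_real r" a] by (simp add: scaleC_of_real)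

lemma rep_zero: "\<pi> 0 = 0"
  using rep_scaleR[of 0 0] by simp

lemma rep_minus: "\<pi> (- a) = - \<pi> a"
  using rep_scaleR[of "-1" a] by simp

lemma rep_diff: "\<pi> (a - b) = \<pi> a - \<pi> b"
  using rep_add[of a "- b"] by (simp add: rep_minus)

lemma rep_cinner: "cinner (capply (\<pi> a) x) y = cinner x (capply (\<pi> (star a)) y)"
  by (simp add: rep_star cinner_cadj)

lemma rep_pos: "cpos a \<Longrightarrow> cinner (capply (\<pi> a) x) x = of_real (Re (cinner (capply (\<pi> a) x) x)) \<and>
    0 \<le> Re (cinner (capply (\<pi> a) x) x)"
proof -
  assume "cpos a"
  then obtain h where h: "star h = h" "a = h * h" by (auto simp: cpos_def)
  have "cinner (capply (\<pi> a) x) x = cinner (capply (\<pi> h) x) (capply (\<pi> h) x)"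
    by (simp add: h(2) rep_mult rep_cinner[of h] h(1))
  then show ?thesis by (simp add: cinner_self)
qed

text \<open>\<open>star_representation\<close> is purely algebraic; boundedness in the norm of the
  algebra follows from positivity of \<open>1 - star c * c\<close>.\<close>

lemma rep_contraction:
  assumes "norm c \<le> 1" shows "norm (capply (\<pi> c) x) \<le> norm x"
proof -
  have "norm (star c * c) \<le> 1" using assms by (simp add: cstar_identity power_le_one)
  then have "cpos (1 - star c * c)"
    using cpos_norm_minus[of "star c * c" 1] by (simp add: star_mult star_star)
  then have "0 \<le> Re (cinner (capply (\<pi> (1 - star c * c)) x) x)" using rep_pos by blast
  also have "cinner (capply (\<pi> (1 - star c * c)) x) x = cinner x x - cinner (capply (\<pi> c) x) (capply (\<pi> c) x)"
    by (simp add: rep_diff rep_one rep_mult capply_minus_left cinner_diff_left rep_cinner[of "star c"] star_star)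
  finally have "(norm (capply (\<pi> c) x))\<^sup>2 \<le> (norm x)\<^sup>2" by (simp add: cinner_self)
  then show ?thesis by (rule power2_le_imp_le) simp
qed

lemma rep_bound: "norm (capply (\<pi> a) x) \<le> norm a * norm x"
proof (cases "a = 0")
  case False
  have "norm (capply (\<pi> ((1 / norm a) *\<^sub>R a)) x) \<le> norm x"
    by (rule rep_contraction) (use False in simp)
  then show ?thesis using False by (simp add: rep_scaleR capply_scaleR_left field_simps)
qed (simp add: rep_zero)

definition vec_functional :: "'h \<Rightarrow> 'h \<Rightarrow> 'a cdual"
  where "vec_functional \<xi> \<eta> = CBlinfun (\<lambda>a. cinner (capply (\<pi> a) \<xi>) \<eta>)"

lemma vec_functional_apply: "capply (vec_functional \<xi> \<eta>) a = cinner (capply (\<pi> a) \<xi>) \<eta>"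
proof -
  have "bounded_clinear (\<lambda>a. cinner (capply (\<pi> a) \<xi>) \<eta>)"
  proof (rule bounded_clinearI)
    fix a
    have "cmod (cinner (capply (\<pi> a) \<xi>) \<eta>) \<le> norm (capply (\<pi> a) \<xi>) * norm \<eta>" by (rule cinner_norm_le)
    also have "\<dots> \<le> norm a * norm \<xi> * norm \<eta>" by (intro mult_right_mono rep_bound) simp
    finally show "cmod (cinner (capply (\<pi> a) \<xi>) \<eta>) \<le> norm a * (norm \<xi> * norm \<eta>)" by (simp add: mult_ac)
  qed (simp_all add: rep_add rep_scaleC capply_plus capply_scaleC_left cinner_simps scaleC_complex_def)
  then show ?thesis by (simp add: vec_functional_def CBlinfun_inverse)
qed

lemma norm_vec_functional: "norm (vec_functional \<xi> \<eta>) \<le> norm \<xi> * norm \<eta>"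
proof (rule norm_cblinfun_bound)
  fix a
  have "cmod (cinner (capply (\<pi> a) \<xi>) \<eta>) \<le> norm (capply (\<pi> a) \<xi>) * norm \<eta>" by (rule cinner_norm_le)
  also have "\<dots> \<le> norm a * norm \<xi> * norm \<eta>" by (intro mult_right_mono rep_bound) simp
  finally show "norm (capply (vec_functional \<xi> \<eta>) a) \<le> norm \<xi> * norm \<eta> * norm a"
    by (simp add: vec_functional_apply mult_ac)
qed simp

lemma vec_functional_add_right: "vec_functional \<xi> (\<eta> + \<zeta>) = vec_functional \<xi> \<eta> + vec_functional \<xi> \<zeta>"
  and vec_functional_scaleC_right: "vec_functional \<xi> (c *\<^sub>C \<eta>) = cnj c *\<^sub>C vec_functional \<xi> \<eta>"
  and vec_functional_add_left: "vec_functional (\<eta> + \<zeta>) \<xi> = vec_functional \<eta> \<xi> + vec_functional \<zeta> \<xi>"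
  and vec_functional_diff_left: "vec_functional (\<eta> - \<zeta>) \<xi> = vec_functional \<eta> \<xi> - vec_functional \<zeta> \<xi>"
  and dual_shift_vec_functional: "dual_shift (vec_functional \<xi> \<eta>) a = vec_functional \<xi> (capply (\<pi> (star a)) \<eta>)"
  and dual_star_vec_functional: "dual_star (vec_functional \<xi> \<eta>) = vec_functional \<eta> \<xi>"
proof -
  show "dual_star (vec_functional \<xi> \<eta>) = vec_functional \<eta> \<xi>"
  proof (rule cblinfun_ext)
    fix x
    show "capply (dual_star (vec_functional \<xi> \<eta>)) x = capply (vec_functional \<eta> \<xi>) x"
      unfolding dual_star_apply vec_functional_apply cinner_commute[of "capply (\<pi> x) \<eta>" \<xi>]
      by (simp add: rep_cinner[of "star x"] star_star)
  qed
qed (auto intro!: cblinfun_ext simp: vec_functional_apply cinner_simps capply_plus capply_scaleC_left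
    scaleC_complex_def dual_shift_apply capply_add capply_diff capply_minus_left rep_mult rep_cinner[of a])

lemma operator_star_algebra_range: "operator_star_algebra (range \<pi>)"
  unfolding operator_star_algebra_def
  by (auto simp: rep_simps[symmetric])

lemma operator_star_algebra_commutant_range: "operator_star_algebra (commutant (range \<pi>))"
  by (rule operator_star_algebra_commutant) (auto simp: rep_star[symmetric])

end

text \<open>The projection \<open>s\<close> acts as the identity in the representation: its value
  \<open>1\<close> on \<open>\<omega>\<close> settles the vector \<Omega>, centrality carries this
  to all \<open>capply (\<pi> a) \<Omega>\<close>, and cyclicity to every vector.\<close>

lemma support_vec_functional:
  fixes \<pi> :: "'a::cstar_algebra \<Rightarrow> 'h::complex_hilbert operator"
  assumes "star_representation \<pi>" and cyc: "closure (range (\<lambda>a. capply (\<pi> a) \<Omega>)) = UNIV"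
    and \<omega>: "\<omega> = star_rep.vec_functional \<pi> \<Omega> \<Omega>" and \<omega>1: "capply \<omega> 1 = 1"
    and proj: "bidual_projection s" and s\<omega>: "capply s \<omega> = 1" and central: "s \<in> bidual_centre"
  shows "capply s (star_rep.vec_functional \<pi> \<xi> \<eta>) = cinner \<xi> \<eta>"
proof -
  interpret star_rep \<pi> by (rule star_rep.intro) fact
  have \<Omega>1: "cinner \<Omega> \<Omega> = 1" using \<omega>1 by (simp add: \<omega> vec_functional_apply rep_one)
  have bnd: "cmod (capply s (vec_functional \<xi> \<eta>)) \<le> norm s * (norm \<xi> * norm \<eta>)" for \<xi> \<eta>
    by (rule order_trans[OF norm_capply mult_left_mono[OF norm_vec_functional]]) simp
  have "\<exists>f::'h cdual. capply f = (\<lambda>\<eta>. cnj (capply s (vec_functional \<Omega> \<eta>)))"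
    by (rule cblinfun_exists[where K = "norm s * norm \<Omega>"])
      (use bnd[of \<Omega>] in \<open>simp_all add: vec_functional_add_right vec_functional_scaleC_right capply_add
        capply_scaleC scaleC_complex_def mult_ac\<close>)
  then obtain p where "\<And>\<eta>. cnj (capply s (vec_functional \<Omega> \<eta>)) = cinner \<eta> p"
    using riesz by metis
  \<comment> \<open>\<open>p\<close> plays the role of s \<Omega>. Idempotence and selfadjointness
    of \<open>s\<close> express \<open>cinner p p\<close> through \<open>cinner p \<Omega>\<close>,
    and the value of \<open>s\<close> at \<open>\<omega>\<close> then forces
    \<open>p = \<Omega>\<close>.\<close>
  then have p: "capply s (vec_functional \<Omega> \<eta>) = cinner p \<eta>" for \<eta>
    by (metis cinner_commute complex_cnj_cnj)
  have act: "bidual_act s (vec_functional \<Omega> \<eta>) = vec_functional p \<eta>" for \<eta>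
    by (rule cblinfun_ext) (simp add: bidual_act_apply dual_shift_vec_functional p vec_functional_apply
        rep_cinner)
  have ss: "capply s (vec_functional p \<eta>) = cinner p \<eta>" for \<eta>
    using proj arg_cong[of _ _ "\<lambda>F. capply F (vec_functional \<Omega> \<eta>)"] unfolding bidual_projection_def
    by (metis act arens_apply p)
  have sst: "capply s (dual_star f) = cnj (capply s f)" for f
    using proj bidual_star_apply[of s f] unfolding bidual_projection_def by simp
  have "cinner p p = capply s (vec_functional \<Omega> p)" by (simp add: p)
  also have "\<dots> = cnj (capply s (vec_functional p \<Omega>))"
    using sst[of "vec_functional p \<Omega>"] by (simp add: dual_star_vec_functional)
  finally have pp: "cinner p p = cnj (cinner p \<Omega>)" by (simp add: ss)
  have p\<Omega>: "cinner p \<Omega> = 1" using p[of \<Omega>] s\<omega> \<omega> by simp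
  have "cinner \<Omega> p = 1" using p\<Omega> cinner_commute[of \<Omega> p] by simp
  then have "cinner (p - \<Omega>) (p - \<Omega>) = 0" using pp p\<Omega> \<Omega>1 by (simp add: cinner_simps)
  then have p_eq: "p = \<Omega>" by simp
  have sa: "capply s (vec_functional (capply (\<pi> a) \<Omega>) \<eta>) = cinner (capply (\<pi> a) \<Omega>) \<eta>" for a \<eta>
  proof -
    let ?f = "vec_functional \<Omega> \<eta>"
    \<comment> \<open>The two orders of the Arens product of \<open>s\<close> with
      \<open>bidual_embed a\<close> are evaluated separately; one involves the functional of
      \<open>capply (\<pi> a) \<Omega>\<close>, the other only that of \<Omega>.\<close>
    have "bidual_act (bidual_embed a) ?f = vec_functional (capply (\<pi> a) \<Omega>) \<eta>"
      by (rule cblinfun_ext) (simp add: bidual_act_apply dual_shift_apply vec_functional_apply rep_mult)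
    then have "capply s (vec_functional (capply (\<pi> a) \<Omega>) \<eta>) = capply (arens s (bidual_embed a)) ?f"
      by (simp add: arens_apply)
    also have "\<dots> = capply (arens (bidual_embed a) s) ?f"
      using central by (simp add: bidual_centre_def)
    also have "\<dots> = capply s (dual_shift ?f a)" by (simp add: arens_apply bidual_act_apply)
    also have "\<dots> = cinner (capply (\<pi> a) \<Omega>) \<eta>"
      by (simp add: dual_shift_vec_functional p p_eq rep_cinner[of a])
    finally show ?thesis .
  qed
  obtain a where a: "(\<lambda>n. capply (\<pi> (a n)) \<Omega>) \<longlonglongrightarrow> \<xi>"
  proof -
    have "\<xi> \<in> closure (range (\<lambda>a. capply (\<pi> a) \<Omega>))" by (simp add: cyc)
    then obtain f where f: "\<And>n. f n \<in> range (\<lambda>a. capply (\<pi> a) \<Omega>)" "f \<longlonglongrightarrow> \<xi>"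
      unfolding closure_sequential by blast
    then have "\<exists>a. f n = capply (\<pi> a) \<Omega>" for n by blast
    then obtain a where "\<And>n. f n = capply (\<pi> (a n)) \<Omega>" by metis
    then have "f = (\<lambda>n. capply (\<pi> (a n)) \<Omega>)" by auto
    then show thesis using f(2) that by blast
  qed
  have "(\<lambda>n. capply s (vec_functional (capply (\<pi> (a n)) \<Omega> - \<xi>) \<eta>)) \<longlonglongrightarrow> 0"
  proof (rule Lim_null_comparison)
    show "\<forall>\<^sub>F n in sequentially. norm (capply s (vec_functional (capply (\<pi> (a n)) \<Omega> - \<xi>) \<eta>))
        \<le> norm s * (norm (capply (\<pi> (a n)) \<Omega> - \<xi>) * norm \<eta>)"
      by (intro always_eventually allI bnd)
    have "(\<lambda>n. norm s * (norm (capply (\<pi> (a n)) \<Omega> - \<xi>) * norm \<eta>)) \<longlonglongrightarrow> norm s * (norm (\<xi> - \<xi>) * norm \<eta>)"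
      by (intro tendsto_intros a)
    then show "(\<lambda>n. norm s * (norm (capply (\<pi> (a n)) \<Omega> - \<xi>) * norm \<eta>)) \<longlonglongrightarrow> 0" by simp
  qed
  then have "(\<lambda>n. cinner (capply (\<pi> (a n)) \<Omega>) \<eta> - capply s (vec_functional \<xi> \<eta>)) \<longlonglongrightarrow> 0"
    by (simp add: vec_functional_diff_left capply_diff sa)
  then have "(\<lambda>n. cinner (capply (\<pi> (a n)) \<Omega>) \<eta>) \<longlonglongrightarrow> capply s (vec_functional \<xi> \<eta>)"
    by (rule LIM_zero_cancel)
  moreover have "(\<lambda>n. cinner (capply (\<pi> (a n)) \<Omega>) \<eta>) \<longlonglongrightarrow> cinner \<xi> \<eta>"
    by (intro tendsto_intros a)
  ultimately show ?thesis by (rule LIMSEQ_unique)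
qed

text \<open>Kaplansky's trick: \<open>h = a\<^sup>2 (1 + a\<^sup>2)\<^sup>-\<^sup>1\<close> is a positive contraction with \<open>h - 1/2 = u (a - 1)\<close>.\<close>

lemma positive_contraction:
  fixes a :: "'a::cstar_algebra"
  assumes sa: "star a = a"
  obtains h r u where "cpos h" "cpos (1 - h)" "h = a * r * a" "norm r \<le> 1"
    "h - (1/2) *\<^sub>R 1 = u * (a - 1)" "norm u \<le> 1"
proof -
  define r where "r = one_plus_inv (a * a)"
  have aa: "cpos (a * a)" by (rule cpos_square[OF sa])
  have r: "cpos r" "cpos (1 - r)" "1 - r = (a * a) * r"
    unfolding r_def by (intro one_plus_inv_cpos one_minus_one_plus_inv aa)+
  have ra: "r * a = a * r" unfolding r_def by (rule one_plus_inv_commute[OF aa]) (simp add: mult.assoc)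
  have nr: "norm r \<le> 1" by (rule cpos_le_one_norm[OF r(1,2)])
  have "norm (star (r * a) * (r * a)) \<le> 1"
  proof -
    have "star (r * a) * (r * a) = (1 - r) * r"
      unfolding r(3) star_mult sa cpos_star[OF r(1)] using ra by (metis mult.assoc)
    also have "norm \<dots> \<le> norm (1 - r) * norm r" by (rule norm_mult_ineq)
    also have "\<dots> \<le> 1 * 1"
      using nr cpos_le_one_norm[OF r(2)] r(1) by (intro mult_mono) auto
    finally show ?thesis by simp
  qed
  then have "norm (r * a) \<le> 1" unfolding cstar_identity by (simp add: power_le_one_iff)
  then have nu: "norm ((1/2) *\<^sub>R (r * a + r)) \<le> 1"
    using nr norm_triangle_ineq[of "r * a" r] by simp
  have "(1 - r) - (1/2) *\<^sub>R 1 = (1/2) *\<^sub>R (1 - r) - (1/2) *\<^sub>R r"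
    by (simp add: algebra_simps flip: scaleR_add_left)
  also have "\<dots> = ((1/2) *\<^sub>R (r * a + r)) * (a - 1)"
    unfolding r(3) using ra by (simp add: algebra_simps)
  finally have "(1 - r) - (1/2) *\<^sub>R 1 = ((1/2) *\<^sub>R (r * a + r)) * (a - 1)" .
  moreover have "1 - r = a * r * a" unfolding r(3) using ra by (simp add: mult.assoc)
  moreover have "cpos (1 - (1 - r))" using r(1) by simp
  ultimately show thesis using that[of "1 - r" r] r(2) nr nu by blast
qed

lemma half_power_sum: "(\<Sum>k<n. 2 ^ k * (1 / 4 ^ k)) \<le> (2::real)"
proof -
  have "(4::real) ^ k = 2 ^ k * 2 ^ k" for k by (simp flip: power_mult_distrib)
  then have "(\<Sum>k<n. 2 ^ k * (1 / 4 ^ k)) = (\<Sum>k<n. (1/2::real) ^ k)"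
    by (simp add: power_divide)
  also have "\<dots> \<le> 2" by (simp add: geometric_sum)
  finally show ?thesis .
qed

theorem commutant_cyclic:
  fixes \<pi> :: "'a::cstar_algebra \<Rightarrow> 'h::complex_hilbert operator"
  assumes rep: "star_representation \<pi>" and cyc: "closure (range (\<lambda>a. capply (\<pi> a) \<Omega>)) = UNIV"
    and \<omega>: "\<And>a. capply \<omega> a = cinner (capply (\<pi> a) \<Omega>) \<Omega>" and \<omega>1: "capply \<omega> 1 = 1"
    and supp: "is_support \<omega> s" and central: "s \<in> bidual_centre"
  shows "closure ((\<lambda>B. capply B \<Omega>) ` commutant (range \<pi>)) = UNIV"
proof (rule ccontr)
  interpret star_rep \<pi> by (rule star_rep.intro) fact
  let ?R = "commutant (range \<pi>)"
  assume not_dense: "closure ((\<lambda>B. capply B \<Omega>) ` ?R) \<noteq> UNIV"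
  have R: "operator_star_algebra ?R" by (rule operator_star_algebra_commutant_range)
  obtain x where x: "x \<notin> closure ((\<lambda>B. capply B \<Omega>) ` ?R)" using not_dense by blast
  obtain E where E: "E \<in> commutant ?R" "cadj E = E" "capply E \<Omega> = \<Omega>"
    "\<And>x. capply E x \<in> closure ((\<lambda>B. capply B \<Omega>) ` ?R)"
    "\<And>x. (\<And>B. B \<in> ?R \<Longrightarrow> cinner (capply B \<Omega>) x = 0) \<Longrightarrow> capply E x = 0"
    using cyclic_projection[OF R, of \<Omega>] by blast
  define \<xi> where "\<xi> = x - capply E x"
  have \<xi>0: "\<xi> \<noteq> 0" using x E(4)[of x] by (auto simp: \<xi>_def)
  have EB: "capply E (capply B \<Omega>) = capply B \<Omega>" if "B \<in> ?R" for B
    using commutantD[OF E(1) that, of \<Omega>] by (simp add: E(3))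
  have "capply E \<xi> = 0"
  proof (rule E(5))
    fix B assume B: "B \<in> ?R"
    have "cinner (capply B \<Omega>) (capply E x) = cinner (capply B \<Omega>) x"
      using cinner_cadj[of E "capply B \<Omega>" x] by (simp add: E(2) EB[OF B])
    then show "cinner (capply B \<Omega>) \<xi> = 0" by (simp add: \<xi>_def cinner_diff_right)
  qed
  \<comment> \<open>The complementary projection lies in the double commutant of
    \<open>range \<pi>\<close>, kills \<Omega> and fixes \<xi>; it is the target of the selfadjoint
    approximation.\<close>
  define T where "T = cid + (- 1) *\<^sub>C E"
  have T_app: "capply T z = z - capply E z" for z
    by (simp add: T_def capply_minus_left scaleC_minus_left)
  have T: "T \<in> commutant ?R" unfolding T_def by (intro commutant_add commutant_scaleC commutant_cid E)
  have T_sa: "cadj T = T" by (simp add: T_def cadj_add cadj_scaleC E)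
  have T\<Omega>: "capply T \<Omega> = 0" and T\<xi>: "capply T \<xi> = \<xi>"
    by (simp_all add: T_app E(3) \<open>capply E \<xi> = 0\<close>)
  have ex: "\<exists>h. cpos h \<and> cpos (1 - h) \<and> Re (capply \<omega> h) \<le> 1 / 4 ^ k \<and>
      norm (capply (\<pi> h) \<xi> - (1/2) *\<^sub>R \<xi>) \<le> 1 / 4 ^ k" for k :: nat
  proof -
    let ?e = "1 / 4 ^ k :: real"
    obtain A where A: "A \<in> range \<pi>" "cadj A = A" "norm (capply A \<Omega> - capply T \<Omega>) < ?e"
      "norm (capply A \<xi> - capply T \<xi>) < ?e"
      using selfadjoint_density[OF operator_star_algebra_range T T_sa, of ?e \<Omega> \<xi>] by auto
    then obtain a' where a': "A = \<pi> a'" by blast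
    define a where "a = (1/2) *\<^sub>R (a' + star a')"
    have sa: "star a = a" by (simp add: a_def star_simps add.commute)
    have "\<pi> a = (1/2) *\<^sub>R (A + A)" using A(2) by (simp add: a_def rep_scaleR rep_add rep_star a')
    then have \<pi>a: "\<pi> a = A" by simp
    obtain h r u where h: "cpos h" "cpos (1 - h)" "h = a * r * a" "norm r \<le> 1"
      "h - (1/2) *\<^sub>R 1 = u * (a - 1)" "norm u \<le> 1" using positive_contraction[OF sa] .
    have "capply \<omega> h = cinner (capply (\<pi> r) (capply (\<pi> a) \<Omega>)) (capply (\<pi> a) \<Omega>)"
      by (simp add: \<omega> h(3) mult.assoc rep_mult rep_cinner[of a] sa)
    also have "Re \<dots> \<le> norm (capply (\<pi> r) (capply (\<pi> a) \<Omega>)) * norm (capply (\<pi> a) \<Omega>)"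
      using cinner_norm_le complex_Re_le_cmod order_trans by blast
    also have "\<dots> \<le> norm (capply (\<pi> a) \<Omega>) * norm (capply (\<pi> a) \<Omega>)"
      by (intro mult_right_mono rep_contraction h) simp
    also have "\<dots> \<le> ?e * 1"
    proof (intro mult_mono)
      show "norm (capply (\<pi> a) \<Omega>) \<le> ?e" using A(3) by (simp add: \<pi>a T\<Omega>)
      then show "norm (capply (\<pi> a) \<Omega>) \<le> 1"
        by (rule order_trans) (simp add: field_simps)
    qed auto
    finally have 1: "Re (capply \<omega> h) \<le> ?e" by simp
    have "capply (\<pi> h) \<xi> - (1/2) *\<^sub>R \<xi> = capply (\<pi> (h - (1/2) *\<^sub>R 1)) \<xi>"
      by (simp add: rep_diff rep_scaleR rep_one capply_minus_left capply_scaleR_left)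
    also have "\<dots> = capply (\<pi> u) (capply (\<pi> a) \<xi> - \<xi>)"
      unfolding h(5) by (simp add: rep_mult rep_diff rep_one capply_minus_left)
    also have "norm \<dots> \<le> norm (capply (\<pi> a) \<xi> - \<xi>)" by (rule rep_contraction[OF h(6)])
    finally have "norm (capply (\<pi> h) \<xi> - (1/2) *\<^sub>R \<xi>) \<le> ?e"
      using A(4) by (simp add: \<pi>a T\<xi>)
    then show ?thesis using h(1,2) 1 by blast
  qed
  obtain h :: "nat \<Rightarrow> 'a" where h: "\<And>k. cpos (h k)" "\<And>k. cpos (1 - h k)" "\<And>k. Re (capply \<omega> (h k)) \<le> 1 / 4 ^ k"
    "\<And>k. norm (capply (\<pi> (h k)) \<xi> - (1/2) *\<^sub>R \<xi>) \<le> 1 / 4 ^ k"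
    using ex by metis
  \<comment> \<open>The weights 2^k grow, yet the values of \<open>\<omega>\<close> at
    \<open>b n\<close> stay below 2 because of the bounds 1/4^k, while each \<open>h k\<close> keeps
    about half of \<xi>.\<close>
  define b where "b n = (\<Sum>k<n. 2 ^ k *\<^sub>R h k)" for n
  have b_pos: "cpos (b n)" for n unfolding b_def by (intro cpos_sum cpos_scaleR h) simp
  have b_inc: "cpos (b (Suc n) - b n)" for n unfolding b_def by (simp add: cpos_scaleR h)
  define g where "g n m = one_plus_inv ((1 / real (Suc m)) *\<^sub>R b n)" for n m
  interpret g: resolvent_family g
    unfolding g_def by (rule resolvent_family_of_increasing[of b]) (rule b_pos b_inc)+
  let ?q = "g.limit_projection"
  have c_pos: "cpos ((1 / real (Suc m)) *\<^sub>R b n)" for n m by (intro cpos_scaleR b_pos) simp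
  have \<omega>_pos: "0 \<le> Re (capply \<omega> a) \<and> Im (capply \<omega> a) = 0" if "cpos a" for a
    using rep_pos[OF that, of \<Omega>] unfolding \<omega> by (metis Im_complex_of_real)
  have \<omega>_b: "Re (capply \<omega> (b n)) \<le> 2" for n
  proof -
    have "Re (capply \<omega> (b n)) = (\<Sum>k<n. 2 ^ k * Re (capply \<omega> (h k)))"
      by (simp add: b_def capply_sum capply_scaleR)
    also have "\<dots> \<le> (\<Sum>k<n. 2 ^ k * (1 / 4 ^ k))" by (intro sum_mono mult_left_mono h) simp
    also have "\<dots> \<le> 2" by (rule half_power_sum)
    finally show ?thesis .
  qed
  \<comment> \<open>The lower bound is 1 - 1/(1 + c) \<le> c for the positive element
    \<open>c\<close> given by \<open>b n\<close> divided by \<open>Suc m\<close>.\<close>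
  have \<omega>_g: "1 - 2 / real (Suc m) \<le> Re (capply \<omega> (g n m))" "Re (capply \<omega> (g n m)) \<le> 1"
    "Im (capply \<omega> (g n m)) = 0" for n m
  proof -
    let ?c = "(1 / real (Suc m)) *\<^sub>R b n"
    have "1 - g n m = ?c * g n m" unfolding g_def by (rule one_minus_one_plus_inv[OF c_pos])
    then have "?c - (1 - g n m) = ?c - ?c * g n m" by (rule arg_cong)
    also have "\<dots> = ?c * (1 - g n m)" by (simp only: right_diff_distrib mult_1_right)
    finally have eq: "?c - (1 - g n m) = ?c * (1 - g n m)" .
    have comm: "g n m * ?c = ?c * g n m" unfolding g_def by (rule one_plus_inv_commute[OF c_pos refl])
    have "cpos (?c * (1 - g n m))"
      by (intro cpos_mult_commute c_pos g.le_one)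
        (simp only: right_diff_distrib left_diff_distrib comm mult_1_left mult_1_right)
    then have "0 \<le> Re (capply \<omega> (?c - (1 - g n m)))" unfolding eq using \<omega>_pos by blast
    then have "1 - Re (capply \<omega> (b n)) / real (Suc m) \<le> Re (capply \<omega> (g n m))"
      by (simp add: capply_diff capply_scaleR \<omega>1)
    moreover have "Re (capply \<omega> (b n)) / real (Suc m) \<le> 2 / real (Suc m)"
      by (intro divide_right_mono \<omega>_b) simp
    ultimately show "1 - 2 / real (Suc m) \<le> Re (capply \<omega> (g n m))" by linarith
    have "0 \<le> Re (capply \<omega> (1 - g n m))" using \<omega>_pos g.le_one by blast
    then show "Re (capply \<omega> (g n m)) \<le> 1" by (simp add: capply_diff \<omega>1)
    show "Im (capply \<omega> (g n m)) = 0" using \<omega>_pos g.pos by blast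
  qed
  have lim_in: "(\<lambda>n. capply f (g n m)) \<longlonglongrightarrow> capply (g.inner_limit f m) 1" for f m
    using g.inner_limit_apply[of f 1 m] by simp
  have q\<omega>: "capply ?q \<omega> = 1"
  proof (rule LIMSEQ_unique[OF g.limit_projection_tendsto])
    have "norm (capply (g.inner_limit \<omega> m) 1 - 1) \<le> 2 / real (Suc m)" for m
    proof (rule LIMSEQ_le_const2[OF tendsto_norm[OF tendsto_diff[OF lim_in tendsto_const]]])
      have "cmod (capply \<omega> (g n m) - 1) \<le> 2 / real (Suc m)" for n
      proof -
        have "capply \<omega> (g n m) - 1 = of_real (Re (capply \<omega> (g n m)) - 1)"
          using \<omega>_g(3)[of n m] by (simp add: complex_eq_iff)
        then have "cmod (capply \<omega> (g n m) - 1) = \<bar>Re (capply \<omega> (g n m)) - 1\<bar>" by (metis norm_of_real)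
        then show ?thesis using \<omega>_g(1)[of m n] \<omega>_g(2)[of n m] by linarith
      qed
      then show "\<exists>N. \<forall>n\<ge>N. cmod (capply \<omega> (g n m) - 1) \<le> 2 / real (Suc m)" by blast
    qed
    then have "\<forall>\<^sub>F m in sequentially. norm (capply (g.inner_limit \<omega> m) 1 - 1) \<le> 2 / real (Suc m)" by simp
    moreover have "(\<lambda>m. 2 / real (Suc m)) \<longlonglongrightarrow> 0" using LIMSEQ_Suc[OF lim_const_over_n[of 2]] .
    ultimately have "(\<lambda>m. capply (g.inner_limit \<omega> m) 1 - 1) \<longlonglongrightarrow> 0" by (rule Lim_null_comparison)
    then show "(\<lambda>m. capply (g.inner_limit \<omega> m) 1) \<longlonglongrightarrow> 1" by (rule LIM_zero_cancel)
  qed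
  \<comment> \<open>The vector \<open>\<zeta>\<close>, the resolvent applied to \<eta>, has bounded
    energy for \<open>b (Suc n)\<close>, in which \<open>h n\<close> carries the weight 2^n; so
    \<open>h n\<close> nearly annihilates it. As \<xi> is close to twice
    \<open>capply (\<pi> (h n)) \<xi>\<close>, its inner product with \<open>\<zeta>\<close> is
    small.\<close>
  have inner0: "(\<lambda>n. capply (vec_functional \<xi> \<eta>) (g (Suc n) m)) \<longlonglongrightarrow> 0" for \<eta> m
  proof (rule Lim_null_comparison)
    let ?C = "sqrt (real (Suc m) * (norm \<eta>)\<^sup>2)"
    have bound: "norm (capply (vec_functional \<xi> \<eta>) (g (Suc n) m))
        \<le> 2 * norm \<xi> * (?C * sqrt ((1/2) ^ n)) + 2 * norm \<eta> * (1/4) ^ n" for n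
    proof -
      define \<zeta> where "\<zeta> = capply (\<pi> (g (Suc n) m)) \<eta>"
      let ?c = "(1 / real (Suc m)) *\<^sub>R b (Suc n)"
      have n\<zeta>: "norm \<zeta> \<le> norm \<eta>" unfolding \<zeta>_def by (rule rep_contraction[OF g.norm_le_one])
      have eta: "\<zeta> + capply (\<pi> ?c) \<zeta> = \<eta>"
      proof -
        have "capply (\<pi> ((1 + ?c) * g (Suc n) m)) \<eta> = \<eta>"
          unfolding g_def one_plus_inv_right[OF c_pos] by (simp add: rep_one)
        then show ?thesis by (simp only: rep_mult rep_add rep_one capply_compose capply_plus capply_cid \<zeta>_def)
      qed
      have "Re (cinner (capply (\<pi> ?c) \<zeta>) \<zeta>) \<le> (norm \<eta>)\<^sup>2"
      proof -
        have "Re (cinner (capply (\<pi> ?c) \<zeta>) \<zeta>) \<le> Re (cinner (\<zeta> + capply (\<pi> ?c) \<zeta>) \<zeta>)"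
          by (simp only: cinner_add_left cinner_self plus_complex.sel Re_complex_of_real) simp
        also have "\<dots> \<le> norm \<eta> * norm \<zeta>" unfolding eta
          using cinner_norm_le complex_Re_le_cmod order_trans by blast
        also have "\<dots> \<le> norm \<eta> * norm \<eta>" by (intro mult_left_mono n\<zeta>) simp
        finally show ?thesis by (simp add: power2_eq_square)
      qed
      then have b_le: "Re (cinner (capply (\<pi> (b (Suc n))) \<zeta>) \<zeta>) \<le> real (Suc m) * (norm \<eta>)\<^sup>2"
        by (simp add: rep_scaleR capply_scaleR_left cinner_scaleR_left field_simps)
      have "b (Suc n) - 2 ^ n *\<^sub>R h n = b n" by (simp add: b_def)
      then have "0 \<le> Re (cinner (capply (\<pi> (b (Suc n) - 2 ^ n *\<^sub>R h n)) \<zeta>) \<zeta>)"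
        using rep_pos[OF b_pos[of n], of \<zeta>] by simp
      then have "2 ^ n * Re (cinner (capply (\<pi> (h n)) \<zeta>) \<zeta>) \<le> real (Suc m) * (norm \<eta>)\<^sup>2"
        using b_le by (simp add: rep_diff rep_scaleR capply_minus_left capply_scaleR_left cinner_simps)
      then have 1: "Re (cinner (capply (\<pi> (h n)) \<zeta>) \<zeta>) \<le> real (Suc m) * (norm \<eta>)\<^sup>2 * (1/2) ^ n"
        by (simp add: power_divide field_simps)
      \<comment> \<open>\<open>h n\<close> dominates its square, which turns the bound on the form
        into a bound on the norm.\<close>
      have "cpos (h n * (1 - h n))" by (intro cpos_mult_commute h) (simp add: algebra_simps)
      then have "0 \<le> Re (cinner (capply (\<pi> (h n * (1 - h n))) \<zeta>) \<zeta>)" using rep_pos by blast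
      also have "cinner (capply (\<pi> (h n * (1 - h n))) \<zeta>) \<zeta>
          = cinner (capply (\<pi> (h n)) \<zeta>) \<zeta> - cinner (capply (\<pi> (h n)) \<zeta>) (capply (\<pi> (h n)) \<zeta>)"
        using rep_cinner[of "h n" "capply (\<pi> (h n)) \<zeta>" \<zeta>]
        by (simp add: right_diff_distrib rep_diff rep_mult capply_minus_left cinner_diff_left cpos_star[OF h(1)])
      finally have "(norm (capply (\<pi> (h n)) \<zeta>))\<^sup>2 \<le> real (Suc m) * (norm \<eta>)\<^sup>2 * (1/2) ^ n"
        using 1 by (simp add: cinner_self)
      then have "norm (capply (\<pi> (h n)) \<zeta>) \<le> sqrt (real (Suc m) * (norm \<eta>)\<^sup>2 * (1/2) ^ n)"
        by (rule real_le_rsqrt)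
      then have h\<zeta>: "norm (capply (\<pi> (h n)) \<zeta>) \<le> ?C * sqrt ((1/2) ^ n)" by (simp only: real_sqrt_mult)
      have "capply (vec_functional \<xi> \<eta>) (g (Suc n) m) = cinner \<xi> \<zeta>"
        by (simp add: vec_functional_apply rep_cinner[of _ \<xi>] cpos_star[OF g.pos] \<zeta>_def)
      also have "\<xi> = 2 *\<^sub>R (capply (\<pi> (h n)) \<xi> - (capply (\<pi> (h n)) \<xi> - (1/2) *\<^sub>R \<xi>))" by simp
      also have "cinner \<dots> \<zeta> = 2 * cinner \<xi> (capply (\<pi> (h n)) \<zeta>) - 2 * cinner (capply (\<pi> (h n)) \<xi> - (1/2) *\<^sub>R \<xi>) \<zeta>"
        unfolding cinner_scaleR_left cinner_diff_left[of "capply (\<pi> (h n)) \<xi>" "_ - _"] rep_cinner[of "h n" \<xi>] cpos_star[OF h(1)]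
        by (simp add: right_diff_distrib)
      also have "cmod \<dots> \<le> 2 * cmod (cinner \<xi> (capply (\<pi> (h n)) \<zeta>)) + 2 * cmod (cinner (capply (\<pi> (h n)) \<xi> - (1/2) *\<^sub>R \<xi>) \<zeta>)"
        by (rule order_trans[OF norm_triangle_ineq4]) (simp add: norm_mult)
      also have "\<dots> \<le> 2 * (norm \<xi> * (?C * sqrt ((1/2) ^ n))) + 2 * ((1 / 4 ^ n) * norm \<eta>)"
      proof (intro add_mono mult_left_mono)
        show "cmod (cinner \<xi> (capply (\<pi> (h n)) \<zeta>)) \<le> norm \<xi> * (?C * sqrt ((1/2) ^ n))"
          by (rule order_trans[OF cinner_norm_le]) (intro mult_left_mono h\<zeta> norm_ge_zero)
        show "cmod (cinner (capply (\<pi> (h n)) \<xi> - (1/2) *\<^sub>R \<xi>) \<zeta>) \<le> (1 / 4 ^ n) * norm \<eta>"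
          by (rule order_trans[OF cinner_norm_le]) (intro mult_mono h n\<zeta>; simp)
      qed auto
      finally show ?thesis by (simp add: power_divide mult_ac)
    qed
    then show "\<forall>\<^sub>F n in sequentially. norm (capply (vec_functional \<xi> \<eta>) (g (Suc n) m))
        \<le> 2 * norm \<xi> * (?C * sqrt ((1/2) ^ n)) + 2 * norm \<eta> * (1/4) ^ n" by simp
    have "(\<lambda>n. 2 * norm \<xi> * (?C * sqrt ((1/2) ^ n)) + 2 * norm \<eta> * (1/4) ^ n)
        \<longlonglongrightarrow> 2 * norm \<xi> * (?C * sqrt 0) + 2 * norm \<eta> * 0"
      by (intro tendsto_intros LIMSEQ_power_zero) auto
    then show "(\<lambda>n. 2 * norm \<xi> * (?C * sqrt ((1/2) ^ n)) + 2 * norm \<eta> * (1/4) ^ n) \<longlonglongrightarrow> 0" by simp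
  qed
  have q0: "capply ?q (vec_functional \<xi> \<eta>) = 0" for \<eta>
  proof -
    have "capply (g.inner_limit (vec_functional \<xi> \<eta>) m) 1 = 0" for m
      by (rule LIMSEQ_unique[OF LIMSEQ_Suc[OF lim_in] inner0])
    then show ?thesis
      using g.limit_projection_tendsto[of "vec_functional \<xi> \<eta>"] by (simp add: LIMSEQ_const_iff)
  qed
  have "bidual_act ?q (vec_functional \<xi> \<xi>) = 0"
    by (rule cblinfun_ext) (simp add: bidual_act_apply dual_shift_vec_functional q0)
  then have "capply (arens s ?q) (vec_functional \<xi> \<xi>) = 0" by (simp add: arens_apply)
  moreover have "arens s ?q = s"
    using supp q\<omega> g.bidual_projection_limit_projection unfolding is_support_def by blast
  moreover have "capply s (vec_functional \<xi> \<xi>) = cinner \<xi> \<xi>"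
  proof (rule support_vec_functional[OF rep cyc])
    show "\<omega> = vec_functional \<Omega> \<Omega>" by (rule cblinfun_ext) (simp add: \<omega> vec_functional_apply)
  qed (use supp central \<omega>1 in \<open>auto simp: is_support_def\<close>)
  ultimately show False using \<xi>0 by simp
qed

section \<open>Ergodic averages\<close>

text \<open>\<open>avg z 0\<close> is \<open>0\<close>, so the bound in \<open>norm_avg_le\<close>
  holds for every \<open>N\<close>.\<close>

definition avg :: "(nat \<Rightarrow> 'a::real_vector) \<Rightarrow> nat \<Rightarrow> 'a"
  where "avg z N = (1 / real N) *\<^sub>R (\<Sum>n<N. z n)"

lemma norm_avg_le:
  fixes z :: "nat \<Rightarrow> 'a::real_normed_vector"
  assumes "\<And>n. norm (z n) \<le> B" "B \<ge> 0" shows "norm (avg z N) \<le> B"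
proof -
  have "norm (\<Sum>n<N. z n) \<le> real N * B"
    using sum_norm_bound[of "{..<N}" z B] assms(1) by simp
  then show ?thesis using assms(2) by (cases "N = 0") (auto simp: avg_def field_simps)
qed

lemma avg_diff: "avg (\<lambda>n. f n - g n) N = avg f N - avg g N"
  by (simp add: avg_def sum_subtractf scaleR_diff_right)

lemma avg_add: "avg (\<lambda>n. f n + g n) N = avg f N + avg g N"
  by (simp add: avg_def sum.distrib scaleR_add_right)

lemma avg_capply: "avg (\<lambda>n. capply T (f n)) N = capply T (avg f N)"
  by (simp add: avg_def capply_sum capply_scaleR)

lemma avg_scaleC: "avg (\<lambda>n. c *\<^sub>C f n) N = c *\<^sub>C avg f N"
  by (simp add: avg_def scaleC_sum_right scaleC_scaleR_commute)

lemma cinner_avg_left: "cinner (avg f N) y = avg (\<lambda>n. cinner (f n) y) N"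
  by (simp add: avg_def cinner_scaleR_left cinner_sum_left scaleR_conv_of_real)

lemma cinner_avg_avg:
  "cinner (avg f H) (avg f H) = (1 / (real H)\<^sup>2) *\<^sub>R (\<Sum>h<H. \<Sum>h'<H. cinner (f h) (f h'))"
proof -
  have "cinner (\<Sum>h<H. f h) (\<Sum>h'<H. f h') = (\<Sum>h<H. cinner (f h) (\<Sum>h'<H. f h'))"
    by (rule cinner_sum_left)
  also have "\<dots> = (\<Sum>h<H. \<Sum>h'<H. cinner (f h) (f h'))" unfolding cinner_sum_right ..
  finally show ?thesis
    unfolding avg_def cinner_scaleR_left cinner_scaleR_right
    by (simp add: scaleR_conv_of_real power2_eq_square)
qed

text \<open>Each unit shift exchanges one term at either end of the sum.\<close>

lemma norm_sum_shift_le: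
  fixes z :: "nat \<Rightarrow> 'a::real_normed_vector"
  assumes "\<And>n. norm (z n) \<le> B"
  shows "norm ((\<Sum>n<N. z n) - (\<Sum>n<N. z (n + j))) \<le> 2 * real j * B"
proof (induction j)
  case (Suc j)
  have "(\<Sum>n<N. z (Suc n + j) - z (n + j)) = z (N + j) - z (0 + j)"
    by (rule sum_lessThan_telescope)
  then have eq: "(\<Sum>n<N. z n) - (\<Sum>n<N. z (n + Suc j))
      = ((\<Sum>n<N. z n) - (\<Sum>n<N. z (n + j))) - (z (N + j) - z j)"
    by (simp add: sum_subtractf algebra_simps)
  have "norm ((\<Sum>n<N. z n) - (\<Sum>n<N. z (n + Suc j)))
      \<le> norm ((\<Sum>n<N. z n) - (\<Sum>n<N. z (n + j))) + (norm (z (N + j)) + norm (z j))"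
    unfolding eq
    using norm_triangle_ineq4[of "(\<Sum>n<N. z n) - (\<Sum>n<N. z (n + j))" "z (N + j) - z j"]
      norm_triangle_ineq4[of "z (N + j)" "z j"] by linarith
  then show ?case using Suc assms[of "N + j"] assms[of j] by (simp add: algebra_simps)
qed simp

lemma norm_avg_shift_le:
  fixes z :: "nat \<Rightarrow> 'a::real_normed_vector"
  assumes "\<And>n. norm (z n) \<le> B" "N > 0"
  shows "norm (avg z N - avg (\<lambda>n. z (n + j)) N) \<le> 2 * real j * B / real N"
  using divide_right_mono[OF norm_sum_shift_le[of z B N j], of "real N"] assms
  by (simp add: avg_def flip: scaleR_diff_right)

lemma avg_shift_tendsto:
  fixes z :: "nat \<Rightarrow> 'a::real_normed_vector"
  assumes "\<And>n. norm (z n) \<le> B"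
  shows "(\<lambda>N. avg z N - avg (\<lambda>n. z (n + j)) N) \<longlonglongrightarrow> 0"
proof (rule Lim_null_comparison)
  show "\<forall>\<^sub>F N in sequentially. norm (avg z N - avg (\<lambda>n. z (n + j)) N) \<le> 2 * real j * B / real N"
    using eventually_gt_at_top[of "0::nat"] by eventually_elim (rule norm_avg_shift_le[of z B], auto simp: assms)
  show "(\<lambda>N. 2 * real j * B / real N) \<longlonglongrightarrow> 0" by (rule lim_const_over_n)
qed

text \<open>The norms of the averages decrease to the minimal norm of the closed convex hull, and the
  parallelogram law makes minimizing sequences of convex combinations Cauchy.\<close>

lemma stationary_avg_convergent:
  fixes z :: "nat \<Rightarrow> 'h::complex_hilbert"
  assumes stat: "\<And>m n. cinner (z (Suc m)) (z (Suc n)) = cinner (z m) (z n)"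
  shows "convergent (avg z)"
proof -
  define B where "B = norm (z 0)"
  have shift: "cinner (z (m + k)) (z (n + k)) = cinner (z m) (z n)" for m n k
    by (induction k) (auto simp: stat)
  have nz: "norm (z n) \<le> B" for n
  proof -
    have "complex_of_real ((norm (z n))\<^sup>2) = of_real (B\<^sup>2)"
      using shift[of 0 n 0] by (simp add: cinner_self B_def del: of_real_power)
    then have "(norm (z n))\<^sup>2 = B\<^sup>2" by (simp only: of_real_eq_iff)
    then show ?thesis by (simp add: B_def power2_eq_iff_nonneg)
  qed
  have norm_shift: "norm (\<Sum>j<J. c j *\<^sub>R z (j + n)) = norm (\<Sum>j<J. c j *\<^sub>R z j)" for c :: "nat \<Rightarrow> real" and J n
  proof -
    have "cinner (\<Sum>j<J. c j *\<^sub>R z (j + n)) (\<Sum>j<J. c j *\<^sub>R z (j + n))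
        = cinner (\<Sum>j<J. c j *\<^sub>R z j) (\<Sum>j<J. c j *\<^sub>R z j)"
      by (simp add: cinner_sum_left cinner_sum_right cinner_scaleR_left cinner_scaleR_right shift)
    then have "(norm (\<Sum>j<J. c j *\<^sub>R z (j + n)))\<^sup>2 = (norm (\<Sum>j<J. c j *\<^sub>R z j))\<^sup>2"
      unfolding cinner_self by (simp only: of_real_eq_iff)
    then show ?thesis by (simp add: power2_eq_iff_nonneg)
  qed
  \<comment> \<open>Shifting a convex combination preserves its norm by stationarity, and averaging
    the shifts reproduces \<open>avg z N\<close> up to boundary terms.\<close>
  have convex_bound: "norm (avg z N) \<le> norm (\<Sum>j<J. c j *\<^sub>R z j) + 2 * real J * B / real N"
    if c: "\<And>j. c j \<ge> 0" "(\<Sum>j<J. c j) = 1" and N: "N > 0" for c J N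
  proof -
    let ?Y = "\<lambda>n. \<Sum>j<J. c j *\<^sub>R z (j + n)"
    have B0: "B \<ge> 0" by (simp add: B_def)
    have "avg ?Y N = (\<Sum>j<J. c j *\<^sub>R avg (\<lambda>n. z (n + j)) N)"
      by (simp add: avg_def scaleR_sum_right sum.swap[of _ "{..<J}"] add.commute mult.commute)
    then have "avg z N - avg ?Y N = (\<Sum>j<J. c j *\<^sub>R (avg z N - avg (\<lambda>n. z (n + j)) N))"
      using c(2) by (simp add: scaleR_diff_right sum_subtractf flip: scaleR_sum_left)
    also have "norm \<dots> \<le> (\<Sum>j<J. c j * (2 * real J * B / real N))"
    proof (rule sum_norm_le)
      fix j assume "j \<in> {..<J}"
      then have "2 * real j * B / real N \<le> 2 * real J * B / real N"
        using B0 by (intro divide_right_mono mult_right_mono) auto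
      then have "norm (avg z N - avg (\<lambda>n. z (n + j)) N) \<le> 2 * real J * B / real N"
        using norm_avg_shift_le[of z B N j, OF nz N] by linarith
      then show "norm (c j *\<^sub>R (avg z N - avg (\<lambda>n. z (n + j)) N)) \<le> c j * (2 * real J * B / real N)"
        unfolding norm_scaleR abs_of_nonneg[OF c(1)] by (rule mult_left_mono[OF _ c(1)])
    qed
    also have "\<dots> = 2 * real J * B / real N" unfolding sum_distrib_right[symmetric] c(2) by simp
    finally have "norm (avg z N - avg ?Y N) \<le> 2 * real J * B / real N" .
    moreover have "norm (avg ?Y N) \<le> norm (\<Sum>j<J. c j *\<^sub>R z j)"
      by (rule norm_avg_le) (simp_all add: norm_shift)
    ultimately show ?thesis using norm_triangle_ineq[of "avg z N - avg ?Y N" "avg ?Y N"] by simp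
  qed
  define d where "d = (INF N\<in>{1..}. norm (avg z N))"
  have bdd: "bdd_below ((\<lambda>N. norm (avg z N)) ` {1..})" by (rule bdd_belowI[of _ 0]) auto
  have d_le: "d \<le> norm (avg z N)" if "N > 0" for N
    unfolding d_def using bdd that by (intro cINF_lower) auto
  have d0: "d \<ge> 0" unfolding d_def by (rule cINF_greatest) auto
  \<comment> \<open>Letting \<open>N\<close> grow in \<open>convex_bound\<close>, the infimum over
    the averages becomes a lower bound on the whole convex hull.\<close>
  have d_convex: "d \<le> norm (\<Sum>j<J. c j *\<^sub>R z j)" if c: "\<And>j. c j \<ge> 0" "(\<Sum>j<J. c j) = 1" for c J
  proof (rule LIMSEQ_le_const)
    have "(\<lambda>N. norm (\<Sum>j<J. c j *\<^sub>R z j) + 2 * real J * B / real N) \<longlonglongrightarrow> norm (\<Sum>j<J. c j *\<^sub>R z j) + 0"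
      by (intro tendsto_intros lim_const_over_n)
    then show "(\<lambda>N. norm (\<Sum>j<J. c j *\<^sub>R z j) + 2 * real J * B / real N) \<longlonglongrightarrow> norm (\<Sum>j<J. c j *\<^sub>R z j)" by simp
    show "\<exists>N. \<forall>n\<ge>N. d \<le> norm (\<Sum>j<J. c j *\<^sub>R z j) + 2 * real J * B / real n"
    proof (intro exI[of _ 1] allI impI)
      fix n :: nat assume "1 \<le> n"
      then show "d \<le> norm (\<Sum>j<J. c j *\<^sub>R z j) + 2 * real J * B / real n"
        using d_le[of n] convex_bound[OF c, of n] by simp
    qed
  qed
  \<comment> \<open>The weights of \<open>avg z N\<close>, padded by zeros so that two averages
    become combinations over one range.\<close>
  let ?c = "\<lambda>N j. if j < N then 1 / real N else 0 :: real"
  have avg_c: "avg z N = (\<Sum>j<J. ?c N j *\<^sub>R z j)" "N > 0 \<Longrightarrow> (\<Sum>j<J. ?c N j) = 1" if "N \<le> J" for N J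
  proof -
    have "{..<J} \<inter> {j. j < N} = {..<N}" using that by auto
    then have 1: "(\<Sum>j<J. if j < N then f j else 0) = (\<Sum>j<N. f j)" for f :: "nat \<Rightarrow> 'b::comm_monoid_add"
      by (simp add: sum.If_cases)
    have "(\<Sum>j<J. ?c N j *\<^sub>R z j) = (\<Sum>j<J. if j < N then (1 / real N) *\<^sub>R z j else 0)"
      by (intro sum.cong) auto
    then show "avg z N = (\<Sum>j<J. ?c N j *\<^sub>R z j)" unfolding 1 by (simp add: avg_def scaleR_sum_right)
    show "(\<Sum>j<J. ?c N j) = 1" if "N > 0" unfolding 1 using that by simp
  qed
  have mid: "2 * d \<le> norm (avg z N + avg z M)" if "N > 0" "M > 0" for N M
  proof -
    let ?J = "max N M"
    let ?e = "\<lambda>j. (1/2) * (?c N j + ?c M j)"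
    have "(\<Sum>j<?J. ?e j) = (1/2) * ((\<Sum>j<?J. ?c N j) + (\<Sum>j<?J. ?c M j))"
      unfolding sum_distrib_left[symmetric] sum.distrib ..
    then have "(\<Sum>j<?J. ?e j) = 1"
      using avg_c(2)[of N ?J] avg_c(2)[of M ?J] that by simp
    then have "d \<le> norm (\<Sum>j<?J. ?e j *\<^sub>R z j)"
      by (intro d_convex) auto
    also have "(\<Sum>j<?J. ?e j *\<^sub>R z j) = (1/2) *\<^sub>R (avg z N + avg z M)"
      using avg_c(1)[of N ?J] avg_c(1)[of M ?J]
      by (simp add: scaleR_add_left scaleR_sum_right sum.distrib scaleR_add_right distrib_left)
    finally show ?thesis by simp
  qed
  have a_lim: "(\<lambda>N. norm (avg z N)) \<longlonglongrightarrow> d"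
  proof (rule order_tendstoI)
    fix a assume "a < d"
    then show "\<forall>\<^sub>F N in sequentially. a < norm (avg z N)"
      by (intro eventually_mono[OF eventually_gt_at_top[of "0::nat"]]) (erule less_le_trans[OF _ d_le])
  next
    fix a assume "d < a"
    then obtain K where K: "K > 0" "norm (avg z K) < a"
      using cINF_less_iff[OF _ bdd, of a] unfolding d_def by (auto simp: Suc_le_eq)
    have "(\<lambda>N. norm (avg z K) + 2 * real K * B / real N) \<longlonglongrightarrow> norm (avg z K) + 0"
      by (intro tendsto_intros lim_const_over_n)
    then have "\<forall>\<^sub>F N in sequentially. norm (avg z K) + 2 * real K * B / real N < a"
      using order_tendstoD(2) K(2) by fastforce
    then show "\<forall>\<^sub>F N in sequentially. norm (avg z N) < a"
      using eventually_gt_at_top[of "0::nat"]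
    proof eventually_elim
      case (elim N)
      have "norm (avg z N) \<le> norm (avg z K) + 2 * real K * B / real N"
        using convex_bound[of "?c K" K N] avg_c[of K K] K(1) elim(2) by simp
      then show ?case using elim(1) by linarith
    qed
  qed
  have "Cauchy (avg z)"
  proof (rule metric_CauchyI)
    fix e :: real assume e: "e > 0"
    have "(\<lambda>N. 4 * ((norm (avg z N))\<^sup>2 - d\<^sup>2)) \<longlonglongrightarrow> 4 * (d\<^sup>2 - d\<^sup>2)"
      by (intro tendsto_intros a_lim)
    then have "\<forall>\<^sub>F N in sequentially. 4 * ((norm (avg z N))\<^sup>2 - d\<^sup>2) < e\<^sup>2"
      using order_tendstoD(2)[of _ "4 * (d\<^sup>2 - d\<^sup>2)" _ "e\<^sup>2"] e by simp
    then have "\<forall>\<^sub>F N in sequentially. N > 0 \<and> 4 * ((norm (avg z N))\<^sup>2 - d\<^sup>2) < e\<^sup>2"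
      using eventually_gt_at_top[of "0::nat"] by eventually_elim simp
    then obtain N0 where N0: "\<And>N. N \<ge> N0 \<Longrightarrow> N > 0 \<and> 4 * ((norm (avg z N))\<^sup>2 - d\<^sup>2) < e\<^sup>2"
      by (auto simp: eventually_sequentially)
    have "dist (avg z m) (avg z n) < e" if "m \<ge> N0" "n \<ge> N0" for m n
    proof -
      have "(2 * d)\<^sup>2 \<le> (norm (avg z m + avg z n))\<^sup>2"
        using mid[of m n] N0 that d0 by (intro power_mono) auto
      then have "(norm (avg z m - avg z n))\<^sup>2 < e\<^sup>2"
        using parallelogram[of "avg z m" "avg z n"] N0[OF that(1)] N0[OF that(2)]
        by (simp add: power_mult_distrib)
      then show ?thesis using e by (simp add: dist_norm power_less_imp_less_base)
    qed
    then show "\<exists>M. \<forall>m\<ge>M. \<forall>n\<ge>M. dist (avg z m) (avg z n) < e" by blast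
  qed
  then show ?thesis by (rule Cauchy_convergent)
qed

lemma unitary_funpow_cinner:
  "unitary_op U \<Longrightarrow> cinner ((capply U ^^ n) x) ((capply U ^^ n) y) = cinner x y"
  by (induction n) (simp_all add: unitary_cinner)

lemma unitary_funpow_norm: "unitary_op U \<Longrightarrow> norm ((capply U ^^ n) x) = norm x"
  by (induction n) (simp_all add: unitary_norm)

text \<open>The last clause says that \<open>y\<close> is the orthogonal projection of
  \<open>x\<close> onto the fixed vectors, in the form in which coefficients are later read
  off.\<close>

theorem mean_ergodic:
  assumes U: "unitary_op U"
  obtains y where "avg (\<lambda>n. (capply U ^^ n) x) \<longlonglongrightarrow> y" "capply U y = y"
    "\<And>e. capply U e = e \<Longrightarrow> cinner y e = cinner x e"
proof -
  let ?z = "\<lambda>n. (capply U ^^ n) x"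
  have "convergent (avg ?z)"
    by (rule stationary_avg_convergent) (simp add: unitary_cinner[OF U])
  then obtain y where y: "avg ?z \<longlonglongrightarrow> y" by (auto simp: convergent_def)
  have nz: "norm (?z n) \<le> norm x" for n by (simp add: unitary_funpow_norm[OF U])
  have "capply U y = y"
  proof (rule LIMSEQ_unique)
    show "(\<lambda>N. capply U (avg ?z N)) \<longlonglongrightarrow> capply U y" by (intro tendsto_intros y)
    have "(\<lambda>N. avg ?z N - (avg ?z N - avg (\<lambda>n. ?z (n + 1)) N)) \<longlonglongrightarrow> y - 0"
      by (intro tendsto_diff y avg_shift_tendsto[OF nz])
    then show "(\<lambda>N. capply U (avg ?z N)) \<longlonglongrightarrow> y"
      by (simp add: avg_capply[symmetric])
  qed
  moreover have "cinner y e = cinner x e" if e: "capply U e = e" for e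
  proof (rule LIMSEQ_unique)
    show "(\<lambda>N. cinner (avg ?z N) e) \<longlonglongrightarrow> cinner y e" by (intro tendsto_intros y)
    have en: "(capply U ^^ n) e = e" for n by (induction n) (simp_all add: e)
    have "cinner (?z n) e = cinner x e" for n
      using unitary_funpow_cinner[OF U, of n x e] by (simp add: en)
    then have "\<forall>\<^sub>F N in sequentially. cinner (avg ?z N) e = cinner x e"
      by (intro eventually_mono[OF eventually_gt_at_top[of "0::nat"]])
        (simp add: cinner_avg_left, simp add: avg_def scaleR_conv_of_real)
    then show "(\<lambda>N. cinner (avg ?z N) e) \<longlonglongrightarrow> cinner x e" by (rule tendsto_eventually)
  qed
  ultimately show thesis using that y by blast
qed

text \<open>Van der Corput's inequality, with correlations that are inner products of a second sequence:
  their mean is then a squared norm, and no absolute values are needed.\<close>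

lemma van_der_corput:
  fixes x :: "nat \<Rightarrow> 'h::complex_hilbert" and z :: "nat \<Rightarrow> 'k::complex_hilbert"
  assumes B: "\<And>n. norm (x n) \<le> B"
    and corr: "\<And>h h'. (\<lambda>N. avg (\<lambda>n. cinner (x (n + h)) (x (n + h'))) N) \<longlonglongrightarrow> cinner (z h) (z h')"
    and H: "H > 0" and e: "e > 0"
  shows "\<forall>\<^sub>F N in sequentially. (norm (avg x N))\<^sup>2 < (norm (avg z H))\<^sup>2 + e"
proof -
  \<comment> \<open>Means over windows of length \<open>H\<close>: passing from \<open>x\<close> to
    \<open>y\<close> changes the average by boundary terms only, and the mean square of
    \<open>y\<close> is made of correlations of \<open>x\<close>.\<close>
  define y where "y n = avg (\<lambda>h. x (n + h)) H" for n
  have B0: "B \<ge> 0" using B[of 0] norm_ge_zero order_trans by blast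
  \<comment> \<open>The error term is the product of \<open>2 * real H * B / real N\<close>, which
    bounds the difference of the norms of the two averages, and \<open>2 * B\<close>, which bounds
    their sum.\<close>
  define F where "F N = Re (avg (\<lambda>n. cinner (y n) (y n)) N) + 4 * real H * B\<^sup>2 / real N" for N
  have yy: "cinner (y n) (y n) = (1 / (real H)\<^sup>2) *\<^sub>R (\<Sum>h<H. \<Sum>h'<H. cinner (x (n + h)) (x (n + h')))" for n
    unfolding y_def by (rule cinner_avg_avg)
  have "(\<lambda>N. avg (\<lambda>n. cinner (y n) (y n)) N) \<longlonglongrightarrow> (1 / (real H)\<^sup>2) *\<^sub>R (\<Sum>h<H. \<Sum>h'<H. cinner (z h) (z h'))"
  proof -
    have "avg (\<lambda>n. cinner (y n) (y n)) N
        = (1 / (real H)\<^sup>2) *\<^sub>R (\<Sum>h<H. \<Sum>h'<H. avg (\<lambda>n. cinner (x (n + h)) (x (n + h'))) N)" for N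
    proof -
      have "(\<Sum>n<N. \<Sum>h<H. \<Sum>h'<H. cinner (x (n + h)) (x (n + h'))) =
        (\<Sum>h<H. \<Sum>h'<H. \<Sum>n<N. cinner (x (n + h)) (x (n + h')))"
        by (subst sum.swap) (intro sum.cong refl sum.swap)
      then show ?thesis
        by (simp add: avg_def yy scaleR_sum_right[symmetric] scaleR_left_commute del: scaleR_scaleR)
    qed
    then show ?thesis by (simp only:) (intro tendsto_intros corr)
  qed
  also have "(1 / (real H)\<^sup>2) *\<^sub>R (\<Sum>h<H. \<Sum>h'<H. cinner (z h) (z h')) = cinner (avg z H) (avg z H)"
    by (rule cinner_avg_avg[symmetric])
  finally have "F \<longlonglongrightarrow> Re (cinner (avg z H) (avg z H)) + 0"
    unfolding F_def by (intro tendsto_intros lim_const_over_n)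
  then have "\<forall>\<^sub>F N in sequentially. F N < (norm (avg z H))\<^sup>2 + e"
    using e by (intro order_tendstoD(2)[of F]) (auto simp: cinner_self)
  then show ?thesis using eventually_gt_at_top[of "0::nat"]
  proof eventually_elim
    case (elim N)
    have y_avg: "avg y N = avg (\<lambda>h. avg (\<lambda>n. x (n + h)) N) H"
      by (simp add: y_def avg_def scaleR_sum_right sum.swap[of _ "{..<N}"] mult.commute)
    have "avg x N - avg y N = avg (\<lambda>h. avg x N - avg (\<lambda>n. x (n + h)) N) H"
      using H by (simp add: y_avg avg_diff) (simp add: avg_def sum_constant_scaleR)
    then have eq: "avg x N - avg y N = (1 / real H) *\<^sub>R (\<Sum>h<H. avg x N - avg (\<lambda>n. x (n + h)) N)"
      by (simp add: avg_def)
    have S: "norm (\<Sum>h<H. avg x N - avg (\<lambda>n. x (n + h)) N) \<le> (\<Sum>h<H. 2 * real H * B / real N)"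
    proof (rule sum_norm_le)
      fix h assume "h \<in> {..<H}"
      then have "2 * real h * B / real N \<le> 2 * real H * B / real N"
        using B0 by (intro divide_right_mono mult_right_mono) auto
      then show "norm (avg x N - avg (\<lambda>n. x (n + h)) N) \<le> 2 * real H * B / real N"
        using norm_avg_shift_le[of x B N h, OF B elim(2)] by linarith
    qed
    have "norm (avg x N - avg y N) = (1 / real H) * norm (\<Sum>h<H. avg x N - avg (\<lambda>n. x (n + h)) N)"
      unfolding eq by simp
    also have "\<dots> \<le> (1 / real H) * (\<Sum>h<H. 2 * real H * B / real N)"
      by (intro mult_left_mono S) simp
    finally have "norm (avg x N - avg y N) \<le> (1 / real H) * (\<Sum>h<H. 2 * real H * B / real N)" .
    then have d: "norm (avg x N - avg y N) \<le> 2 * real H * B / real N" using H by simp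
    have nx: "norm (avg x N) \<le> B" by (rule norm_avg_le[OF B B0])
    have ny: "norm (y n) \<le> B" for n unfolding y_def by (rule norm_avg_le[OF B B0])
    have nay: "norm (avg y N) \<le> B" by (rule norm_avg_le[OF ny B0])
    have "(norm (avg x N))\<^sup>2 - (norm (avg y N))\<^sup>2 = (norm (avg x N) - norm (avg y N)) * (norm (avg x N) + norm (avg y N))"
      by (simp add: power2_eq_square algebra_simps)
    also have "\<dots> \<le> (2 * real H * B / real N) * (2 * B)"
      using d nx nay B0 norm_triangle_sub[of "avg x N" "avg y N"] by (intro mult_mono) auto
    finally have 1: "(norm (avg x N))\<^sup>2 \<le> (norm (avg y N))\<^sup>2 + 4 * real H * B\<^sup>2 / real N"
      by (simp add: power2_eq_square)
    have "(norm (\<Sum>n<N. y n))\<^sup>2 \<le> (\<Sum>n<N. norm (y n))\<^sup>2"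
      by (intro power_mono norm_sum) simp
    also have "\<dots> \<le> (\<Sum>n<N. (norm (y n))\<^sup>2) * real N"
      using sum_squared_le_sum_of_squares[of "\<lambda>n. norm (y n)" "{..<N}"] by simp
    finally have "(norm (avg y N))\<^sup>2 \<le> (1 / real N) * (\<Sum>n<N. (norm (y n))\<^sup>2)"
      using elim(2) by (simp add: avg_def power2_eq_square field_simps)
    also have "\<dots> = Re (avg (\<lambda>n. cinner (y n) (y n)) N)"
      by (simp add: avg_def cinner_self)
    finally show ?case using 1 elim(1) unfolding F_def by linarith
  qed
qed

section \<open>Eigenvectors from compactness\<close>

lemma csubspaceD:
  assumes "csubspace E"
  shows "0 \<in> E" "x \<in> E \<Longrightarrow> y \<in> E \<Longrightarrow> x + y \<in> E" "x \<in> E \<Longrightarrow> c *\<^sub>C x \<in> E"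
    "x \<in> E \<Longrightarrow> y \<in> E \<Longrightarrow> x - y \<in> E" "x \<in> E \<Longrightarrow> r *\<^sub>R x \<in> E"
proof -
  show 1: "0 \<in> E" "x \<in> E \<Longrightarrow> y \<in> E \<Longrightarrow> x + y \<in> E" "x \<in> E \<Longrightarrow> c *\<^sub>C x \<in> E" for x y c
    using assms unfolding csubspace_def by auto
  show "x \<in> E \<Longrightarrow> y \<in> E \<Longrightarrow> x - y \<in> E"
    using 1(2)[of x "- y"] 1(3)[of y "- 1"] by (simp add: scaleC_minus_left)
  show "x \<in> E \<Longrightarrow> r *\<^sub>R x \<in> E" using 1(3)[of x "complex_of_real r"] by (simp add: scaleC_of_real)
qed

lemma quadratic_nonneg_imp_linear_zero:
  fixes a b :: real
  assumes "\<And>t. 0 \<le> 2 * t * a + t\<^sup>2 * b" shows "a = 0"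
proof (rule ccontr)
  assume a: "a \<noteq> 0"
  define s where "s = \<bar>b\<bar> + 1"
  have s: "s > 0" "b \<le> s" by (simp_all add: s_def)
  have "0 \<le> 2 * (- a / s) * a + (- a / s)\<^sup>2 * b" by (rule assms)
  also have "\<dots> \<le> 2 * (- a / s) * a + (- a / s)\<^sup>2 * s" by (intro add_left_mono mult_left_mono s) simp
  also have "\<dots> = - (a\<^sup>2 / s)" using s(1) by (simp add: power2_eq_square field_simps)
  also have "\<dots> < 0" using a s(1) by simp
  finally show False by simp
qed

text \<open>Compactness yields a maximizer of the real part of
  \<open>cinner (capply U \<xi>) \<xi>\<close> on the unit sphere of \<open>E\<close>. It satisfies
  a quadratic equation in \<open>U\<close> whose roots have modulus one, so an eigenvector appears
  after at most one linear factor is applied.\<close>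

lemma eigenvector_in_compact_subspace:
  fixes U :: "'h::complex_hilbert operator"
  assumes U: "unitary_op U" and E: "csubspace E" "\<xi>1 \<in> E" "\<xi>1 \<noteq> 0"
    and inv: "\<And>x. x \<in> E \<Longrightarrow> capply U x \<in> E" "\<And>x. x \<in> E \<Longrightarrow> capply (cadj U) x \<in> E"
    and cpt: "\<And>f. (\<And>n::nat. f n \<in> E \<and> norm (f n) \<le> 1) \<Longrightarrow> \<exists>l\<in>E. \<exists>r. strict_mono r \<and> (f \<circ> r) \<longlonglongrightarrow> l"
  obtains y ev where "y \<in> E" "y \<noteq> 0" "capply U y = ev *\<^sub>C y"
proof -
  note Es = csubspaceD[OF E(1)]
  let ?S = "{\<xi>\<in>E. norm \<xi> = 1}"
  let ?f = "\<lambda>\<xi>. Re (cinner (capply U \<xi>) \<xi>)"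
  define \<mu> where "\<mu> = (SUP \<xi>\<in>?S. ?f \<xi>)"
  have f_le: "\<bar>?f \<xi>\<bar> \<le> (norm \<xi>)\<^sup>2" for \<xi>
    using abs_Re_le_cmod[of "cinner (capply U \<xi>) \<xi>"] cinner_norm_le[of "capply U \<xi>" \<xi>]
    by (simp add: unitary_norm[OF U] power2_eq_square)
  have bdd: "bdd_above (?f ` ?S)"
  proof (rule bdd_aboveI2)
    fix \<xi> assume "\<xi> \<in> ?S"
    then show "?f \<xi> \<le> 1" using f_le[of \<xi>] by auto
  qed
  have ne: "?S \<noteq> {}"
    using E(2,3) Es(5)[OF E(2), of "1 / norm \<xi>1"] by (auto intro!: exI[of _ "(1 / norm \<xi>1) *\<^sub>R \<xi>1"])
  have \<mu>_ge: "?f \<xi> \<le> \<mu>" if "\<xi> \<in> ?S" for \<xi> unfolding \<mu>_def by (rule cSUP_upper[OF that bdd])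
  have q_nonneg: "0 \<le> \<mu> * (norm \<xi>)\<^sup>2 - ?f \<xi>" if "\<xi> \<in> E" for \<xi>
  proof (cases "\<xi> = 0")
    case False
    have "?f ((1 / norm \<xi>) *\<^sub>R \<xi>) \<le> \<mu>" by (rule \<mu>_ge) (use False Es(5)[OF that] in simp)
    then show ?thesis using False
      by (simp add: capply_scaleR cinner_scaleR_left cinner_scaleR_right field_simps power2_eq_square)
  qed simp
  have "\<exists>\<xi>\<in>?S. \<mu> - 1 / real (Suc n) < ?f \<xi>" for n
    using less_cSUP_iff[OF ne bdd, of "\<mu> - 1 / real (Suc n)"] unfolding \<mu>_def by auto
  then have "\<forall>n. \<exists>\<xi>. \<xi> \<in> E \<and> norm \<xi> = 1 \<and> \<mu> - 1 / real (Suc n) < ?f \<xi>" by blast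
  then obtain g where g: "\<And>n. g n \<in> E" "\<And>n. norm (g n) = 1" "\<And>n. \<mu> - 1 / real (Suc n) < ?f (g n)"
    by metis
  obtain \<xi> r where \<xi>: "\<xi> \<in> E" "strict_mono r" "(g \<circ> r) \<longlonglongrightarrow> \<xi>"
    using cpt[of g] g(1,2) by auto
  have n\<xi>: "norm \<xi> = 1"
    using tendsto_norm[OF \<xi>(3)] by (simp add: g(2) LIMSEQ_const_iff)
  have "?f \<xi> \<ge> \<mu>"
  proof (rule LIMSEQ_le)
    have "(\<lambda>n. \<mu> - 1 / real (Suc n)) \<longlonglongrightarrow> \<mu> - 0" by (intro tendsto_intros LIMSEQ_Suc lim_1_over_n)
    then show "((\<lambda>n. \<mu> - 1 / real (Suc n)) \<circ> r) \<longlonglongrightarrow> \<mu>" using LIMSEQ_subseq_LIMSEQ[OF _ \<xi>(2)] by simp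
    show "(\<lambda>n. ?f ((g \<circ> r) n)) \<longlonglongrightarrow> ?f \<xi>" by (intro tendsto_intros \<xi>(3))
    show "\<exists>N. \<forall>n\<ge>N. ((\<lambda>n. \<mu> - 1 / real (Suc n)) \<circ> r) n \<le> ?f ((g \<circ> r) n)"
      using g(3) by (auto intro: less_imp_le)
  qed
  then have f\<xi>: "?f \<xi> = \<mu>" using \<mu>_ge[of \<xi>] \<xi>(1) n\<xi> by simp
  \<comment> \<open>The gradient, at its minimizer, of the nonnegative form
    \<open>\<mu> * (norm \<xi>)\<^sup>2 - ?f \<xi>\<close>; it lies in \<open>E\<close> and is
    real-orthogonal to \<open>E\<close>.\<close>
  define w where "w = (2 * \<mu>) *\<^sub>R \<xi> - capply U \<xi> - capply (cadj U) \<xi>"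
  have "Re (cinner w \<eta>) = 0" if \<eta>: "\<eta> \<in> E" for \<eta>
  proof -
    have eqw: "Re (cinner w \<eta>) = 2 * \<mu> * Re (cinner \<xi> \<eta>) - Re (cinner (capply U \<xi>) \<eta>) - Re (cinner (capply (cadj U) \<xi>) \<eta>)"
      by (simp add: w_def cinner_diff_left cinner_scaleR_left)
    have "Re (cinner w \<eta>) / 2 = 0"
    proof (rule quadratic_nonneg_imp_linear_zero[where b = "\<mu> * (norm \<eta>)\<^sup>2 - ?f \<eta>"])
      fix t :: real
      have "0 \<le> \<mu> * (norm (\<xi> + t *\<^sub>R \<eta>))\<^sup>2 - ?f (\<xi> + t *\<^sub>R \<eta>)"
        by (rule q_nonneg) (intro Es \<xi> \<eta>)
      also have "(norm (\<xi> + t *\<^sub>R \<eta>))\<^sup>2 = 1 + t\<^sup>2 * (norm \<eta>)\<^sup>2 + 2 * t * Re (cinner \<xi> \<eta>)"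
        by (simp add: norm_add_sq n\<xi> cinner_scaleR_right power_mult_distrib)
      also have "?f (\<xi> + t *\<^sub>R \<eta>) = \<mu> + t * Re (cinner (capply U \<xi>) \<eta>) + t * Re (cinner (capply U \<eta>) \<xi>) + t\<^sup>2 * ?f \<eta>"
        by (simp add: capply_add capply_scaleR cinner_add_left cinner_add_right cinner_scaleR_left
            cinner_scaleR_right f\<xi> power2_eq_square distrib_left)
      also have "Re (cinner (capply U \<eta>) \<xi>) = Re (cinner (capply (cadj U) \<xi>) \<eta>)"
        by (simp add: cinner_cadj Re_cinner_commute[of \<eta>])
      finally show "0 \<le> 2 * t * (Re (cinner w \<eta>) / 2) + t\<^sup>2 * (\<mu> * (norm \<eta>)\<^sup>2 - ?f \<eta>)"
        by (simp add: eqw field_simps)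
    qed
    then show ?thesis by simp
  qed
  moreover have "w \<in> E" unfolding w_def by (intro Es inv \<xi>)
  ultimately have "Re (cinner w w) = 0" by blast
  then have "w = 0" by (simp add: cinner_self)
  then have w0: "capply U \<xi> + capply (cadj U) \<xi> = (2 * \<mu>) *\<^sub>R \<xi>" by (simp add: w_def algebra_simps)
  have \<mu>1: "\<mu>\<^sup>2 \<le> 1" using f_le[of \<xi>] by (simp add: f\<xi> n\<xi> abs_square_le_1)
  \<comment> \<open>A root of z^2 - 2 \<mu> z + 1, of modulus one since \<mu> lies between -1 and 1;
    the other root is \<open>cnj v\<close>.\<close>
  define v where "v = Complex \<mu> (sqrt (1 - \<mu>\<^sup>2))"
  have vv: "v * cnj v = 1" using \<mu>1 by (simp add: v_def complex_eq_iff power2_eq_square)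
  have v2: "v + cnj v = of_real (2 * \<mu>)" by (simp add: v_def complex_eq_iff)
  \<comment> \<open>If \<eta> vanishes, \<xi> is an eigenvector for \<open>cnj v\<close>; otherwise
    \<eta> is one for \<open>v\<close>.\<close>
  define \<eta> where "\<eta> = capply U \<xi> - cnj v *\<^sub>C \<xi>"
  have "capply U (capply U \<xi>) = (2 * \<mu>) *\<^sub>R capply U \<xi> - \<xi>"
    using arg_cong[OF w0, of "capply U"] by (simp add: capply_add capply_scaleR unitary_op_apply[OF U] algebra_simps)
  also have "(2 * \<mu>) *\<^sub>R capply U \<xi> = v *\<^sub>C capply U \<xi> + cnj v *\<^sub>C capply U \<xi>"
    unfolding scaleC_add_left[symmetric] v2 by (rule scaleC_of_real[symmetric])
  finally have "capply U \<eta> = v *\<^sub>C \<eta>"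
    by (simp add: \<eta>_def capply_diff capply_scaleC scaleC_diff_right scaleC_scaleC vv)
  moreover have "\<eta> \<in> E" unfolding \<eta>_def by (intro Es inv \<xi>)
  moreover have "capply U \<xi> = cnj v *\<^sub>C \<xi>" if "\<eta> = 0" using that by (simp add: \<eta>_def)
  moreover have "\<xi> \<noteq> 0" using n\<xi> by auto
  ultimately show thesis using that \<xi>(1) by blast
qed

text \<open>Provides the compact sets that contain the images of the unit ball under the finite-rank
  approximants in \<open>weak_mixing_or_eigenvector\<close>.\<close>

lemma compact_combinations:
  fixes v :: "nat \<Rightarrow> 'a::complex_normed"
  shows "compact {\<Sum>n<N. c n *\<^sub>C v n | c. \<forall>n<N. cmod (c n) \<le> C}"
proof (induction N)
  case (Suc N)
  let ?K = "{\<Sum>n<N. c n *\<^sub>C v n | c. \<forall>n<N. cmod (c n) \<le> C}"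
  let ?L = "(\<lambda>a. a *\<^sub>C v N) ` cball 0 C"
  have "compact ?L"
    by (intro compact_continuous_image linear_continuous_on bounded_linear_scaleC_left compact_cball)
  then have "compact {x + y | x y. x \<in> ?K \<and> y \<in> ?L}" by (rule compact_sums[OF Suc])
  also have "{x + y | x y. x \<in> ?K \<and> y \<in> ?L} = {\<Sum>n<Suc N. c n *\<^sub>C v n | c. \<forall>n<Suc N. cmod (c n) \<le> C}"
    (is "?A = ?B")
  proof
    show "?B \<subseteq> ?A"
    proof
      fix z assume "z \<in> ?B"
      then obtain c where "z = (\<Sum>n<N. c n *\<^sub>C v n) + c N *\<^sub>C v N" "\<forall>n<Suc N. cmod (c n) \<le> C" by auto
      then show "z \<in> ?A" by fastforce
    qed
    show "?A \<subseteq> ?B"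
    proof
      fix z assume "z \<in> ?A"
      then obtain c a where c: "z = (\<Sum>n<N. c n *\<^sub>C v n) + a *\<^sub>C v N" "\<forall>n<N. cmod (c n) \<le> C" "cmod a \<le> C"
        by auto
      then show "z \<in> ?B"
        by (intro CollectI exI[of _ "c(N := a)"]) (auto simp: less_Suc_eq)
    qed
  qed
  finally show ?case .
qed simp

lemma hilbert_tensor_inner: "hilbert_tensor t \<Longrightarrow> cinner (t a b) (t c d) = cinner a c * cinner b d"
  unfolding hilbert_tensor_def by blast

lemma hilbert_tensor_norm:
  assumes "hilbert_tensor t" shows "norm (t a b) = norm a * norm b"
proof -
  have "complex_of_real ((norm (t a b))\<^sup>2) = of_real ((norm a * norm b)\<^sup>2)"
    using hilbert_tensor_inner[OF assms, of a b a b] by (simp add: cinner_self power_mult_distrib)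
  then have "(norm (t a b))\<^sup>2 = (norm a * norm b)\<^sup>2" by (simp only: of_real_eq_iff)
  then show ?thesis by (simp add: power2_eq_iff_nonneg)
qed

text \<open>The mean \<open>Z\<close> of the stationary sequence \<open>P\<^sup>n x \<otimes> R\<^sup>n b\<close> is a Hilbert--Schmidt type
  conjugate-linear operator \<open>J\<close>, \<open>\<langle>J \<xi>, \<eta>\<rangle> = \<langle>Z, \<xi> \<otimes> \<eta>\<rangle>\<close>, and \<open>J P = R J\<close>. The vectors at which \<open>J\<close>
  attains its norm form a \<open>P\<close>-invariant subspace with compact unit ball.\<close>

lemma weak_mixing_or_eigenvector:
  fixes P R :: "'h::complex_hilbert operator" and t :: "'h \<Rightarrow> 'h \<Rightarrow> 'k::complex_hilbert"
  assumes P: "unitary_op P" and R: "unitary_op R" and t: "hilbert_tensor t"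
    and no_eigen: "\<And>y ev. capply P y = ev *\<^sub>C y \<Longrightarrow> cinner x y = 0"
  shows "avg (\<lambda>n. t ((capply P ^^ n) x) ((capply R ^^ n) b)) \<longlonglongrightarrow> 0"
proof -
  let ?P = "\<lambda>n. (capply P ^^ n) x" and ?R = "\<lambda>n. (capply R ^^ n) b"
  let ?z = "\<lambda>n. t (?P n) (?R n)"
  note t_inner = hilbert_tensor_inner[OF t] and t_norm = hilbert_tensor_norm[OF t]
  have t_dense: "closure {(\<Sum>i<n. t (x i) (y i)) | (n::nat) x y. True} = UNIV"
    using t unfolding hilbert_tensor_def by blast
  have stat: "cinner (?z (Suc m)) (?z (Suc n)) = cinner (?z m) (?z n)" for m n
    by (simp add: t_inner unitary_cinner[OF P] unitary_cinner[OF R])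
  obtain Z where Z: "avg ?z \<longlonglongrightarrow> Z"
    using stationary_avg_convergent[of ?z, OF stat] by (auto simp: convergent_def)
  have "Z = 0"
  proof (rule ccontr)
    assume Z0: "Z \<noteq> 0"
    \<comment> \<open>Finite-rank conjugate-linear approximants of \<open>J\<close>. The distance on
      the unit ball is at most that of \<open>avg ?z N\<close> to \<open>Z\<close>, which is what
      will make \<open>J\<close> compact.\<close>
    define J' where "J' N \<xi> = avg (\<lambda>n. cinner (?P n) \<xi> *\<^sub>C ?R n) N" for N \<xi>
    have J'_inner: "cinner (J' N \<xi>) \<eta> = cinner (avg ?z N) (t \<xi> \<eta>)" for N \<xi> \<eta>
      by (simp add: J'_def cinner_avg_left t_inner cinner_scaleC_left)
    have norm_from_inner: "norm y \<le> C" if "\<And>\<eta>. cmod (cinner y \<eta>) \<le> C * norm \<eta>" "C \<ge> 0" for y :: 'h and C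
    proof -
      have "(norm y)\<^sup>2 \<le> C * norm y" using that(1)[of y] by (simp add: cinner_self norm_power)
      then show ?thesis using that(2) by (cases "y = 0") (auto simp: power2_eq_square)
    qed
    have J'_diff: "norm (J' N \<xi> - J' M \<xi>) \<le> norm (avg ?z N - avg ?z M) * norm \<xi>" for N M \<xi>
    proof (rule norm_from_inner)
      fix \<eta>
      have "cinner (J' N \<xi> - J' M \<xi>) \<eta> = cinner (avg ?z N - avg ?z M) (t \<xi> \<eta>)"
        by (simp add: cinner_diff_left J'_inner)
      then show "cmod (cinner (J' N \<xi> - J' M \<xi>) \<eta>) \<le> norm (avg ?z N - avg ?z M) * norm \<xi> * norm \<eta>"
        using cinner_norm_le[of "avg ?z N - avg ?z M" "t \<xi> \<eta>"] by (simp add: t_norm mult_ac)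
    qed simp
    have "convergent (\<lambda>N. J' N \<xi>)" for \<xi>
    proof (rule Cauchy_convergent, rule metric_CauchyI)
      fix e :: real assume e: "e > 0"
      have n\<xi>: "norm \<xi> + 1 > 0" by (simp add: add_nonneg_pos)
      obtain N0 where N0: "\<And>m n. m \<ge> N0 \<Longrightarrow> n \<ge> N0 \<Longrightarrow> dist (avg ?z m) (avg ?z n) < e / (norm \<xi> + 1)"
        using metric_CauchyD[OF LIMSEQ_imp_Cauchy[OF Z], of "e / (norm \<xi> + 1)"] e n\<xi> by auto
      have "dist (J' m \<xi>) (J' n \<xi>) < e" if "m \<ge> N0" "n \<ge> N0" for m n
      proof -
        have "dist (J' m \<xi>) (J' n \<xi>) \<le> dist (avg ?z m) (avg ?z n) * norm \<xi>"
          unfolding dist_norm by (rule J'_diff)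
        also have "\<dots> \<le> e / (norm \<xi> + 1) * norm \<xi>" using N0[OF that] by (intro mult_right_mono) auto
        also have "\<dots> < e" using e n\<xi> by (simp add: field_simps)
        finally show ?thesis .
      qed
      then show "\<exists>M. \<forall>m\<ge>M. \<forall>n\<ge>M. dist (J' m \<xi>) (J' n \<xi>) < e" by blast
    qed
    then obtain J where J: "\<And>\<xi>. (\<lambda>N. J' N \<xi>) \<longlonglongrightarrow> J \<xi>" unfolding convergent_def by metis
    have J_inner: "cinner (J \<xi>) \<eta> = cinner Z (t \<xi> \<eta>)" for \<xi> \<eta>
    proof (rule LIMSEQ_unique)
      show "(\<lambda>N. cinner (J' N \<xi>) \<eta>) \<longlonglongrightarrow> cinner (J \<xi>) \<eta>" by (intro tendsto_intros J)
      show "(\<lambda>N. cinner (J' N \<xi>) \<eta>) \<longlonglongrightarrow> cinner Z (t \<xi> \<eta>)" unfolding J'_inner by (intro tendsto_intros Z)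
    qed
    have inner_ext: "a = b" if "\<And>\<eta>. cinner a \<eta> = cinner b \<eta>" for a b :: 'h
      using that[of "a - b"] by (metis cinner_diff_left cinner_self_eq_0 right_minus_eq)
    have t_lin: "t (\<xi> + \<xi>') \<eta> = t \<xi> \<eta> + t \<xi>' \<eta>" "t (c *\<^sub>C \<xi>) \<eta> = c *\<^sub>C t \<xi> \<eta>" for \<xi> \<xi>' \<eta> c
      using t unfolding hilbert_tensor_def by blast+
    have J_add: "J (\<xi> + \<xi>') = J \<xi> + J \<xi>'" for \<xi> \<xi>'
      by (rule inner_ext) (simp add: J_inner cinner_add_left t_lin cinner_add_right)
    have J_scale: "J (c *\<^sub>C \<xi>) = cnj c *\<^sub>C J \<xi>" for c \<xi>
      by (rule inner_ext) (simp add: J_inner cinner_scaleC_left t_lin cinner_scaleC_right)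
    have J_scaleR: "J (r *\<^sub>R \<xi>) = r *\<^sub>R J \<xi>" for r \<xi>
      using J_scale[of "complex_of_real r" \<xi>] by (simp add: scaleC_of_real)
    have J_diff: "J (\<xi> - \<xi>') = J \<xi> - J \<xi>'" for \<xi> \<xi>'
      using J_add[of "\<xi> - \<xi>'" \<xi>'] by simp
    have JJ': "norm (J \<xi> - J' N \<xi>) \<le> norm (Z - avg ?z N) * norm \<xi>" for \<xi> N
    proof (rule norm_from_inner)
      fix \<eta>
      have "cinner (J \<xi> - J' N \<xi>) \<eta> = cinner (Z - avg ?z N) (t \<xi> \<eta>)"
        by (simp add: cinner_diff_left J'_inner J_inner)
      then show "cmod (cinner (J \<xi> - J' N \<xi>) \<eta>) \<le> norm (Z - avg ?z N) * norm \<xi> * norm \<eta>"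
        using cinner_norm_le[of "Z - avg ?z N" "t \<xi> \<eta>"] by (simp add: t_norm mult_ac)
    qed simp
    have J_bound: "norm (J \<xi>) \<le> norm Z * norm \<xi>" for \<xi>
    proof (rule norm_from_inner)
      fix \<eta> show "cmod (cinner (J \<xi>) \<eta>) \<le> norm Z * norm \<xi> * norm \<eta>"
        unfolding J_inner using cinner_norm_le[of Z "t \<xi> \<eta>"] by (simp add: t_norm mult_ac)
    qed simp
    \<comment> \<open>\<open>Z\<close> is invariant under a simultaneous step of \<open>P\<close>
      and \<open>R\<close>, by shifting the averages.\<close>
    have JP: "norm (J (capply P \<xi>)) = norm (J \<xi>)" for \<xi>
    proof -
      have "cinner (J (capply P \<xi>)) (capply R \<eta>) = cinner (J \<xi>) \<eta>" for \<eta>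
      proof -
        let ?T = "t (capply P \<xi>) (capply R \<eta>)"
        have nz: "norm (?z n) \<le> norm x * norm b" for n
          by (simp add: t_norm unitary_funpow_norm[OF P] unitary_funpow_norm[OF R])
        have "(\<lambda>N. cinner (avg ?z N - avg (\<lambda>n. ?z (n + 1)) N) ?T) \<longlonglongrightarrow> cinner 0 ?T"
          by (intro tendsto_intros avg_shift_tendsto[of ?z "norm x * norm b"] nz)
        moreover have "cinner (avg (\<lambda>n. ?z (n + 1)) N) ?T = cinner (avg ?z N) (t \<xi> \<eta>)" for N
          by (simp add: cinner_avg_left t_inner unitary_cinner[OF P] unitary_cinner[OF R])
        ultimately have "(\<lambda>N. cinner (avg ?z N) ?T - cinner (avg ?z N) (t \<xi> \<eta>)) \<longlonglongrightarrow> 0"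
          by (simp add: cinner_diff_left)
        moreover have "(\<lambda>N. cinner (avg ?z N) ?T - cinner (avg ?z N) (t \<xi> \<eta>)) \<longlonglongrightarrow> cinner Z ?T - cinner Z (t \<xi> \<eta>)"
          by (intro tendsto_intros Z)
        ultimately have "cinner Z ?T - cinner Z (t \<xi> \<eta>) = 0" using LIMSEQ_unique by blast
        then show ?thesis by (simp add: J_inner)
      qed
      then have "capply (cadj R) (J (capply P \<xi>)) = J \<xi>"
        by (intro inner_ext) (simp add: cinner_cadj')
      then show ?thesis using unitary_norm[OF unitary_op_cadj[OF R]] by metis
    qed
    \<comment> \<open>Compactness of \<open>J\<close>: on the unit ball it agrees up to
      \<open>e / 4\<close> with some \<open>J' N\<close>, whose values lie in a compact set of
      finite combinations.\<close>
    have subseq: "\<exists>l r. strict_mono r \<and> ((\<lambda>n. J (f n)) \<circ> r) \<longlonglongrightarrow> l" if f: "\<And>n. norm (f n) \<le> 1" for f :: "nat \<Rightarrow> 'h"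
    proof -
      let ?S = "closure (J ` cball 0 1)"
      have "compact ?S"
        unfolding compact_eq_totally_bounded
      proof (intro conjI allI impI)
        show "complete ?S" by (simp add: complete_eq_closed)
        fix e :: real assume e: "e > 0"
        obtain N where N: "dist (avg ?z N) Z < e / 4"
          using metric_LIMSEQ_D[OF Z, of "e/4"] e by auto
        let ?K = "{\<Sum>n<N. c n *\<^sub>C ?R n | c. \<forall>n<N. cmod (c n) \<le> (1 / real N) * norm x}"
        have "compact ?K" by (rule compact_combinations)
        then obtain k where k: "finite k" "?K \<subseteq> (\<Union>y\<in>k. ball y (e/4))"
          unfolding compact_eq_totally_bounded using e by (meson zero_less_divide_iff zero_less_numeral)
        have "J ` cball 0 1 \<subseteq> (\<Union>y\<in>k. cball y (e/2))"
        proof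
          fix w assume "w \<in> J ` cball 0 1"
          then obtain \<xi> where \<xi>: "w = J \<xi>" "norm \<xi> \<le> 1" by auto
          have "J' N \<xi> = (\<Sum>n<N. ((1 / real N) *\<^sub>R cinner (?P n) \<xi>) *\<^sub>C ?R n)"
            unfolding J'_def avg_def scaleR_sum_right
            by (intro sum.cong refl) (simp add: scaleR_conv_of_real scaleC_scaleC flip: scaleC_of_real)
          moreover have "cmod ((1 / real N) *\<^sub>R cinner (?P n) \<xi>) \<le> (1 / real N) * norm x" for n
          proof -
            have "cmod (cinner (?P n) \<xi>) \<le> norm x * 1"
              using cinner_norm_le[of "?P n" \<xi>] mult_left_mono[OF \<xi>(2), of "norm x"]
              by (simp add: unitary_funpow_norm[OF P])
            then have "(1 / real N) * cmod (cinner (?P n) \<xi>) \<le> (1 / real N) * norm x"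
              by (intro mult_left_mono) auto
            then show ?thesis by simp
          qed
          ultimately have "J' N \<xi> \<in> ?K" by (intro CollectI exI[of _ "\<lambda>n. (1 / real N) *\<^sub>R cinner (?P n) \<xi>"]) blast
          then obtain y where y: "y \<in> k" "dist y (J' N \<xi>) < e/4" using k(2) by auto
          have "dist (J' N \<xi>) (J \<xi>) \<le> norm (Z - avg ?z N) * 1"
            using JJ'[of \<xi> N] mult_left_mono[OF \<xi>(2), of "norm (Z - avg ?z N)"]
            by (simp add: dist_norm norm_minus_commute)
          also have "\<dots> < e / 4" using N by (simp add: dist_norm norm_minus_commute)
          finally have "dist y (J \<xi>) \<le> e/2"
            using y(2) dist_triangle[of y "J \<xi>" "J' N \<xi>"] by linarith
          then show "w \<in> (\<Union>y\<in>k. cball y (e/2))" using y(1) \<xi>(1) by auto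
        qed
        moreover have "closed (\<Union>y\<in>k. cball y (e/2))" using k(1) by (intro closed_UN) auto
        ultimately have "?S \<subseteq> (\<Union>y\<in>k. cball y (e/2))" by (rule closure_minimal)
        also have "\<dots> \<subseteq> (\<Union>y\<in>k. ball y e)" using e by force
        finally show "\<exists>k. finite k \<and> ?S \<subseteq> (\<Union>x\<in>k. ball x e)" using k(1) by blast
      qed
      moreover have "J (f n) \<in> ?S" for n
        by (intro subsetD[OF closure_subset] imageI) (use f in simp)
      ultimately show ?thesis unfolding compact_def by (elim allE[of _ "\<lambda>n. J (f n)"]) blast
    qed
    define c where "c = (SUP \<xi>\<in>cball 0 1. norm (J \<xi>))"
    have bdd: "bdd_above ((\<lambda>\<xi>. norm (J \<xi>)) ` cball 0 1)"
    proof (rule bdd_aboveI2)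
      fix \<xi> :: 'h assume "\<xi> \<in> cball 0 1"
      then show "norm (J \<xi>) \<le> norm Z * 1" using J_bound[of \<xi>] mult_left_mono[of "norm \<xi>" 1 "norm Z"] by simp
    qed
    have c_ge1: "norm (J \<xi>) \<le> c" if "norm \<xi> \<le> 1" for \<xi>
      unfolding c_def using that by (intro cSUP_upper bdd) auto
    have c_ge: "norm (J \<xi>) \<le> c * norm \<xi>" for \<xi>
    proof (cases "\<xi> = 0")
      case False
      then show ?thesis using c_ge1[of "(1 / norm \<xi>) *\<^sub>R \<xi>"] by (simp add: J_scaleR field_simps)
    next
      case True
      then show ?thesis using J_scaleR[of 0 0] by simp
    qed
    obtain \<xi>0 where "J \<xi>0 \<noteq> 0"
    proof (rule ccontr)
      assume "\<not> thesis"
      then have J0: "J \<xi> = 0" for \<xi> using that by blast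
      have "Z = 0"
      proof (rule cinner_ext_dense[OF t_dense])
        fix w assume "w \<in> {(\<Sum>i<n. t (x i) (y i)) | (n::nat) x y. True}"
        then obtain n :: nat and x y where w: "w = (\<Sum>i<n. t (x i) (y i))" by blast
        have "cinner Z w = 0" unfolding w cinner_sum_right J_inner[symmetric] by (simp add: J0)
        then show "cinner w Z = cinner w 0" using cinner_commute[of w Z] by simp
      qed
      then show False using Z0 by simp
    qed
    then have c_pos: "c > 0" using c_ge[of \<xi>0] by (metis mult_nonneg_nonpos2 norm_ge_zero norm_le_zero_iff not_le order_trans)
    \<comment> \<open>Norm attainment passes to sums because the parallelogram law is an equality
      for arguments and for images. On \<open>E\<close> the map \<open>J\<close> is \<open>c\<close>
      times an isometry, so convergence of images gives convergence of arguments.\<close>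
    define E where "E = {\<xi>. norm (J \<xi>) = c * norm \<xi>}"
    have E_sub: "csubspace E"
      unfolding csubspace_def
    proof (intro conjI ballI allI)
      show "0 \<in> E" using J_scaleR[of 0 0] by (simp add: E_def)
    next
      fix a \<xi> assume "\<xi> \<in> E"
      then show "a *\<^sub>C \<xi> \<in> E" by (simp add: E_def J_scale norm_scaleC)
    next
      fix \<xi> \<eta> assume "\<xi> \<in> E" "\<eta> \<in> E"
      then have "(norm (J (\<xi> + \<eta>)))\<^sup>2 + (norm (J (\<xi> - \<eta>)))\<^sup>2 = (c * norm (\<xi> + \<eta>))\<^sup>2 + (c * norm (\<xi> - \<eta>))\<^sup>2"
        using parallelogram[of "J \<xi>" "J \<eta>"] arg_cong[OF parallelogram[of \<xi> \<eta>], of "\<lambda>r. c\<^sup>2 * r"]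
        by (simp add: J_add J_diff E_def power_mult_distrib algebra_simps)
      moreover have "(norm (J (\<xi> + \<eta>)))\<^sup>2 \<le> (c * norm (\<xi> + \<eta>))\<^sup>2" "(norm (J (\<xi> - \<eta>)))\<^sup>2 \<le> (c * norm (\<xi> - \<eta>))\<^sup>2"
        by (intro power_mono c_ge norm_ge_zero)+
      ultimately have "(norm (J (\<xi> + \<eta>)))\<^sup>2 = (c * norm (\<xi> + \<eta>))\<^sup>2" by linarith
      then show "\<xi> + \<eta> \<in> E" using c_pos by (simp add: E_def power2_eq_iff_nonneg)
    qed
    have J_tendsto: "(\<lambda>n. J (f n)) \<longlonglongrightarrow> J l" if "f \<longlonglongrightarrow> l" for f l
    proof (rule LIM_zero_cancel, rule Lim_null_comparison)
      show "\<forall>\<^sub>F n in sequentially. norm (J (f n) - J l) \<le> c * norm (f n - l)"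
        using c_ge by (simp flip: J_diff)
      have "(\<lambda>n. c * norm (f n - l)) \<longlonglongrightarrow> c * norm (l - l)" by (intro tendsto_intros that)
      then show "(\<lambda>n. c * norm (f n - l)) \<longlonglongrightarrow> 0" by simp
    qed
    have E_closed: "l \<in> E" if "\<And>n. f n \<in> E" "f \<longlonglongrightarrow> l" for f l
    proof -
      have "(\<lambda>n. norm (J (f n))) \<longlonglongrightarrow> norm (J l)" by (intro tendsto_norm J_tendsto that)
      moreover have "(\<lambda>n. c * norm (f n)) \<longlonglongrightarrow> c * norm l" by (intro tendsto_intros that)
      ultimately show ?thesis using that(1) LIMSEQ_unique by (auto simp: E_def)
    qed
    have E_cpt: "\<exists>l\<in>E. \<exists>r. strict_mono r \<and> (f \<circ> r) \<longlonglongrightarrow> l" if f: "\<And>n::nat. f n \<in> E \<and> norm (f n) \<le> 1" for f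
    proof -
      obtain l r where r: "strict_mono r" "((\<lambda>n. J (f n)) \<circ> r) \<longlonglongrightarrow> l" using subseq[of f] f by blast
      have "Cauchy (f \<circ> r)"
      proof (rule metric_CauchyI)
        fix e :: real assume e: "e > 0"
        obtain N where N: "\<And>m n. m \<ge> N \<Longrightarrow> n \<ge> N \<Longrightarrow> dist (J (f (r m))) (J (f (r n))) < c * e"
          using metric_CauchyD[OF LIMSEQ_imp_Cauchy[OF r(2)], of "c * e"] e c_pos by auto
        have "dist (f (r m)) (f (r n)) < e" if "m \<ge> N" "n \<ge> N" for m n
        proof -
          have "f (r m) - f (r n) \<in> E" using csubspaceD(4)[OF E_sub] f by blast
          then have "c * dist (f (r m)) (f (r n)) = dist (J (f (r m))) (J (f (r n)))"
            by (simp add: E_def dist_norm J_diff)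
          then have "c * dist (f (r m)) (f (r n)) < c * e" using N[OF that] by simp
          then show ?thesis using c_pos by (simp only: mult_less_cancel_left_pos)
        qed
        then show "\<exists>M. \<forall>m\<ge>M. \<forall>n\<ge>M. dist ((f \<circ> r) m) ((f \<circ> r) n) < e" by auto
      qed
      then obtain l' where l': "(f \<circ> r) \<longlonglongrightarrow> l'" using Cauchy_convergent convergent_def by blast
      have "l' \<in> E" by (rule E_closed[OF _ l']) (simp add: f)
      then show ?thesis using r(1) l' by blast
    qed
    \<comment> \<open>A maximizing sequence with convergent image converges itself: the images force
      \<open>norm (?g m + ?g n)\<close> close to 2, and the parallelogram law makes the differences
      small.\<close>
    obtain \<xi>1 where \<xi>1: "\<xi>1 \<in> E" "\<xi>1 \<noteq> 0"
    proof -
      have ne: "cball 0 1 \<noteq> ({}::'h set)" by simp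
      have "\<exists>\<xi>\<in>cball 0 1. c - 1 / real (Suc n) < norm (J \<xi>)" for n
        using less_cSUP_iff[OF ne bdd, of "c - 1 / real (Suc n)"] unfolding c_def by auto
      then obtain f where f: "\<And>n. norm (f n) \<le> 1" "\<And>n. c - 1 / real (Suc n) < norm (J (f n))"
        by (metis mem_cball_0)
      obtain l r where r: "strict_mono r" "((\<lambda>n. J (f n)) \<circ> r) \<longlonglongrightarrow> l" using subseq[of f] f by blast
      let ?g = "\<lambda>n. f (r n)"
      have Jg: "(\<lambda>n. J (?g n)) \<longlonglongrightarrow> l" using r(2) by (simp add: o_def)
      have nl: "norm l = c"
      proof (rule antisym)
        show "norm l \<le> c" by (rule LIMSEQ_le_const2[OF tendsto_norm[OF Jg]]) (use c_ge1 f in blast)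
        have "(\<lambda>n. c - 1 / real (Suc n)) \<longlonglongrightarrow> c - 0" by (intro tendsto_intros LIMSEQ_Suc lim_1_over_n)
        then have "((\<lambda>n. c - 1 / real (Suc n)) \<circ> r) \<longlonglongrightarrow> c" using LIMSEQ_subseq_LIMSEQ[OF _ r(1)] by simp
        then show "c \<le> norm l"
          by (rule LIMSEQ_le[OF _ tendsto_norm[OF Jg]]) (use f(2) in \<open>auto intro: less_imp_le\<close>)
      qed
      have "Cauchy ?g"
      proof (rule metric_CauchyI)
        fix e :: real assume e: "e > 0"
        \<comment> \<open>Chosen so that \<open>d = c * s\<close> gives 4 - (2 - d/c)^2 \<le> 4 s <
          e^2 while 2 - d/c stays positive.\<close>
        define s where "s = min 1 (e\<^sup>2 / 8)"
        have s: "0 < s" "s \<le> 1" "s \<le> e\<^sup>2 / 8" using e by (simp_all add: s_def)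
        have "4 - (2 - s)\<^sup>2 \<le> 4 * s" by (simp add: power2_eq_square algebra_simps)
        also have "\<dots> < e\<^sup>2" using s e by simp
        finally obtain d :: real where d: "4 - (2 - d / c)\<^sup>2 < e\<^sup>2" "d < 2 * c" "d > 0"
          using s(1,2) c_pos by (intro that[of "c * s"]) auto
        obtain N where N: "\<And>n. n \<ge> N \<Longrightarrow> dist (J (?g n)) l < d / 2"
          using metric_LIMSEQ_D[OF Jg, of "d/2"] d(3) by auto
        have "dist (?g m) (?g n) < e" if "m \<ge> N" "n \<ge> N" for m n
        proof -
          have "2 *\<^sub>R l = (J (?g m) + J (?g n)) - ((J (?g m) - l) + (J (?g n) - l))" by (simp add: scaleR_2)
          then have "norm (2 *\<^sub>R l) \<le> norm (J (?g m) + J (?g n)) + norm ((J (?g m) - l) + (J (?g n) - l))"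
            by (metis norm_triangle_ineq4)
          also have "\<dots> \<le> norm (J (?g m) + J (?g n)) + (dist (J (?g m)) l + dist (J (?g n)) l)"
            unfolding dist_norm by (intro add_left_mono norm_triangle_ineq)
          finally have "2 * c - d \<le> norm (J (?g m + ?g n))"
            using N[OF that(1)] N[OF that(2)] by (simp add: nl J_add)
          also have "\<dots> \<le> c * norm (?g m + ?g n)" by (rule c_ge)
          finally have "2 - d / c \<le> norm (?g m + ?g n)" using c_pos by (simp add: field_simps)
          then have "(2 - d / c)\<^sup>2 \<le> (norm (?g m + ?g n))\<^sup>2"
            using d(2) c_pos by (intro power_mono) (simp_all add: field_simps)
          moreover have "(norm (?g m))\<^sup>2 \<le> 1" "(norm (?g n))\<^sup>2 \<le> 1" using f(1) by (simp_all add: power_le_one)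
          ultimately have "(norm (?g m - ?g n))\<^sup>2 < e\<^sup>2"
            using parallelogram[of "?g m" "?g n"] d(1) by linarith
          then show ?thesis using e by (simp add: dist_norm power_less_imp_less_base)
        qed
        then show "\<exists>M. \<forall>m\<ge>M. \<forall>n\<ge>M. dist (?g m) (?g n) < e" by blast
      qed
      then obtain \<xi> where \<xi>: "?g \<longlonglongrightarrow> \<xi>" using Cauchy_convergent convergent_def by blast
      have "J \<xi> = l" by (rule LIMSEQ_unique[OF J_tendsto[OF \<xi>] Jg])
      moreover have "norm \<xi> \<le> 1" by (rule LIMSEQ_le_const2[OF tendsto_norm[OF \<xi>]]) (use f(1) in blast)
      ultimately have "norm (J \<xi>) = c" "c * norm \<xi> \<le> c" using nl c_pos by simp_all
      then have "\<xi> \<in> E" using c_ge[of \<xi>] by (simp add: E_def)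
      moreover have "\<xi> \<noteq> 0" using \<open>norm (J \<xi>) = c\<close> c_pos c_ge[of \<xi>] by auto
      ultimately show thesis by (rule that)
    qed
    have inv1: "capply P \<xi> \<in> E" if "\<xi> \<in> E" for \<xi> using that by (simp add: E_def JP unitary_norm[OF P])
    have inv2: "capply (cadj P) \<xi> \<in> E" if "\<xi> \<in> E" for \<xi>
      using that JP[of "capply (cadj P) \<xi>"]
      by (simp add: E_def unitary_norm[OF unitary_op_cadj[OF P]] unitary_op_apply[OF P])
    obtain y ev where y: "y \<in> E" "y \<noteq> 0" "capply P y = ev *\<^sub>C y"
      using eigenvector_in_compact_subspace[OF P E_sub \<xi>1 inv1 inv2 E_cpt] by blast
    have l0: "ev \<noteq> 0" using unitary_norm[OF P, of y] y(2,3) by auto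
    have xy: "cinner x y = 0" by (rule no_eigen[OF y(3)])
    \<comment> \<open>Being an eigenvector, \<open>y\<close> is orthogonal to the whole orbit of
      \<open>x\<close>, so every \<open>J' N\<close> kills it, although \<open>J\<close> multiplies
      its norm by \<open>c\<close>.\<close>
    have Pny: "(capply P ^^ n) y = ev ^ n *\<^sub>C y" for n
      by (induction n) (simp_all add: capply_scaleC y(3) scaleC_scaleC mult.commute)
    have "cinner (?P n) y = 0" for n
      using unitary_funpow_cinner[OF P, of n x y] l0 by (simp add: Pny cinner_scaleC_right xy)
    then have "J' N y = 0" for N by (simp add: J'_def avg_def)
    then have "J y = 0" using J[of y] by (simp add: LIMSEQ_const_iff)
    then show False using y(1,2) c_pos by (simp add: E_def)
  qed
  then show ?thesis using Z by simp
qed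

section \<open>Integer powers\<close>

lemma zpow_succ:
  assumes "bij f" shows "zpow f (k + 1) = f \<circ> zpow f k"
proof (cases "k \<ge> 0")
  case True
  then have "nat (k + 1) = Suc (nat k)" by simp
  then show ?thesis using True by (simp add: zpow_def)
next
  case False
  have ff: "f \<circ> inv f = id" by (metis assms bij_is_surj surj_iff)
  show ?thesis
  proof (cases "k = - 1")
    case True
    then show ?thesis by (simp add: zpow_def ff)
  next
    case F: False
    with False have "nat (- k) = Suc (nat (- (k + 1)))" by simp
    moreover have "\<not> 0 \<le> k + 1" using False F by simp
    ultimately show ?thesis using False by (simp add: zpow_def o_assoc ff)
  qed
qed

lemma zpow_pred: "bij f \<Longrightarrow> zpow f (k - 1) = inv f \<circ> zpow f k"
  using zpow_succ[of f "k - 1"] by (simp add: o_assoc bij_is_inj)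

lemma zpow_0 [simp]: "zpow f 0 = id"
  by (simp add: zpow_def)

lemma zpow_add:
  assumes "bij f" shows "zpow f (j + k) = zpow f j \<circ> zpow f k"
proof (induction j rule: int_induct[where k = 0])
  case (step1 i)
  have "zpow f (i + 1 + k) = f \<circ> zpow f (i + k)" using zpow_succ[OF assms, of "i + k"] by (simp add: algebra_simps)
  then show ?case by (simp add: step1 zpow_succ[OF assms] o_assoc)
next
  case (step2 i)
  have "zpow f (i - 1 + k) = inv f \<circ> zpow f (i + k)" using zpow_pred[OF assms, of "i + k"] by (simp add: algebra_simps)
  then show ?case by (simp add: step2 zpow_pred[OF assms] o_assoc)
qed simp

lemma zpow_mult_nat: "bij f \<Longrightarrow> zpow f (int n * k) = (zpow f k) ^^ n"
  by (induction n) (simp_all add: distrib_right zpow_add)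

lemma zpow_fixed:
  assumes "bij f" "zpow f k x = x" shows "zpow f (n * k) x = x"
proof -
  have nn: "zpow f (int m * k) x = x" for m
    unfolding zpow_mult_nat[OF assms(1)] by (induction m) (simp_all add: assms(2))
  show ?thesis
  proof (cases "n \<ge> 0")
    case True
    then show ?thesis using nn[of "nat n"] by simp
  next
    case False
    then have "n * k + int (nat (- n)) * k = 0" by simp
    then have "zpow f (n * k) (zpow f (int (nat (- n)) * k) x) = x"
      using zpow_add[OF assms(1), of "n * k" "int (nat (- n)) * k"] by (metis comp_apply id_apply zpow_0)
    then show ?thesis unfolding nn .
  qed
qed

lemma unitary_bij: "unitary_op U \<Longrightarrow> bij (capply U)"
  by (rule o_bij[of "capply (cadj U)"]) (auto simp: unitary_op_apply fun_eq_iff)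

lemma unitary_inv: "unitary_op U \<Longrightarrow> inv (capply U) = capply (cadj U)"
  by (rule inv_equality) (simp_all add: unitary_op_apply)

text \<open>Both conjugations are included so that the relation passes to inverses and hence to all
  integer powers.\<close>

definition normalizes :: "'h::complex_hilbert operator \<Rightarrow> 'h operator set \<Rightarrow> bool"
  where "normalizes W N \<longleftrightarrow> unitary_op W \<and>
    (\<forall>T\<in>N. W o\<^sub>C T o\<^sub>C cadj W \<in> N \<and> cadj W o\<^sub>C T o\<^sub>C W \<in> N)"

lemma normalizes_cid: "normalizes cid N"
  by (simp add: normalizes_def unitary_op_cid)

lemma normalizes_cadj: "normalizes W N \<Longrightarrow> normalizes (cadj W) N"
  by (simp add: normalizes_def unitary_op_cadj)

lemma normalizes_compose: "normalizes W N \<Longrightarrow> normalizes W' N \<Longrightarrow> normalizes (W o\<^sub>C W') N"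
  unfolding normalizes_def by (auto simp: unitary_op_compose cadj_compose) (metis ccompose_assoc)+

lemma normalizes_commutant:
  assumes "normalizes W R" shows "normalizes W (commutant R)"
proof -
  have W: "unitary_op W" using assms by (simp add: normalizes_def)
  have "W o\<^sub>C T o\<^sub>C cadj W \<in> commutant R" if T: "T \<in> commutant R" and W: "normalizes W R" for T W
    unfolding commutant_iff
  proof (intro ballI allI)
    fix A x assume A: "A \<in> R"
    have u: "unitary_op W" using W by (simp add: normalizes_def)
    have "cadj W o\<^sub>C A o\<^sub>C W \<in> R" using W A by (simp add: normalizes_def)
    from commutantD[OF T this, of "capply (cadj W) x"]
    have "capply T (capply (cadj W) (capply A x)) = capply (cadj W) (capply A (capply W (capply T (capply (cadj W) x))))"
      by (simp add: unitary_op_apply[OF u])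
    then show "capply (W o\<^sub>C T o\<^sub>C cadj W) (capply A x) = capply A (capply (W o\<^sub>C T o\<^sub>C cadj W) x)"
      by (simp add: unitary_op_apply[OF u])
  qed
  from this[OF _ assms] this[OF _ normalizes_cadj[OF assms]] show ?thesis
    using W by (simp add: normalizes_def)
qed

lemma unitary_power_exists:
  assumes "unitary_op U"
  obtains W where "capply W = zpow (capply U) k" "\<And>N. normalizes U N \<Longrightarrow> normalizes W N"
    "unitary_op W"
proof -
  have ex: "\<exists>W. capply W = capply U ^^ n \<and> (\<forall>N. normalizes U N \<longrightarrow> normalizes W N)" for U :: "'a operator" and n
  proof (induction n)
    case 0
    show ?case by (rule exI[of _ cid]) (auto simp: normalizes_cid)
  next
    case (Suc n)
    then obtain W where "capply W = capply U ^^ n" "\<forall>N. normalizes U N \<longrightarrow> normalizes W N" by blast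
    then show ?case by (intro exI[of _ "U o\<^sub>C W"]) (auto intro: normalizes_compose)
  qed
  have "\<exists>W. capply W = zpow (capply U) k \<and> (\<forall>N. normalizes U N \<longrightarrow> normalizes W N)"
    using ex[where U = U] ex[where U = "cadj U"] normalizes_cadj unfolding zpow_def unitary_inv[OF assms] by metis
  \<comment> \<open>For the empty set the relation reduces to unitarity, so the clause about
    normalization also yields \<open>unitary_op W\<close>.\<close>
  moreover have "normalizes U {}" using assms by (simp add: normalizes_def)
  ultimately show thesis using that unfolding normalizes_def by blast
qed

section \<open>Averages in a von Neumann algebra in standard position\<close>

lemma capply_sum_left: "capply (\<Sum>i\<in>I. T i) x = (\<Sum>i\<in>I. capply (T i) x)"
  by (induction I rule: infinite_finite_induct) (auto simp: capply_plus)

lemma capply_avg_left: "capply (avg T N) x = avg (\<lambda>n. capply (T n) x) N"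
  by (simp add: avg_def capply_scaleR_left capply_sum_left)

text \<open>Mutual commutants with a common cyclic, hence separating, vector. Closure under adjoints
  passes from \<open>N\<close> to \<open>N'\<close>, so every result is available for the pair in
  the opposite order.\<close>

locale standard_pair =
  fixes N N' :: "'h::complex_hilbert operator set" and \<Omega> :: 'h
  assumes N_eq: "N = commutant N'" and N'_eq: "N' = commutant N"
    and N_cadj: "A \<in> N \<Longrightarrow> cadj A \<in> N"
    and dense_N: "closure ((\<lambda>A. capply A \<Omega>) ` N) = UNIV"
    and dense_N': "closure ((\<lambda>B. capply B \<Omega>) ` N') = UNIV"
begin

lemma N'_cadj: "B \<in> N' \<Longrightarrow> cadj B \<in> N'"
  using commutant_cadj[of N B] N_cadj N'_eq by blast

lemma swap: "standard_pair N' N \<Omega>"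
  by (rule standard_pair.intro[OF N'_eq N_eq N'_cadj dense_N' dense_N])

lemma commute: "A \<in> N \<Longrightarrow> B \<in> N' \<Longrightarrow> capply A (capply B x) = capply B (capply A x)"
  using commutantD[of A N' B x] N_eq by blast

lemma separating:
  assumes "A \<in> N" "B \<in> N" "capply A \<Omega> = capply B \<Omega>" shows "A = B"
proof (rule cblinfun_ext_dense[OF dense_N'])
  fix x assume "x \<in> (\<lambda>B. capply B \<Omega>) ` N'"
  then obtain C where C: "C \<in> N'" "x = capply C \<Omega>" by blast
  show "capply A x = capply B x"
    unfolding C(2) commute[OF assms(1) C(1)] commute[OF assms(2) C(1)] assms(3) ..
qed

lemma closed_ops: "A \<in> N \<Longrightarrow> B \<in> N \<Longrightarrow> A o\<^sub>C B \<in> N" "A \<in> N \<Longrightarrow> B \<in> N \<Longrightarrow> A + B \<in> N" "A \<in> N \<Longrightarrow> c *\<^sub>C A \<in> N"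
  "cid \<in> N"
  unfolding N_eq by (auto intro: commutant_compose commutant_add commutant_scaleC commutant_cid)

text \<open>\<open>T\<close> is the Fourier coefficient of \<open>A\<close> at \<open>v\<close>
  under conjugation by \<open>W\<close>. The averages converge strongly because at
  \<open>capply B \<Omega>\<close> they reduce, by commutation with \<open>B\<close>, to the mean
  ergodic theorem for \<open>cnj v *\<^sub>C W\<close> at \<open>capply A \<Omega>\<close>.\<close>

lemma eigen_average:
  assumes W: "normalizes W N" and W\<Omega>: "capply W \<Omega> = \<Omega>" and v: "cmod v = 1" and A: "A \<in> N"
  obtains T where "T \<in> N" "capply W (capply T \<Omega>) = v *\<^sub>C capply T \<Omega>" "W o\<^sub>C T o\<^sub>C cadj W = v *\<^sub>C T"
    "\<And>e. capply W e = v *\<^sub>C e \<Longrightarrow> cinner (capply T \<Omega>) e = cinner (capply A \<Omega>) e"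
proof -
  have u: "unitary_op W" using W by (simp add: normalizes_def)
  have vc: "cnj v * v = 1" "v * cnj v = 1"
    using v complex_norm_square[of v] by (simp_all add: mult.commute)
  have W\<Omega>': "capply (cadj W) \<Omega> = \<Omega>" using unitary_op_apply(1)[OF u, of \<Omega>] by (simp add: W\<Omega>)
  define C where "C n = ((\<lambda>T. cnj v *\<^sub>C (W o\<^sub>C T o\<^sub>C cadj W)) ^^ n) A" for n
  have C_Suc: "C (Suc n) = cnj v *\<^sub>C (W o\<^sub>C C n o\<^sub>C cadj W)" for n by (simp add: C_def)
  have C_N: "C n \<in> N" for n
  proof (induction n)
    case (Suc n)
    then show ?case using W unfolding C_Suc by (intro closed_ops(3)) (simp add: normalizes_def)
  qed (simp add: C_def A)
  have C_bound: "norm (capply (C n) x) \<le> norm A * norm x" for n x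
  proof (induction n arbitrary: x)
    case (Suc n)
    show ?case
      using Suc[of "capply (cadj W) x"]
      by (simp add: C_Suc capply_scaleC_left norm_scaleC v unitary_norm[OF u] unitary_norm[OF unitary_op_cadj[OF u]])
  qed (simp add: C_def norm_capply)
  let ?W = "cnj v *\<^sub>C W"
  have u': "unitary_op ?W" using unitary_op_scaleC[OF u, of "cnj v"] v by simp
  have C\<Omega>: "capply (C n) \<Omega> = (capply ?W ^^ n) (capply A \<Omega>)" for n
    by (induction n) (simp_all add: C_Suc capply_scaleC_left W\<Omega>', simp add: C_def)
  obtain y where y: "avg (\<lambda>n. (capply ?W ^^ n) (capply A \<Omega>)) \<longlonglongrightarrow> y" "capply ?W y = y"
    "\<And>e. capply ?W e = e \<Longrightarrow> cinner y e = cinner (capply A \<Omega>) e"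
    using mean_ergodic[OF u'] by metis
  have lim_B: "(\<lambda>K. capply (avg C K) (capply B \<Omega>)) \<longlonglongrightarrow> capply B y" if B: "B \<in> N'" for B
  proof -
    have "capply (avg C K) (capply B \<Omega>) = capply B (avg (\<lambda>n. (capply ?W ^^ n) (capply A \<Omega>)) K)" for K
      unfolding capply_avg_left commute[OF C_N B] C\<Omega> by (rule avg_capply)
    then show ?thesis by (simp only:) (intro tendsto_intros y)
  qed
  have "\<exists>T. \<forall>x. (\<lambda>K. capply (avg C K) x) \<longlonglongrightarrow> capply T x"
  proof (rule strong_limit_exists)
    show "norm (capply (avg C K) x) \<le> norm A * norm x" for K x
      unfolding capply_avg_left by (rule norm_avg_le[OF C_bound]) simp
    show "closure ((\<lambda>B. capply B \<Omega>) ` N') = UNIV" by (rule dense_N')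
    fix x assume "x \<in> (\<lambda>B. capply B \<Omega>) ` N'"
    then show "convergent (\<lambda>K. capply (avg C K) x)" using lim_B by (auto simp: convergent_def)
  qed
  then obtain T where T: "\<And>x. (\<lambda>K. capply (avg C K) x) \<longlonglongrightarrow> capply T x" by blast
  have "T \<in> commutant N'"
    unfolding commutant_iff
  proof (intro ballI allI)
    fix B x assume B: "B \<in> N'"
    have eq: "capply (avg C K) (capply B x) = capply B (capply (avg C K) x)" for K
      unfolding capply_avg_left commute[OF C_N B] avg_capply ..
    have "(\<lambda>K. capply (avg C K) (capply B x)) \<longlonglongrightarrow> capply B (capply T x)"
      unfolding eq by (intro tendsto_intros T)
    then show "capply T (capply B x) = capply B (capply T x)" by (rule LIMSEQ_unique[OF T])
  qed
  then have TN: "T \<in> N" using N_eq by simp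
  have T\<Omega>: "capply T \<Omega> = y"
    using lim_B[of cid] T[of \<Omega>] LIMSEQ_unique N'_eq commutant_cid by (metis capply_cid)
  have Wy: "capply W y = v *\<^sub>C y"
    using arg_cong[OF y(2), of "\<lambda>z. v *\<^sub>C z"] by (simp add: capply_scaleC_left scaleC_scaleC vc)
  have "W o\<^sub>C T o\<^sub>C cadj W = v *\<^sub>C T"
  proof (rule separating)
    show "W o\<^sub>C T o\<^sub>C cadj W \<in> N" using W TN by (simp add: normalizes_def)
    show "v *\<^sub>C T \<in> N" by (intro closed_ops TN)
  qed (simp add: W\<Omega>' T\<Omega> Wy capply_scaleC_left)
  moreover have "cinner y e = cinner (capply A \<Omega>) e" if "capply W e = v *\<^sub>C e" for e
    by (rule y(3)) (simp add: capply_scaleC_left that scaleC_scaleC vc)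
  ultimately show thesis using that[OF TN] by (simp add: T\<Omega> Wy)
qed

text \<open>If \<open>T \<in> N\<close> is an eigenoperator then \<open>T\<^sup>* T\<close> and \<open>T T\<^sup>*\<close> are scalars, since
  their values at \<open>\<Omega>\<close> are fixed.\<close>

lemma eigen_unitary_exists:
  assumes U: "normalizes U N" and U\<Omega>: "capply U \<Omega> = \<Omega>" and \<Omega>1: "norm \<Omega> = 1"
    and fixed: "\<And>e. capply U e = e \<Longrightarrow> \<exists>c. e = c *\<^sub>C \<Omega>" and v: "v \<in> point_spectrum U"
  shows "\<exists>T. T \<in> N \<and> unitary_op T \<and> U o\<^sub>C T o\<^sub>C cadj U = v *\<^sub>C T \<and>
    eigenspace U v = range (\<lambda>c. c *\<^sub>C capply T \<Omega>)"
proof -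
  have u: "unitary_op U" using U by (simp add: normalizes_def)
  obtain \<zeta> where \<zeta>: "\<zeta> \<noteq> 0" "capply U \<zeta> = v *\<^sub>C \<zeta>"
    using v by (auto simp: point_spectrum_def eigenspace_def)
  have v1: "cmod v = 1" using unitary_norm[OF u, of \<zeta>] \<zeta> by (simp add: norm_scaleC)
  have vc: "cnj v * v = 1" "v * cnj v = 1"
    using v1 complex_norm_square[of v] by (simp_all add: mult.commute)
  have "\<exists>A\<in>N. cinner (capply A \<Omega>) \<zeta> \<noteq> 0"
  proof (rule ccontr)
    assume "\<not> ?thesis"
    then have "\<zeta> = 0" by (intro cinner_ext_dense[OF dense_N]) auto
    then show False using \<zeta> by simp
  qed
  then obtain A where A: "A \<in> N" "cinner (capply A \<Omega>) \<zeta> \<noteq> 0" by blast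
  obtain T where T: "T \<in> N" "capply U (capply T \<Omega>) = v *\<^sub>C capply T \<Omega>" "U o\<^sub>C T o\<^sub>C cadj U = v *\<^sub>C T"
    "\<And>e. capply U e = v *\<^sub>C e \<Longrightarrow> cinner (capply T \<Omega>) e = cinner (capply A \<Omega>) e"
    using eigen_average[OF U U\<Omega> v1 A(1)] by metis
  have T0: "capply T \<Omega> \<noteq> 0" using T(4)[OF \<zeta>(2)] A(2) by auto
  have UT: "capply U (capply T x) = v *\<^sub>C capply T (capply U x)" for x
    using arg_cong[OF T(3), of "\<lambda>S. capply S (capply U x)"]
    by (simp add: unitary_op_apply[OF u] capply_scaleC_left)
  have UT': "capply U (capply (cadj T) x) = cnj v *\<^sub>C capply (cadj T) (capply U x)" for x
  proof -
    have "cadj (U o\<^sub>C T o\<^sub>C cadj U) = cnj v *\<^sub>C cadj T" by (simp add: T(3) cadj_scaleC)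
    then have "U o\<^sub>C (cadj T o\<^sub>C cadj U) = cnj v *\<^sub>C cadj T" by (simp add: cadj_compose)
    from arg_cong[OF this, of "\<lambda>S. capply S (capply U x)"] show ?thesis
      by (simp add: unitary_op_apply[OF u] capply_scaleC_left)
  qed
  have sc: "\<exists>c. S = c *\<^sub>C cid" if S: "S \<in> N" and fS: "capply U (capply S \<Omega>) = capply S \<Omega>" for S
  proof -
    obtain c where "capply S \<Omega> = c *\<^sub>C \<Omega>" using fixed[OF fS] by blast
    then have "S = c *\<^sub>C cid"
      by (intro separating S closed_ops) (simp add: capply_scaleC_left)
    then show ?thesis by blast
  qed
  obtain c where c: "cadj T o\<^sub>C T = c *\<^sub>C cid"
    using sc[of "cadj T o\<^sub>C T"] closed_ops(1)[OF N_cadj[OF T(1)] T(1)]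
    by (auto simp: UT UT' U\<Omega> capply_scaleC scaleC_scaleC vc)
  obtain c' where c': "T o\<^sub>C cadj T = c' *\<^sub>C cid"
    using sc[of "T o\<^sub>C cadj T"] closed_ops(1)[OF T(1) N_cadj[OF T(1)]]
    by (auto simp: UT UT' U\<Omega> capply_scaleC scaleC_scaleC vc)
  have TT: "capply (cadj T) (capply T x) = c *\<^sub>C x" "capply T (capply (cadj T) x) = c' *\<^sub>C x" for x
    using arg_cong[OF c, of "\<lambda>S. capply S x"] arg_cong[OF c', of "\<lambda>S. capply S x"]
    by (simp_all add: capply_scaleC_left)
  define r where "r = (norm (capply T \<Omega>))\<^sup>2"
  have r: "r > 0" using T0 by (simp add: r_def)
  have "c * cinner \<Omega> \<Omega> = cinner (capply T \<Omega>) (capply T \<Omega>)"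
    by (simp add: cinner_cadj'[symmetric] flip: cinner_scaleC_left TT(1))
  then have cr: "c = of_real r" by (simp add: cinner_self \<Omega>1 r_def)
  \<comment> \<open>The threefold product of \<open>T\<close>, \<open>cadj T\<close>,
    \<open>T\<close> at \<Omega> can be bracketed in two ways, which identifies the two
    scalars.\<close>
  have "c' *\<^sub>C capply T \<Omega> = c *\<^sub>C capply T \<Omega>"
    using TT(2)[of "capply T \<Omega>"] by (simp add: TT(1) capply_scaleC)
  then have "(c' - c) *\<^sub>C capply T \<Omega> = 0" by (simp add: scaleC_diff_left)
  then have c'r: "c' = of_real r" using T0 cr by simp
  define V where "V = complex_of_real (1 / sqrt r) *\<^sub>C T"
  have rr: "complex_of_real (sqrt r) * complex_of_real (sqrt r) = of_real r"
    using r by (simp flip: of_real_mult)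
  have V_unit: "unitary_op V"
    by (rule unitary_opI)
      (use r in \<open>simp_all add: V_def cadj_scaleC capply_scaleC_left capply_scaleC scaleC_scaleC TT cr c'r rr\<close>)
  moreover have "V \<in> N" unfolding V_def by (intro closed_ops T)
  moreover have UVU: "U o\<^sub>C V o\<^sub>C cadj U = v *\<^sub>C V"
  proof (rule cblinfun_ext)
    fix x
    have "capply (U o\<^sub>C T o\<^sub>C cadj U) x = v *\<^sub>C capply T x" by (simp add: T(3) capply_scaleC_left)
    then show "capply (U o\<^sub>C V o\<^sub>C cadj U) x = capply (v *\<^sub>C V) x"
      by (simp add: V_def capply_scaleC_left capply_scaleC scaleC_scaleC mult.commute)
  qed
  moreover have "eigenspace U v = range (\<lambda>c. c *\<^sub>C capply V \<Omega>)"
  proof (intro subset_antisym subsetI)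
    fix \<xi> assume "\<xi> \<in> eigenspace U v"
    \<comment> \<open>\<open>cadj T\<close> maps the eigenspace of \<open>v\<close> into the fixed
      vectors, which are multiples of \<Omega>; applying \<open>T\<close> shows that this eigenspace
      is one-dimensional.\<close>
    then have "capply U (capply (cadj T) \<xi>) = capply (cadj T) \<xi>"
      by (simp add: eigenspace_def UT' capply_scaleC scaleC_scaleC vc)
    then obtain d where d: "capply (cadj T) \<xi> = d *\<^sub>C \<Omega>" using fixed by blast
    have "of_real r *\<^sub>C \<xi> = d *\<^sub>C capply T \<Omega>"
      using TT(2)[of \<xi>] by (simp add: d capply_scaleC c'r)
    then have "complex_of_real (1/r) *\<^sub>C of_real r *\<^sub>C \<xi> = complex_of_real (1/r) *\<^sub>C d *\<^sub>C capply T \<Omega>" by simp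
    then have "\<xi> = (complex_of_real (1/r) * d) *\<^sub>C capply T \<Omega>" using r by (simp add: scaleC_scaleC)
    also have "capply T \<Omega> = complex_of_real (sqrt r) *\<^sub>C capply V \<Omega>"
      using r by (simp add: V_def capply_scaleC_left scaleC_scaleC flip: of_real_mult)
    finally show "\<xi> \<in> range (\<lambda>c. c *\<^sub>C capply V \<Omega>)" by (simp add: scaleC_scaleC)
  next
    fix \<xi> assume "\<xi> \<in> range (\<lambda>c. c *\<^sub>C capply V \<Omega>)"
    then show "\<xi> \<in> eigenspace U v"
      by (auto simp: eigenspace_def V_def capply_scaleC capply_scaleC_left T(2) scaleC_scaleC mult.commute mult.left_commute)
  qed
  ultimately show ?thesis by blast
qed

end

section \<open>Ergodicity and fixed vectors\<close>

text \<open>A selfadjoint \<open>S\<close> in the commutant with \<open>S \<Omega>\<close> fixed perturbs \<open>\<omega>\<close> to invariant states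
  \<open>\<langle>\<pi>(\<cdot>)(1 \<plusminus> S)\<Omega>, \<Omega>\<rangle>\<close>, which must agree with \<open>\<omega>\<close>.\<close>

context
  fixes \<alpha> :: "'a::cstar_algebra \<Rightarrow> 'a" and \<omega> :: "'a cdual" and \<pi> :: "'a \<Rightarrow> 'h::complex_hilbert operator"
    and U :: "'h operator" and \<Omega> :: 'h and K :: int
  assumes dyn: "cstar_dynamical_system \<alpha> \<omega>" and gns: "covariant_GNS \<alpha> \<omega> \<pi> U \<Omega>"
    and erg: "ergodic_state (range (\<lambda>n::int. zpow \<alpha> (n * K))) \<omega>"
begin

interpretation star_rep \<pi>
  using gns by (auto simp: covariant_GNS_def intro: star_rep.intro)

lemma GNS_facts:
  shows GNS_unitary: "unitary_op U" and GNS_fix: "capply U \<Omega> = \<Omega>"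
    and GNS_cyclic: "closure (range (\<lambda>a. capply (\<pi> a) \<Omega>)) = UNIV"
    and GNS_state: "capply \<omega> a = cinner (capply (\<pi> a) \<Omega>) \<Omega>"
    and GNS_cov: "capply (\<pi> (\<alpha> a)) (capply U x) = capply U (capply (\<pi> a) x)"
    and GNS_bij: "bij \<alpha>" and GNS_one: "capply \<omega> 1 = 1" and GNS_inv: "capply \<omega> (\<alpha> a) = capply \<omega> a"
    and GNS_norm: "norm \<Omega> = 1"
proof -
  show u: "unitary_op U" and "capply U \<Omega> = \<Omega>" and "closure (range (\<lambda>a. capply (\<pi> a) \<Omega>)) = UNIV"
    and s: "capply \<omega> a = cinner (capply (\<pi> a) \<Omega>) \<Omega>" for a
    using gns by (auto simp: covariant_GNS_def)
  show "capply (\<pi> (\<alpha> a)) (capply U x) = capply U (capply (\<pi> a) x)"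
  proof -
    have "\<pi> (\<alpha> a) = U o\<^sub>C \<pi> a o\<^sub>C cadj U" using gns by (simp add: covariant_GNS_def)
    then show ?thesis by (simp add: unitary_op_apply[OF u])
  qed
  show "bij \<alpha>" and one: "capply \<omega> 1 = 1" and "capply \<omega> (\<alpha> a) = capply \<omega> a"
    using dyn by (auto simp: cstar_dynamical_system_def star_automorphism_def is_state_def)
  have "cinner \<Omega> \<Omega> = 1" using s[of 1] one by (simp add: rep_one)
  then have "complex_of_real ((norm \<Omega>)\<^sup>2) = of_real 1" by (simp add: cinner_self)
  then have "(norm \<Omega>)\<^sup>2 = 1" by (simp only: of_real_eq_iff)
  then show "norm \<Omega> = 1" by (simp add: power2_eq_1_iff) (smt (verit) norm_ge_zero)
qed

lemma GNS_normalizes_range: "normalizes U (range \<pi>)"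
  unfolding normalizes_def
proof (intro conjI ballI GNS_unitary)
  fix T assume "T \<in> range \<pi>"
  then obtain a where T: "T = \<pi> a" by blast
  show "U o\<^sub>C T o\<^sub>C cadj U \<in> range \<pi>" using gns by (auto simp: covariant_GNS_def T)
  obtain b where "a = \<alpha> b" using GNS_bij by (meson bij_pointE)
  then have "cadj U o\<^sub>C T o\<^sub>C U = \<pi> b"
    by (intro cblinfun_ext) (simp add: T GNS_cov unitary_op_apply[OF GNS_unitary])
  then show "cadj U o\<^sub>C T o\<^sub>C U \<in> range \<pi>" by blast
qed

lemma zpow_U_cinner: "cinner (zpow (capply U) m x) (zpow (capply U) m y) = cinner x y"
  by (metis unitary_power_exists[OF GNS_unitary] unitary_cinner)

lemma zpow_cov: "capply (\<pi> (zpow \<alpha> m a)) (zpow (capply U) m x) = zpow (capply U) m (capply (\<pi> a) x)"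
proof (induction m arbitrary: a x rule: int_induct[where k = 0])
  case (step1 i)
  then show ?case by (simp add: zpow_succ GNS_bij unitary_bij[OF GNS_unitary] GNS_cov)
next
  case (step2 i)
  let ?b = "inv \<alpha> (zpow \<alpha> i a)" and ?y = "capply (cadj U) (zpow (capply U) i x)"
  have "capply U (capply (\<pi> ?b) ?y) = capply (\<pi> (\<alpha> ?b)) (capply U ?y)" by (simp add: GNS_cov)
  also have "\<dots> = zpow (capply U) i (capply (\<pi> a) x)"
    by (simp add: unitary_op_apply[OF GNS_unitary] bij_is_surj[OF GNS_bij] surj_f_inv_f step2)
  finally have "capply (\<pi> ?b) ?y = capply (cadj U) (zpow (capply U) i (capply (\<pi> a) x))"
    by (metis unitary_op_apply(1)[OF GNS_unitary])
  then show ?case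
    by (simp add: zpow_pred GNS_bij unitary_bij[OF GNS_unitary] unitary_inv[OF GNS_unitary])
qed simp

lemma perturbed_state_fixed:
  assumes S: "S \<in> commutant (range \<pi>)" and sa: "cadj S = S" and inv: "zpow (capply U) K (capply S \<Omega>) = capply S \<Omega>"
    and small: "norm S \<le> 1/2"
  shows "\<exists>c. capply S \<Omega> = c *\<^sub>C \<Omega>"
proof -
  define \<psi> where "\<psi> = vec_functional (capply S \<Omega>) \<Omega>"
  define s where "s = Re (cinner (capply S \<Omega>) \<Omega>)"
  have Sreal: "cinner (capply S y) y = of_real (Re (cinner (capply S y) y))" for y
  proof -
    have "cinner (capply S y) y = cnj (cinner (capply S y) y)"
      using cinner_cadj[of S y y] cinner_commute[of y "capply S y"] by (simp add: sa)
    then show ?thesis by (metis Reals_cnj_iff complex_is_Real_iff complex_eq_iff Im_complex_of_real Re_complex_of_real)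
  qed
  have Sbound: "\<bar>Re (cinner (capply S y) y)\<bar> \<le> (1/2) * (norm y)\<^sup>2" for y
  proof -
    have "\<bar>Re (cinner (capply S y) y)\<bar> \<le> norm (capply S y) * norm y"
      using abs_Re_le_cmod cinner_norm_le order_trans by blast
    also have "\<dots> \<le> norm S * norm y * norm y" by (intro mult_right_mono norm_capply) simp
    also have "\<dots> \<le> 1/2 * norm y * norm y" by (intro mult_right_mono small) auto
    finally show ?thesis by (simp add: power2_eq_square)
  qed
  have s_bound: "\<bar>s\<bar> \<le> 1/2" using Sbound[of \<Omega>] by (simp add: s_def GNS_norm)
  \<comment> \<open>The bound on \<open>S\<close> makes 1 + e S a positive operator and the
    normalizing factor 1 + e s positive for both signs of \<open>e\<close>.\<close>
  define \<phi> where "\<phi> e = (1 / (1 + e * s)) *\<^sub>R (\<omega> + e *\<^sub>R \<psi>)" for e :: real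
  have \<psi>_app: "capply \<psi> a = cinner (capply S (capply (\<pi> a) \<Omega>)) \<Omega>" for a
    using commutantD[OF S, of "\<pi> a" \<Omega>] by (simp add: \<psi>_def vec_functional_apply)
  have \<phi>_inv: "\<phi> e \<in> invariant_states (range (\<lambda>n::int. zpow \<alpha> (n * K)))" if e: "e = 1 \<or> e = -1" for e
  proof -
    have pos: "1 + e * s > 0" using s_bound e by auto
    have "capply (\<phi> e) (star a * a) \<in> \<real>\<^sub>\<ge>\<^sub>0" for a
    proof -
      let ?y = "capply (\<pi> a) \<Omega>"
      have 1: "capply \<omega> (star a * a) = of_real ((norm ?y)\<^sup>2)"
        by (simp add: GNS_state rep_mult rep_cinner[of "star a"] star_star cinner_self)
      have "capply \<psi> (star a * a) = cinner (capply (\<pi> (star a)) (capply S ?y)) \<Omega>"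
        using commutantD[OF S, of "\<pi> (star a)" ?y] by (simp add: \<psi>_app rep_mult)
      also have "\<dots> = cinner (capply S ?y) ?y" by (simp add: rep_cinner[of "star a"] star_star)
      finally have 2: "capply \<psi> (star a * a) = of_real (Re (cinner (capply S ?y) ?y))" by (simp only: Sreal[symmetric])
      have "0 \<le> (norm ?y)\<^sup>2 + e * Re (cinner (capply S ?y) ?y)" using Sbound[of ?y] e by auto
      then have "0 \<le> (1 / (1 + e * s)) * ((norm ?y)\<^sup>2 + e * Re (cinner (capply S ?y) ?y))" using pos by simp
      moreover have "capply (\<phi> e) (star a * a) = of_real ((1 / (1 + e * s)) * ((norm ?y)\<^sup>2 + e * Re (cinner (capply S ?y) ?y)))"
        unfolding \<phi>_def capply_scaleR_left capply_plus 1 2 by (simp add: scaleR_conv_of_real)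
      ultimately show ?thesis by (simp only: nonneg_Reals_of_real_iff)
    qed
    moreover have "capply (\<phi> e) 1 = 1"
    proof -
      have "capply \<psi> 1 = of_real s" unfolding s_def Sreal[symmetric] by (simp add: \<psi>_app rep_one)
      then have "capply (\<phi> e) 1 = (1 / (1 + e * s)) *\<^sub>R complex_of_real (1 + e * s)"
        by (simp add: \<phi>_def capply_scaleR_left capply_plus GNS_one scaleR_conv_of_real)
      then show ?thesis using pos by (simp add: scaleR_conv_of_real flip: of_real_mult del: of_real_add)
    qed
    moreover have "capply (\<phi> e) (zpow \<alpha> (n * K) a) = capply (\<phi> e) a" for n a
    proof -
      let ?Z = "zpow (capply U) (n * K)"
      have fx: "?Z \<Omega> = \<Omega>"
        using zpow_fixed[OF unitary_bij[OF GNS_unitary], of 1 \<Omega> "n * K"] by (simp add: zpow_def GNS_fix)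
      have fS: "?Z (capply S \<Omega>) = capply S \<Omega>" by (rule zpow_fixed[OF unitary_bij[OF GNS_unitary] inv])
      have "cinner (capply (\<pi> (zpow \<alpha> (n * K) a)) y) \<Omega> = cinner (capply (\<pi> a) y) \<Omega>" if "?Z y = y" for y
        using zpow_cov[of "n * K" a y] zpow_U_cinner[of "n * K" "capply (\<pi> a) y" \<Omega>] by (simp add: that fx)
      from this[OF fx] this[OF fS] show ?thesis
        by (simp add: \<phi>_def capply_scaleR_left capply_plus GNS_state \<psi>_def vec_functional_apply)
    qed
    ultimately show ?thesis by (auto simp: invariant_states_def is_state_def)
  qed
  \<comment> \<open>The two normalizing factors 1 - s and 1 + s, halved, are the weights of the
    convex combination.\<close>
  have comb: "\<omega> = (1 - (1 + s) / 2) *\<^sub>R \<phi> (-1) + ((1 + s) / 2) *\<^sub>R \<phi> 1"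
  proof -
    have ne: "1 + s \<noteq> 0" "1 - s \<noteq> 0" using s_bound by auto
    have "(1 - (1 + s) / 2) *\<^sub>R \<phi> (-1) = (1/2) *\<^sub>R (\<omega> - \<psi>)"
      using ne by (simp add: \<phi>_def field_simps)
    moreover have "((1 + s) / 2) *\<^sub>R \<phi> 1 = (1/2) *\<^sub>R (\<omega> + \<psi>)" using ne by (simp add: \<phi>_def)
    ultimately show ?thesis by (simp add: scaleR_diff_right scaleR_add_right flip: scaleR_add_left)
  qed
  have "\<phi> (-1) = \<phi> 1"
  proof (rule ccontr)
    assume "\<phi> (-1) \<noteq> \<phi> 1"
    then have "\<omega> \<in> open_segment (\<phi> (-1)) (\<phi> 1)"
      unfolding in_segment using comb s_bound by (intro conjI exI[of _ "(1 + s) / 2"]) auto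
    then show False using erg \<phi>_inv unfolding ergodic_state_def extreme_point_of_def by blast
  qed
  then have "\<omega> = \<phi> 1" using comb by (simp flip: scaleR_add_left)
  moreover have "1 + s \<noteq> 0" using s_bound by auto
  then have "(1 + s) *\<^sub>R \<phi> 1 = \<omega> + \<psi>" by (simp add: \<phi>_def)
  ultimately have "(1 + s) *\<^sub>R \<omega> = \<omega> + \<psi>" by simp
  then have \<psi>s: "\<psi> = s *\<^sub>R \<omega>" by (simp add: scaleR_add_left)
  have "capply S \<Omega> = complex_of_real s *\<^sub>C \<Omega>"
  proof (rule cinner_ext_dense[OF GNS_cyclic])
    fix z assume "z \<in> range (\<lambda>a. capply (\<pi> a) \<Omega>)"
    then obtain a where z: "z = capply (\<pi> a) \<Omega>" by blast
    have "cinner z (capply S \<Omega>) = capply \<psi> a"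
      using cinner_cadj[of S z \<Omega>] by (simp add: sa \<psi>_app z)
    also have "\<dots> = cinner z (complex_of_real s *\<^sub>C \<Omega>)"
      by (simp add: \<psi>s capply_scaleR_left GNS_state z cinner_scaleC_right scaleR_conv_of_real)
    finally show "cinner z (capply S \<Omega>) = cinner z (complex_of_real s *\<^sub>C \<Omega>)" .
  qed
  then show ?thesis by blast
qed

lemma selfadjoint_fixed:
  assumes S: "S \<in> commutant (range \<pi>)" and sa: "cadj S = S" and inv: "zpow (capply U) K (capply S \<Omega>) = capply S \<Omega>"
  shows "\<exists>c. capply S \<Omega> = c *\<^sub>C \<Omega>"
proof -
  obtain W where W: "capply W = zpow (capply U) K" using unitary_power_exists[OF GNS_unitary] by metis
  define r where "r = 1 / (2 * (norm S + 1))"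
  have nS: "norm S + 1 > 0" by (simp add: add_nonneg_pos)
  then have r: "r > 0" by (simp add: r_def)
  let ?S = "complex_of_real r *\<^sub>C S"
  have "\<exists>c. capply ?S \<Omega> = c *\<^sub>C \<Omega>"
  proof (rule perturbed_state_fixed)
    show "zpow (capply U) K (capply ?S \<Omega>) = capply ?S \<Omega>"
      using inv unfolding W[symmetric] by (simp add: capply_scaleC_left capply_scaleC)
    have "norm ?S = r * norm S" using r by (simp add: norm_scaleC)
    also have "\<dots> \<le> 1/2" using nS by (simp add: r_def field_simps)
    finally show "norm ?S \<le> 1/2" .
  qed (auto intro: commutant_scaleC S simp: cadj_scaleC sa)
  then obtain c where "complex_of_real r *\<^sub>C capply S \<Omega> = c *\<^sub>C \<Omega>" by (auto simp: capply_scaleC_left)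
  then have "complex_of_real (1/r) *\<^sub>C complex_of_real r *\<^sub>C capply S \<Omega> = complex_of_real (1/r) *\<^sub>C c *\<^sub>C \<Omega>" by simp
  then show ?thesis using r by (auto simp: scaleC_scaleC)
qed

text \<open>Extremality only speaks about selfadjoint operators in the commutant. Averaging an
  element B of the commutant yields T with T \<Omega> fixed, and the real and imaginary parts of T
  are of that kind. Density of the vectors B \<Omega> then excludes a nonzero fixed vector
  orthogonal to \<Omega>.\<close>

lemma GNS_fixed_vectors:
  assumes pair: "standard_pair (commutant (range \<pi>)) (commutant (commutant (range \<pi>))) \<Omega>"
    and e: "zpow (capply U) K e = e"
  shows "\<exists>c. e = c *\<^sub>C \<Omega>"
proof -
  let ?N = "commutant (range \<pi>)"
  interpret standard_pair ?N "commutant ?N" \<Omega> by (rule pair)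
  obtain W where W: "capply W = zpow (capply U) K" "\<And>N. normalizes U N \<Longrightarrow> normalizes W N" "unitary_op W"
    using unitary_power_exists[OF GNS_unitary] by metis
  have WN: "normalizes W ?N" by (intro W(2) normalizes_commutant GNS_normalizes_range)
  have W\<Omega>: "capply W \<Omega> = \<Omega>"
    using zpow_fixed[OF unitary_bij[OF GNS_unitary], of 1 \<Omega> K] by (simp add: W(1) zpow_def GNS_fix)
  have W\<Omega>': "capply (cadj W) \<Omega> = \<Omega>" using unitary_op_apply(1)[OF W(3), of \<Omega>] by (simp add: W\<Omega>)
  have We: "capply W e = e" by (simp add: W(1) e)
  have \<Omega>\<Omega>: "cinner \<Omega> \<Omega> = 1" by (simp add: cinner_self GNS_norm)
  define e0 where "e0 = e - cinner e \<Omega> *\<^sub>C \<Omega>"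
  have We0: "capply W e0 = e0" by (simp add: e0_def capply_diff capply_scaleC We W\<Omega>)
  have e0\<Omega>: "cinner \<Omega> e0 = 0"
    using cinner_commute[of \<Omega> e] by (simp add: e0_def cinner_diff_right cinner_scaleC_right \<Omega>\<Omega>)
  have "e0 = 0"
  proof (rule cinner_ext_dense[OF dense_N])
    fix z assume "z \<in> (\<lambda>A. capply A \<Omega>) ` ?N"
    then obtain B where B: "B \<in> ?N" "z = capply B \<Omega>" by blast
    obtain T where T: "T \<in> ?N" "capply W (capply T \<Omega>) = 1 *\<^sub>C capply T \<Omega>" "W o\<^sub>C T o\<^sub>C cadj W = 1 *\<^sub>C T"
      "\<And>e. capply W e = 1 *\<^sub>C e \<Longrightarrow> cinner (capply T \<Omega>) e = cinner (capply B \<Omega>) e"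
      using eigen_average[OF WN W\<Omega> _ B(1), of 1] by auto
    have WT': "capply W (capply (cadj T) \<Omega>) = capply (cadj T) \<Omega>"
    proof -
      have "cadj (W o\<^sub>C T o\<^sub>C cadj W) = cadj T" by (simp add: T(3))
      then have "W o\<^sub>C (cadj T o\<^sub>C cadj W) = cadj T" by (simp add: cadj_compose)
      from arg_cong[OF this, of "\<lambda>S. capply S \<Omega>"] show ?thesis by (simp add: W\<Omega>')
    qed
    have T': "cadj T \<in> ?N" by (rule N_cadj[OF T(1)])
    have "\<exists>c. capply (T + cadj T) \<Omega> = c *\<^sub>C \<Omega>"
      by (rule selfadjoint_fixed)
        (use T(2) WT' in \<open>auto intro: closed_ops T(1) T' simp: cadj_add add.commute capply_plus capply_add W(1)[symmetric]\<close>)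
    moreover have "\<exists>c. capply (\<i> *\<^sub>C (T + (- 1) *\<^sub>C cadj T)) \<Omega> = c *\<^sub>C \<Omega>"
    proof (rule selfadjoint_fixed)
      let ?D = "\<i> *\<^sub>C (T + (- 1) *\<^sub>C cadj T)"
      show "?D \<in> ?N" by (intro closed_ops(2,3) T(1) T')
      show "cadj ?D = ?D"
        by (rule cblinfun_ext) (simp only: cadj_scaleC cadj_add cadj_cadj capply_plus capply_scaleC_left,
          simp add: scaleC_minus_left scaleC_add_right scaleC_diff_right)
      show "zpow (capply U) K (capply ?D \<Omega>) = capply ?D \<Omega>"
        unfolding W(1)[symmetric] using T(2) WT'
        by (simp only: capply_plus capply_scaleC_left capply_scaleC capply_add scaleC_one)
    qed
    ultimately obtain c d where cd: "capply T \<Omega> + capply (cadj T) \<Omega> = c *\<^sub>C \<Omega>"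
      "\<i> *\<^sub>C (capply T \<Omega> - capply (cadj T) \<Omega>) = d *\<^sub>C \<Omega>"
      by (auto simp: capply_plus capply_scaleC_left scaleC_minus_left capply_minus_left)
    have "(- \<i>) *\<^sub>C \<i> *\<^sub>C (capply T \<Omega> - capply (cadj T) \<Omega>) = (- \<i>) *\<^sub>C d *\<^sub>C \<Omega>" by (simp only: cd(2))
    then have "capply T \<Omega> - capply (cadj T) \<Omega> = (- \<i> * d) *\<^sub>C \<Omega>" by (simp add: scaleC_scaleC)
    then have "2 *\<^sub>R capply T \<Omega> = (c - \<i> * d) *\<^sub>C \<Omega>"
      using cd(1) by (simp add: scaleR_2 scaleC_diff_left scaleC_minus_left algebra_simps)
    then have "cinner (2 *\<^sub>R capply T \<Omega>) e0 = 0" by (simp add: cinner_scaleC_left e0\<Omega>)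
    then have "cinner (capply T \<Omega>) e0 = 0" by (simp add: cinner_scaleR_left)
    then show "cinner z e0 = cinner z 0" using T(4)[of e0] We0 by (simp add: B(2))
  qed
  then show ?thesis by (auto simp: e0_def)
qed

end

section \<open>Orthonormal families\<close>

lemma norm_sum_orthonormal:
  fixes \<phi> :: "'i \<Rightarrow> 'h::complex_hilbert"
  assumes F: "finite F" and on: "\<And>i j. i \<in> F \<Longrightarrow> j \<in> F \<Longrightarrow> cinner (\<phi> i) (\<phi> j) = (if i = j then 1 else 0)"
  shows "(norm (\<Sum>i\<in>F. c i *\<^sub>C \<phi> i))\<^sup>2 = (\<Sum>i\<in>F. (cmod (c i))\<^sup>2)"
proof -
  have inner: "cinner (c i *\<^sub>C \<phi> i) (\<Sum>j\<in>F. c j *\<^sub>C \<phi> j) = of_real ((cmod (c i))\<^sup>2)" if "i \<in> F" for i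
  proof -
    have "cinner (c i *\<^sub>C \<phi> i) (\<Sum>j\<in>F. c j *\<^sub>C \<phi> j) = (\<Sum>j\<in>F. if i = j then c i * cnj (c j) else 0)"
      unfolding cinner_sum_right
      by (intro sum.cong refl) (use on that in \<open>simp add: cinner_scaleC_left cinner_scaleC_right\<close>)
    also have "\<dots> = c i * cnj (c i)" using F that by simp
    finally show ?thesis by (simp add: complex_norm_square del: of_real_power)
  qed
  have "cinner (\<Sum>i\<in>F. c i *\<^sub>C \<phi> i) (\<Sum>j\<in>F. c j *\<^sub>C \<phi> j) = (\<Sum>i\<in>F. of_real ((cmod (c i))\<^sup>2))"
    unfolding cinner_sum_left[of "\<lambda>i. c i *\<^sub>C \<phi> i"] by (intro sum.cong refl inner)
  then have "complex_of_real ((norm (\<Sum>i\<in>F. c i *\<^sub>C \<phi> i))\<^sup>2) = of_real (\<Sum>i\<in>F. (cmod (c i))\<^sup>2)"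
    by (simp only: cinner_self of_real_sum)
  then show ?thesis by (simp only: of_real_eq_iff)
qed

lemma bessel_finite:
  fixes \<phi> :: "'i \<Rightarrow> 'h::complex_hilbert"
  assumes F: "finite F" and on: "\<And>i j. i \<in> F \<Longrightarrow> j \<in> F \<Longrightarrow> cinner (\<phi> i) (\<phi> j) = (if i = j then 1 else 0)"
  shows "(\<Sum>i\<in>F. (cmod (cinner x (\<phi> i)))\<^sup>2) \<le> (norm x)\<^sup>2"
proof -
  let ?p = "\<Sum>i\<in>F. cinner x (\<phi> i) *\<^sub>C \<phi> i" and ?s = "\<Sum>i\<in>F. (cmod (cinner x (\<phi> i)))\<^sup>2"
  have "cinner x ?p = (\<Sum>i\<in>F. of_real ((cmod (cinner x (\<phi> i)))\<^sup>2))"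
    unfolding cinner_sum_right cinner_scaleC_right complex_norm_square by (simp add: mult.commute)
  then have "Re (cinner x ?p) = ?s" by (simp flip: of_real_sum)
  then have "(norm (x - ?p))\<^sup>2 = (norm x)\<^sup>2 - ?s"
    using norm_sum_orthonormal[OF F on, of "\<lambda>i. cinner x (\<phi> i)"] by (simp add: norm_diff_sq)
  then show ?thesis using zero_le_power2[of "norm (x - ?p)"] by linarith
qed

text \<open>Squared norms of finite partial sums are sums of squares, so the net over finite subsets
  is Cauchy once the squares are summable.\<close>

lemma orthonormal_summable:
  fixes \<phi> :: "'i \<Rightarrow> 'h::complex_hilbert"
  assumes on: "\<And>i j. i \<in> I \<Longrightarrow> j \<in> I \<Longrightarrow> cinner (\<phi> i) (\<phi> j) = (if i = j then 1 else 0)"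
    and C: "\<And>F. finite F \<Longrightarrow> F \<subseteq> I \<Longrightarrow> (\<Sum>i\<in>F. (cmod (c i))\<^sup>2) \<le> C\<^sup>2" "C \<ge> 0"
  shows "(\<lambda>i. c i *\<^sub>C \<phi> i) summable_on I" and "norm (\<Sum>\<^sub>\<infinity>i\<in>I. c i *\<^sub>C \<phi> i) \<le> C"
proof -
  let ?f = "\<lambda>i. c i *\<^sub>C \<phi> i" and ?g = "\<lambda>i. (cmod (c i))\<^sup>2"
  have nrm: "(norm (sum ?f F))\<^sup>2 = sum ?g F" if "finite F" "F \<subseteq> I" for F
    by (rule norm_sum_orthonormal[OF that(1)]) (rule on; use that(2) in blast)
  have sg: "?g summable_on I"
    by (rule nonneg_bdd_above_summable_on) (auto intro!: bdd_aboveI[of _ "C\<^sup>2"] C)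
  have "cauchy_filter (filtermap (sum ?f) (finite_subsets_at_top I))"
    unfolding cauchy_filter_metric_filtermap
  proof (intro allI impI)
    fix e :: real assume e: "e > 0"
    obtain F0 where F0: "finite F0" "F0 \<subseteq> I" "dist (sum ?g F0) (infsum ?g I) \<le> e\<^sup>2 / 16"
      using infsum_finite_approximation[OF sg, of "e\<^sup>2 / 16"] e by auto
    have near: "dist (sum ?f F) (sum ?f F0) < e / 2" if F: "finite F" "F0 \<subseteq> F" "F \<subseteq> I" for F
    proof -
      have "sum ?g F \<le> infsum ?g I" by (rule finite_sum_le_infsum[OF sg F(1,3)]) simp
      then have "sum ?g F - sum ?g F0 \<le> e\<^sup>2 / 16" using F0(3) unfolding dist_real_def by arith
      moreover have "sum ?g F - sum ?g F0 = (norm (sum ?f (F - F0)))\<^sup>2"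
        using nrm[of "F - F0"] F by (simp add: sum_diff subset_iff)
      moreover have "sum ?f (F - F0) = sum ?f F - sum ?f F0" using F by (simp add: sum_diff)
      moreover have "e\<^sup>2 / 16 < (e/2)\<^sup>2" using e by (simp add: power2_eq_square)
      ultimately have "(norm (sum ?f F - sum ?f F0))\<^sup>2 < (e/2)\<^sup>2" by simp
      then show ?thesis unfolding dist_norm by (rule power_less_imp_less_base) (use e in simp)
    qed
    have "dist (sum ?f F) (sum ?f F') < e" if "finite F" "F0 \<subseteq> F" "F \<subseteq> I" "finite F'" "F0 \<subseteq> F'" "F' \<subseteq> I" for F F'
      using near[OF that(1-3)] near[OF that(4-6)] dist_triangle2[of "sum ?f F" "sum ?f F'" "sum ?f F0"] by linarith
    moreover have "\<forall>\<^sub>F F in finite_subsets_at_top I. finite F \<and> F0 \<subseteq> F \<and> F \<subseteq> I"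
      by (rule eventually_finite_subsets_at_top[THEN iffD2]) (use F0 in blast)
    ultimately show "\<exists>P. eventually P (finite_subsets_at_top I) \<and>
        (\<forall>x y. P x \<and> P y \<longrightarrow> dist (sum ?f x) (sum ?f y) < e)"
      by (intro exI[of _ "\<lambda>F. finite F \<and> F0 \<subseteq> F \<and> F \<subseteq> I"]) blast
  qed
  moreover have "complete (UNIV :: 'h set)"
    by (simp add: complete_eq_closed)
  ultimately obtain L where L: "(sum ?f \<longlongrightarrow> L) (finite_subsets_at_top I)"
    using complete_uniform[where S = "UNIV :: 'h set"] by (force simp: filterlim_def)
  then show "?f summable_on I" unfolding summable_on_def has_sum_def by blast
  have "infsum ?f I = L" using L by (intro infsumI) (simp add: has_sum_def)
  moreover have "norm L \<le> C"
  proof (rule tendsto_upperbound[OF tendsto_norm[OF L]])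
    show "\<forall>\<^sub>F F in finite_subsets_at_top I. norm (sum ?f F) \<le> C"
    proof (rule eventually_finite_subsets_at_top_weakI)
      fix F assume "finite F" "F \<subseteq> I"
      then have "(norm (sum ?f F))\<^sup>2 \<le> C\<^sup>2" using nrm C(1) by simp
      then show "norm (sum ?f F) \<le> C" using C(2) by (rule power2_le_imp_le)
    qed
  qed simp
  ultimately show "norm (infsum ?f I) \<le> C" by simp
qed

section \<open>Eigenvectors of powers\<close>

text \<open>\<open>zpow\<close> lives on functions; here the power is an operator again, so that
  adjoints and conjugation make sense for it.\<close>

definition upow :: "'h::complex_hilbert operator \<Rightarrow> int \<Rightarrow> 'h operator"
  where "upow U k = (SOME W. capply W = zpow (capply U) k)"

lemma upow_apply: "unitary_op U \<Longrightarrow> capply (upow U k) = zpow (capply U) k"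
  unfolding upow_def by (rule someI_ex) (metis unitary_power_exists)

lemma upow_unique: "unitary_op U \<Longrightarrow> capply W = zpow (capply U) k \<Longrightarrow> upow U k = W"
  by (metis upow_apply capply_inject)

lemma upow_normalizes: "unitary_op U \<Longrightarrow> normalizes U N \<Longrightarrow> normalizes (upow U k) N"
  by (metis unitary_power_exists upow_unique)

lemma upow_unitary: "unitary_op U \<Longrightarrow> unitary_op (upow U k)"
  by (metis unitary_power_exists upow_unique)

lemma upow_add: "unitary_op U \<Longrightarrow> capply (upow U (j + k)) x = capply (upow U j) (capply (upow U k) x)"
  by (simp add: upow_apply zpow_add unitary_bij)

lemma upow_0: "unitary_op U \<Longrightarrow> capply (upow U 0) x = x"
  by (simp add: upow_apply)

lemma upow_1: "unitary_op U \<Longrightarrow> capply (upow U 1) x = capply U x"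
  by (simp add: upow_apply zpow_def)

lemma upow_cadj: "unitary_op U \<Longrightarrow> capply (cadj (upow U k)) x = capply (upow U (- k)) x"
  by (metis upow_add upow_0 upow_unitary unitary_op_apply(1) add.right_inverse)

lemma upow_funpow: "unitary_op U \<Longrightarrow> (capply (upow U k) ^^ n) x = capply (upow U (int n * k)) x"
  by (simp add: upow_apply zpow_mult_nat unitary_bij)

lemma upow_eigen:
  assumes U: "unitary_op U" and "capply U x = \<mu> *\<^sub>C x" "\<mu> \<noteq> 0"
  shows "capply (upow U k) x = \<mu> powi k *\<^sub>C x"
proof (induction k rule: int_induct[where k = 0])
  case base
  show ?case by (simp add: upow_0[OF U])
next
  case (step1 i)
  then show ?case
    using assms(3) upow_add[OF U, of i 1 x]
    by (simp add: upow_1[OF U] assms(2) capply_scaleC scaleC_scaleC power_int_add mult.commute)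
next
  case (step2 i)
  have "capply (upow U (- 1)) (\<mu> *\<^sub>C x) = x"
    using upow_add[OF U, of "-1" 1 x] by (simp add: upow_1[OF U] upow_0[OF U] assms(2))
  then have "inverse \<mu> *\<^sub>C \<mu> *\<^sub>C capply (upow U (- 1)) x = inverse \<mu> *\<^sub>C x" by (simp add: capply_scaleC)
  then have "capply (upow U (- 1)) x = inverse \<mu> *\<^sub>C x" using assms(3) by (simp add: scaleC_scaleC)
  then show ?case
    using step2 assms(3) upow_add[OF U, of i "-1" x]
    by (simp add: capply_scaleC scaleC_scaleC power_int_diff divide_inverse mult.commute)
qed

lemma sum_root_powers:
  fixes w :: complex
  assumes "w ^ m = 1" "w \<noteq> 1" shows "(\<Sum>j<m. w ^ j) = 0"
  using geometric_sum[OF assms(2), of m] assms(1) by simp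

text \<open>A discrete Fourier transform splits an eigenvector of \<open>U\<^sup>m\<close> into eigenvectors of \<open>U\<close>.\<close>

lemma eigen_power_split_nat:
  assumes U: "unitary_op U" and m: "m > 0" and y: "(capply U ^^ m) y = ev *\<^sub>C y"
  obtains z \<mu> where "y = (\<Sum>j<m. z j)" "\<And>j. capply U (z j) = \<mu> j *\<^sub>C z j" "\<And>j. z j \<noteq> 0 \<Longrightarrow> \<mu> j \<noteq> 0 \<and> \<mu> j ^ m = ev"
proof (cases "y = 0")
  case True
  show ?thesis by (rule that[of "\<lambda>_. 0" "\<lambda>_. 1"]) (simp_all add: True)
next
  case False
  have ev1: "cmod ev = 1"
    using unitary_funpow_norm[OF U, of m y] False by (simp add: y norm_scaleC)
  \<comment> \<open>One root of order \<open>m\<close> of \<open>ev\<close>; the others are its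
    multiples by powers of the primitive root of unity \<open>\<zeta>\<close>.\<close>
  define \<mu>0 where "\<mu>0 = cis (Arg ev / real m)"
  have ev0: "ev \<noteq> 0" using ev1 by auto
  have "\<mu>0 ^ m = cis (Arg ev)" unfolding \<mu>0_def Complex.DeMoivre using m by simp
  also have "\<dots> = ev" using cis_Arg[OF ev0] ev1 by (simp add: sgn_div_norm)
  finally have \<mu>0: "\<mu>0 ^ m = ev" .
  define \<zeta> where "\<zeta> = exp (2 * of_real pi * \<i> * of_nat 1 / of_nat m)"
  have \<zeta>m: "\<zeta> ^ m = 1" unfolding \<zeta>_def by (rule complex_root_unity) (use m in simp)
  have \<zeta>i: "\<zeta> ^ i \<noteq> 1" if "0 < i" "i < m" for i
  proof -
    have "\<zeta> ^ i = exp (2 * of_real pi * \<i> * of_nat i / of_nat m)"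
      unfolding \<zeta>_def by (simp add: exp_of_nat_mult[symmetric] mult_ac)
    then show ?thesis
      using complex_root_unity_eq_1[of m i] m that by (simp add: nat_dvd_not_less)
  qed
  define \<mu> where "\<mu> j = \<mu>0 * \<zeta> ^ j" for j
  have \<mu>0_nz: "\<mu>0 \<noteq> 0" by (simp add: \<mu>0_def)
  have \<mu>_nz: "\<mu> j \<noteq> 0" for j by (simp add: \<mu>_def \<mu>0_nz \<zeta>_def)
  have \<mu>m: "\<mu> j ^ m = ev" for j
    by (simp add: \<mu>_def power_mult_distrib \<mu>0 power_mult[symmetric] mult.commute[of j])
      (simp add: power_mult \<zeta>m)
  define d where "d j = inverse (\<mu> j)" for j
  \<comment> \<open>The component of \<open>y\<close> at the eigenvalue \<open>\<mu> j\<close>. The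
    terms of the sum are periodic, the one at \<open>m\<close> being again the one at
    \<open>0\<close>, because \<open>\<mu> j ^ m = ev\<close>.\<close>
  define z where "z j = (1 / real m) *\<^sub>R (\<Sum>i<m. d j ^ i *\<^sub>C (capply U ^^ i) y)" for j
  have "capply U (z j) = \<mu> j *\<^sub>C z j" for j
  proof -
    let ?t = "\<lambda>i. d j ^ i *\<^sub>C (capply U ^^ i) y"
    have dm: "\<mu> j * d j = 1" using \<mu>_nz by (simp add: d_def)
    have "capply U (\<Sum>i<m. ?t i) = (\<Sum>i<m. \<mu> j *\<^sub>C ?t (Suc i))"
      unfolding capply_sum
      by (intro sum.cong refl) (simp add: capply_scaleC scaleC_scaleC dm mult.assoc[symmetric])
    also have "\<dots> = \<mu> j *\<^sub>C (\<Sum>i<m. ?t (Suc i))" by (rule scaleC_sum_right[symmetric])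
    also have "(\<Sum>i<m. ?t (Suc i)) = (\<Sum>i<m. ?t i) + (?t m - ?t 0)"
      using sum_lessThan_telescope[of ?t m] by (simp add: sum_subtractf algebra_simps)
    also have "?t m = ?t 0"
      using \<mu>m[of j] ev0 by (simp add: y scaleC_scaleC d_def power_inverse)
    finally show ?thesis by (simp add: z_def capply_scaleR scaleC_scaleR_commute)
  qed
  moreover have "y = (\<Sum>j<m. z j)"
  proof -
    \<comment> \<open>Orthogonality of characters: summing over \<open>j\<close> retains only the
      term \<open>i = 0\<close>.\<close>
    have coef: "(\<Sum>j<m. d j ^ i) = (if i = 0 then of_nat m else 0)" if i: "i < m" for i
    proof (cases "i = 0")
      case False
      have "d j ^ i = inverse \<mu>0 ^ i * (inverse (\<zeta> ^ i)) ^ j" for j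
        by (simp add: d_def \<mu>_def power_mult_distrib power_inverse[symmetric] power_mult[symmetric] mult.commute)
      moreover have "(\<Sum>j<m. (inverse (\<zeta> ^ i)) ^ j) = 0"
      proof (rule sum_root_powers)
        have "(\<zeta> ^ i) ^ m = 1" by (metis \<zeta>m mult.commute power_mult power_one)
        then show "(inverse (\<zeta> ^ i)) ^ m = 1" by (simp add: power_inverse)
        show "inverse (\<zeta> ^ i) \<noteq> 1" using \<zeta>i[of i] i False by simp
      qed
      ultimately show ?thesis using False by (simp flip: sum_distrib_left)
    qed simp
    have "(\<Sum>j<m. z j) = (1 / real m) *\<^sub>R (\<Sum>i<m. \<Sum>j<m. d j ^ i *\<^sub>C (capply U ^^ i) y)"
      unfolding z_def scaleR_sum_right[symmetric] by (subst sum.swap) (rule refl)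
    also have "(\<Sum>i<m. \<Sum>j<m. d j ^ i *\<^sub>C (capply U ^^ i) y) = (\<Sum>i<m. (\<Sum>j<m. d j ^ i) *\<^sub>C (capply U ^^ i) y)"
      by (intro sum.cong refl) (simp add: linear_sum[OF bounded_linear.linear[OF bounded_linear_scaleC_left]])
    also have "\<dots> = (\<Sum>i<m. if i = 0 then of_nat m *\<^sub>C y else 0)"
      by (intro sum.cong refl) (auto simp: coef)
    also have "\<dots> = real m *\<^sub>R y" using m by (simp flip: scaleC_of_real)
    finally show ?thesis using m by simp
  qed
  ultimately show ?thesis using that[of z \<mu>] \<mu>_nz \<mu>m by blast
qed

text \<open>Lets facts about eigenvectors of \<open>U\<close> decide about eigenvectors of its
  powers \<open>k1\<close> and \<open>k2\<close>. Negative exponents reduce to positive ones by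
  inverting \<open>ev\<close>.\<close>

lemma eigen_power_split:
  assumes U: "unitary_op U" and k: "k \<noteq> 0" and y: "capply (upow U k) y = ev *\<^sub>C y" and ev: "ev \<noteq> 0"
  obtains m :: nat and z \<mu> where "y = (\<Sum>j<m. z j)" "\<And>j. capply U (z j) = \<mu> j *\<^sub>C z j"
    "\<And>j. z j \<noteq> 0 \<Longrightarrow> \<mu> j powi k = ev"
proof (cases "k > 0")
  case True
  have eq: "(capply U ^^ nat k) y = ev *\<^sub>C y" using y True by (simp add: upow_apply[OF U] zpow_def)
  show ?thesis
    by (rule eigen_power_split_nat[OF U _ eq]) (use True that in \<open>auto simp: power_int_def\<close>)
next
  case False
  have "capply (upow U (- k)) (ev *\<^sub>C y) = y"
    using upow_add[OF U, of "- k" k y] by (simp add: upow_0[OF U] y)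
  then have "inverse ev *\<^sub>C ev *\<^sub>C capply (upow U (- k)) y = inverse ev *\<^sub>C y" by (simp add: capply_scaleC)
  then have "capply (upow U (- k)) y = inverse ev *\<^sub>C y" using ev by (simp add: scaleC_scaleC)
  then have eq: "(capply U ^^ nat (- k)) y = inverse ev *\<^sub>C y" using False by (simp add: upow_apply[OF U] zpow_def)
  show ?thesis
  proof (rule eigen_power_split_nat[OF U _ eq])
    show "0 < nat (- k)" using False k by simp
    fix z \<mu> assume z: "y = (\<Sum>j<nat (- k). z j)" "\<And>j. capply U (z j) = \<mu> j *\<^sub>C z j"
      "\<And>j. z j \<noteq> 0 \<Longrightarrow> \<mu> j \<noteq> 0 \<and> \<mu> j ^ nat (- k) = inverse ev"
    have "\<mu> j powi k = ev" if "z j \<noteq> 0" for j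
    proof -
      have "\<mu> j powi k = inverse (\<mu> j ^ nat (- k))" using False k by (simp add: power_int_def power_inverse)
      then show ?thesis using z(3)[OF that] by simp
    qed
    then show thesis using that z(1,2) by blast
  qed
qed

lemma finite_powi_roots:
  assumes "k \<noteq> 0" shows "finite {w::complex. w powi k = c}"
proof (cases "k > 0")
  case True
  then have "{w::complex. w powi k = c} = {w. w ^ nat k = c}" by (auto simp: power_int_def)
  then show ?thesis using True by (simp add: finite_nth_roots)
next
  case False
  then have "{w::complex. w powi k = c} \<subseteq> {w. w ^ nat (- k) = inverse c}"
    using assms by (auto simp: power_int_def power_inverse)
  moreover have "finite {w::complex. w ^ nat (- k) = inverse c}" using False assms by (intro finite_nth_roots) simp
  ultimately show ?thesis by (rule finite_subset)
qed

text \<open>Used for the group of eigenvalues, with a commutation phase as the multiplicative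
  function \<open>h\<close>.\<close>

lemma powi_character:
  fixes h :: "complex \<Rightarrow> complex"
  assumes G: "0 \<notin> G" "\<And>x y. x \<in> G \<Longrightarrow> y \<in> G \<Longrightarrow> x * y \<in> G" "\<And>x. x \<in> G \<Longrightarrow> inverse x \<in> G"
    and h: "\<And>x y. x \<in> G \<Longrightarrow> y \<in> G \<Longrightarrow> h (x * y) = h x * h y" "\<And>x. x \<in> G \<Longrightarrow> h x \<noteq> 0" and x: "x \<in> G"
  shows "x powi n \<in> G \<and> h (x powi n) = h x powi n"
proof -
  have x0: "x \<noteq> 0" using G(1) x by auto
  have one: "1 \<in> G" using G(2)[OF x G(3)[OF x]] x0 by simp
  have h1: "h 1 = 1" using h(1)[OF one one] h(2)[OF one] by simp
  have hinv: "h (inverse x) = inverse (h x)"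
    using h(1)[OF x G(3)[OF x]] x0 h1 h(2)[OF x] by (simp add: field_simps)
  show ?thesis
  proof (induction n rule: int_induct[where k = 0])
    case base
    then show ?case by (simp add: one h1)
  next
    case (step1 i)
    then show ?case using G(2)[OF _ x] h(1)[OF _ x] x0 h(2)[OF x] by (simp add: power_int_add)
  next
    case (step2 i)
    then show ?case using G(2)[OF _ G(3)[OF x]] h(1)[OF _ G(3)[OF x]] x0 h(2)[OF x]
      by (simp add: power_int_diff divide_inverse hinv)
  qed
qed

section \<open>The limit theorem for a pair in standard position\<close>

text \<open>The hypotheses are symmetric in \<open>M\<close> and \<open>M'\<close>; statements about
  \<open>W\<close> come from interpreting the same locale for the swapped pair.\<close>

locale ergodic_pair = standard_pair M M' \<Omega>
  for M M' :: "'h::complex_hilbert operator set" and \<Omega> :: 'h +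
  fixes U :: "'h operator" and k1 k2 :: int and t :: "'h \<Rightarrow> 'h \<Rightarrow> 'k::complex_hilbert"
  assumes UM: "normalizes U M" and UM': "normalizes U M'" and U\<Omega>: "capply U \<Omega> = \<Omega>" and norm\<Omega>: "norm \<Omega> = 1"
    and fixK: "\<And>e. capply (upow U (k2 - k1)) e = e \<Longrightarrow> \<exists>c. e = c *\<^sub>C \<Omega>"
    and k1: "k1 \<noteq> 0" and k2: "k2 \<noteq> 0" and t: "hilbert_tensor t"
begin

lemma swapped: "ergodic_pair M' M \<Omega> U k1 k2 t"
  by (rule ergodic_pair.intro[OF swap]) (rule ergodic_pair_axioms.intro[OF UM' UM U\<Omega> norm\<Omega> fixK k1 k2 t])

lemma unitary: "unitary_op U"
  using UM by (simp add: normalizes_def)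

abbreviation V where "V \<equiv> eigen_unitary M U \<Omega>"
abbreviation W where "W \<equiv> eigen_unitary M' U \<Omega>"
abbreviation sp where "sp \<equiv> point_spectrum U"
abbreviation pw where "pw \<equiv> upow U"

lemma fix1:
  assumes "capply U e = e" shows "\<exists>c. e = c *\<^sub>C \<Omega>"
proof (rule fixK)
  show "capply (pw (k2 - k1)) e = e"
    using upow_eigen[OF unitary, of e 1 "k2 - k1"] assms by simp
qed

lemma V_props:
  assumes "v \<in> sp"
  shows V_M: "V v \<in> M" and V_unitary: "unitary_op (V v)" and V_cov: "U o\<^sub>C V v o\<^sub>C cadj U = v *\<^sub>C V v"
    and V_space: "eigenspace U v = range (\<lambda>c. c *\<^sub>C capply (V v) \<Omega>)"
  using someI_ex[OF eigen_unitary_exists[OF UM U\<Omega> norm\<Omega> fix1 assms]]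
  unfolding eigen_unitary_def by auto

lemma cmod_sp: "v \<in> sp \<Longrightarrow> cmod v = 1"
proof -
  assume "v \<in> sp"
  then obtain \<xi> where "\<xi> \<noteq> 0" "capply U \<xi> = v *\<^sub>C \<xi>" by (auto simp: point_spectrum_def eigenspace_def)
  then show "cmod v = 1" using unitary_norm[OF unitary, of \<xi>] by (simp add: norm_scaleC)
qed

lemma sp_nonzero: "v \<in> sp \<Longrightarrow> v \<noteq> 0"
  using cmod_sp by force

lemma spI: "capply U x = v *\<^sub>C x \<Longrightarrow> x \<noteq> 0 \<Longrightarrow> v \<in> sp"
  by (auto simp: point_spectrum_def eigenspace_def)

lemma U_V: "v \<in> sp \<Longrightarrow> capply U (capply (V v) x) = v *\<^sub>C capply (V v) (capply U x)"
  using arg_cong[OF V_cov, of v "\<lambda>S. capply S (capply U x)"]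
  by (simp add: unitary_op_apply[OF unitary] capply_scaleC_left)

lemma U_V\<Omega>: "v \<in> sp \<Longrightarrow> capply U (capply (V v) \<Omega>) = v *\<^sub>C capply (V v) \<Omega>"
  by (simp add: U_V U\<Omega>)

lemma pw_V:
  assumes v: "v \<in> sp"
  shows "capply (pw m) (capply (V v) x) = v powi m *\<^sub>C capply (V v) (capply (pw m) x)"
proof (induction m rule: int_induct[where k = 0])
  case base
  show ?case by (simp add: upow_0[OF unitary])
next
  case (step1 i)
  have "capply (pw (i + 1)) y = capply U (capply (pw i) y)" for y
    using upow_add[OF unitary, of 1 i y] by (simp add: upow_1[OF unitary] add.commute)
  then show ?case
    using step1 sp_nonzero[OF v] by (simp add: capply_scaleC U_V[OF v] scaleC_scaleC power_int_add)
next
  case (step2 i)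
  have 1: "capply (pw i) y = capply U (capply (pw (i - 1)) y)" for y
    using upow_add[OF unitary, of 1 "i - 1" y] by (simp add: upow_1[OF unitary])
  have "capply U (capply (pw (i - 1)) (capply (V v) x)) = capply U (v powi (i - 1) *\<^sub>C capply (V v) (capply (pw (i - 1)) x))"
    using step2(2) sp_nonzero[OF v]
    by (simp add: 1 capply_scaleC U_V[OF v] scaleC_scaleC power_int_diff)
  then show ?case by (metis unitary_op_apply(1)[OF unitary])
qed

lemma norm_V\<Omega>: "v \<in> sp \<Longrightarrow> norm (capply (V v) x) = norm x"
  by (rule unitary_norm[OF V_unitary])

lemma V\<Omega>_inner: "v \<in> sp \<Longrightarrow> cinner (capply (V v) \<Omega>) (capply (V v) \<Omega>) = 1"
  by (simp add: cinner_self norm_V\<Omega> norm\<Omega>)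

lemma V_nonzero: "v \<in> sp \<Longrightarrow> capply (V v) x = 0 \<longleftrightarrow> x = 0"
  using norm_V\<Omega>[of v x] by (metis norm_eq_zero)

lemma \<Omega>_nonzero: "\<Omega> \<noteq> 0"
  using norm\<Omega> by auto

lemma eigen_unique:
  assumes "v \<in> sp" "capply U x = v *\<^sub>C x"
  shows "x = cinner x (capply (V v) \<Omega>) *\<^sub>C capply (V v) \<Omega>"
proof -
  have "x \<in> eigenspace U v" using assms(2) by (simp add: eigenspace_def)
  then obtain c where c: "x = c *\<^sub>C capply (V v) \<Omega>" using V_space[OF assms(1)] by auto
  have "cinner x (capply (V v) \<Omega>) = c" by (simp add: c cinner_scaleC_left V\<Omega>_inner[OF assms(1)])
  then show ?thesis by (simp add: c)
qed

lemma eigen_orthogonal: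
  assumes "v \<in> sp" "w \<in> sp" "v \<noteq> w" "capply U x = v *\<^sub>C x" "capply U y = w *\<^sub>C y"
  shows "cinner x y = 0"
proof (rule ccontr)
  assume ne: "cinner x y \<noteq> 0"
  have "cinner x y = v * cnj w * cinner x y"
    using unitary_cinner[OF unitary, of x y, symmetric]
    by (simp only: assms(4,5) cinner_scaleC_left cinner_scaleC_right mult_ac)
  then have "v * cnj w = 1" using ne by simp
  moreover have "w * cnj w = 1" using cmod_sp[OF assms(2)] complex_norm_square[of w] by simp
  ultimately have "v * cnj w = w * cnj w" by simp
  then show False using assms(3) sp_nonzero[OF assms(2)] by simp
qed

lemma V\<Omega>_orthonormal: "v \<in> sp \<Longrightarrow> w \<in> sp \<Longrightarrow> cinner (capply (V v) \<Omega>) (capply (V w) \<Omega>) = (if v = w then 1 else 0)"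
  using V\<Omega>_inner[of v] eigen_orthogonal[of v w "capply (V v) \<Omega>" "capply (V w) \<Omega>"] U_V\<Omega> by auto

lemma sp_mult: "v \<in> sp \<Longrightarrow> w \<in> sp \<Longrightarrow> v * w \<in> sp"
  by (rule spI[of "capply (V v) (capply (V w) \<Omega>)"])
    (simp_all add: U_V U\<Omega> capply_scaleC scaleC_scaleC V_nonzero \<Omega>_nonzero)

lemma sp_inverse:
  assumes v: "v \<in> sp" shows "inverse v \<in> sp"
proof (rule spI)
  let ?y = "capply (cadj (V v)) \<Omega>"
  have y: "capply (V v) ?y = \<Omega>" by (rule unitary_op_apply(2)[OF V_unitary[OF v]])
  have "v *\<^sub>C capply (V v) (capply U ?y) = capply (V v) ?y"
    using U_V[OF v, of ?y] by (simp add: y U\<Omega>)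
  then have "capply (V v) (v *\<^sub>C capply U ?y) = capply (V v) ?y" by (simp add: capply_scaleC)
  then have "v *\<^sub>C capply U ?y = ?y" by (metis unitary_op_apply(1)[OF V_unitary[OF v]])
  then have "inverse v *\<^sub>C v *\<^sub>C capply U ?y = inverse v *\<^sub>C ?y" by simp
  then show "capply U ?y = inverse v *\<^sub>C ?y" using sp_nonzero[OF v] by (simp add: scaleC_scaleC)
  show "?y \<noteq> 0" using y \<Omega>_nonzero by auto
qed

text \<open>The arithmetic form of ergodicity: an eigenvector for such a \<open>v\<close> is fixed
  by the power \<open>k2 - k1\<close>, hence a multiple of \<Omega>.\<close>

lemma sp_unit:
  assumes v: "v \<in> sp" and vK: "v powi (k2 - k1) = 1" shows "v = 1"
proof -
  let ?e = "capply (V v) \<Omega>"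
  have "capply (pw (k2 - k1)) ?e = ?e"
    using upow_eigen[OF unitary U_V\<Omega>[OF v] sp_nonzero[OF v], of "k2 - k1"] vK by simp
  then obtain c where "?e = c *\<^sub>C \<Omega>" using fixK by blast
  then have "capply U ?e = ?e" by (simp add: capply_scaleC U\<Omega>)
  then have "(v - 1) *\<^sub>C ?e = 0" using U_V\<Omega>[OF v] by (simp add: scaleC_diff_left)
  then show ?thesis using V_nonzero[OF v] \<Omega>_nonzero by simp
qed

text \<open>The quotient \<open>z\<close> of the first coordinates satisfies z^k1 = z^k2, so
  \<open>sp_unit\<close> applies. This is why the range vectors in the sum for the partial isometry
  are orthogonal.\<close>

lemma Sigma_inj:
  assumes "(v, w) \<in> Sigma_set U k1 k2" "(v', w') \<in> Sigma_set U k1 k2" "v * w = v' * w'"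
  shows "v = v' \<and> w = w'"
proof -
  have m: "v \<in> sp" "w \<in> sp" "v' \<in> sp" "w' \<in> sp" and
    e: "v powi k1 * w powi k2 = 1" "v' powi k1 * w' powi k2 = 1"
    using assms(1,2) by (auto simp: Sigma_set_def)
  have nz: "v \<noteq> 0" "w \<noteq> 0" "v' \<noteq> 0" "w' \<noteq> 0" using m sp_nonzero by auto
  define z where "z = v' * inverse v"
  have z: "z \<in> sp" unfolding z_def by (intro sp_mult sp_inverse m)
  have w: "w = z * w'" using assms(3) nz by (simp add: z_def field_simps)
  have v': "v' = z * v" using nz by (simp add: z_def)
  have z0: "z \<noteq> 0" using sp_nonzero[OF z] .
  have 1: "v powi k1 * (z powi k2 * w' powi k2) = 1" using e(1) by (simp add: w power_int_mult_distrib)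
  have 2: "z powi k1 * v powi k1 * w' powi k2 = 1" using e(2) by (simp add: v' power_int_mult_distrib)
  have "z powi k2 = z powi k1"
  proof -
    have "z powi k2 * (v powi k1 * w' powi k2) = z powi k1 * (v powi k1 * w' powi k2)"
      using 1 2 by (simp add: mult_ac)
    then show ?thesis using nz by simp
  qed
  then have "z powi (k2 - k1) = 1" using z0 by (simp add: power_int_diff)
  then have "z = 1" by (rule sp_unit[OF z])
  then show ?thesis using v' w by simp
qed

subsection \<open>Commutation of the eigenunitaries\<close>

text \<open>Eigenspaces are one-dimensional and \<Omega> is separating, so eigenoperators in
  \<open>M\<close> for one eigenvalue differ by a scalar.\<close>

lemma V_proportional:
  assumes "v \<in> sp" "w \<in> sp" "T \<in> M" "capply U (capply T \<Omega>) = v *\<^sub>C capply T \<Omega>"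
    "S \<in> M" "capply U (capply S \<Omega>) = v *\<^sub>C capply S \<Omega>" "capply S \<Omega> \<noteq> 0"
  shows "\<exists>c. T = c *\<^sub>C S"
proof -
  let ?e = "capply (V v) \<Omega>"
  obtain a b where ab: "capply T \<Omega> = a *\<^sub>C ?e" "capply S \<Omega> = b *\<^sub>C ?e"
    using eigen_unique[OF assms(1,4)] eigen_unique[OF assms(1,6)] by blast
  have b: "b \<noteq> 0" using ab(2) assms(7) by auto
  have "capply T \<Omega> = (a / b) *\<^sub>C capply S \<Omega>" using b by (simp add: ab scaleC_scaleC)
  then have "T = (a / b) *\<^sub>C S"
    by (intro separating assms(3) closed_ops(3) assms(5)) (simp add: capply_scaleC_left)
  then show ?thesis by blast
qed

text \<open>Both products belong to the eigenvalue \<open>v * w\<close> and are therefore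
  proportional. The factor is a bicharacter on the group of eigenvalues, trivial on the
  diagonal.\<close>

definition phase :: "complex \<Rightarrow> complex \<Rightarrow> complex"
  where "phase v w = (SOME c. V v o\<^sub>C V w = c *\<^sub>C (V w o\<^sub>C V v))"

lemma phase:
  assumes "v \<in> sp" "w \<in> sp"
  shows "capply (V v) (capply (V w) x) = phase v w *\<^sub>C capply (V w) (capply (V v) x)"
proof -
  have "\<exists>c. V v o\<^sub>C V w = c *\<^sub>C (V w o\<^sub>C V v)"
    by (rule V_proportional[OF sp_mult[OF assms] assms(2)])
      (use assms in \<open>simp_all add: closed_ops(1) V_M U_V U\<Omega> capply_scaleC scaleC_scaleC V_nonzero \<Omega>_nonzero mult.commute\<close>)
  from someI_ex[OF this] have "V v o\<^sub>C V w = phase v w *\<^sub>C (V w o\<^sub>C V v)" unfolding phase_def .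
  from arg_cong[OF this, of "\<lambda>S. capply S x"] show ?thesis by (simp add: capply_scaleC_left)
qed

lemma phase_unique:
  assumes "v \<in> sp" "w \<in> sp" "capply (V v) (capply (V w) \<Omega>) = c *\<^sub>C capply (V w) (capply (V v) \<Omega>)"
  shows "phase v w = c"
proof -
  have "(phase v w - c) *\<^sub>C capply (V w) (capply (V v) \<Omega>) = 0"
    using phase[OF assms(1,2), of \<Omega>] assms(3) by (simp add: scaleC_diff_left)
  then show ?thesis using assms by (simp add: V_nonzero \<Omega>_nonzero)
qed

lemma phase_nonzero: "v \<in> sp \<Longrightarrow> w \<in> sp \<Longrightarrow> phase v w \<noteq> 0"
  using phase[of v w \<Omega>] V_nonzero[of v "capply (V w) \<Omega>"] V_nonzero[of w \<Omega>] \<Omega>_nonzero by auto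

lemma phase_self: "v \<in> sp \<Longrightarrow> phase v v = 1"
  by (rule phase_unique) simp_all

lemma phase_sym: "v \<in> sp \<Longrightarrow> w \<in> sp \<Longrightarrow> phase w v = inverse (phase v w)"
  by (rule phase_unique) (simp_all add: phase[of v w] scaleC_scaleC phase_nonzero)

lemma phase_mult:
  assumes "v \<in> sp" "v' \<in> sp" "w \<in> sp" shows "phase (v * v') w = phase v w * phase v' w"
proof (rule phase_unique[OF sp_mult[OF assms(1,2)] assms(3)])
  have vv: "v * v' \<in> sp" by (rule sp_mult[OF assms(1,2)])
  obtain a where "V (v * v') = a *\<^sub>C (V v o\<^sub>C V v')"
    using V_proportional[OF vv assms(3) V_M[OF vv] U_V\<Omega>[OF vv] closed_ops(1)[OF V_M[OF assms(1)] V_M[OF assms(2)]]]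
    by (auto simp: assms U_V U\<Omega> capply_scaleC scaleC_scaleC V_nonzero \<Omega>_nonzero)
  then have a: "capply (V (v * v')) x = a *\<^sub>C capply (V v) (capply (V v') x)" for x by (simp add: capply_scaleC_left)
  show "capply (V (v * v')) (capply (V w) \<Omega>) = (phase v w * phase v' w) *\<^sub>C capply (V w) (capply (V (v * v')) \<Omega>)"
    by (simp add: a phase[OF assms(2,3)] phase[OF assms(1,3)] capply_scaleC scaleC_scaleC mult_ac)
qed

lemma phase_powi:
  assumes "v \<in> sp" "w \<in> sp" shows "v powi n \<in> sp" "phase (v powi n) w = phase v w powi n"
proof -
  have "0 \<notin> sp" using sp_nonzero by blast
  then have "v powi n \<in> sp \<and> phase (v powi n) w = phase v w powi n"
    by (rule powi_character[where h = "\<lambda>v. phase v w"]) (auto intro: sp_mult sp_inverse phase_mult assms dest: phase_nonzero[OF _ assms(2)])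
  then show "v powi n \<in> sp" "phase (v powi n) w = phase v w powi n" by auto
qed

text \<open>With \<open>d = gcd k1 k2\<close>, \<open>k1 = a d\<close>, \<open>k2 = b d\<close>, the number \<open>v\<^sup>a w\<^sup>b\<close> is an eigenvalue whose \<open>d\<close>-th power is
  \<open>1\<close>. As \<open>d\<close> divides \<open>k2 - k1\<close>, ergodicity forces \<open>v\<^sup>a w\<^sup>b = 1\<close>, so that \<open>phase v w\<close> is killed by \<open>a\<close> and by \<open>b\<close>.\<close>

lemma V_commute:
  assumes "(v, w) \<in> Sigma_set U k1 k2"
  shows "capply (V v) (capply (V w) x) = capply (V w) (capply (V v) x)"
proof -
  have m: "v \<in> sp" "w \<in> sp" and e: "v powi k1 * w powi k2 = 1" using assms by (auto simp: Sigma_set_def)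
  have nz: "v \<noteq> 0" "w \<noteq> 0" using m sp_nonzero by auto
  define d where "d = gcd k1 k2"
  obtain a b where ab: "k1 = a * d" "k2 = b * d" "coprime a b"
    using gcd_coprime_exists[of k1 k2] k1 unfolding d_def by auto
  have va: "v powi a \<in> sp" and wb: "w powi b \<in> sp" using phase_powi(1) m by blast+
  define z where "z = v powi a * w powi b"
  have z: "z \<in> sp" unfolding z_def by (rule sp_mult[OF va wb])
  have zd: "z powi d = 1" using e by (simp add: z_def power_int_mult_distrib ab power_int_mult)
  have "k2 - k1 = d * (b - a)" by (simp add: ab algebra_simps)
  then have "z powi (k2 - k1) = 1" by (simp add: power_int_mult zd)
  then have z1: "v powi a * w powi b = 1" using sp_unit[OF z] by (simp add: z_def)
  have 1: "phase v w powi a = 1"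
  proof -
    \<comment> \<open>Rewriting the first argument as a power of \<open>w\<close> reduces the phase
      to a power of \<open>phase w w\<close>, which is \<open>1\<close>.\<close>
    have "v powi a = w powi (- b)" using z1 nz by (simp add: power_int_minus field_simps)
    then show ?thesis using phase_powi(2)[OF m(1,2), of a] phase_powi(2)[OF m(2,2), of "- b"] by (simp add: phase_self[OF m(2)])
  qed
  have 2: "phase v w powi b = 1"
  proof -
    have "w powi b = v powi (- a)" using z1 nz by (simp add: power_int_minus field_simps)
    then have "phase w v powi b = 1"
      using phase_powi(2)[OF m(2,1), of b] phase_powi(2)[OF m(1,1), of "- a"] by (simp add: phase_self[OF m(1)])
    then show ?thesis by (simp add: phase_sym[OF m] power_int_inverse)
  qed
  obtain p q where pq: "p * a + q * b = 1" using bezout_int[of a b] ab(3) by auto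
  have "phase v w = phase v w powi (a * p + b * q)" using pq by (simp add: mult.commute)
  also have "\<dots> = 1" using phase_nonzero[OF m] by (simp add: power_int_add power_int_mult 1 2)
  finally show ?thesis using phase[OF m, of x] by simp
qed

subsection \<open>The averages\<close>

definition G :: "'h operator \<Rightarrow> 'h \<Rightarrow> nat \<Rightarrow> 'h"
  where "G B x n = capply (pw (int n * k2)) (capply B (capply (pw (- (int n * (k2 - k1)))) x))"

lemma pw_norm: "norm (capply (pw m) x) = norm x"
  by (rule unitary_norm[OF upow_unitary[OF unitary]])

lemma pw_cinner: "cinner (capply (pw m) x) (capply (pw m) y) = cinner x y"
  by (rule unitary_cinner[OF upow_unitary[OF unitary]])

lemma pw_\<Omega>: "capply (pw m) \<Omega> = \<Omega>"
  using upow_eigen[OF unitary, of \<Omega> 1 m] by (simp add: U\<Omega>)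

lemma pw_pw: "capply (pw j) (capply (pw k) x) = capply (pw (j + k)) x"
  by (simp add: upow_add[OF unitary])

lemma G_norm: "norm (G B x n) \<le> norm B * norm x"
  unfolding G_def pw_norm using norm_capply[of B "capply (pw (- (int n * (k2 - k1)))) x"] by (simp add: pw_norm)

lemma G_diff: "G B x n - G B y n = G B (x - y) n"
  by (simp add: G_def capply_diff)

lemma avg_G_norm: "norm (avg (G B x) n) \<le> norm B * norm x"
  by (rule norm_avg_le[OF G_norm]) simp

lemma avg_G_diff: "avg (G B x) n - avg (G B y) n = avg (G B (x - y)) n"
  unfolding avg_diff[symmetric] G_diff ..

lemma conj_M: "A \<in> M \<Longrightarrow> pw m o\<^sub>C A o\<^sub>C cadj (pw m) \<in> M"
  using upow_normalizes[OF unitary UM] by (simp add: normalizes_def)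

lemma conj_M': "B \<in> M' \<Longrightarrow> pw m o\<^sub>C B o\<^sub>C cadj (pw m) \<in> M'"
  using upow_normalizes[OF unitary UM'] by (simp add: normalizes_def)

text \<open>Powers of \<open>U\<close> fix \<Omega>, so their action on
  \<open>capply B \<Omega>\<close> is conjugation of \<open>B\<close>, which stays in
  \<open>M'\<close> and passes \<open>X\<close>; the exponents then add up to
  \<open>k2\<close>.\<close>

lemma exchange:
  assumes X: "X \<in> M" and B: "B \<in> M'"
  shows "capply (pw (int n * k1)) (capply X (capply (pw (int n * (k2 - k1))) (capply B \<Omega>))) = G B (capply X \<Omega>) n"
proof -
  let ?m = "int n * (k2 - k1)"
  let ?B = "pw ?m o\<^sub>C B o\<^sub>C cadj (pw ?m)"
  have "capply (pw ?m) (capply B \<Omega>) = capply ?B \<Omega>"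
    by (simp add: upow_cadj[OF unitary] pw_\<Omega>)
  then have "capply X (capply (pw ?m) (capply B \<Omega>)) = capply ?B (capply X \<Omega>)"
    using commute[OF X conj_M'[OF B]] by simp
  moreover have "int n * k1 + ?m = int n * k2" by (simp add: algebra_simps)
  ultimately show ?thesis by (simp add: G_def upow_cadj[OF unitary] pw_pw)
qed

definition zt :: "'h \<Rightarrow> 'h \<Rightarrow> nat \<Rightarrow> 'k"
  where "zt x b h = t (capply (pw (int h * k1)) x) (capply (pw (int h * k2)) b)"

lemmas t_inner = hilbert_tensor_inner[OF t] and t_norm = hilbert_tensor_norm[OF t]

lemma t_lin: "t (x + x') y = t x y + t x' y" "t x (y + y') = t x y + t x y'"
  "t (c *\<^sub>C x) y = c *\<^sub>C t x y" "t x (c *\<^sub>C y) = c *\<^sub>C t x y"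
  using t unfolding hilbert_tensor_def by blast+

lemma t_diff: "t x y - t x' y = t (x - x') y" "t x y - t x y' = t x (y - y')"
  using t_lin(1)[of "x - x'" x' y] t_lin(2)[of x "y - y'" y'] by (simp_all add: eq_diff_eq diff_eq_eq)

lemma van_der_corput_bound:
  assumes A: "A \<in> M" and B: "B \<in> M'" and H: "H > 0" and e: "e > 0"
  shows "\<forall>\<^sub>F N in sequentially. (norm (avg (G B (capply A \<Omega>)) N))\<^sup>2 < (norm (avg (zt (capply A \<Omega>) (capply B \<Omega>)) H))\<^sup>2 + e"
proof (rule van_der_corput[OF G_norm _ H e])
  fix h h' :: nat
  define An where "An n = pw (int n * k1) o\<^sub>C A o\<^sub>C cadj (pw (int n * k1))" for n
  define Bn where "Bn n = pw (int n * k2) o\<^sub>C B o\<^sub>C cadj (pw (int n * k2))" for n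
  have An: "An n \<in> M" and Bn: "Bn n \<in> M'" for n unfolding An_def Bn_def by (rule conj_M[OF A] conj_M'[OF B])+
  have An\<Omega>: "capply (An n) \<Omega> = capply (pw (int n * k1)) (capply A \<Omega>)"
    and Bn\<Omega>: "capply (Bn n) \<Omega> = capply (pw (int n * k2)) (capply B \<Omega>)" for n
    by (simp_all add: An_def Bn_def upow_cadj[OF unitary] pw_\<Omega>)
  have G_AB: "G B (capply A \<Omega>) n = capply (An n) (capply (Bn n) \<Omega>)" for n
  proof -
    have "- (int n * k1) + int n * k2 = int n * (k2 - k1)" by (simp add: algebra_simps)
    then show ?thesis
      unfolding exchange[OF A B, symmetric] Bn\<Omega> by (simp add: An_def upow_cadj[OF unitary] pw_pw)
  qed
  \<comment> \<open>\<open>C\<close> and \<open>D\<close> collect the factors from \<open>M\<close>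
    and from \<open>M'\<close> in the correlation of the shifts \<open>h\<close> and
    \<open>h'\<close>; the common shift \<open>n\<close> enters only through conjugation by powers
    of \<open>U\<close>.\<close>
  define C where "C = cadj (An h') o\<^sub>C An h"
  define D where "D = cadj (Bn h) o\<^sub>C Bn h'"
  have inner: "cinner (capply a (capply b \<Omega>)) (capply a' (capply b' \<Omega>)) = cinner (capply (cadj a' o\<^sub>C a) \<Omega>) (capply (cadj b o\<^sub>C b') \<Omega>)"
    if a: "a \<in> M" "a' \<in> M" and b: "b \<in> M'" "b' \<in> M'" for a a' b b'
  proof -
    have "cinner (capply a (capply b \<Omega>)) (capply a' (capply b' \<Omega>)) = cinner (capply (cadj a' o\<^sub>C a) (capply b \<Omega>)) (capply b' \<Omega>)"
      by (simp add: cinner_cadj')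
    also have "capply (cadj a' o\<^sub>C a) (capply b \<Omega>) = capply b (capply (cadj a' o\<^sub>C a) \<Omega>)"
      by (rule commute[OF closed_ops(1)[OF N_cadj[OF a(2)] a(1)] b(1)])
    finally show ?thesis by (simp add: cinner_cadj)
  qed
  have An_add: "capply (An (n + h)) x = capply (pw (int n * k1)) (capply (An h) (capply (pw (- (int n * k1))) x))" for n h x
    by (simp add: An_def upow_cadj[OF unitary] pw_pw algebra_simps)
  have Bn_add: "capply (Bn (n + h)) x = capply (pw (int n * k2)) (capply (Bn h) (capply (pw (- (int n * k2))) x))" for n h x
    by (simp add: Bn_def upow_cadj[OF unitary] pw_pw algebra_simps)
  have cadj_An: "capply (cadj (An (n + h))) x = capply (pw (int n * k1)) (capply (cadj (An h)) (capply (pw (- (int n * k1))) x))" for n h x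
    by (simp add: An_def cadj_compose upow_cadj[OF unitary] pw_pw algebra_simps)
  have cadj_Bn: "capply (cadj (Bn (n + h))) x = capply (pw (int n * k2)) (capply (cadj (Bn h)) (capply (pw (- (int n * k2))) x))" for n h x
    by (simp add: Bn_def cadj_compose upow_cadj[OF unitary] pw_pw algebra_simps)
  have corr: "cinner (G B (capply A \<Omega>) (n + h)) (G B (capply A \<Omega>) (n + h'))
      = cinner (capply C \<Omega>) ((capply (pw (k2 - k1)) ^^ n) (capply D \<Omega>))" for n
  proof -
    have CC: "capply (cadj (An (n + h')) o\<^sub>C An (n + h)) \<Omega> = capply (pw (int n * k1)) (capply C \<Omega>)"
      by (simp add: cadj_An An_add pw_pw pw_\<Omega> C_def upow_0[OF unitary])
    have DD: "capply (cadj (Bn (n + h)) o\<^sub>C Bn (n + h')) \<Omega> = capply (pw (int n * k2)) (capply D \<Omega>)"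
      by (simp add: cadj_Bn Bn_add pw_pw pw_\<Omega> D_def upow_0[OF unitary])
    have "int n * k2 = int n * k1 + int n * (k2 - k1)" by (simp add: algebra_simps)
    then have "capply (pw (int n * k2)) (capply D \<Omega>) = capply (pw (int n * k1)) (capply (pw (int n * (k2 - k1))) (capply D \<Omega>))"
      by (simp only: pw_pw)
    then show ?thesis
      unfolding G_AB inner[OF An An Bn Bn] CC DD by (simp only: pw_cinner upow_funpow[OF unitary])
  qed
  obtain y where y: "avg (\<lambda>n. (capply (pw (k2 - k1)) ^^ n) (capply D \<Omega>)) \<longlonglongrightarrow> y" "capply (pw (k2 - k1)) y = y"
    "\<And>e. capply (pw (k2 - k1)) e = e \<Longrightarrow> cinner y e = cinner (capply D \<Omega>) e"
    using mean_ergodic[OF upow_unitary[OF unitary]] by metis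
  \<comment> \<open>Ergodicity: the mean of the powers at D \<Omega> is the component along
    \<Omega>, so the limit correlation splits into two factors.\<close>
  obtain c where c: "y = c *\<^sub>C \<Omega>" using fixK[OF y(2)] by blast
  have "c = cinner (capply D \<Omega>) \<Omega>" using y(3)[OF pw_\<Omega>] by (simp add: c cinner_scaleC_left cinner_self norm\<Omega>)
  then have cc: "cnj c = cinner \<Omega> (capply D \<Omega>)" by (metis cinner_commute)
  have avg_right: "avg (\<lambda>n. cinner x (f n)) N = cinner x (avg f N)" for x :: 'h and f N
    by (simp add: avg_def cinner_scaleR_right cinner_sum_right scaleR_conv_of_real)
  have "(\<lambda>N. avg (\<lambda>n. cinner (G B (capply A \<Omega>) (n + h)) (G B (capply A \<Omega>) (n + h'))) N) \<longlonglongrightarrow> cinner (capply C \<Omega>) y"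
    unfolding corr avg_right by (intro tendsto_intros y)
  also have "cinner (capply C \<Omega>) y = cinner (capply C \<Omega>) \<Omega> * cinner \<Omega> (capply D \<Omega>)"
    by (simp add: c cinner_scaleC_right cc)
  also have "\<dots> = cinner (zt (capply A \<Omega>) (capply B \<Omega>) h) (zt (capply A \<Omega>) (capply B \<Omega>) h')"
    by (simp add: zt_def t_inner C_def D_def cinner_cadj' An\<Omega> Bn\<Omega> flip: cinner_cadj)
  finally show "(\<lambda>N. avg (\<lambda>n. cinner (G B (capply A \<Omega>) (n + h)) (G B (capply A \<Omega>) (n + h'))) N)
      \<longlonglongrightarrow> cinner (zt (capply A \<Omega>) (capply B \<Omega>) h) (zt (capply A \<Omega>) (capply B \<Omega>) h')" .
qed

lemma zt_avg_diff: "norm (avg (zt x b) H - avg (zt y b) H) \<le> norm (x - y) * norm b"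
proof -
  have "avg (zt x b) H - avg (zt y b) H = avg (\<lambda>h. t (capply (pw (int h * k1)) (x - y)) (capply (pw (int h * k2)) b)) H"
    unfolding avg_diff[symmetric] by (simp add: zt_def t_diff capply_diff)
  also have "norm \<dots> \<le> norm (x - y) * norm b"
    by (rule norm_avg_le) (simp_all add: t_norm pw_norm)
  finally show ?thesis .
qed

text \<open>An eigenvector of the power \<open>k1\<close> is a finite sum of eigenvectors of
  \<open>U\<close>, so \<open>weak_mixing_or_eigenvector\<close> applies to \<open>pw k1\<close>.
  The van der Corput bound is stated for vectors of M \<Omega> and is therefore used at an
  approximation of \<open>x\<close>.\<close>

lemma avg_G_orthogonal:
  assumes B: "B \<in> M'" and x: "\<And>y \<mu>. capply U y = \<mu> *\<^sub>C y \<Longrightarrow> cinner x y = 0"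
  shows "avg (G B x) \<longlonglongrightarrow> 0"
proof -
  have "avg (\<lambda>n. t ((capply (pw k1) ^^ n) x) ((capply (pw k2) ^^ n) (capply B \<Omega>))) \<longlonglongrightarrow> 0"
  proof (rule weak_mixing_or_eigenvector[OF upow_unitary[OF unitary] upow_unitary[OF unitary] t])
    fix y ev assume y: "capply (pw k1) y = ev *\<^sub>C y"
    show "cinner x y = 0"
    proof (cases "y = 0")
      case False
      have "ev \<noteq> 0" using pw_norm[of k1 y] False y by auto
      then obtain m :: nat and z \<mu> where z: "y = (\<Sum>j<m. z j)" "\<And>j. capply U (z j) = \<mu> j *\<^sub>C z j"
        using eigen_power_split[OF unitary k1 y] by metis
      show ?thesis unfolding z(1) cinner_sum_right using x[OF z(2)] by simp
    qed simp
  qed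
  then have lim: "avg (zt x (capply B \<Omega>)) \<longlonglongrightarrow> 0" unfolding upow_funpow[OF unitary] zt_def .
  show ?thesis
  proof (rule metric_LIMSEQ_I)
    fix r :: real assume r: "r > 0"
    \<comment> \<open>Budget: the mean of \<open>zt\<close> is below \<open>e\<close> at
      \<open>x\<close> and at most \<open>2 * e\<close> at the approximation, the inequality gives
      less than \<open>3 * e\<close> for \<open>G\<close> there, and returning to \<open>x\<close>
      costs one more \<open>e\<close>.\<close>
    define e where "e = r / 4"
    have e: "e > 0" using r by (simp add: e_def)
    obtain H0 where H0: "\<And>H. H \<ge> H0 \<Longrightarrow> norm (avg (zt x (capply B \<Omega>)) H) < e"
      using metric_LIMSEQ_D[OF lim e] by (auto simp: dist_norm)
    define H where "H = Suc H0"
    define s where "s = norm B + norm (capply B \<Omega>) + 1"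
    have s: "s > 0" unfolding s_def by (simp add: add_nonneg_pos)
    obtain A where A: "A \<in> M" "norm (x - capply A \<Omega>) < e / s"
      using closure_UNIV_approx[OF dense_N, of "e / s" x] e s by auto
    have small: "norm (x - capply A \<Omega>) * c \<le> e" if "0 \<le> c" "c \<le> s" for c
    proof -
      have "norm (x - capply A \<Omega>) * c \<le> (e / s) * s" using A(2) that e s by (intro mult_mono) auto
      then show ?thesis using s by simp
    qed
    have "norm (avg (zt (capply A \<Omega>) (capply B \<Omega>)) H)
        \<le> norm (avg (zt x (capply B \<Omega>)) H) + norm (avg (zt x (capply B \<Omega>)) H - avg (zt (capply A \<Omega>) (capply B \<Omega>)) H)"
      using norm_triangle_ineq4[of "avg (zt x (capply B \<Omega>)) H" "avg (zt x (capply B \<Omega>)) H - avg (zt (capply A \<Omega>) (capply B \<Omega>)) H"] by simp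
    also have "\<dots> \<le> e + e"
      using H0[of H] zt_avg_diff[of x "capply B \<Omega>" H "capply A \<Omega>"] small[of "norm (capply B \<Omega>)"]
      by (simp add: H_def s_def)
    finally have zA: "norm (avg (zt (capply A \<Omega>) (capply B \<Omega>)) H) \<le> 2 * e" by simp
    have "\<forall>\<^sub>F N in sequentially. (norm (avg (G B (capply A \<Omega>)) N))\<^sup>2 < (norm (avg (zt (capply A \<Omega>) (capply B \<Omega>)) H))\<^sup>2 + e\<^sup>2"
      by (rule van_der_corput_bound[OF A(1) B]) (use e in \<open>simp_all add: H_def\<close>)
    then have "\<forall>\<^sub>F N in sequentially. dist (avg (G B x) N) 0 < r"
    proof eventually_elim
      case (elim N)
      have "(norm (avg (zt (capply A \<Omega>) (capply B \<Omega>)) H))\<^sup>2 \<le> (2 * e)\<^sup>2" by (rule power_mono[OF zA]) simp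
      then have "(norm (avg (G B (capply A \<Omega>)) N))\<^sup>2 < (3 * e)\<^sup>2"
        using elim mult_pos_pos[OF e e] by (simp add: power2_eq_square)
      then have 1: "norm (avg (G B (capply A \<Omega>)) N) < 3 * e" by (rule power_less_imp_less_base) (use e in simp)
      have "norm (avg (G B x) N - avg (G B (capply A \<Omega>)) N) \<le> norm (x - capply A \<Omega>) * norm B"
        unfolding avg_G_diff using avg_G_norm[of B "x - capply A \<Omega>" N] by (simp add: mult.commute)
      also have "\<dots> \<le> e" by (rule small) (simp_all add: s_def)
      finally have "norm (avg (G B x) N) < 4 * e"
        using 1 norm_triangle_ineq[of "avg (G B x) N - avg (G B (capply A \<Omega>)) N" "avg (G B (capply A \<Omega>)) N"] by simp
      then show ?case by (simp add: e_def)
    qed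
    then show "\<exists>no. \<forall>n\<ge>no. dist (avg (G B x) n) 0 < r" by (simp add: eventually_sequentially)
  qed
qed

section \<open>Averages at eigenvectors\<close>

definition Fw :: "complex \<Rightarrow> complex set"
  where "Fw v = {w \<in> sp. v powi k1 * w powi k2 = 1}"

lemma finite_Fw: "finite (Fw v)"
proof (rule finite_subset)
  show "Fw v \<subseteq> {w. w powi k2 = inverse (v powi k1)}"
    by (auto simp: Fw_def) (metis inverse_unique)
qed (rule finite_powi_roots[OF k2])

text \<open>The remainder after subtracting the projection splits into eigenvectors of
  \<open>U\<close> whose eigenvalues belong to \<open>Fw v\<close>, so it is orthogonal to its own
  summands.\<close>

lemma fixed_expansion:
  assumes v: "v \<in> sp" and y: "capply (pw k2) y = inverse (v powi k1) *\<^sub>C y"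
  shows "y = (\<Sum>w\<in>Fw v. cinner y (capply (V w) \<Omega>) *\<^sub>C capply (V w) \<Omega>)"
proof -
  let ?e = "\<lambda>w. capply (V w) \<Omega>"
  define y' where "y' = y - (\<Sum>w\<in>Fw v. cinner y (?e w) *\<^sub>C ?e w)"
  have v0: "inverse (v powi k1) \<noteq> 0" using sp_nonzero[OF v] by simp
  have Fsp: "w \<in> sp" if "w \<in> Fw v" for w using that by (simp add: Fw_def)
  have Fpow: "w powi k2 = inverse (v powi k1)" if "w \<in> Fw v" for w
    using that by (auto simp: Fw_def intro: inverse_unique[symmetric])
  have y'_pw: "capply (pw k2) y' = inverse (v powi k1) *\<^sub>C y'"
  proof -
    have "capply (pw k2) (?e w) = inverse (v powi k1) *\<^sub>C ?e w" if "w \<in> Fw v" for w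
      using upow_eigen[OF unitary U_V\<Omega>[OF Fsp[OF that]] sp_nonzero[OF Fsp[OF that]], of k2] Fpow[OF that] by simp
    then show ?thesis
      by (simp add: y'_def capply_diff y capply_sum capply_scaleC scaleC_diff_right scaleC_sum_right scaleC_scaleC mult.commute)
  qed
  have y'_orth: "cinner y' (?e w) = 0" if w: "w \<in> Fw v" for w
  proof -
    have "cinner (\<Sum>w'\<in>Fw v. cinner y (?e w') *\<^sub>C ?e w') (?e w) = (\<Sum>w'\<in>Fw v. if w' = w then cinner y (?e w) else 0)"
      unfolding cinner_sum_left
      by (intro sum.cong refl) (use w Fsp in \<open>auto simp: cinner_scaleC_left V\<Omega>_orthonormal\<close>)
    also have "\<dots> = cinner y (?e w)" using w finite_Fw by simp
    finally show ?thesis by (simp add: y'_def cinner_diff_left)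
  qed
  obtain m :: nat and z \<mu> where z: "y' = (\<Sum>j<m. z j)" "\<And>j. capply U (z j) = \<mu> j *\<^sub>C z j"
    "\<And>j. z j \<noteq> 0 \<Longrightarrow> \<mu> j powi k2 = inverse (v powi k1)"
    using eigen_power_split[OF unitary k2 y'_pw v0] by metis
  have "cinner y' (z j) = 0" for j
  proof (cases "z j = 0")
    case False
    have \<mu>: "\<mu> j \<in> sp" by (rule spI[OF z(2) False])
    then have "\<mu> j \<in> Fw v" using z(3)[OF False] v0 by (simp add: Fw_def)
    then show ?thesis
      using y'_orth by (subst eigen_unique[OF \<mu> z(2)]) (simp add: cinner_scaleC_right)
  qed simp
  then have "cinner y' y' = 0" by (subst (2) z(1)) (simp add: cinner_sum_right)
  then show ?thesis by (simp add: y'_def)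
qed

text \<open>Here \<open>G\<close> is \<open>V v\<close> applied to powers of the unitary
  \<open>v powi k1 *\<^sub>C pw k2\<close>; the mean ergodic theorem gives the limit and
  \<open>fixed_expansion\<close> its coordinates.\<close>

lemma avg_G_eigen_V:
  assumes v: "v \<in> sp" and B: "B \<in> M'"
  shows "avg (G B (capply (V v) \<Omega>)) \<longlonglongrightarrow>
    capply (V v) (\<Sum>w\<in>Fw v. cinner (capply B \<Omega>) (capply (V w) \<Omega>) *\<^sub>C capply (V w) \<Omega>)"
proof -
  define c where "c = v powi k1"
  have v0: "v \<noteq> 0" by (rule sp_nonzero[OF v])
  have c1: "cmod c = 1" by (simp add: c_def norm_power_int cmod_sp[OF v])
  have c0: "c \<noteq> 0" using c1 by auto
  let ?T = "c *\<^sub>C pw k2"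
  have T: "unitary_op ?T" by (rule unitary_op_scaleC[OF upow_unitary[OF unitary] c1])
  obtain y where y: "avg (\<lambda>n. (capply ?T ^^ n) (capply B \<Omega>)) \<longlonglongrightarrow> y" "capply ?T y = y"
    "\<And>e. capply ?T e = e \<Longrightarrow> cinner y e = cinner (capply B \<Omega>) e"
    using mean_ergodic[OF T] by metis
  have Tn: "(capply ?T ^^ n) x = c ^ n *\<^sub>C capply (pw (int n * k2)) x" for n x
  proof (induction n)
    case (Suc n)
    have "int (Suc n) * k2 = k2 + int n * k2" by (simp add: algebra_simps)
    then show ?case using Suc by (simp add: capply_scaleC_left capply_scaleC scaleC_scaleC pw_pw)
  qed (simp add: upow_0[OF unitary])
  have "G B (capply (V v) \<Omega>) n = capply (V v) ((capply ?T ^^ n) (capply B \<Omega>))" for n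
  proof -
    let ?m = "- (int n * (k2 - k1))"
    have "capply (pw ?m) (capply (V v) \<Omega>) = v powi ?m *\<^sub>C capply (V v) \<Omega>" by (simp only: pw_V[OF v] pw_\<Omega>)
    then have "G B (capply (V v) \<Omega>) n = v powi ?m *\<^sub>C capply (pw (int n * k2)) (capply B (capply (V v) \<Omega>))"
      by (simp only: G_def capply_scaleC)
    also have "capply B (capply (V v) \<Omega>) = capply (V v) (capply B \<Omega>)"
      by (rule commute[OF V_M[OF v] B, symmetric])
    also have "capply (pw (int n * k2)) (capply (V v) (capply B \<Omega>))
        = v powi (int n * k2) *\<^sub>C capply (V v) (capply (pw (int n * k2)) (capply B \<Omega>))" by (rule pw_V[OF v])
    also have "v powi ?m *\<^sub>C v powi (int n * k2) *\<^sub>C capply (V v) (capply (pw (int n * k2)) (capply B \<Omega>))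
        = c ^ n *\<^sub>C capply (V v) (capply (pw (int n * k2)) (capply B \<Omega>))"
    proof -
      have "?m + int n * k2 = k1 * int n" by (simp add: algebra_simps)
      then have "v powi ?m * v powi (int n * k2) = v powi (k1 * int n)" using v0 by (simp add: power_int_add[symmetric])
      then show ?thesis by (simp add: scaleC_scaleC c_def power_int_mult)
    qed
    finally show ?thesis by (simp only: Tn capply_scaleC)
  qed
  then have "avg (G B (capply (V v) \<Omega>)) = (\<lambda>N. capply (V v) (avg (\<lambda>n. (capply ?T ^^ n) (capply B \<Omega>)) N))"
    by (intro ext) (simp only: avg_capply[symmetric], simp add: avg_def)
  then have lim: "avg (G B (capply (V v) \<Omega>)) \<longlonglongrightarrow> capply (V v) y"
    by (simp only:) (intro tendsto_intros y)
  have "inverse c *\<^sub>C c *\<^sub>C capply (pw k2) y = inverse c *\<^sub>C y" using y(2) by (simp add: capply_scaleC_left)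
  then have "capply (pw k2) y = inverse (v powi k1) *\<^sub>C y" using c0 by (simp add: scaleC_scaleC c_def)
  then have y_exp: "y = (\<Sum>w\<in>Fw v. cinner y (capply (V w) \<Omega>) *\<^sub>C capply (V w) \<Omega>)" by (rule fixed_expansion[OF v])
  have "cinner y (capply (V w) \<Omega>) = cinner (capply B \<Omega>) (capply (V w) \<Omega>)" if w: "w \<in> Fw v" for w
  proof (rule y(3))
    have ws: "w \<in> sp" and e: "c * w powi k2 = 1" using w by (simp_all add: Fw_def c_def)
    show "capply ?T (capply (V w) \<Omega>) = capply (V w) \<Omega>"
      using upow_eigen[OF unitary U_V\<Omega>[OF ws] sp_nonzero[OF ws], of k2]
      by (simp add: capply_scaleC_left scaleC_scaleC e)
  qed
  then have "y = (\<Sum>w\<in>Fw v. cinner (capply B \<Omega>) (capply (V w) \<Omega>) *\<^sub>C capply (V w) \<Omega>)"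
    using y_exp by (metis (no_types, lifting) sum.cong)
  then show ?thesis using lim by simp
qed


lemma W_sp: "v \<in> sp \<Longrightarrow> W v \<in> M'"
  using ergodic_pair.V_M[OF swapped] .

lemma V_via_W:
  assumes v: "v \<in> sp"
  obtains c where "cnj c * c = 1" "capply (V v) \<Omega> = c *\<^sub>C capply (W v) \<Omega>"
proof -
  interpret sw: ergodic_pair M' M \<Omega> U k1 k2 t by (rule swapped)
  define c where "c = cinner (capply (V v) \<Omega>) (capply (W v) \<Omega>)"
  have eq: "capply (V v) \<Omega> = c *\<^sub>C capply (W v) \<Omega>"
    unfolding c_def by (rule sw.eigen_unique[OF v U_V\<Omega>[OF v]])
  have "cmod c = 1"
    using arg_cong[OF eq, of norm] by (simp add: norm_scaleC norm_V\<Omega>[OF v] sw.norm_V\<Omega>[OF v] norm\<Omega>)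
  then show thesis using that[OF _ eq] complex_norm_square[of c] by (simp add: mult.commute)
qed

text \<open>The rank-one projection onto an eigenspace does not see whether its unit vector comes
  from \<open>M\<close> or from \<open>M'\<close>.\<close>

lemma eigen_component:
  assumes "v \<in> sp"
  shows "cinner b (capply (V v) \<Omega>) *\<^sub>C capply (V v) \<Omega> = cinner b (capply (W v) \<Omega>) *\<^sub>C capply (W v) \<Omega>"
proof -
  obtain c where c: "cnj c * c = 1" "capply (V v) \<Omega> = c *\<^sub>C capply (W v) \<Omega>" by (rule V_via_W[OF assms])
  have "cinner b (capply (V v) \<Omega>) *\<^sub>C capply (V v) \<Omega> = (cnj c * c * cinner b (capply (W v) \<Omega>)) *\<^sub>C capply (W v) \<Omega>"
    by (simp add: c(2) cinner_scaleC_right scaleC_scaleC mult_ac)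
  then show ?thesis by (simp add: c(1))
qed

lemma Fw_sp: "w \<in> Fw v \<Longrightarrow> w \<in> sp"
  by (simp add: Fw_def)

text \<open>For \<open>B\<close> in \<open>M\<close> the swapped pair gives a limit with
  \<open>W v\<close> in place of \<open>V v\<close>; commutation of \<open>W v\<close> and
  \<open>W w\<close> for pairs in \<open>Sigma_set\<close> brings it to the common form.\<close>

lemma avg_G_eigen:
  assumes v: "v \<in> sp" and B: "B \<in> M \<or> B \<in> M'"
  shows "avg (G B (capply (V v) \<Omega>)) \<longlonglongrightarrow>
    (\<Sum>w\<in>Fw v. cinner (capply B \<Omega>) (capply (W w) \<Omega>) *\<^sub>C capply (V v) (capply (W w) \<Omega>))"
  using B
proof
  assume "B \<in> M'"
  from avg_G_eigen_V[OF v this] show ?thesis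
    by (simp add: eigen_component[OF Fw_sp] capply_sum capply_scaleC cong: sum.cong)
next
  assume B: "B \<in> M"
  interpret sw: ergodic_pair M' M \<Omega> U k1 k2 t by (rule swapped)
  obtain c where c: "capply (V v) \<Omega> = c *\<^sub>C capply (W v) \<Omega>" by (rule V_via_W[OF v])
  have "G B (capply (V v) \<Omega>) n = c *\<^sub>C G B (capply (W v) \<Omega>) n" for n
    by (simp add: G_def c capply_scaleC)
  then have "avg (G B (capply (V v) \<Omega>)) = (\<lambda>N. c *\<^sub>C avg (G B (capply (W v) \<Omega>)) N)"
    unfolding avg_scaleC[symmetric] by (intro ext) (simp add: avg_def)
  then have "avg (G B (capply (V v) \<Omega>)) \<longlonglongrightarrow>
    c *\<^sub>C capply (W v) (\<Sum>w\<in>Fw v. cinner (capply B \<Omega>) (capply (W w) \<Omega>) *\<^sub>C capply (W w) \<Omega>)"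
    using tendsto_scaleC_right[OF sw.avg_G_eigen_V[OF v B], of c] by (simp only:)
  also have "c *\<^sub>C capply (W v) (\<Sum>w\<in>Fw v. cinner (capply B \<Omega>) (capply (W w) \<Omega>) *\<^sub>C capply (W w) \<Omega>)
    = (\<Sum>w\<in>Fw v. cinner (capply B \<Omega>) (capply (W w) \<Omega>) *\<^sub>C capply (V v) (capply (W w) \<Omega>))"
  proof -
    have "c *\<^sub>C capply (W v) (capply (W w) \<Omega>) = capply (V v) (capply (W w) \<Omega>)" if w: "w \<in> Fw v" for w
    proof -
      have "(v, w) \<in> Sigma_set U k1 k2" using w v by (simp add: Fw_def Sigma_set_def)
      then have "c *\<^sub>C capply (W v) (capply (W w) \<Omega>) = capply (W w) (capply (V v) \<Omega>)"
        using sw.V_commute[of v w \<Omega>] by (simp add: c capply_scaleC)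
      then show ?thesis using commute[OF V_M[OF v] W_sp[OF Fw_sp[OF w]]] by simp
    qed
    then show ?thesis
      by (simp add: capply_sum capply_scaleC scaleC_sum_right scaleC_scaleC mult.commute[of c] cong: sum.cong)
        (simp add: scaleC_scaleC[symmetric])
  qed
  finally show ?thesis .
qed

section \<open>The partial isometry\<close>

abbreviation "Sig \<equiv> Sigma_set U k1 k2"

definition tens :: "complex \<times> complex \<Rightarrow> 'k" where "tens p = t (capply (V (fst p)) \<Omega>) (capply (W (snd p)) \<Omega>)"
definition prd :: "complex \<times> complex \<Rightarrow> 'h" where "prd p = capply (V (fst p)) (capply (W (snd p)) \<Omega>)"
definition Vsum :: "'k \<Rightarrow> 'h" where "Vsum = ergodic_V M U \<Omega> t k1 k2"

lemma Vsum_eq: "Vsum \<zeta> = (\<Sum>\<^sub>\<infinity>p\<in>Sig. cinner \<zeta> (tens p) *\<^sub>C prd p)"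
  unfolding Vsum_def ergodic_V_def Let_def N'_eq[symmetric] tens_def prd_def by (simp add: case_prod_unfold)

lemma Sig_sp: "p \<in> Sig \<Longrightarrow> fst p \<in> sp \<and> snd p \<in> sp"
  by (auto simp: Sigma_set_def)

lemma tens_orthonormal: "p \<in> Sig \<Longrightarrow> q \<in> Sig \<Longrightarrow> cinner (tens p) (tens q) = (if p = q then 1 else 0)"
  using Sig_sp[of p] Sig_sp[of q]
  by (auto simp: tens_def t_inner V\<Omega>_orthonormal ergodic_pair.V\<Omega>_orthonormal[OF swapped] prod_eq_iff)

lemma U_prd:
  assumes "p \<in> Sig" shows "capply U (prd p) = (fst p * snd p) *\<^sub>C prd p"
  using Sig_sp[OF assms]
  by (simp add: prd_def U_V ergodic_pair.U_V\<Omega>[OF swapped] capply_scaleC scaleC_scaleC)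

text \<open>By \<open>Sigma_inj\<close> distinct pairs give eigenvectors of \<open>U\<close> for
  distinct eigenvalues.\<close>

lemma prd_orthonormal:
  assumes "p \<in> Sig" "q \<in> Sig" shows "cinner (prd p) (prd q) = (if p = q then 1 else 0)"
proof (cases "p = q")
  case True
  have "norm (prd p) = 1"
    using Sig_sp[OF assms(1)] by (simp add: prd_def norm_V\<Omega> ergodic_pair.norm_V\<Omega>[OF swapped] norm\<Omega>)
  then show ?thesis using True by (simp add: cinner_self)
next
  case False
  have "fst p * snd p \<noteq> fst q * snd q"
    using Sigma_inj[of "fst p" "snd p" "fst q" "snd q"] assms False by (auto simp: prod_eq_iff)
  then have "cinner (prd p) (prd q) = 0"
    using Sig_sp assms by (intro eigen_orthogonal[OF _ _ _ U_prd[OF assms(1)] U_prd[OF assms(2)]] sp_mult) auto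
  then show ?thesis using False by simp
qed

text \<open>Bessel's inequality for \<open>tens\<close> supplies square-summable coefficients for
  the orthonormal family \<open>prd\<close>.\<close>

lemma Vsum_summable: "(\<lambda>p. cinner \<zeta> (tens p) *\<^sub>C prd p) summable_on Sig"
  and norm_Vsum: "norm (Vsum \<zeta>) \<le> norm \<zeta>"
proof -
  have "(\<Sum>p\<in>F. (cmod (cinner \<zeta> (tens p)))\<^sup>2) \<le> (norm \<zeta>)\<^sup>2" if "finite F" "F \<subseteq> Sig" for F
    by (rule bessel_finite[OF that(1)]) (rule tens_orthonormal; use that(2) in blast)
  note * = orthonormal_summable[of Sig prd "\<lambda>p. cinner \<zeta> (tens p)" "norm \<zeta>", OF prd_orthonormal this norm_ge_zero]
  show "(\<lambda>p. cinner \<zeta> (tens p) *\<^sub>C prd p) summable_on Sig" using *(1) by blast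
  show "norm (Vsum \<zeta>) \<le> norm \<zeta>" unfolding Vsum_eq using *(2) by blast
qed

lemma Vsum_add: "Vsum (\<zeta> + \<eta>) = Vsum \<zeta> + Vsum \<eta>"
  unfolding Vsum_eq cinner_add_left scaleC_add_left by (rule infsum_add[OF Vsum_summable Vsum_summable])

lemma Vsum_scaleC: "Vsum (c *\<^sub>C \<zeta>) = c *\<^sub>C Vsum \<zeta>"
proof -
  have "((\<lambda>p. cinner \<zeta> (tens p) *\<^sub>C prd p) has_sum Vsum \<zeta>) Sig"
    unfolding Vsum_eq using Vsum_summable by (rule has_sum_infsum)
  from has_sum_bounded_linear[OF bounded_linear_scaleC_right this, of c]
  show ?thesis unfolding Vsum_eq[of "c *\<^sub>C \<zeta>"] cinner_scaleC_left scaleC_scaleC by (rule infsumI)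
qed

lemma Vsum_diff: "Vsum \<zeta> - Vsum \<eta> = Vsum (\<zeta> - \<eta>)"
  using Vsum_add[of "\<zeta> - \<eta>" \<eta>] by simp

text \<open>Only the pairs over \<open>v\<close> survive, and there are finitely many of
  them.\<close>

lemma Vsum_eigen:
  assumes v: "v \<in> sp"
  shows "Vsum (t (capply (V v) \<Omega>) \<xi>) = (\<Sum>w\<in>Fw v. cinner \<xi> (capply (W w) \<Omega>) *\<^sub>C capply (V v) (capply (W w) \<Omega>))"
proof -
  have "Vsum (t (capply (V v) \<Omega>) \<xi>) = (\<Sum>\<^sub>\<infinity>p\<in>Pair v ` Fw v. cinner (t (capply (V v) \<Omega>) \<xi>) (tens p) *\<^sub>C prd p)"
    unfolding Vsum_eq
  proof (rule infsum_cong_neutral)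
    fix p assume "p \<in> Pair v ` Fw v - Sig"
    then show "cinner (t (capply (V v) \<Omega>) \<xi>) (tens p) *\<^sub>C prd p = 0"
      using v by (auto simp: Fw_def Sigma_set_def)
  next
    fix p assume p: "p \<in> Sig - Pair v ` Fw v"
    then have "fst p \<noteq> v" by (auto simp: Fw_def Sigma_set_def)
    moreover have "fst p \<in> sp" using Sig_sp p by blast
    ultimately show "cinner (t (capply (V v) \<Omega>) \<xi>) (tens p) *\<^sub>C prd p = 0"
      using v by (simp add: tens_def t_inner V\<Omega>_orthonormal)
  qed simp
  also have "\<dots> = (\<Sum>p\<in>Pair v ` Fw v. cinner (t (capply (V v) \<Omega>) \<xi>) (tens p) *\<^sub>C prd p)"
    by (rule infsum_finite) (simp add: finite_Fw)
  also have "\<dots> = (\<Sum>w\<in>Fw v. cinner (t (capply (V v) \<Omega>) \<xi>) (tens (v, w)) *\<^sub>C prd (v, w))"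
    by (subst sum.reindex) (auto simp: inj_on_def)
  finally show ?thesis using v by (simp add: tens_def prd_def t_inner V\<Omega>_inner)
qed

lemma Vsum_orthogonal:
  assumes "\<And>v. v \<in> sp \<Longrightarrow> cinner x (capply (V v) \<Omega>) = 0"
  shows "Vsum (t x \<xi>) = 0"
  unfolding Vsum_eq by (rule infsum_0) (use assms Sig_sp in \<open>simp add: tens_def t_inner\<close>)

text \<open>Instead of decomposing \<open>x\<close>, the set where the limit holds is shown to have
  trivial orthogonal complement: a vector orthogonal to it is orthogonal to all eigenvectors, hence
  belongs to the set, hence vanishes. Uniform bounds then reach every \<open>x\<close>.\<close>

lemma avg_G_limit:
  assumes B: "B \<in> M \<or> B \<in> M'"
  shows "avg (G B x) \<longlonglongrightarrow> Vsum (t x (capply B \<Omega>))"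
proof -
  interpret sw: ergodic_pair M' M \<Omega> U k1 k2 t by (rule swapped)
  let ?D = "{x. avg (G B x) \<longlonglongrightarrow> Vsum (t x (capply B \<Omega>))}"
  have G0: "avg (G B 0) \<longlonglongrightarrow> Vsum (t 0 (capply B \<Omega>))"
  proof -
    have "avg (G B 0) N = 0" for N by (simp add: G_def avg_def)
    moreover have "Vsum (t 0 (capply B \<Omega>)) = 0" by (rule Vsum_orthogonal) simp
    ultimately show ?thesis by (simp add: tendsto_eventually)
  qed
  have "csubspace ?D"
    unfolding csubspace_def
  proof (intro conjI ballI allI)
    show "0 \<in> ?D" using G0 by simp
  next
    fix x y assume "x \<in> ?D" "y \<in> ?D"
    then have "(\<lambda>N. avg (G B x) N + avg (G B y) N) \<longlonglongrightarrow> Vsum (t x (capply B \<Omega>)) + Vsum (t y (capply B \<Omega>))"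
      by (intro tendsto_add) auto
    moreover have "avg (G B x) N + avg (G B y) N = avg (G B (x + y)) N" for N
      unfolding avg_add[symmetric] by (simp add: G_def[abs_def] capply_add)
    ultimately show "x + y \<in> ?D" by (simp add: t_lin Vsum_add)
  next
    fix c x assume "x \<in> ?D"
    then have "(\<lambda>N. c *\<^sub>C avg (G B x) N) \<longlonglongrightarrow> c *\<^sub>C Vsum (t x (capply B \<Omega>))" by (intro tendsto_intros) auto
    moreover have "c *\<^sub>C avg (G B x) N = avg (G B (c *\<^sub>C x)) N" for N
      unfolding avg_scaleC[symmetric] by (simp add: G_def[abs_def] capply_scaleC)
    ultimately show "c *\<^sub>C x \<in> ?D" by (simp add: t_lin Vsum_scaleC)
  qed
  then have dense: "closure ?D = UNIV"
  proof (rule dense_if_orthogonal_trivial)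
    fix z assume z: "\<And>y. y \<in> ?D \<Longrightarrow> cinner y z = 0"
    have zV: "cinner z (capply (V v) \<Omega>) = 0" if v: "v \<in> sp" for v
    proof -
      have "capply (V v) \<Omega> \<in> ?D" using avg_G_eigen[OF v B] by (simp add: Vsum_eigen[OF v])
      from z[OF this] show ?thesis using cinner_commute[of z "capply (V v) \<Omega>"] by simp
    qed
    have ze: "cinner z y = 0" if y: "capply U y = \<mu> *\<^sub>C y" for y \<mu>
    proof (cases "y = 0")
      case False
      have "\<mu> \<in> sp" by (rule spI[OF y False])
      from eigen_unique[OF this y] zV[OF this] show ?thesis by (metis cinner_scaleC_right mult_zero_right)
    qed simp
    have "avg (G B z) \<longlonglongrightarrow> 0" using B avg_G_orthogonal[of B z] sw.avg_G_orthogonal[of B z] ze by blast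
    then have "z \<in> ?D" using Vsum_orthogonal[OF zV] by simp
    from z[OF this] show "z = 0" by simp
  qed
  show ?thesis
  proof (rule limit_from_approx)
    fix e :: real assume e: "e > 0"
    define s where "s = norm B + norm (capply B \<Omega>) + 1"
    have s: "s > 0" unfolding s_def by (simp add: add_nonneg_pos)
    obtain y where y: "y \<in> ?D" "norm (x - y) < e / s"
      using closure_UNIV_approx[OF dense, of "e / s" x] e s by auto
    have small: "c * norm (x - y) \<le> e" if "0 \<le> c" "c \<le> s" for c
    proof -
      have "c * norm (x - y) \<le> s * (e / s)" using y(2) that e s by (intro mult_mono) auto
      then show ?thesis using s by simp
    qed
    have "norm (avg (G B x) n - avg (G B y) n) \<le> e" for n
      unfolding avg_G_diff by (rule order_trans[OF avg_G_norm small]) (simp_all add: s_def)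
    moreover have "norm (Vsum (t x (capply B \<Omega>)) - Vsum (t y (capply B \<Omega>))) \<le> e"
    proof -
      have "norm (Vsum (t x (capply B \<Omega>)) - Vsum (t y (capply B \<Omega>))) \<le> norm (capply B \<Omega>) * norm (x - y)"
        unfolding Vsum_diff t_diff using norm_Vsum[of "t (x - y) (capply B \<Omega>)"] by (simp add: t_norm mult.commute)
      also have "\<dots> \<le> e" by (rule small) (simp_all add: s_def)
      finally show ?thesis .
    qed
    ultimately show "\<exists>H m. H \<longlonglongrightarrow> m \<and> (\<forall>n. norm (avg (G B x) n - H n) \<le> e) \<and> norm (Vsum (t x (capply B \<Omega>)) - m) \<le> e"
      using y(1) by blast
  qed
qed

section \<open>From \<open>G\<close> back to the averages of the theorem\<close>

definition L :: "'h operator \<Rightarrow> 'h \<Rightarrow> nat \<Rightarrow> 'h"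
  where "L X \<xi> n = capply (pw (int n * k1)) (capply X (capply (pw (int n * (k2 - k1))) \<xi>))"

lemma avg_L_norm: "norm (avg (L X \<xi>) N) \<le> norm X * norm \<xi>"
proof (rule norm_avg_le)
  fix n show "norm (L X \<xi> n) \<le> norm X * norm \<xi>"
    unfolding L_def pw_norm using norm_capply[of X "capply (pw (int n * (k2 - k1))) \<xi>"] by (simp add: pw_norm)
qed simp

lemma avg_L_diff: "avg (L X \<xi>) N - avg (L X \<eta>) N = avg (L X (\<xi> - \<eta>)) N"
  "avg (L X \<xi>) N - avg (L Y \<xi>) N = avg (L (X - Y) \<xi>) N"
  unfolding avg_diff[symmetric] by (simp_all add: L_def[abs_def] capply_diff capply_minus_left)

text \<open>Vectors \<open>capply B \<Omega>\<close> with \<open>B\<close> from the other algebra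
  are dense, and \<open>exchange\<close> turns \<open>L\<close> into \<open>G\<close> there.\<close>

lemma avg_L_limit:
  assumes X: "X \<in> M \<or> X \<in> M'"
  shows "avg (L X \<xi>) \<longlonglongrightarrow> Vsum (t (capply X \<Omega>) \<xi>)"
proof -
  interpret sw: ergodic_pair M' M \<Omega> U k1 k2 t by (rule swapped)
  have dense: "closure {\<xi>. avg (L X \<xi>) \<longlonglongrightarrow> Vsum (t (capply X \<Omega>) \<xi>)} = UNIV" (is "closure ?D = _")
  proof -
    have "capply B \<Omega> \<in> ?D" if B: "X \<in> M \<and> B \<in> M' \<or> X \<in> M' \<and> B \<in> M" for B
    proof -
      have "L X (capply B \<Omega>) = G B (capply X \<Omega>)"
        using B exchange[of X B] sw.exchange[of X B] unfolding L_def by blast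
      then show ?thesis using avg_G_limit[of B "capply X \<Omega>"] B by auto
    qed
    then have "(\<lambda>B. capply B \<Omega>) ` M' \<subseteq> ?D \<or> (\<lambda>B. capply B \<Omega>) ` M \<subseteq> ?D" using X by blast
    then show ?thesis
      using closure_mono[of "(\<lambda>B. capply B \<Omega>) ` M'" ?D] closure_mono[of "(\<lambda>B. capply B \<Omega>) ` M" ?D]
        dense_N dense_N' by auto
  qed
  show ?thesis
  proof (rule limit_from_approx)
    fix e :: real assume e: "e > 0"
    define s where "s = norm X + norm (capply X \<Omega>) + 1"
    have s: "s > 0" unfolding s_def by (simp add: add_nonneg_pos)
    obtain \<eta> where \<eta>: "\<eta> \<in> ?D" "norm (\<xi> - \<eta>) < e / s"
      using closure_UNIV_approx[OF dense, of "e / s" \<xi>] e s by auto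
    have small: "c * norm (\<xi> - \<eta>) \<le> e" if "0 \<le> c" "c \<le> s" for c
    proof -
      have "c * norm (\<xi> - \<eta>) \<le> s * (e / s)" using \<eta>(2) that e s by (intro mult_mono) auto
      then show ?thesis using s by simp
    qed
    have "norm (avg (L X \<xi>) n - avg (L X \<eta>) n) \<le> e" for n
      unfolding avg_L_diff by (rule order_trans[OF avg_L_norm small]) (simp_all add: s_def)
    moreover have "norm (Vsum (t (capply X \<Omega>) \<xi>) - Vsum (t (capply X \<Omega>) \<eta>)) \<le> e"
    proof -
      have "norm (Vsum (t (capply X \<Omega>) \<xi>) - Vsum (t (capply X \<Omega>) \<eta>)) \<le> norm (capply X \<Omega>) * norm (\<xi> - \<eta>)"
        unfolding Vsum_diff t_diff using norm_Vsum[of "t (capply X \<Omega>) (\<xi> - \<eta>)"] by (simp add: t_norm)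
      also have "\<dots> \<le> e" by (rule small) (simp_all add: s_def)
      finally show ?thesis .
    qed
    ultimately show "\<exists>H m. H \<longlonglongrightarrow> m \<and> (\<forall>n. norm (avg (L X \<xi>) n - H n) \<le> e) \<and> norm (Vsum (t (capply X \<Omega>) \<xi>) - m) \<le> e"
      using \<eta>(1) by blast
  qed
qed

text \<open>Both sides are bounded by \<open>norm X * norm \<xi>\<close>, so their agreement on M +
  M' passes to the norm closure.\<close>

theorem limit_theorem:
  assumes X: "X \<in> closure {S + T | S T. S \<in> M \<and> T \<in> M'}"
  shows "avg (L X \<xi>) \<longlonglongrightarrow> Vsum (t (capply X \<Omega>) \<xi>)"
proof (rule limit_from_approx)
  fix e :: real assume e: "e > 0"
  have s: "norm \<xi> + 1 > 0" by (simp add: add_nonneg_pos)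
  then obtain Y where Y: "Y \<in> {S + T | S T. S \<in> M \<and> T \<in> M'}" "dist Y X < e / (norm \<xi> + 1)"
    using X e unfolding closure_approachable by (meson divide_pos_pos)
  then obtain S T where ST: "S \<in> M" "T \<in> M'" "Y = S + T" by blast
  have "norm (X - Y) * norm \<xi> \<le> (e / (norm \<xi> + 1)) * (norm \<xi> + 1)"
    using Y(2) e s by (intro mult_mono) (auto simp: dist_norm norm_minus_commute)
  then have small: "norm (X - Y) * norm \<xi> \<le> e" using s by simp
  have "(\<lambda>N. avg (L S \<xi>) N + avg (L T \<xi>) N) \<longlonglongrightarrow> Vsum (t (capply S \<Omega>) \<xi>) + Vsum (t (capply T \<Omega>) \<xi>)"
    by (intro tendsto_add avg_L_limit) (use ST in auto)
  moreover have "avg (L S \<xi>) N + avg (L T \<xi>) N = avg (L Y \<xi>) N" for N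
    unfolding avg_add[symmetric] by (simp add: L_def[abs_def] ST(3) capply_plus capply_add)
  ultimately have lim: "avg (L Y \<xi>) \<longlonglongrightarrow> Vsum (t (capply Y \<Omega>) \<xi>)"
    by (simp add: ST(3) capply_plus t_lin Vsum_add)
  have "norm (avg (L X \<xi>) n - avg (L Y \<xi>) n) \<le> e" for n
    unfolding avg_L_diff by (rule order_trans[OF avg_L_norm small])
  moreover have "norm (Vsum (t (capply X \<Omega>) \<xi>) - Vsum (t (capply Y \<Omega>) \<xi>)) \<le> e"
  proof -
    have "norm (Vsum (t (capply X \<Omega>) \<xi>) - Vsum (t (capply Y \<Omega>) \<xi>)) \<le> norm (capply (X - Y) \<Omega>) * norm \<xi>"
      unfolding Vsum_diff t_diff using norm_Vsum[of "t (capply (X - Y) \<Omega>) \<xi>"]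
      by (simp add: t_norm capply_minus_left)
    also have "\<dots> \<le> norm (X - Y) * norm \<xi>"
      using norm_capply[of "X - Y" \<Omega>] by (intro mult_right_mono) (simp_all add: norm\<Omega>)
    finally show ?thesis using small by simp
  qed
  ultimately show "\<exists>H m. H \<longlonglongrightarrow> m \<and> (\<forall>n. norm (avg (L X \<xi>) n - H n) \<le> e) \<and> norm (Vsum (t (capply X \<Omega>) \<xi>) - m) \<le> e"
    using lim by blast
qed

end

theorem theorem4p2:
  fixes \<alpha> :: "'a::cstar_algebra \<Rightarrow> 'a"
    and \<omega> :: "'a cdual"
    and s :: "'a cdual cdual"
    and \<pi> :: "'a \<Rightarrow> 'h::complex_hilbert operator"
    and U :: "'h operator"
    and \<Omega> :: 'h
    and tensor :: "'h \<Rightarrow> 'h \<Rightarrow> 'k::complex_hilbert"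
    and k1 k2 :: int
    and M M' \<XX> :: "'h operator set"
  assumes "cstar_dynamical_system \<alpha> \<omega>"
    and "is_support \<omega> s" and "s \<in> bidual_centre"
    and "covariant_GNS \<alpha> \<omega> \<pi> U \<Omega>"
    and "hilbert_tensor tensor"
    and "k1 \<noteq> 0" and "k2 \<noteq> 0" and "k1 \<noteq> k2"
    and "ergodic_state (range (\<lambda>n::int. zpow \<alpha> (n * (k2 - k1)))) \<omega>"
  defines "M \<equiv> commutant (commutant (range \<pi>))"
    and "M' \<equiv> commutant (range \<pi>)"
    and "\<XX> \<equiv> closure {S + T | S T. S \<in> M \<and> T \<in> M'}"
  shows "\<forall>X\<in>\<XX>. \<forall>\<xi>.
    (\<lambda>N. (1 / real N) *\<^sub>R (\<Sum>n<N. zpow (capply U) (int n * k1)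
        (capply X (zpow (capply U) (int n * (k2 - k1)) \<xi>))))
      \<longlonglongrightarrow> ergodic_V M U \<Omega> tensor k1 k2 (tensor (capply X \<Omega>) \<xi>)"
proof -
  note gns = GNS_unitary[OF assms(1,4,9)] GNS_fix[OF assms(1,4,9)] GNS_cyclic[OF assms(1,4,9)]
    GNS_state[OF assms(1,4,9)] GNS_one[OF assms(1,4,9)] GNS_norm[OF assms(1,4,9)]
    GNS_normalizes_range[OF assms(1,4,9)]
  have rep: "star_representation \<pi>" using assms(4) by (simp add: covariant_GNS_def)
  interpret star_rep \<pi> by (rule star_rep.intro) (rule rep)
  \<comment> \<open>The one place where centrality of the support enters.\<close>
  have dense_M': "closure ((\<lambda>B. capply B \<Omega>) ` M') = UNIV"
    unfolding M'_def by (rule commutant_cyclic[OF rep gns(3,4,5) assms(2,3)])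
  have "range \<pi> \<subseteq> M" by (auto simp: M_def commutant_def)
  then have "range (\<lambda>a. capply (\<pi> a) \<Omega>) \<subseteq> (\<lambda>A. capply A \<Omega>) ` M" by blast
  then have dense_M: "closure ((\<lambda>A. capply A \<Omega>) ` M) = UNIV"
    using gns(3) closure_mono by blast
  have M'_cadj: "cadj B \<in> M'" if "B \<in> M'" for B
    using operator_star_algebraD(2)[OF operator_star_algebra_commutant_range] that by (simp add: M'_def)
  have M_comm: "M = commutant M'" and M'_comm: "M' = commutant M"
    by (simp_all add: M_def M'_def commutant_triple)
  \<comment> \<open>Ordered with \<open>M'\<close> first, since \<open>GNS_fixed_vectors\<close>
    perturbs the state by operators of the commutant; the interpretation below uses the swapped
    pair.\<close>
  have pair': "standard_pair M' M \<Omega>"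
    by (rule standard_pair.intro[OF M'_comm M_comm M'_cadj dense_M' dense_M])
  have normM': "normalizes U M'" unfolding M'_def by (rule normalizes_commutant[OF gns(7)])
  then have normM: "normalizes U M" unfolding M_comm by (rule normalizes_commutant)
  interpret ergodic_pair M M' \<Omega> U k1 k2 tensor
  proof (rule ergodic_pair.intro[OF standard_pair.swap[OF pair']], rule ergodic_pair_axioms.intro)
    fix e assume "capply (upow U (k2 - k1)) e = e"
    then have "zpow (capply U) (k2 - k1) e = e" by (simp add: upow_apply[OF gns(1)])
    then show "\<exists>c. e = c *\<^sub>C \<Omega>"
      using GNS_fixed_vectors[OF assms(1,4,9)] pair' unfolding M_comm unfolding M'_def by blast
  qed (fact normM normM' gns(2) gns(6) assms(6) assms(7) assms(5))+
  show ?thesis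
  proof (intro ballI allI)
    fix X \<xi> assume "X \<in> \<XX>"
    then have "avg (L X \<xi>) \<longlonglongrightarrow> Vsum (tensor (capply X \<Omega>) \<xi>)" unfolding \<XX>_def by (rule limit_theorem)
    then show "(\<lambda>N. (1 / real N) *\<^sub>R (\<Sum>n<N. zpow (capply U) (int n * k1)
        (capply X (zpow (capply U) (int n * (k2 - k1)) \<xi>))))
      \<longlonglongrightarrow> ergodic_V M U \<Omega> tensor k1 k2 (tensor (capply X \<Omega>) \<xi>)"
      by (simp only: avg_def[abs_def] L_def[abs_def] Vsum_def upow_apply[OF gns(1)])
  qed
qed

end
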